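(* Let $\alpha>0$ and let $\beta\in\mathbb{C}$ satisfy $\Re(\beta)>(1-\alpha)/2$ and $\beta\notin\{1/2,0,-1/2,-1,-3/2,\ldots\}$. Let $L_\beta$ denote the operator defined below acting on $C^\alpha([0,1])$. Then the essential spectral radius of $L_\beta$ satisfies \[\rho_e(L_\beta):=\sup_{\lambda\in\sigma_e(L_\beta)}|\lambda|\;\le\;\rho\big(\mathcal{L}_{\Re(\beta)+\alpha}\big):=\sup_{\lambda\in\sigma(\mathcal{L}_{\Re(\beta)+\alpha})}|\lambda|.\] Furthermore, for every $\lambda\in\sigma(L_\beta)$ with $|\lambda|>\rho_e(L_\beta)$, the generalised eigenspace $\bigcup_{r\ge1}\ker(L_\beta-\lambda I)^r$ of $L_\beta$ consists of analytic functions which extend to generalised eigenfunctions (for the eigenvalue $\lambda$) of the operator $\mathcal{L}_\beta$ on $A_\infty(D)$.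
   Context: For $\alpha=k+\eta$ with $k\in\mathbb{Z}_{\ge0}$ and $\eta\in[0,1)$, $C^\alpha([0,1])$ is the Banach space of functions $f:[0,1]\to\mathbb{C}$ that are $k$ times differentiable with $k$-th derivative continuous (if $\eta=0$) or $\eta$-Hölder continuous (if $\eta\in(0,1)$), with its standard norm. The Hurwitz zeta function is $\zeta_H(s,z)=\sum_{n\ge0}(n+z)^{-s}$, meromorphically continued in $s$ with a single simple pole at $s=1$. With $k=\lfloor\alpha\rfloor$, the operator $L_\beta$ on $C^\alpha([0,1])$ is \[L_\beta(f)(z)=\sum_{n=0}^{k}\frac{f^{(n)}(0)}{n!}\,\zeta_H(n+2\beta,z+1)+\sum_{n=1}^\infty\frac{1}{(n+z)^{2\beta}}\,f^\star\!\left(\frac{1}{n+z}\right),\qquad f^\star(z)=f(z)-\sum_{n=0}^k\frac{f^{(n)}(0)}{n!}z^n .\] Let $D=\{z\in\mathbb{C}:|z-1|<3/2\}$ and $A_\infty(D)$ the Banach space (sup norm) of functions holomorphic on $D$ with continuous extension to $\overline D$. The Mayer transfer operator $\mathcal{L}_\beta$ on $A_\infty(D)$ is given for $\Re\beta>1/2$ by $\mathcal{L}_\beta(f)(z)=\sum_{n\ge1}(n+z)^{-2\beta}f(1/(n+z))$ and for other $\beta$ by the meromorphic continuation given by the same displayed formula as for $L_\beta$ (with any $k$ large enough); it is nuclear, with poles only at $\beta\in\{1/2,0,-1/2,\ldots\}$. In particular for real $t>1/2$, $\mathcal{L}_t$ is given by the series and $\rho(\mathcal{L}_t)$ is its spectral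 radius. The essential spectrum $\sigma_e(T)$ of a bounded operator $T$ on a Banach space $B$ (in the sense of Browder) is the set of $\lambda\in\mathbb{C}$ such that $(T-\lambda I)B$ is not closed, or $\bigcup_{r\ge1}\ker(T-\lambda I)^r$ is infinite-dimensional, or $\lambda$ is a limit point of $\sigma(T)$. *)

theory Defs
  imports "HOL-Complex_Analysis.Complex_Analysis"
begin

text \<open>
  A normed space of complex-valued functions is given by a carrier \<open>V\<close>, closed under the pointwise
  operations, and a norm \<open>N\<close>. Functions on a set \<open>X\<close> are represented by functions on the whole
  type that vanish outside \<open>X\<close>, so that elements of \<open>V\<close> are equal iff they agree on \<open>X\<close>.
\<close>

definition bounded_op ::
  "('a \<Rightarrow> complex) set \<Rightarrow> (('a \<Rightarrow> complex) \<Rightarrow> real) \<Rightarrow> (('a \<Rightarrow> complex) \<Rightarrow> 'a \<Rightarrow> complex) \<Rightarrow> bool" where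
  "bounded_op V N T \<longleftrightarrow>
     (\<forall>f\<in>V. T f \<in> V) \<and>
     (\<forall>f\<in>V. \<forall>g\<in>V. T (\<lambda>x. f x + g x) = (\<lambda>x. T f x + T g x)) \<and>
     (\<forall>c. \<forall>f\<in>V. T (\<lambda>x. c * f x) = (\<lambda>x. c * T f x)) \<and>
     (\<exists>C. \<forall>f\<in>V. N (T f) \<le> C * N f)"

definition shift_op ::
  "(('a \<Rightarrow> complex) \<Rightarrow> 'a \<Rightarrow> complex) \<Rightarrow> complex \<Rightarrow> ('a \<Rightarrow> complex) \<Rightarrow> 'a \<Rightarrow> complex" where
  "shift_op T l f = (\<lambda>x. T f x - l * f x)"

definition op_spectrum ::
  "('a \<Rightarrow> complex) set \<Rightarrow> (('a \<Rightarrow> complex) \<Rightarrow> real) \<Rightarrow> (('a \<Rightarrow> complex) \<Rightarrow> 'a \<Rightarrow> complex) \<Rightarrow> complex set" where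
  "op_spectrum V N T =
     {l. \<not> (\<exists>S. bounded_op V N S \<and>
              (\<forall>f\<in>V. S (shift_op T l f) = f \<and> shift_op T l (S f) = f))}"

definition gen_eigenspace ::
  "('a \<Rightarrow> complex) set \<Rightarrow> (('a \<Rightarrow> complex) \<Rightarrow> 'a \<Rightarrow> complex) \<Rightarrow> complex \<Rightarrow> ('a \<Rightarrow> complex) set" where
  "gen_eigenspace V T l = (\<Union>r\<in>{1..}. {f \<in> V. (shift_op T l ^^ r) f = (\<lambda>x. 0)})"

definition finite_dim :: "('a \<Rightarrow> complex) set \<Rightarrow> bool" where
  "finite_dim W \<longleftrightarrow>
     (\<exists>B. finite B \<and> (\<forall>f\<in>W. \<exists>c. f = (\<lambda>x. \<Sum>b\<in>B. c b * b x)))"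

definition norm_closed ::
  "('a \<Rightarrow> complex) set \<Rightarrow> (('a \<Rightarrow> complex) \<Rightarrow> real) \<Rightarrow> ('a \<Rightarrow> complex) set \<Rightarrow> bool" where
  "norm_closed V N R \<longleftrightarrow>
     (\<forall>s. \<forall>g\<in>V. (\<forall>n::nat. s n \<in> R) \<and> (\<lambda>n. N (\<lambda>x. s n x - g x)) \<longlonglongrightarrow> 0 \<longrightarrow> g \<in> R)"

text \<open>The essential spectrum in the sense of Browder.\<close>

definition ess_spectrum ::
  "('a \<Rightarrow> complex) set \<Rightarrow> (('a \<Rightarrow> complex) \<Rightarrow> real) \<Rightarrow> (('a \<Rightarrow> complex) \<Rightarrow> 'a \<Rightarrow> complex) \<Rightarrow> complex set" where
  "ess_spectrum V N T =
     {l. \<not> norm_closed V N (shift_op T l ` V) \<or>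
         \<not> finite_dim (gen_eigenspace V T l) \<or>
         l islimpt op_spectrum V N T}"

text \<open>The suprema are taken in \<open>[0, \<infinity>]\<close>, where they always exist.\<close>

definition spectral_radius ::
  "('a \<Rightarrow> complex) set \<Rightarrow> (('a \<Rightarrow> complex) \<Rightarrow> real) \<Rightarrow> (('a \<Rightarrow> complex) \<Rightarrow> 'a \<Rightarrow> complex) \<Rightarrow> ennreal" where
  "spectral_radius V N T = (SUP l\<in>op_spectrum V N T. ennreal (cmod l))"

definition ess_spectral_radius ::
  "('a \<Rightarrow> complex) set \<Rightarrow> (('a \<Rightarrow> complex) \<Rightarrow> real) \<Rightarrow> (('a \<Rightarrow> complex) \<Rightarrow> 'a \<Rightarrow> complex) \<Rightarrow> ennreal" where
  "ess_spectral_radius V N T = (SUP l\<in>ess_spectrum V N T. ennreal (cmod l))"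

text \<open>The derivative on \<open>[0,1]\<close>, one-sided at the endpoints.\<close>

definition deriv01 :: "(real \<Rightarrow> complex) \<Rightarrow> real \<Rightarrow> complex" where
  "deriv01 f x = (if x \<in> {0..1} then vector_derivative f (at x within {0..1}) else 0)"

definition C_space :: "real \<Rightarrow> (real \<Rightarrow> complex) set" where
  "C_space \<alpha> = {f. (\<forall>x. x \<notin> {0..1} \<longrightarrow> f x = 0) \<and>
     (\<forall>j < nat \<lfloor>\<alpha>\<rfloor>. (deriv01 ^^ j) f differentiable_on {0..1}) \<and>
     (if frac \<alpha> = 0 then continuous_on {0..1} ((deriv01 ^^ nat \<lfloor>\<alpha>\<rfloor>) f)
      else \<exists>C. \<forall>x\<in>{0..1}. \<forall>y\<in>{0..1}.
        cmod ((deriv01 ^^ nat \<lfloor>\<alpha>\<rfloor>) f x - (deriv01 ^^ nat \<lfloor>\<alpha>\<rfloor>) f y) \<le> C * \<bar>x - y\<bar> powr frac \<alpha>)}"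

definition C_norm :: "real \<Rightarrow> (real \<Rightarrow> complex) \<Rightarrow> real" where
  "C_norm \<alpha> f =
     (\<Sum>j\<le>nat \<lfloor>\<alpha>\<rfloor>. SUP x\<in>{0..1}. cmod ((deriv01 ^^ j) f x)) +
     (if frac \<alpha> = 0 then 0
      else SUP (x, y)\<in>{(x, y). x \<in> {0..1} \<and> y \<in> {0..1} \<and> x \<noteq> y}.
        cmod ((deriv01 ^^ nat \<lfloor>\<alpha>\<rfloor>) f x - (deriv01 ^^ nat \<lfloor>\<alpha>\<rfloor>) f y) / \<bar>x - y\<bar> powr frac \<alpha>)"

text \<open>
  The analytic continuation in \<open>s\<close> of \<open>\<Sum>n. (n + z) powr - s\<close>, for \<open>Re z > 0\<close>. It is unique on the
  connected set \<open>- {1}\<close>; the value at the pole is fixed only so that the description is unique.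
\<close>

definition hurwitz_zeta :: "complex \<Rightarrow> complex \<Rightarrow> complex" where
  "hurwitz_zeta s z =
     (THE F. F holomorphic_on (- {1}) \<and> F 1 = 0 \<and>
        (\<forall>w. Re w > 1 \<longrightarrow> (\<lambda>n. (of_nat n + z) powr (- w)) sums F w)) s"

definition L_op :: "real \<Rightarrow> complex \<Rightarrow> (real \<Rightarrow> complex) \<Rightarrow> real \<Rightarrow> complex" where
  "L_op \<alpha> \<beta> f z =
     (let k = nat \<lfloor>\<alpha>\<rfloor>;
          a = (\<lambda>n. (deriv01 ^^ n) f 0 / fact n);
          fstar = (\<lambda>x. f x - (\<Sum>n\<le>k. a n * of_real x ^ n))
      in if z \<in> {0..1} then
           (\<Sum>n\<le>k. a n * hurwitz_zeta (of_nat n + 2 * \<beta>) (of_real z + 1)) +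
           (\<Sum>n. of_real (real (Suc n) + z) powr (- (2 * \<beta>)) * fstar (1 / (real (Suc n) + z)))
         else 0)"

definition A_space :: "(complex \<Rightarrow> complex) set" where
  "A_space = {f. (\<forall>z. z \<notin> cball 1 (3/2) \<longrightarrow> f z = 0) \<and>
     f holomorphic_on ball 1 (3/2) \<and> continuous_on (cball 1 (3/2)) f}"

definition A_norm :: "(complex \<Rightarrow> complex) \<Rightarrow> real" where
  "A_norm f = (SUP z\<in>cball 1 (3/2). cmod (f z))"

definition mayer_series :: "complex \<Rightarrow> (complex \<Rightarrow> complex) \<Rightarrow> complex \<Rightarrow> complex" where
  "mayer_series \<beta> f z =
     (\<Sum>n. (of_nat (Suc n) + z) powr (- (2 * \<beta>)) * f (1 / (of_nat (Suc n) + z)))"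

definition mayer_continued :: "nat \<Rightarrow> complex \<Rightarrow> (complex \<Rightarrow> complex) \<Rightarrow> complex \<Rightarrow> complex" where
  "mayer_continued k \<beta> f z =
     (let a = (\<lambda>n. (deriv ^^ n) f 0 / fact n);
          fstar = (\<lambda>w. f w - (\<Sum>n\<le>k. a n * w ^ n))
      in (\<Sum>n\<le>k. a n * hurwitz_zeta (of_nat n + 2 * \<beta>) (z + 1)) + mayer_series \<beta> fstar z)"

text \<open>
  Since \<open>fstar w = O(w ^ (k + 1))\<close> at \<open>0\<close>, the series in \<open>mayer_continued k \<beta> f\<close> converges for all
  \<open>f\<close> as soon as \<open>k > - 2 * Re \<beta>\<close>, and its value does not depend on such \<open>k\<close>. The choice
  \<open>nat \<lfloor>- 2 * Re \<beta>\<rfloor> + 1\<close> is admissible.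
\<close>

definition mayer_op :: "complex \<Rightarrow> (complex \<Rightarrow> complex) \<Rightarrow> complex \<Rightarrow> complex" where
  "mayer_op \<beta> f z =
     (if z \<in> cball 1 (3/2) then
        (if Re \<beta> > 1/2 then mayer_series \<beta> f z
         else mayer_continued (nat \<lfloor>- 2 * Re \<beta>\<rfloor> + 1) \<beta> f z)
      else 0)"

end

theory Submission
  imports Defs
begin

text \<open>
  Write \<open>t = Re \<beta> + \<alpha>\<close>. On the cylinder of a word \<open>w\<close> of length \<open>n\<close> the \<open>n\<close>-th power of the transfer
  operator acts by \<open>f \<mapsto> (c z + d) powr (- 2 * \<beta>) * f ((a z + b) / (c z + d))\<close>. Replacing \<open>f\<close> by its Taylor
  polynomial of order \<open>\<lfloor>\<alpha>\<rfloor>\<close> at one point of the cylinder gives an operator of finite rank, and the error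
  has norm at most a constant times \<open>d powr (- 2 * t)\<close>, because a cylinder has length about
  \<open>d powr (- 2)\<close>. Summing over \<open>w\<close> bounds the total error by the value at \<open>0\<close> of the \<open>n\<close>-th power of
  the Mayer operator with parameter \<open>t\<close> applied to \<open>1\<close>, which grows at most like the spectral radius.
  So a power of the transfer operator is a small perturbation of a finite rank operator, and Fredholm
  theory describes the spectrum outside that radius. The determinant and adjugate of this theory are
  built by adding rank one operators one at a time.

  If \<open>l\<close> is an isolated point of the spectrum, the contour integral of the resolvent around \<open>l\<close>
  fixes the generalised eigenfunctions. Approximating such a function \<open>f\<close> by polynomials that are
  bounded in the Hoelder norm, and using that on analytic functions the two resolvents agree,
  exhibits \<open>f\<close> as a pointwise limit of elements of the generalised eigenspace of the Mayer operator.
  That space is finite dimensional because the Mayer operator is compact, so it contains the limit.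
\<close>

section \<open>Normed spaces of functions and their operators\<close>

text \<open>Two obstacles shape the proof. For small Re beta the branches are not summable in norm.
  They become summable once the Taylor polynomial at 0 is subtracted, at the price of finite rank,
  but the subtraction destroys the multiplicativity that expands a power over words. The proof
  therefore moves between the regularised series, its truncation to M branches, and the
  unregularised truncation; neighbours in this chain agree up to finite rank or a small norm error.
  The power n is chosen first and M afterwards, so the bound on the words must be uniform in M, and
  its constant must not depend on n, since a high power has to beat it.

  The second obstacle is that for non-integer alpha polynomials are not dense in the Hoelder norm.
  The resolvents of the approximants then converge only pointwise, which is proved by Arzela-Ascoli
  together with the uniqueness of the resolvent. On the disc there is no norm bound at all for the
  approximating eigenfunctions, only convergence at the points of [0,1]; finite dimension is what
  turns this into an element of the eigenspace.\<close>

locale complex_function_space =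
  fixes V :: "('a \<Rightarrow> complex) set" and N :: "('a \<Rightarrow> complex) \<Rightarrow> real"
  assumes zero_mem: "(\<lambda>x. 0) \<in> V"
    and add_mem: "f \<in> V \<Longrightarrow> g \<in> V \<Longrightarrow> (\<lambda>x. f x + g x) \<in> V"
    and scale_mem: "f \<in> V \<Longrightarrow> (\<lambda>x. c * f x) \<in> V"
    and norm_add: "f \<in> V \<Longrightarrow> g \<in> V \<Longrightarrow> N (\<lambda>x. f x + g x) \<le> N f + N g"
    and norm_scale: "f \<in> V \<Longrightarrow> N (\<lambda>x. c * f x) = cmod c * N f"
    and eval_le: "f \<in> V \<Longrightarrow> cmod (f x) \<le> N f"
    and complete: "(\<And>n::nat. s n \<in> V) \<Longrightarrow>
      (\<And>e. e > 0 \<Longrightarrow> \<exists>M. \<forall>m\<ge>M. \<forall>n\<ge>M. N (\<lambda>x. s m x - s n x) < e) \<Longrightarrow>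
      \<exists>g\<in>V. (\<lambda>n. N (\<lambda>x. s n x - g x)) \<longlonglongrightarrow> 0"
begin

lemma norm_nonneg: "f \<in> V \<Longrightarrow> 0 \<le> N f"
  using eval_le norm_ge_zero order_trans by blast

lemma norm_zero [simp]: "N (\<lambda>x. 0) = 0"
  using norm_scale[OF zero_mem, of 0] by simp

lemma uminus_mem: "f \<in> V \<Longrightarrow> (\<lambda>x. - f x) \<in> V"
  using scale_mem[of f "-1"] by simp

lemma norm_uminus: "f \<in> V \<Longrightarrow> N (\<lambda>x. - f x) = N f"
  using norm_scale[of f "-1"] by simp

lemma diff_mem: "f \<in> V \<Longrightarrow> g \<in> V \<Longrightarrow> (\<lambda>x. f x - g x) \<in> V"
  using add_mem[OF _ uminus_mem, of f g] by simp

lemma norm_diff: "f \<in> V \<Longrightarrow> g \<in> V \<Longrightarrow> N (\<lambda>x. f x - g x) \<le> N f + N g"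
  using norm_add[OF _ uminus_mem, of f g] norm_uminus[of g] by simp

lemma norm_diff_commute: "f \<in> V \<Longrightarrow> g \<in> V \<Longrightarrow> N (\<lambda>x. f x - g x) = N (\<lambda>x. g x - f x)"
  using norm_uminus[OF diff_mem, of f g] by simp

lemma sum_mem: "(\<And>i. i \<in> I \<Longrightarrow> f i \<in> V) \<Longrightarrow> (\<lambda>x. \<Sum>i\<in>I. f i x) \<in> V"
  by (induction I rule: infinite_finite_induct) (auto intro: zero_mem add_mem)

lemma norm_sum: "(\<And>i. i \<in> I \<Longrightarrow> f i \<in> V) \<Longrightarrow> N (\<lambda>x. \<Sum>i\<in>I. f i x) \<le> (\<Sum>i\<in>I. N (f i))"
proof (induction I rule: infinite_finite_induct)
  case (insert i I)
  have "N (\<lambda>x. f i x + (\<Sum>i\<in>I. f i x)) \<le> N (f i) + N (\<lambda>x. \<Sum>i\<in>I. f i x)"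
    by (intro norm_add sum_mem) (use insert in auto)
  with insert show ?case by auto
qed auto

lemma eq_zeroI: "f \<in> V \<Longrightarrow> N f \<le> 0 \<Longrightarrow> f = (\<lambda>x. 0)"
  using eval_le[of f] by (metis norm_le_zero_iff order_trans)

text \<open>This is what the axiom \<open>eval_le\<close> is for: norm limits are pointwise limits,
  so operators given by pointwise formulas can be compared with limits obtained from
  completeness.\<close>

lemma tendsto_eval:
  assumes "\<And>n. s n \<in> V" "g \<in> V" "(\<lambda>n. N (\<lambda>x. s n x - g x)) \<longlonglongrightarrow> 0"
  shows "(\<lambda>n. s n x) \<longlonglongrightarrow> g x"
proof -
  have "(\<lambda>n. s n x - g x) \<longlonglongrightarrow> 0"
  proof (rule Lim_null_comparison[OF _ assms(3)], rule always_eventually, rule allI)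
    fix n show "norm (s n x - g x) \<le> N (\<lambda>x. s n x - g x)"
      using eval_le[OF diff_mem[OF assms(1)[of n] assms(2)], of x] by simp
  qed
  thus ?thesis by (rule LIM_zero_cancel)
qed

text \<open>Completeness gives some norm limit of the partial sums; since evaluation is continuous,
  this limit must be the pointwise sum, the form in which the transfer operators are
  written.\<close>

lemma series:
  assumes g: "\<And>n. g n \<in> V" and b: "\<And>n. N (g n) \<le> b n" and sb: "summable b"
  shows "(\<lambda>x. \<Sum>n. g n x) \<in> V" "N (\<lambda>x. \<Sum>n. g n x) \<le> suminf b"
    "\<And>x. summable (\<lambda>n. g n x)"
    "(\<lambda>n. N (\<lambda>x. (\<Sum>i<n. g i x) - (\<Sum>n. g n x))) \<longlonglongrightarrow> 0"
proof -
  define s where "s n = (\<lambda>x. \<Sum>i<n. g i x)" for n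
  have sV: "s n \<in> V" for n unfolding s_def by (intro sum_mem g)
  have b0: "b n \<ge> 0" for n using order_trans[OF norm_nonneg[OF g] b] .
  have le: "N (\<lambda>x. s n x - s m x) \<le> (\<Sum>i=m..<n. b i)" if "m \<le> n" for m n
  proof -
    have "{..<n} = {..<m} \<union> {m..<n}" using that by auto
    hence "N (\<lambda>x. s n x - s m x) = N (\<lambda>x. \<Sum>i=m..<n. g i x)"
      unfolding s_def by (simp add: sum.union_disjoint ivl_disj_int)
    also have "\<dots> \<le> (\<Sum>i=m..<n. N (g i))" by (rule norm_sum) (rule g)
    also have "\<dots> \<le> (\<Sum>i=m..<n. b i)" by (intro sum_mono b)
    finally show ?thesis .
  qed
  have cauchy: "\<exists>M. \<forall>m\<ge>M. \<forall>n\<ge>M. N (\<lambda>x. s m x - s n x) < e" if "e > 0" for e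
  proof -
    obtain M where M: "\<And>m n. m \<ge> M \<Longrightarrow> norm (\<Sum>i=m..<n. b i) < e"
      using sb \<open>e > 0\<close> unfolding summable_Cauchy by blast
    have "N (\<lambda>x. s m x - s n x) < e" if "m \<ge> M" "n \<ge> M" for m n
    proof (cases "m \<le> n")
      case True
      have "N (\<lambda>x. s m x - s n x) = N (\<lambda>x. s n x - s m x)"
        by (rule norm_diff_commute[OF sV sV])
      also have "\<dots> \<le> norm (\<Sum>i=m..<n. b i)" using le[OF True] by simp
      finally show ?thesis using M[OF that(1), of n] by simp
    next
      case False
      have "N (\<lambda>x. s m x - s n x) \<le> norm (\<Sum>i=n..<m. b i)" using le[of n m] False by simp
      thus ?thesis using M[OF that(2), of m] by simp
    qed
    thus ?thesis by blast
  qed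
  obtain h where h: "h \<in> V" "(\<lambda>n. N (\<lambda>x. s n x - h x)) \<longlonglongrightarrow> 0"
    using complete[of s] sV cauchy by blast
  have lim: "(\<lambda>n. s n x) \<longlonglongrightarrow> h x" for x by (rule tendsto_eval[OF sV h])
  hence sums: "(\<lambda>n. g n x) sums h x" for x unfolding s_def sums_def by simp
  thus sm: "summable (\<lambda>n. g n x)" for x by (rule sums_summable)
  have heq: "h = (\<lambda>x. \<Sum>n. g n x)" using sums sums_unique by fastforce
  show "(\<lambda>x. \<Sum>n. g n x) \<in> V" using h(1) heq by simp
  show "(\<lambda>n. N (\<lambda>x. (\<Sum>i<n. g i x) - (\<Sum>n. g n x))) \<longlonglongrightarrow> 0"
    using h(2) unfolding s_def heq .
  have "N h \<le> suminf b + N (\<lambda>x. s n x - h x)" for n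
  proof -
    have "h = (\<lambda>x. s n x - (s n x - h x))" by simp
    hence "N h \<le> N (s n) + N (\<lambda>x. s n x - h x)"
      using norm_diff[OF sV diff_mem[OF sV h(1)], of n n] by simp
    moreover have "N (s n) \<le> (\<Sum>i<n. N (g i))" unfolding s_def by (rule norm_sum) (rule g)
    moreover have "\<dots> \<le> (\<Sum>i<n. b i)" by (intro sum_mono b)
    moreover have "\<dots> \<le> suminf b" by (rule sum_le_suminf[OF sb]) (auto simp: b0)
    ultimately show ?thesis by linarith
  qed
  hence "N h \<le> suminf b + 0"
    by (intro tendsto_lowerbound[OF tendsto_add[OF tendsto_const h(2)]] always_eventually) auto
  thus "N (\<lambda>x. \<Sum>n. g n x) \<le> suminf b" using heq by simp
qed

section \<open>Algebra of bounded operators\<close>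

lemma op_mem: "bounded_op V N T \<Longrightarrow> f \<in> V \<Longrightarrow> T f \<in> V"
  and op_add: "bounded_op V N T \<Longrightarrow> f \<in> V \<Longrightarrow> g \<in> V \<Longrightarrow> T (\<lambda>x. f x + g x) = (\<lambda>x. T f x + T g x)"
  and op_scale: "bounded_op V N T \<Longrightarrow> f \<in> V \<Longrightarrow> T (\<lambda>x. c * f x) = (\<lambda>x. c * T f x)"
  unfolding bounded_op_def by blast+

lemma op_bound:
  assumes "bounded_op V N T"
  obtains C where "C \<ge> 0" "\<And>f. f \<in> V \<Longrightarrow> N (T f) \<le> C * N f"
proof -
  obtain C where C: "\<forall>f\<in>V. N (T f) \<le> C * N f" using assms unfolding bounded_op_def by blast
  have "N (T f) \<le> max C 0 * N f" if "f \<in> V" for f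
    using C that norm_nonneg[OF that] by (smt (verit) mult_right_mono max.cobounded1)
  thus ?thesis using that[of "max C 0"] by simp
qed

lemma op_zero: "bounded_op V N T \<Longrightarrow> T (\<lambda>x. 0) = (\<lambda>x. 0)"
  using op_scale[OF _ zero_mem, of T 0] by simp

lemma op_uminus: "bounded_op V N T \<Longrightarrow> f \<in> V \<Longrightarrow> T (\<lambda>x. - f x) = (\<lambda>x. - T f x)"
  using op_scale[of T f "-1"] by simp

lemma op_diff: "bounded_op V N T \<Longrightarrow> f \<in> V \<Longrightarrow> g \<in> V \<Longrightarrow> T (\<lambda>x. f x - g x) = (\<lambda>x. T f x - T g x)"
  using op_add[OF _ _ uminus_mem, of T f g] op_uminus[of T g] by simp

lemma op_sum:
  assumes "bounded_op V N T"
  shows "(\<And>i. i \<in> I \<Longrightarrow> f i \<in> V) \<Longrightarrow> T (\<lambda>x. \<Sum>i\<in>I. f i x) = (\<lambda>x. \<Sum>i\<in>I. T (f i) x)"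
proof (induction I rule: infinite_finite_induct)
  case (insert i I)
  have "T (\<lambda>x. f i x + (\<Sum>i\<in>I. f i x)) = (\<lambda>x. T (f i) x + T (\<lambda>x. \<Sum>i\<in>I. f i x) x)"
    by (intro op_add[OF assms] sum_mem) (use insert in auto)
  with insert show ?case by auto
qed (auto simp: op_zero[OF assms])

lemma bounded_opI:
  assumes "\<And>f. f \<in> V \<Longrightarrow> T f \<in> V"
    and "\<And>f g. f \<in> V \<Longrightarrow> g \<in> V \<Longrightarrow> T (\<lambda>x. f x + g x) = (\<lambda>x. T f x + T g x)"
    and "\<And>c f. f \<in> V \<Longrightarrow> T (\<lambda>x. c * f x) = (\<lambda>x. c * T f x)"
    and "\<And>f. f \<in> V \<Longrightarrow> N (T f) \<le> C * N f"
  shows "bounded_op V N T"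
  unfolding bounded_op_def using assms by blast

lemma bounded_op_id: "bounded_op V N (\<lambda>f. f)"
  by (rule bounded_opI[where C = 1]) auto

lemma bounded_op_add:
  assumes "bounded_op V N S" "bounded_op V N T"
  shows "bounded_op V N (\<lambda>f x. S f x + T f x)"
proof -
  obtain C where C: "\<And>f. f \<in> V \<Longrightarrow> N (S f) \<le> C * N f" using op_bound[OF assms(1)] by metis
  obtain D where D: "\<And>f. f \<in> V \<Longrightarrow> N (T f) \<le> D * N f" using op_bound[OF assms(2)] by metis
  show ?thesis
  proof (rule bounded_opI[where C = "C + D"])
    fix f assume f: "f \<in> V"
    have "N (\<lambda>x. S f x + T f x) \<le> N (S f) + N (T f)"
      by (intro norm_add op_mem[OF assms(1)] op_mem[OF assms(2)] f)
    thus "N (\<lambda>x. S f x + T f x) \<le> (C + D) * N f"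
      using C[OF f] D[OF f] by (simp add: distrib_right)
  qed (auto simp: op_add[OF assms(1)] op_add[OF assms(2)] op_scale[OF assms(1)] op_scale[OF assms(2)]
      algebra_simps intro!: add_mem op_mem[OF assms(1)] op_mem[OF assms(2)])
qed

lemma bounded_op_scale:
  assumes "bounded_op V N S"
  shows "bounded_op V N (\<lambda>f x. c * S f x)"
proof -
  obtain C where C: "\<And>f. f \<in> V \<Longrightarrow> N (S f) \<le> C * N f" using op_bound[OF assms(1)] by metis
  show ?thesis
  proof (rule bounded_opI[where C = "cmod c * C"])
    fix f assume f: "f \<in> V"
    show "N (\<lambda>x. c * S f x) \<le> cmod c * C * N f"
      using C[OF f] norm_scale[OF op_mem[OF assms f], of c] by (simp add: mult_left_mono mult.assoc)
  qed (auto simp: op_add[OF assms(1)] op_scale[OF assms(1)] algebra_simps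
      intro!: scale_mem op_mem[OF assms(1)])
qed

lemma bounded_op_diff:
  assumes "bounded_op V N S" "bounded_op V N T"
  shows "bounded_op V N (\<lambda>f x. S f x - T f x)"
  using bounded_op_add[OF assms(1) bounded_op_scale[OF assms(2), of "-1"]] by simp

lemma bounded_op_zero: "bounded_op V N (\<lambda>f x. 0)"
  by (rule bounded_opI[where C = 0]) (auto intro: zero_mem)

lemma bounded_op_sum:
  "(\<And>i. i \<in> I \<Longrightarrow> bounded_op V N (S i)) \<Longrightarrow> bounded_op V N (\<lambda>f x. \<Sum>i\<in>I. S i f x)"
  by (induction I rule: infinite_finite_induct) (auto intro: bounded_op_zero bounded_op_add)

lemma bounded_op_comp:
  assumes "bounded_op V N S" "bounded_op V N T"
  shows "bounded_op V N (\<lambda>f. S (T f))"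
proof -
  obtain C where C: "C \<ge> 0" "\<And>f. f \<in> V \<Longrightarrow> N (S f) \<le> C * N f" using op_bound[OF assms(1)] by metis
  obtain D where D: "\<And>f. f \<in> V \<Longrightarrow> N (T f) \<le> D * N f" using op_bound[OF assms(2)] by metis
  show ?thesis
  proof (rule bounded_opI[where C = "C * D"])
    fix f assume f: "f \<in> V"
    have "N (S (T f)) \<le> C * N (T f)" by (rule C(2)[OF op_mem[OF assms(2) f]])
    also have "\<dots> \<le> C * (D * N f)" by (rule mult_left_mono[OF D[OF f] C(1)])
    finally show "N (S (T f)) \<le> C * D * N f" by simp
  qed (simp_all add: op_add[OF assms(1)] op_scale[OF assms(1)] op_add[OF assms(2)] op_scale[OF assms(2)]
      op_mem[OF assms(1)] op_mem[OF assms(2)])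
qed

lemma bounded_op_funpow:
  assumes "bounded_op V N T"
  shows "bounded_op V N (T ^^ n)"
proof (induction n)
  case 0 thus ?case using bounded_op_id by (simp add: id_def)
next
  case (Suc n) thus ?case using bounded_op_comp[OF assms Suc] by (simp add: comp_def)
qed

lemma bounded_op_shift:
  "bounded_op V N T \<Longrightarrow> bounded_op V N (shift_op T l)"
  unfolding shift_op_def[abs_def]
  by (intro bounded_op_diff bounded_op_scale bounded_op_id)

lemma funpow_mem: "bounded_op V N T \<Longrightarrow> f \<in> V \<Longrightarrow> (T ^^ n) f \<in> V"
  by (rule op_mem[OF bounded_op_funpow])

lemma bounded_op_cong:
  assumes "bounded_op V N T" "\<And>f. f \<in> V \<Longrightarrow> S f = T f"
  shows "bounded_op V N S"
proof -
  obtain C where C: "\<And>f. f \<in> V \<Longrightarrow> N (T f) \<le> C * N f" using op_bound[OF assms(1)] by metis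
  show ?thesis
    by (rule bounded_opI[where C = C])
       (simp_all add: assms(2) C add_mem scale_mem op_add[OF assms(1)] op_scale[OF assms(1)] op_mem[OF assms(1)])
qed

text \<open>The cofactor in \<open>w ^ n - A ^ n = (w - A) * geo_op A w n\<close>.\<close>

definition geo_op :: "(('a \<Rightarrow> complex) \<Rightarrow> 'a \<Rightarrow> complex) \<Rightarrow> complex \<Rightarrow> nat \<Rightarrow> ('a \<Rightarrow> complex) \<Rightarrow> 'a \<Rightarrow> complex" where
  "geo_op A w n f = (\<lambda>x. \<Sum>i<n. w ^ i * (A ^^ (n - 1 - i)) f x)"

lemma bounded_op_geo: "bounded_op V N A \<Longrightarrow> bounded_op V N (geo_op A w n)"
  unfolding geo_op_def[abs_def] by (intro bounded_op_sum bounded_op_scale bounded_op_funpow)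

lemma geo_op_Suc: "geo_op A w (Suc n) f x = (A ^^ n) f x + w * geo_op A w n f x"
  unfolding geo_op_def by (subst sum.lessThan_Suc_shift) (simp add: sum_distrib_left mult.assoc)

lemma geo_op_left:
  assumes A: "bounded_op V N A" and f: "f \<in> V"
  shows "w * geo_op A w n f x - A (geo_op A w n f) x = w ^ n * f x - (A ^^ n) f x"
proof (induction n arbitrary: x)
  case 0 thus ?case by (simp add: geo_op_def op_zero[OF A])
next
  case (Suc n)
  have "A (geo_op A w (Suc n) f) = A (\<lambda>x. (A ^^ n) f x + w * geo_op A w n f x)"
    by (simp add: geo_op_Suc[abs_def])
  also have "\<dots> = (\<lambda>x. A ((A ^^ n) f) x + w * A (geo_op A w n f) x)"
    using op_mem[OF bounded_op_geo[OF A] f] funpow_mem[OF A f]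
    by (simp add: op_add[OF A] op_scale[OF A] scale_mem)
  finally have "w * geo_op A w (Suc n) f x - A (geo_op A w (Suc n) f) x
     = w * (A ^^ n) f x - (A ^^ Suc n) f x + w * (w * geo_op A w n f x - A (geo_op A w n f) x)"
    by (simp add: geo_op_Suc algebra_simps)
  also have "\<dots> = w ^ Suc n * f x - (A ^^ Suc n) f x"
    unfolding Suc.IH by (simp add: algebra_simps)
  finally show ?case .
qed

lemma geo_op_commute:
  assumes A: "bounded_op V N A" and f: "f \<in> V"
  shows "A (geo_op A w n f) = geo_op A w n (A f)"
proof -
  have "A (geo_op A w n f) = (\<lambda>x. \<Sum>i<n. A (\<lambda>x. w ^ i * (A ^^ (n - 1 - i)) f x) x)"
    unfolding geo_op_def by (intro op_sum[OF A] scale_mem funpow_mem[OF A f])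
  also have "\<dots> = (\<lambda>x. \<Sum>i<n. w ^ i * A ((A ^^ (n - 1 - i)) f) x)"
    by (simp add: op_scale[OF A funpow_mem[OF A f]])
  finally show ?thesis unfolding geo_op_def by (simp add: funpow_swap1)
qed

lemma geo_op_right:
  assumes A: "bounded_op V N A" and f: "f \<in> V"
  shows "geo_op A w n (\<lambda>x. w * f x - A f x) = (\<lambda>x. w ^ n * f x - (A ^^ n) f x)"
proof -
  have "geo_op A w n (\<lambda>x. w * f x - A f x) = (\<lambda>x. w * geo_op A w n f x - geo_op A w n (A f) x)"
    using op_diff[OF bounded_op_geo[OF A] scale_mem[OF f] op_mem[OF A f]]
      op_scale[OF bounded_op_geo[OF A] f] by simp
  thus ?thesis using geo_op_left[OF assms] geo_op_commute[OF assms] by simp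
qed

section \<open>Resolvents\<close>

definition is_resolvent :: "(('a \<Rightarrow> complex) \<Rightarrow> 'a \<Rightarrow> complex) \<Rightarrow> complex \<Rightarrow> (('a \<Rightarrow> complex) \<Rightarrow> 'a \<Rightarrow> complex) \<Rightarrow> bool" where
  "is_resolvent T l S \<longleftrightarrow> bounded_op V N S \<and>
     (\<forall>f\<in>V. (\<lambda>x. l * S f x - T (S f) x) = f \<and> S (\<lambda>x. l * f x - T f x) = f)"

text \<open>Resolvents here invert \<open>l - T\<close>, whereas \<open>op_spectrum\<close> speaks
  of \<open>T - l\<close>; the two inverses differ by a sign. With \<open>l - T\<close> the Neumann
  series, the determinants and the contour integrals carry no signs.\<close>

lemma not_spectrum_iff:
  assumes T: "bounded_op V N T"
  shows "l \<notin> op_spectrum V N T \<longleftrightarrow> (\<exists>S. is_resolvent T l S)"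
proof
  assume "l \<notin> op_spectrum V N T"
  then obtain S where S: "bounded_op V N S"
    "\<And>f. f \<in> V \<Longrightarrow> S (shift_op T l f) = f" "\<And>f. f \<in> V \<Longrightarrow> shift_op T l (S f) = f"
    unfolding op_spectrum_def by blast
  have *: "T (\<lambda>x. - S f x) = (\<lambda>x. - T (S f) x)" if "f \<in> V" for f
    by (rule op_uminus[OF T op_mem[OF S(1) that]])
  have "is_resolvent T l (\<lambda>f x. - S f x)"
    unfolding is_resolvent_def
  proof (intro conjI ballI)
    show "bounded_op V N (\<lambda>f x. - S f x)" using bounded_op_scale[OF S(1), of "-1"] by simp
    fix f assume f: "f \<in> V"
    show "(\<lambda>x. l * - S f x - T (\<lambda>x. - S f x) x) = f"
      unfolding *[OF f] using S(3)[OF f] unfolding shift_op_def by (auto simp: fun_eq_iff algebra_simps)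
    have "(\<lambda>x. l * f x - T f x) = (\<lambda>x. - shift_op T l f x)" unfolding shift_op_def by simp
    thus "(\<lambda>x. - S (\<lambda>x. l * f x - T f x) x) = f"
      using op_uminus[OF S(1) op_mem[OF bounded_op_shift[OF T] f]] S(2)[OF f] by simp
  qed
  thus "\<exists>S. is_resolvent T l S" by blast
next
  assume "\<exists>S. is_resolvent T l S"
  then obtain S where S: "bounded_op V N S"
    "\<And>f. f \<in> V \<Longrightarrow> (\<lambda>x. l * S f x - T (S f) x) = f" "\<And>f. f \<in> V \<Longrightarrow> S (\<lambda>x. l * f x - T f x) = f"
    unfolding is_resolvent_def by blast
  have "bounded_op V N (\<lambda>f x. - S f x)" using bounded_op_scale[OF S(1), of "-1"] by simp
  moreover have "(\<lambda>x. - S (shift_op T l f) x) = f" if f: "f \<in> V" for f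
  proof -
    have eq: "shift_op T l f = (\<lambda>x. - (l * f x - T f x))" unfolding shift_op_def by simp
    have "(\<lambda>x. l * f x - T f x) \<in> V" by (intro diff_mem scale_mem op_mem[OF T] f)
    from op_uminus[OF S(1) this] show ?thesis unfolding eq S(3)[OF f] by simp
  qed
  moreover have "shift_op T l (\<lambda>x. - S f x) = f" if f: "f \<in> V" for f
    using S(2)[OF f] op_uminus[OF T op_mem[OF S(1) f]] unfolding shift_op_def
    by (auto simp: fun_eq_iff algebra_simps)
  ultimately show "l \<notin> op_spectrum V N T" unfolding op_spectrum_def by blast
qed

definition resolvent :: "(('a \<Rightarrow> complex) \<Rightarrow> 'a \<Rightarrow> complex) \<Rightarrow> complex \<Rightarrow> ('a \<Rightarrow> complex) \<Rightarrow> 'a \<Rightarrow> complex" where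
  "resolvent T l = (SOME S. is_resolvent T l S)"

lemma resolvent:
  assumes "bounded_op V N T" "l \<notin> op_spectrum V N T"
  shows "bounded_op V N (resolvent T l)"
    and "f \<in> V \<Longrightarrow> l * resolvent T l f x - T (resolvent T l f) x = f x"
    and "f \<in> V \<Longrightarrow> resolvent T l (\<lambda>x. l * f x - T f x) = f"
proof -
  have "is_resolvent T l (resolvent T l)"
    using assms not_spectrum_iff unfolding resolvent_def by (metis someI_ex)
  thus "bounded_op V N (resolvent T l)"
    "f \<in> V \<Longrightarrow> l * resolvent T l f x - T (resolvent T l f) x = f x"
    "f \<in> V \<Longrightarrow> resolvent T l (\<lambda>x. l * f x - T f x) = f"
    unfolding is_resolvent_def by (auto simp: fun_eq_iff)
qed

text \<open>Injectivity of \<open>l - T\<close>. It identifies the resolvent with solutions found by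
  other means: quotients of an adjugate and a determinant, explicit polynomials on generalised
  eigenfunctions, restrictions of analytic functions, and pointwise limits.\<close>

lemma resolvent_unique:
  assumes "bounded_op V N T" "l \<notin> op_spectrum V N T" "f \<in> V" "g \<in> V"
    "\<And>x. l * g x - T g x = f x"
  shows "g = resolvent T l f"
proof -
  have "f = (\<lambda>x. l * g x - T g x)" using assms(5) by auto
  thus ?thesis using resolvent(3)[OF assms(1,2,4)] by simp
qed

lemma resolvent_identity:
  assumes T: "bounded_op V N T" and l: "l \<notin> op_spectrum V N T" and m: "m \<notin> op_spectrum V N T"
    and f: "f \<in> V"
  shows "resolvent T l f x - resolvent T m f x = (m - l) * resolvent T l (resolvent T m f) x"
proof -
  note R = resolvent[OF T l] and R' = resolvent[OF T m]
  let ?g = "resolvent T m f"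
  have g: "?g \<in> V" by (rule op_mem[OF R'(1) f])
  have h: "(\<lambda>x. l * ?g x - T ?g x) \<in> V" by (intro diff_mem scale_mem op_mem[OF T] g)
  have "f = (\<lambda>x. (m - l) * ?g x + (l * ?g x - T ?g x))"
    using R'(2)[OF f] by (auto simp: fun_eq_iff algebra_simps)
  hence "resolvent T l f = resolvent T l (\<lambda>x. (m - l) * ?g x + (l * ?g x - T ?g x))" by simp
  also have "\<dots> = (\<lambda>x. (m - l) * resolvent T l ?g x + ?g x)"
    by (simp add: op_add[OF R(1) scale_mem[OF g] h] op_scale[OF R(1) g] R(3)[OF g])
  finally show ?thesis by simp
qed

text \<open>By the resolvent identity the norm of the resolvent at \<open>m\<close> is at most
  \<open>C * N f\<close> plus \<open>cmod (m - l) * C\<close> times itself; \<open>d\<close> is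
  chosen to make that factor at most 1/2, so it can be absorbed, which doubles the constant.\<close>

lemma resolvent_local_bound:
  assumes T: "bounded_op V N T" and l: "l \<notin> op_spectrum V N T"
  obtains C d where "C \<ge> 0" "d > 0"
    "\<And>m f. cmod (m - l) < d \<Longrightarrow> m \<notin> op_spectrum V N T \<Longrightarrow> f \<in> V \<Longrightarrow> N (resolvent T m f) \<le> C * N f"
proof -
  obtain C where C: "C \<ge> 0" "\<And>f. f \<in> V \<Longrightarrow> N (resolvent T l f) \<le> C * N f"
    using op_bound[OF resolvent(1)[OF T l]] by metis
  define d where "d = 1 / (2 * (C + 1))"
  have d: "d > 0" using C(1) unfolding d_def by simp
  have "N (resolvent T m f) \<le> (2 * C) * N f"
    if m: "cmod (m - l) < d" "m \<notin> op_spectrum V N T" and f: "f \<in> V" for m f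
  proof -
    let ?R = "resolvent T l" and ?S = "resolvent T m"
    have SV: "?S f \<in> V" and RV: "?R f \<in> V"
      using op_mem[OF resolvent(1)[OF T m(2)] f] op_mem[OF resolvent(1)[OF T l] f] by auto
    have RSV: "?R (?S f) \<in> V" by (rule op_mem[OF resolvent(1)[OF T l] SV])
    have "?S f = (\<lambda>x. ?R f x - (m - l) * ?R (?S f) x)"
      using resolvent_identity[OF T l m(2) f] by (auto simp: fun_eq_iff algebra_simps)
    hence "N (?S f) \<le> N (?R f) + cmod (m - l) * N (?R (?S f))"
      using norm_diff[OF RV scale_mem[OF RSV, of "m - l"]] norm_scale[OF RSV, of "m - l"] by metis
    also have "\<dots> \<le> C * N f + d * (C * N (?S f))"
      using C(2)[OF f] C(2)[OF SV] m(1) norm_nonneg[OF RSV] d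
      by (intro add_mono mult_mono) auto
    also have "d * (C * N (?S f)) \<le> 1/2 * N (?S f)"
    proof -
      have "d * C \<le> 1/2" unfolding d_def using C(1) by (simp add: divide_simps)
      from mult_right_mono[OF this norm_nonneg[OF SV]] show ?thesis by (simp add: mult.assoc)
    qed
    finally show ?thesis by simp
  qed
  thus ?thesis using that[of "2 * C" d] C(1) d by auto
qed

text \<open>Take norms in \<open>l * u = f + T u\<close>. For large \<open>l\<close> this makes the
  resolvent of size about \<open>1 / cmod l\<close>, which controls the expansion at infinity in
  \<open>spectral_growth\<close>.\<close>

lemma resolvent_large:
  assumes T: "bounded_op V N T" and l: "l \<notin> op_spectrum V N T" and f: "f \<in> V"
    and C: "\<And>f. f \<in> V \<Longrightarrow> N (T f) \<le> C * N f"
  shows "(cmod l - C) * N (resolvent T l f) \<le> N f"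
proof -
  let ?R = "resolvent T l f"
  have RV: "?R \<in> V" by (rule op_mem[OF resolvent(1)[OF T l] f])
  have "(\<lambda>x. l * ?R x) = (\<lambda>x. f x + T ?R x)"
    using resolvent(2)[OF T l f] by (auto simp: fun_eq_iff algebra_simps)
  hence "cmod l * N ?R \<le> N f + N (T ?R)"
    using norm_scale[OF RV, of l] norm_add[OF f op_mem[OF T RV]] by simp
  thus ?thesis using C[OF RV] by (simp add: algebra_simps)
qed

text \<open>The Neumann series solves \<open>m * g - Q g = f\<close>; the a priori estimate
  \<open>est\<close> gives injectivity and bounds the inverse. The inverse is a choice function, and
  it is linear because solutions are unique.\<close>

lemma neumann:
  assumes Q: "bounded_op V N Q" and q: "\<And>f. f \<in> V \<Longrightarrow> N (Q f) \<le> q * N f" and "q \<ge> 0" and m: "cmod m > q"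
  shows "m \<notin> op_spectrum V N Q"
proof -
  have m0: "m \<noteq> 0" using m \<open>q \<ge> 0\<close> by auto
  have ex: "\<exists>g\<in>V. (\<lambda>x. m * g x - Q g x) = f" if f: "f \<in> V" for f
  proof -
    define g where "g n = (\<lambda>x. inverse m ^ Suc n * (Q ^^ n) f x)" for n
    have QV: "(Q ^^ n) f \<in> V" for n by (rule funpow_mem[OF Q f])
    have gV: "g n \<in> V" for n unfolding g_def by (intro scale_mem QV)
    have Qn: "N ((Q ^^ n) f) \<le> q ^ n * N f" for n
    proof (induction n)
      case (Suc n)
      have "N ((Q ^^ Suc n) f) \<le> q * N ((Q ^^ n) f)" using q[OF QV, of n] by simp
      also have "\<dots> \<le> q * (q ^ n * N f)" by (rule mult_left_mono[OF Suc \<open>q \<ge> 0\<close>])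
      finally show ?case by simp
    qed simp
    have bd: "N (g n) \<le> (N f / cmod m) * (q / cmod m) ^ n" for n
    proof -
      have "N (g n) = inverse (cmod m) ^ Suc n * N ((Q ^^ n) f)"
        unfolding g_def using norm_scale[OF QV, of "inverse m ^ Suc n" n] by (simp add: norm_mult norm_power norm_inverse)
      also have "\<dots> \<le> inverse (cmod m) ^ Suc n * (q ^ n * N f)"
        by (rule mult_left_mono[OF Qn]) simp
      also have "\<dots> = (N f / cmod m) * (q / cmod m) ^ n"
        by (simp add: field_simps power_divide)
      finally show ?thesis .
    qed
    have sm: "summable (\<lambda>n. (N f / cmod m) * (q / cmod m) ^ n)"
      using m \<open>q \<ge> 0\<close> by (intro summable_mult summable_geometric) (auto simp: divide_simps)
    note S = series[OF gV bd sm]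
    define h where "h = (\<lambda>x. \<Sum>n. g n x)"
    define s where "s n = (\<lambda>x. \<Sum>i<n. g i x)" for n
    have sV: "s n \<in> V" for n unfolding s_def by (intro sum_mem gV)
    have hV: "h \<in> V" using S(1) unfolding h_def .
    have lim: "(\<lambda>n. N (\<lambda>x. s n x - h x)) \<longlonglongrightarrow> 0" using S(4) unfolding s_def h_def .
    have QsV: "Q (s n) \<in> V" for n by (rule op_mem[OF Q sV])
    have QhV: "Q h \<in> V" by (rule op_mem[OF Q hV])
    have "(\<lambda>n. N (\<lambda>x. Q (s n) x - Q h x)) \<longlonglongrightarrow> 0"
    proof (rule Lim_null_comparison)
      show "(\<lambda>n. q * N (\<lambda>x. s n x - h x)) \<longlonglongrightarrow> 0" using tendsto_mult_left[OF lim, of q] by simp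
      show "\<forall>\<^sub>F n in sequentially. norm (N (\<lambda>x. Q (s n) x - Q h x)) \<le> q * N (\<lambda>x. s n x - h x)"
      proof (rule always_eventually, rule allI)
        fix n
        have "Q (\<lambda>x. s n x - h x) = (\<lambda>x. Q (s n) x - Q h x)" by (rule op_diff[OF Q sV hV])
        thus "norm (N (\<lambda>x. Q (s n) x - Q h x)) \<le> q * N (\<lambda>x. s n x - h x)"
          using q[OF diff_mem[OF sV hV], of n] norm_nonneg[OF diff_mem[OF QsV QhV], of n] by simp
      qed
    qed
    hence l1: "(\<lambda>n. Q (s n) x) \<longlonglongrightarrow> Q h x" for x
      using tendsto_eval[of "\<lambda>n. Q (s n)", OF QsV QhV] by simp
    have l2: "(\<lambda>n. s n x) \<longlonglongrightarrow> h x" for x by (rule tendsto_eval[OF sV hV lim])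
    \<comment> \<open>Applying \<open>Q\<close> shifts the partial sums by one index; both sides
      converge pointwise, and the limit is the equation for \<open>h\<close>.\<close>
    have Qs: "Q (s n) x = m * s (Suc n) x - f x" for n x
    proof -
      have "Q (s n) = (\<lambda>x. \<Sum>i<n. Q (g i) x)" unfolding s_def by (rule op_sum[OF Q gV])
      moreover have "Q (g i) = (\<lambda>x. m * g (Suc i) x)" for i
        unfolding g_def using m0 by (simp add: op_scale[OF Q QV] fun_eq_iff)
      moreover have "m * s (Suc n) x = f x + (\<Sum>i<n. m * g (Suc i) x)"
        unfolding s_def sum.lessThan_Suc_shift using m0 by (simp add: g_def distrib_left sum_distrib_left)
      ultimately show ?thesis by simp
    qed
    have "Q h x = m * h x - f x" for x
    proof -
      have "(\<lambda>n. m * s (Suc n) x - f x) \<longlonglongrightarrow> m * h x - f x"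
        by (intro tendsto_intros LIMSEQ_Suc l2)
      thus ?thesis using l1[of x] LIMSEQ_unique unfolding Qs by blast
    qed
    thus ?thesis using hV by (intro bexI[of _ h]) auto
  qed
  have est: "N g \<le> N (\<lambda>x. m * g x - Q g x) / (cmod m - q)" if g: "g \<in> V" for g
  proof -
    let ?f = "\<lambda>x. m * g x - Q g x"
    have f: "?f \<in> V" by (intro diff_mem scale_mem g op_mem[OF Q])
    have "(\<lambda>x. m * g x) = (\<lambda>x. ?f x + Q g x)" by simp
    hence "cmod m * N g \<le> N ?f + N (Q g)"
      using norm_scale[OF g, of m] norm_add[OF f op_mem[OF Q g]] by simp
    hence "(cmod m - q) * N g \<le> N ?f" using q[OF g] by (simp add: algebra_simps)
    thus ?thesis using m by (simp add: field_simps)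
  qed
  have inj: "g = h" if "g \<in> V" "h \<in> V" "(\<lambda>x. m * g x - Q g x) = (\<lambda>x. m * h x - Q h x)" for g h
  proof -
    have "(\<lambda>x. m * (g x - h x) - Q (\<lambda>x. g x - h x) x) = (\<lambda>x. 0)"
      unfolding op_diff[OF Q that(1,2)] using that(3) by (auto simp: fun_eq_iff algebra_simps)
    with est[OF diff_mem[OF that(1,2)]] have "N (\<lambda>x. g x - h x) \<le> 0" by simp
    from eq_zeroI[OF diff_mem[OF that(1,2)] this] show ?thesis by (auto simp: fun_eq_iff)
  qed
  define S where "S f = (SOME g. g \<in> V \<and> (\<lambda>x. m * g x - Q g x) = f)" for f
  have S: "S f \<in> V \<and> (\<lambda>x. m * S f x - Q (S f) x) = f" if "f \<in> V" for f
    unfolding S_def by (rule someI_ex[of "\<lambda>g. g \<in> V \<and> (\<lambda>x. m * g x - Q g x) = f"]) (use ex[OF that] in blast)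
  have Sx: "Q (S f) x = m * S f x - f x" if "f \<in> V" for f x
    using S[OF that] by (auto simp: fun_eq_iff algebra_simps)
  have "is_resolvent Q m S"
    unfolding is_resolvent_def
  proof (intro conjI ballI)
    fix f assume f: "f \<in> V"
    show "(\<lambda>x. m * S f x - Q (S f) x) = f" using S[OF f] by simp
    have h: "(\<lambda>x. m * f x - Q f x) \<in> V" by (intro diff_mem scale_mem f op_mem[OF Q])
    show "S (\<lambda>x. m * f x - Q f x) = f" by (rule inj) (use S[OF h] f in auto)
  next
    show "bounded_op V N S"
    proof (rule bounded_opI[where C = "1 / (cmod m - q)"])
      fix f g assume fg: "f \<in> V" "g \<in> V"
      have h: "(\<lambda>x. f x + g x) \<in> V" by (rule add_mem[OF fg])
      show "S (\<lambda>x. f x + g x) = (\<lambda>x. S f x + S g x)"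
      proof (rule inj)
        show "(\<lambda>x. m * S (\<lambda>x. f x + g x) x - Q (S (\<lambda>x. f x + g x)) x) =
          (\<lambda>x. m * (S f x + S g x) - Q (\<lambda>x. S f x + S g x) x)"
          using fg h S by (simp add: Sx op_add[OF Q] algebra_simps)
      qed (use S fg h in \<open>auto intro: add_mem\<close>)
    next
      fix c f assume f: "f \<in> V"
      have h: "(\<lambda>x. c * f x) \<in> V" by (rule scale_mem[OF f])
      show "S (\<lambda>x. c * f x) = (\<lambda>x. c * S f x)"
      proof (rule inj)
        show "(\<lambda>x. m * S (\<lambda>x. c * f x) x - Q (S (\<lambda>x. c * f x)) x) =
          (\<lambda>x. m * (c * S f x) - Q (\<lambda>x. c * S f x) x)"
          using f h S by (simp add: Sx op_scale[OF Q] algebra_simps)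
      qed (use S f h in \<open>auto intro: scale_mem\<close>)
    next
      fix f assume f: "f \<in> V"
      show "S f \<in> V" using S[OF f] by simp
      show "N (S f) \<le> 1 / (cmod m - q) * N f" using est[of "S f"] S[OF f] by simp
    qed
  qed
  thus ?thesis using not_spectrum_iff[OF Q] by blast
qed

end

section \<open>Fredholm theory\<close>

lemma sum_lessThan_add: "(\<Sum>i<m + n. h i) = (\<Sum>i<m. h i) + (\<Sum>i<n. h (m + i :: nat) :: 'a::comm_monoid_add)"
  by (induction n) (auto simp: add.assoc)

text \<open>A polynomial that is O(w^n) at 0 has no terms of degree below n: the constant term is
  the limit at 0, and after dividing by w the induction hypothesis applies. The bound is only
  required off 0, where quotients by w make sense.\<close>

lemma coeffs_zero_if_small:
  fixes a :: "nat \<Rightarrow> complex"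
  assumes "\<forall>\<^sub>F w in at 0. cmod (\<Sum>i<r. w ^ i * a i) \<le> C * cmod w ^ n" "i < n" "i < r"
  shows "a i = 0"
  using assms
proof (induction n arbitrary: r a i)
  case (Suc n)
  obtain r' where r: "r = Suc r'" using Suc.prems(3) by (cases r) auto
  have lim: "((\<lambda>w. \<Sum>i<r. w ^ i * a i) \<longlongrightarrow> (\<Sum>i<r. 0 ^ i * a i)) (at 0)"
    by (intro tendsto_intros)
  have "((\<lambda>w. C * cmod w ^ Suc n) \<longlongrightarrow> C * cmod 0 ^ Suc n) (at 0)" by (intro tendsto_intros)
  hence "((\<lambda>w. C * cmod w ^ Suc n) \<longlongrightarrow> 0) (at 0)" by simp
  hence "((\<lambda>w. \<Sum>i<r. w ^ i * a i) \<longlongrightarrow> 0) (at 0)"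
    by (rule Lim_null_comparison[OF Suc.prems(1)])
  from tendsto_unique[OF _ lim this] have "(\<Sum>i<r. 0 ^ i * a i) = 0" by simp
  hence a0: "a 0 = 0" unfolding r by (subst (asm) sum.lessThan_Suc_shift) simp
  show ?case
  proof (cases i)
    case 0 thus ?thesis using a0 by simp
  next
    case (Suc j)
    have "\<forall>\<^sub>F w in at 0. cmod (\<Sum>i<r'. w ^ i * a (Suc i)) \<le> C * cmod w ^ n"
      using Suc.prems(1) eventually_neq_at_within[of 0 0 UNIV]
    proof eventually_elim
      case (elim w)
      have "(\<Sum>i<r. w ^ i * a i) = w * (\<Sum>i<r'. w ^ i * a (Suc i))"
        unfolding r by (subst sum.lessThan_Suc_shift) (simp add: a0 sum_distrib_left mult.assoc)
      hence "cmod w * cmod (\<Sum>i<r'. w ^ i * a (Suc i)) \<le> cmod w * (C * cmod w ^ n)"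
        using elim(1) by (simp add: norm_mult mult.left_commute)
      thus ?case using elim by simp
    qed
    from Suc.IH[OF this] show ?thesis using Suc.prems Suc r by auto
  qed
qed simp

text \<open>The difference quotient differs from \<open>b\<close> by \<open>(z - z0) * r z\<close>,
  so a bounded remainder suffices; a jet of order 2 supplies exactly this after applying a
  functional.\<close>

lemma has_field_derivative_from_expansion:
  fixes f r :: "complex \<Rightarrow> complex"
  assumes "\<forall>\<^sub>F z in nhds z0. f z = a + (z - z0) * b + (z - z0)\<^sup>2 * r z \<and> cmod (r z) \<le> K"
  shows "(f has_field_derivative b) (at z0)"
proof -
  have fz0: "f z0 = a" using eventually_nhds_x_imp_x[OF assms] by simp
  have ev: "\<forall>\<^sub>F z in at z0. f z = a + (z - z0) * b + (z - z0)\<^sup>2 * r z \<and> cmod (r z) \<le> K"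
    using assms unfolding eventually_at_filter by (rule eventually_mono) auto
  have "((\<lambda>z. (f z - f z0) / (z - z0) - b) \<longlongrightarrow> 0) (at z0)"
  proof (rule Lim_null_comparison)
    have "((\<lambda>z. cmod (z - z0) * K) \<longlongrightarrow> cmod (z0 - z0) * K) (at z0)" by (intro tendsto_intros)
    thus "((\<lambda>z. cmod (z - z0) * K) \<longlongrightarrow> 0) (at z0)" by simp
    show "\<forall>\<^sub>F z in at z0. cmod ((f z - f z0) / (z - z0) - b) \<le> cmod (z - z0) * K"
      using ev eventually_neq_at_within[of z0 z0 UNIV]
    proof eventually_elim
      case (elim z)
      have "(f z - f z0) / (z - z0) - b = (z - z0) * r z"
        using elim fz0 by (simp add: field_simps power2_eq_square)
      thus ?case using elim by (simp add: norm_mult mult_left_mono)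
    qed
  qed
  hence "((\<lambda>z. (f z - f z0) / (z - z0)) \<longlongrightarrow> b) (at z0)" by (rule LIM_zero_cancel)
  thus ?thesis by (simp add: has_field_derivative_iff)
qed

section \<open>Bounded functionals, Taylor jets and determinants\<close>

context complex_function_space
begin

definition bounded_functional :: "(('a \<Rightarrow> complex) \<Rightarrow> complex) \<Rightarrow> bool" where
  "bounded_functional \<phi> \<longleftrightarrow> (\<forall>f\<in>V. \<forall>g\<in>V. \<phi> (\<lambda>x. f x + g x) = \<phi> f + \<phi> g) \<and>
     (\<forall>c. \<forall>f\<in>V. \<phi> (\<lambda>x. c * f x) = c * \<phi> f) \<and> (\<exists>C. \<forall>f\<in>V. cmod (\<phi> f) \<le> C * N f)"

lemma fn_add: "bounded_functional \<phi> \<Longrightarrow> f \<in> V \<Longrightarrow> g \<in> V \<Longrightarrow> \<phi> (\<lambda>x. f x + g x) = \<phi> f + \<phi> g"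
  and fn_scale: "bounded_functional \<phi> \<Longrightarrow> f \<in> V \<Longrightarrow> \<phi> (\<lambda>x. c * f x) = c * \<phi> f"
  unfolding bounded_functional_def by blast+

lemma fn_bound:
  assumes "bounded_functional \<phi>"
  obtains C where "C \<ge> 0" "\<And>f. f \<in> V \<Longrightarrow> cmod (\<phi> f) \<le> C * N f"
proof -
  obtain C where C: "\<forall>f\<in>V. cmod (\<phi> f) \<le> C * N f" using assms unfolding bounded_functional_def by blast
  have "cmod (\<phi> f) \<le> max C 0 * N f" if "f \<in> V" for f
    using C that norm_nonneg[OF that] by (smt (verit) mult_right_mono max.cobounded1)
  thus ?thesis using that[of "max C 0"] by simp
qed

lemma fn_zero: "bounded_functional \<phi> \<Longrightarrow> \<phi> (\<lambda>x. 0) = 0"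
  using fn_scale[OF _ zero_mem, of \<phi> 0] by simp

lemma fn_diff: "bounded_functional \<phi> \<Longrightarrow> f \<in> V \<Longrightarrow> g \<in> V \<Longrightarrow> \<phi> (\<lambda>x. f x - g x) = \<phi> f - \<phi> g"
  using fn_add[OF _ _ uminus_mem, of \<phi> f g] fn_scale[of \<phi> g "-1"] by simp

lemma fn_sum:
  assumes "bounded_functional \<phi>"
  shows "(\<And>i. i \<in> I \<Longrightarrow> f i \<in> V) \<Longrightarrow> \<phi> (\<lambda>x. \<Sum>i\<in>I. f i x) = (\<Sum>i\<in>I. \<phi> (f i))"
proof (induction I rule: infinite_finite_induct)
  case (insert i I)
  have "\<phi> (\<lambda>x. f i x + (\<Sum>i\<in>I. f i x)) = \<phi> (f i) + \<phi> (\<lambda>x. \<Sum>i\<in>I. f i x)"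
    by (intro fn_add[OF assms] sum_mem) (use insert in auto)
  with insert show ?case by auto
qed (auto simp: fn_zero[OF assms])

lemma bounded_functionalI:
  assumes "\<And>f g. f \<in> V \<Longrightarrow> g \<in> V \<Longrightarrow> \<phi> (\<lambda>x. f x + g x) = \<phi> f + \<phi> g"
    and "\<And>c f. f \<in> V \<Longrightarrow> \<phi> (\<lambda>x. c * f x) = c * \<phi> f"
    and "\<And>f. f \<in> V \<Longrightarrow> cmod (\<phi> f) \<le> C * N f"
  shows "bounded_functional \<phi>"
  unfolding bounded_functional_def using assms by blast

lemma bounded_functional_eval: "bounded_functional (\<lambda>f. f x)"
  by (rule bounded_functionalI[where C = 1]) (auto simp: eval_le)

lemma bounded_functional_zero: "bounded_functional (\<lambda>f. 0)"
  by (rule bounded_functionalI[where C = 0]) auto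

lemma bounded_functional_scale:
  assumes "bounded_functional \<phi>"
  shows "bounded_functional (\<lambda>f. c * \<phi> f)"
proof -
  obtain C where C: "C \<ge> 0" "\<And>f. f \<in> V \<Longrightarrow> cmod (\<phi> f) \<le> C * N f" using fn_bound[OF assms] by metis
  have "cmod (c * \<phi> f) \<le> cmod c * C * N f" if "f \<in> V" for f
    using mult_left_mono[OF C(2)[OF that], of "cmod c"] by (simp add: norm_mult mult.assoc)
  thus ?thesis
    by (intro bounded_functionalI[where C = "cmod c * C"])
       (auto simp: fn_add[OF assms] fn_scale[OF assms] distrib_left)
qed

lemma bounded_functional_diff:
  assumes "bounded_functional \<phi>" "bounded_functional \<psi>"
  shows "bounded_functional (\<lambda>f. \<phi> f - \<psi> f)"
proof -
  obtain C where C: "\<And>f. f \<in> V \<Longrightarrow> cmod (\<phi> f) \<le> C * N f" using fn_bound[OF assms(1)] by metis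
  obtain D where D: "\<And>f. f \<in> V \<Longrightarrow> cmod (\<psi> f) \<le> D * N f" using fn_bound[OF assms(2)] by metis
  have "cmod (\<phi> f - \<psi> f) \<le> (C + D) * N f" if "f \<in> V" for f
    using C[OF that] D[OF that] norm_triangle_ineq4[of "\<phi> f" "\<psi> f"] by (simp add: algebra_simps)
  thus ?thesis
    by (intro bounded_functionalI[where C = "C + D"])
       (auto simp: fn_add[OF assms(1)] fn_scale[OF assms(1)] fn_add[OF assms(2)] fn_scale[OF assms(2)] algebra_simps)
qed

lemma bounded_functional_sum:
  "(\<And>i. i \<in> I \<Longrightarrow> bounded_functional (\<phi> i)) \<Longrightarrow> bounded_functional (\<lambda>f. \<Sum>i\<in>I. \<phi> i f)"
proof (induction I rule: infinite_finite_induct)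
  case (insert i I)
  have "bounded_functional (\<lambda>f. \<phi> i f - (-1) * (\<Sum>i\<in>I. \<phi> i f))"
    by (intro bounded_functional_diff bounded_functional_scale) (use insert in auto)
  with insert show ?case by simp
qed (auto intro: bounded_functional_zero)

lemma bounded_functional_comp:
  assumes "bounded_functional \<phi>" "bounded_op V N T"
  shows "bounded_functional (\<lambda>f. \<phi> (T f))"
proof -
  obtain C where C: "C \<ge> 0" "\<And>f. f \<in> V \<Longrightarrow> cmod (\<phi> f) \<le> C * N f" using fn_bound[OF assms(1)] by metis
  obtain D where D: "\<And>f. f \<in> V \<Longrightarrow> N (T f) \<le> D * N f" using op_bound[OF assms(2)] by metis
  have "cmod (\<phi> (T f)) \<le> (C * D) * N f" if "f \<in> V" for f
  proof -
    have "cmod (\<phi> (T f)) \<le> C * N (T f)" by (rule C(2)[OF op_mem[OF assms(2) that]])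
    also have "\<dots> \<le> C * (D * N f)" by (rule mult_left_mono[OF D[OF that] C(1)])
    finally show ?thesis by simp
  qed
  thus ?thesis
    by (intro bounded_functionalI[where C = "C * D"])
       (simp_all add: fn_add[OF assms(1)] fn_scale[OF assms(1)] op_add[OF assms(2)] op_scale[OF assms(2)] op_mem[OF assms(2)])
qed

lemma fn_limit_zero:
  assumes "bounded_functional \<phi>" "\<And>n. s n \<in> V" "g \<in> V" "(\<lambda>n. N (\<lambda>x. s n x - g x)) \<longlonglongrightarrow> 0" "\<And>n. \<phi> (s n) = 0"
  shows "\<phi> g = 0"
proof -
  obtain C where C: "C \<ge> 0" "\<And>f. f \<in> V \<Longrightarrow> cmod (\<phi> f) \<le> C * N f" using fn_bound[OF assms(1)] by metis
  have "cmod (\<phi> g) \<le> C * N (\<lambda>x. s n x - g x)" for n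
    using C(2)[OF diff_mem[OF assms(2) assms(3)], of n] fn_diff[OF assms(1) assms(2) assms(3), of n] assms(5)[of n]
    by simp
  moreover have "(\<lambda>n. C * N (\<lambda>x. s n x - g x)) \<longlonglongrightarrow> 0" using tendsto_mult_left[OF assms(4), of C] by simp
  ultimately have "cmod (\<phi> g) \<le> 0" by (intro tendsto_lowerbound[of _ 0 sequentially "cmod (\<phi> g)"] always_eventually) auto
  thus ?thesis by simp
qed

text \<open>
  \<open>jet p z0 F\<close> says that \<^term>\<open>F\<close> has a Taylor expansion of order \<^term>\<open>p\<close> at \<^term>\<open>z0\<close> with
  coefficients in \<^term>\<open>V\<close> and a remainder that is bounded in norm.
\<close>

primrec jet :: "nat \<Rightarrow> complex \<Rightarrow> (complex \<Rightarrow> 'a \<Rightarrow> complex) \<Rightarrow> bool" where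
  "jet 0 z0 F = (\<exists>C. \<forall>\<^sub>F z in nhds z0. F z \<in> V \<and> N (F z) \<le> C)"
| "jet (Suc p) z0 F = (\<exists>c\<in>V. \<exists>G. jet p z0 G \<and> (\<forall>\<^sub>F z in nhds z0. F z = (\<lambda>x. c x + (z - z0) * G z x)))"

lemma jet_const: "c \<in> V \<Longrightarrow> jet p z0 (\<lambda>z. c)"
proof (induction p arbitrary: c)
  case 0 thus ?case by (auto intro!: exI[of _ "N c"])
next
  case (Suc p)
  show ?case unfolding jet.simps
    by (rule bexI[of _ c], rule exI[of _ "\<lambda>z x. 0"]) (use Suc zero_mem in auto)
qed

lemma jet_add: "jet p z0 F \<Longrightarrow> jet p z0 G \<Longrightarrow> jet p z0 (\<lambda>z x. F z x + G z x)"
proof (induction p arbitrary: F G)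
  case 0
  then obtain C D where "\<forall>\<^sub>F z in nhds z0. F z \<in> V \<and> N (F z) \<le> C" "\<forall>\<^sub>F z in nhds z0. G z \<in> V \<and> N (G z) \<le> D"
    by auto
  hence "\<forall>\<^sub>F z in nhds z0. (\<lambda>x. F z x + G z x) \<in> V \<and> N (\<lambda>x. F z x + G z x) \<le> C + D"
  proof eventually_elim
    case (elim z) thus ?case using norm_add[of "F z" "G z"] add_mem[of "F z" "G z"] by auto
  qed
  thus ?case by auto
next
  case (Suc p)
  obtain c F' where F: "c \<in> V" "jet p z0 F'" "\<forall>\<^sub>F z in nhds z0. F z = (\<lambda>x. c x + (z - z0) * F' z x)"
    using Suc.prems(1) by auto
  obtain d G' where G: "d \<in> V" "jet p z0 G'" "\<forall>\<^sub>F z in nhds z0. G z = (\<lambda>x. d x + (z - z0) * G' z x)"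
    using Suc.prems(2) by auto
  have "\<forall>\<^sub>F z in nhds z0. (\<lambda>x. F z x + G z x) = (\<lambda>x. (c x + d x) + (z - z0) * (F' z x + G' z x))"
    using F(3) G(3) by eventually_elim (simp add: algebra_simps)
  thus ?case using Suc.IH[OF F(2) G(2)] add_mem[OF F(1) G(1)] by auto
qed

text \<open>The divided difference \<open>h1\<close> is analytic again by removable singularities.
  Writing \<open>h z = h z0 + (z - z0) * h1 z\<close> turns the product into a constant plus
  \<open>z - z0\<close> times a function to which the induction hypothesis applies, once with
  \<open>h1\<close> and once with \<open>h\<close>.\<close>

lemma jet_scale:
  assumes "h analytic_on {z0}" "jet p z0 F"
  shows "jet p z0 (\<lambda>z x. h z * F z x)"
  using assms
proof (induction p arbitrary: h F)
  case 0
  obtain C where C: "\<forall>\<^sub>F z in nhds z0. F z \<in> V \<and> N (F z) \<le> C" using 0 by auto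
  have "isCont h z0" using 0(1) analytic_at_imp_isCont by blast
  hence "(h \<longlongrightarrow> h z0) (nhds z0)" using isCont_def tendsto_at_iff_tendsto_nhds by blast
  hence "((\<lambda>z. cmod (h z)) \<longlongrightarrow> cmod (h z0)) (nhds z0)" by (rule tendsto_norm)
  hence "\<forall>\<^sub>F z in nhds z0. cmod (h z) < cmod (h z0) + 1" by (rule order_tendstoD) simp
  with C have "\<forall>\<^sub>F z in nhds z0. (\<lambda>x. h z * F z x) \<in> V \<and> N (\<lambda>x. h z * F z x) \<le> (cmod (h z0) + 1) * C"
  proof eventually_elim
    case (elim z)
    hence "N (\<lambda>x. h z * F z x) \<le> (cmod (h z0) + 1) * C"
      using norm_scale[of "F z" "h z"] norm_nonneg[of "F z"] by (simp add: mult_mono)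
    thus ?case using elim by (auto intro: scale_mem)
  qed
  thus ?case by auto
next
  case (Suc p)
  obtain c F' where F: "c \<in> V" "jet p z0 F'" "\<forall>\<^sub>F z in nhds z0. F z = (\<lambda>x. c x + (z - z0) * F' z x)"
    using Suc.prems(2) by auto
  define h1 where "h1 = (\<lambda>z. if z = z0 then deriv h z0 else (h z - h z0) / (z - z0))"
  obtain U where U: "open U" "z0 \<in> U" "h holomorphic_on U"
    using Suc.prems(1) by (auto simp: analytic_at)
  have "h1 holomorphic_on U" unfolding h1_def by (rule pole_lemma_open[OF U(3,1)])
  hence h1: "h1 analytic_on {z0}" using U by (auto simp: analytic_at)
  have hh: "h z = h z0 + (z - z0) * h1 z" for z unfolding h1_def by auto
  have j: "jet p z0 (\<lambda>z x. h1 z * c x + h z * F' z x)"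
    by (intro jet_add Suc.IH Suc.prems(1) h1 F(2) jet_const F(1))
  have "\<forall>\<^sub>F z in nhds z0. (\<lambda>x. h z * F z x) = (\<lambda>x. h z0 * c x + (z - z0) * (h1 z * c x + h z * F' z x))"
    using F(3)
  proof eventually_elim
    case (elim z)
    have "h z * F z x = h z0 * c x + (z - z0) * (h1 z * c x + h z * F' z x)" for x
    proof -
      have "h z * F z x = h z * c x + (z - z0) * (h z * F' z x)" unfolding elim by (simp add: algebra_simps)
      also have "h z * c x = h z0 * c x + (z - z0) * (h1 z * c x)" by (subst hh) (simp add: algebra_simps)
      finally show ?thesis by (simp add: algebra_simps)
    qed
    thus ?case by auto
  qed
  thus ?case using j scale_mem[OF F(1), of "h z0"] unfolding jet.simps
    by (intro bexI[of _ "\<lambda>x. h z0 * c x"] exI[of _ "\<lambda>z x. h1 z * c x + h z * F' z x"]) auto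
qed

lemma jet_expansion:
  assumes "jet p z0 F"
  shows "\<exists>c G C. (\<forall>j. c j \<in> V) \<and>
    (\<forall>\<^sub>F z in nhds z0. G z \<in> V \<and> N (G z) \<le> C \<and> F z = (\<lambda>x. (\<Sum>j<p. (z - z0) ^ j * c j x) + (z - z0) ^ p * G z x))"
  using assms
proof (induction p arbitrary: F)
  case 0
  then obtain C where "\<forall>\<^sub>F z in nhds z0. F z \<in> V \<and> N (F z) \<le> C" by auto
  thus ?case using zero_mem by (intro exI[of _ "\<lambda>j x. 0"] exI[of _ F] exI[of _ C]) auto
next
  case (Suc p)
  obtain c0 F' where F: "c0 \<in> V" "jet p z0 F'" "\<forall>\<^sub>F z in nhds z0. F z = (\<lambda>x. c0 x + (z - z0) * F' z x)"
    using Suc.prems by auto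
  obtain c G C where c: "\<forall>j. c j \<in> V" and
    G: "\<forall>\<^sub>F z in nhds z0. G z \<in> V \<and> N (G z) \<le> C \<and> F' z = (\<lambda>x. (\<Sum>j<p. (z - z0) ^ j * c j x) + (z - z0) ^ p * G z x)"
    using Suc.IH[OF F(2)] by blast
  define c' where "c' j = (case j of 0 \<Rightarrow> c0 | Suc i \<Rightarrow> c i)" for j
  have "\<forall>j. c' j \<in> V" using c F(1) unfolding c'_def by (auto split: nat.splits)
  moreover have "\<forall>\<^sub>F z in nhds z0. G z \<in> V \<and> N (G z) \<le> C \<and>
      F z = (\<lambda>x. (\<Sum>j<Suc p. (z - z0) ^ j * c' j x) + (z - z0) ^ Suc p * G z x)"
    using F(3) G
  proof eventually_elim
    case (elim z)
    have "F z = (\<lambda>x. (\<Sum>j<Suc p. (z - z0) ^ j * c' j x) + (z - z0) ^ Suc p * G z x)"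
    proof
      fix x
      have "F z x = c0 x + (z - z0) * ((\<Sum>j<p. (z - z0) ^ j * c j x) + (z - z0) ^ p * G z x)"
        using elim by simp
      thus "F z x = (\<Sum>j<Suc p. (z - z0) ^ j * c' j x) + (z - z0) ^ Suc p * G z x"
        by (subst sum.lessThan_Suc_shift) (simp add: c'_def algebra_simps sum_distrib_left)
    qed
    with elim show ?case by blast
  qed
  ultimately show ?case by blast
qed

text \<open>Holomorphy is only ever used after a functional: an expansion of order 2 at every point
  becomes a scalar one, hence a complex derivative at every point.\<close>

lemma jet_functional:
  assumes \<phi>: "bounded_functional \<phi>" and U: "open U" and "\<And>z0. z0 \<in> U \<Longrightarrow> jet 2 z0 F"
  shows "(\<lambda>z. \<phi> (F z)) holomorphic_on U"
proof -
  have "\<exists>D. ((\<lambda>z. \<phi> (F z)) has_field_derivative D) (at z0)" if z0: "z0 \<in> U" for z0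
  proof -
    obtain c G C where c: "\<forall>j. c j \<in> V" and
      ev: "\<forall>\<^sub>F z in nhds z0. G z \<in> V \<and> N (G z) \<le> C \<and> F z = (\<lambda>x. (\<Sum>j<2. (z - z0) ^ j * c j x) + (z - z0) ^ 2 * G z x)"
      using jet_expansion[OF assms(3)[OF z0]] by blast
    obtain K where K: "K \<ge> 0" "\<And>f. f \<in> V \<Longrightarrow> cmod (\<phi> f) \<le> K * N f" using fn_bound[OF \<phi>] by metis
    have "\<forall>\<^sub>F z in nhds z0. \<phi> (F z) = \<phi> (c 0) + (z - z0) * \<phi> (c 1) + (z - z0)\<^sup>2 * \<phi> (G z) \<and> cmod (\<phi> (G z)) \<le> K * C"
      using ev
    proof eventually_elim
      case (elim z)
      hence "F z = (\<lambda>x. (c 0 x + (z - z0) * c 1 x) + (z - z0)\<^sup>2 * G z x)" by (auto simp: numeral_2_eq_2)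
      hence "\<phi> (F z) = \<phi> (c 0) + (z - z0) * \<phi> (c 1) + (z - z0)\<^sup>2 * \<phi> (G z)"
        using c elim by (simp add: fn_add[OF \<phi>] fn_scale[OF \<phi>] add_mem scale_mem)
      moreover have "cmod (\<phi> (G z)) \<le> K * C"
        using K(2)[of "G z"] mult_left_mono[of "N (G z)" C K] K(1) elim by force
      ultimately show ?case by blast
    qed
    from has_field_derivative_from_expansion[OF this] show ?thesis by blast
  qed
  thus ?thesis using U by (metis field_differentiable_at_within field_differentiable_def holomorphic_onI)
qed

text \<open>The resolvent identity reads \<open>R z f = R z0 f - (z - z0) * R z (R z0 f)\<close>, so
  a jet of order \<open>Suc p\<close> at \<open>f\<close> reduces to one of order \<open>p\<close>
  at \<open>R z0 f\<close>. Order 0 is the local bound.\<close>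

lemma jet_resolvent:
  assumes T: "bounded_op V N T" and U: "open U" "U \<inter> op_spectrum V N T = {}" and f: "f \<in> V" and z0: "z0 \<in> U"
  shows "jet p z0 (\<lambda>z. resolvent T z f)"
  using f
proof (induction p arbitrary: f)
  case 0
  have l: "z0 \<notin> op_spectrum V N T" using U z0 by blast
  obtain C d where C: "C \<ge> 0" "d > 0"
    "\<And>m f. cmod (m - z0) < d \<Longrightarrow> m \<notin> op_spectrum V N T \<Longrightarrow> f \<in> V \<Longrightarrow> N (resolvent T m f) \<le> C * N f"
    using resolvent_local_bound[OF T l] by metis
  have "\<forall>\<^sub>F z in nhds z0. z \<in> U \<inter> ball z0 d" using U z0 C(2) by (intro eventually_nhds_in_open) auto
  hence "\<forall>\<^sub>F z in nhds z0. resolvent T z f \<in> V \<and> N (resolvent T z f) \<le> C * N f"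
  proof eventually_elim
    case (elim z)
    hence "cmod (z - z0) < d" "z \<notin> op_spectrum V N T" using U by (auto simp: dist_norm norm_minus_commute)
    thus ?case using C(3) op_mem[OF resolvent(1)[OF T]] 0 by blast
  qed
  thus ?case by auto
next
  case (Suc p)
  have l: "z0 \<notin> op_spectrum V N T" using U z0 by blast
  let ?g = "resolvent T z0 f"
  have g: "?g \<in> V" by (rule op_mem[OF resolvent(1)[OF T l] Suc.prems])
  have "jet p z0 (\<lambda>z x. (-1) * resolvent T z ?g x)" by (intro jet_scale Suc.IH g) auto
  moreover have "\<forall>\<^sub>F z in nhds z0. resolvent T z f = (\<lambda>x. ?g x + (z - z0) * ((-1) * resolvent T z ?g x))"
    using eventually_nhds_in_open[OF U(1) z0]
  proof eventually_elim
    case (elim z)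
    hence "z \<notin> op_spectrum V N T" using U by blast
    from resolvent_identity[OF T this l Suc.prems] show ?case
      by (auto simp: fun_eq_iff algebra_simps)
  qed
  ultimately show ?case using g unfolding jet.simps by blast
qed

text \<open>
  The pair \<open>(d, G)\<close> plays the role of determinant and adjugate of \<^term>\<open>\<mu> - S\<close>.
\<close>

definition fredholm_family where
  "fredholm_family U S d G \<longleftrightarrow> d holomorphic_on U \<and> (\<exists>\<rho>. \<forall>\<mu>\<in>U. cmod \<mu> > \<rho> \<longrightarrow> d \<mu> \<noteq> 0) \<and>
     (\<forall>\<mu>\<in>U. bounded_op V N (G \<mu>)) \<and>
     (\<forall>\<mu>\<in>U. \<forall>f\<in>V. (\<lambda>x. \<mu> * G \<mu> f x - S (G \<mu> f) x) = (\<lambda>x. d \<mu> * f x) \<and>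
                   G \<mu> (\<lambda>x. \<mu> * f x - S f x) = (\<lambda>x. d \<mu> * f x)) \<and>
     (\<forall>f\<in>V. \<forall>z0\<in>U. \<forall>p. jet p z0 (\<lambda>z. G z f))"

lemma fredholm_family_cong:
  assumes "fredholm_family U S d G" "\<And>f. f \<in> V \<Longrightarrow> S f = S' f"
  shows "fredholm_family U S' d G"
  using assms unfolding fredholm_family_def by (auto simp: op_mem)

text \<open>The Sherman-Morrison formula, cleared of denominators.\<close>

lemma fredholm_family_rank_one:
  assumes fam: "fredholm_family U S d G" and U: "open U" and S: "bounded_op V N S"
    and \<phi>: "bounded_functional \<phi>" and e: "e \<in> V"
  shows "fredholm_family U (\<lambda>f x. S f x + \<phi> f * e x) (\<lambda>\<mu>. d \<mu> * (d \<mu> - \<phi> (G \<mu> e)))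
     (\<lambda>\<mu> f x. (d \<mu> - \<phi> (G \<mu> e)) * G \<mu> f x + \<phi> (G \<mu> f) * G \<mu> e x)"
proof -
  have d: "d holomorphic_on U" and large: "\<exists>\<rho>. \<forall>\<mu>\<in>U. cmod \<mu> > \<rho> \<longrightarrow> d \<mu> \<noteq> 0"
    and G: "\<And>\<mu>. \<mu> \<in> U \<Longrightarrow> bounded_op V N (G \<mu>)"
    and left: "\<And>\<mu> f x. \<mu> \<in> U \<Longrightarrow> f \<in> V \<Longrightarrow> S (G \<mu> f) x = \<mu> * G \<mu> f x - d \<mu> * f x"
    and right: "\<And>\<mu> f. \<mu> \<in> U \<Longrightarrow> f \<in> V \<Longrightarrow> G \<mu> (\<lambda>x. \<mu> * f x - S f x) = (\<lambda>x. d \<mu> * f x)"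
    and j: "\<And>f z0 p. f \<in> V \<Longrightarrow> z0 \<in> U \<Longrightarrow> jet p z0 (\<lambda>z. G z f)"
    using fam unfolding fredholm_family_def by (auto simp: fun_eq_iff algebra_simps)
  have GV: "G \<mu> f \<in> V" if "\<mu> \<in> U" "f \<in> V" for \<mu> f using op_mem[OF G] that by blast
  have \<phi>G: "(\<lambda>\<mu>. \<phi> (G \<mu> f)) holomorphic_on U" if "f \<in> V" for f
    by (rule jet_functional[OF \<phi> U]) (rule j[OF that])
  have an: "h analytic_on {z0}" if "h holomorphic_on U" "z0 \<in> U" for h z0
    using that U by (auto simp: analytic_at)
  obtain K where K: "K \<ge> 0" "\<And>f. f \<in> V \<Longrightarrow> cmod (\<phi> f) \<le> K * N f" using fn_bound[OF \<phi>] by metis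
  obtain s where s: "s \<ge> 0" "\<And>f. f \<in> V \<Longrightarrow> N (S f) \<le> s * N f" using op_bound[OF S] by metis
  obtain \<rho> where \<rho>: "\<And>\<mu>. \<mu> \<in> U \<Longrightarrow> cmod \<mu> > \<rho> \<Longrightarrow> d \<mu> \<noteq> 0" using large by blast
  \<comment> \<open>If the new determinant vanished while \<open>d\<close> does not, then
    \<open>u = G \<mu> e\<close> would satisfy \<open>\<mu> * u = d \<mu> * e + S u\<close> with
    \<open>d \<mu> = \<phi> u\<close>. Hence \<open>cmod \<mu> * N u\<close> is at most
    \<open>(s + K * N e) * N u\<close>, so \<open>u = 0\<close> for large \<open>\<mu>\<close>, and
    then \<open>d \<mu> = \<phi> u = 0\<close>.\<close>
  have nz: "d \<mu> * (d \<mu> - \<phi> (G \<mu> e)) \<noteq> 0" if \<mu>: "\<mu> \<in> U" "cmod \<mu> > max \<rho> (s + K * N e)" for \<mu>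
  proof
    assume "d \<mu> * (d \<mu> - \<phi> (G \<mu> e)) = 0"
    moreover have d0: "d \<mu> \<noteq> 0" using \<rho> \<mu> by auto
    ultimately have d\<mu>: "d \<mu> = \<phi> (G \<mu> e)" by simp
    let ?u = "G \<mu> e"
    have u: "?u \<in> V" by (rule GV[OF \<mu>(1) e])
    have "(\<lambda>x. \<mu> * ?u x) = (\<lambda>x. d \<mu> * e x + S ?u x)" using left[OF \<mu>(1) e] by auto
    hence "cmod \<mu> * N ?u \<le> cmod (d \<mu>) * N e + s * N ?u"
      using norm_scale[OF u, of \<mu>] norm_add[OF scale_mem[OF e, of "d \<mu>"] op_mem[OF S u]] norm_scale[OF e, of "d \<mu>"] s(2)[OF u]
      by simp
    moreover have "cmod (d \<mu>) * N e \<le> (K * N ?u) * N e"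
      unfolding d\<mu> by (rule mult_right_mono[OF K(2)[OF u] norm_nonneg[OF e]])
    ultimately have "(cmod \<mu> - (s + K * N e)) * N ?u \<le> 0" by (simp add: algebra_simps)
    hence "N ?u \<le> 0" using \<mu>(2) by (simp add: mult_le_0_iff)
    hence "cmod (\<phi> ?u) \<le> 0" using K(2)[OF u] K(1) by (smt (verit) mult_nonneg_nonpos)
    thus False using d\<mu> d0 by simp
  qed
  show ?thesis
    unfolding fredholm_family_def
  proof (intro conjI ballI allI)
    show "(\<lambda>\<mu>. d \<mu> * (d \<mu> - \<phi> (G \<mu> e))) holomorphic_on U"
      by (intro holomorphic_intros d \<phi>G e)
    show "\<exists>\<rho>. \<forall>\<mu>\<in>U. \<rho> < cmod \<mu> \<longrightarrow> d \<mu> * (d \<mu> - \<phi> (G \<mu> e)) \<noteq> 0" using nz by blast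
  next
    fix \<mu> assume \<mu>: "\<mu> \<in> U"
    obtain C where C: "C \<ge> 0" "\<And>f. f \<in> V \<Longrightarrow> N (G \<mu> f) \<le> C * N f" using op_bound[OF G[OF \<mu>]] by metis
    have "bounded_op V N (\<lambda>f x. \<phi> (G \<mu> f) * G \<mu> e x)"
    proof (rule bounded_opI[where C = "K * C * N (G \<mu> e)"])
      fix f assume f: "f \<in> V"
      have "cmod (\<phi> (G \<mu> f)) \<le> K * (C * N f)"
        using K(2)[OF GV[OF \<mu> f]] mult_left_mono[OF C(2)[OF f] K(1)] by linarith
      from mult_right_mono[OF this norm_nonneg[OF GV[OF \<mu> e]]]
      show "N (\<lambda>x. \<phi> (G \<mu> f) * G \<mu> e x) \<le> K * C * N (G \<mu> e) * N f"
        using norm_scale[OF GV[OF \<mu> e], of "\<phi> (G \<mu> f)"] by (simp add: mult_ac)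
    qed (simp_all add: scale_mem GV[OF \<mu>] e op_add[OF G[OF \<mu>]] op_scale[OF G[OF \<mu>]] fn_add[OF \<phi>] fn_scale[OF \<phi>] distrib_right mult.assoc)
    thus "bounded_op V N (\<lambda>f x. (d \<mu> - \<phi> (G \<mu> e)) * G \<mu> f x + \<phi> (G \<mu> f) * G \<mu> e x)"
      by (intro bounded_op_add bounded_op_scale G \<mu>)
    fix f assume f: "f \<in> V"
    let ?a = "d \<mu> - \<phi> (G \<mu> e)" and ?b = "\<phi> (G \<mu> f)"
    let ?g = "\<lambda>x. ?a * G \<mu> f x + ?b * G \<mu> e x"
    have Sg: "S ?g = (\<lambda>x. ?a * S (G \<mu> f) x + ?b * S (G \<mu> e) x)"
      by (simp add: op_add[OF S] op_scale[OF S] scale_mem GV[OF \<mu> f] GV[OF \<mu> e])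
    have \<phi>g: "\<phi> ?g = ?a * ?b + ?b * \<phi> (G \<mu> e)"
      by (simp add: fn_add[OF \<phi>] fn_scale[OF \<phi>] scale_mem GV[OF \<mu> f] GV[OF \<mu> e])
    show "(\<lambda>x. \<mu> * ?g x - (S ?g x + \<phi> ?g * e x)) = (\<lambda>x. d \<mu> * (d \<mu> - \<phi> (G \<mu> e)) * f x)"
      unfolding Sg \<phi>g left[OF \<mu> f] left[OF \<mu> e] by (auto simp: fun_eq_iff algebra_simps)
    let ?h = "\<lambda>x. \<mu> * f x - (S f x + \<phi> f * e x)"
    have h0: "(\<lambda>x. \<mu> * f x - S f x) \<in> V" by (intro diff_mem scale_mem f op_mem[OF S])
    have "?h = (\<lambda>x. (\<mu> * f x - S f x) - \<phi> f * e x)" by auto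
    hence Gh: "G \<mu> ?h = (\<lambda>x. d \<mu> * f x - \<phi> f * G \<mu> e x)"
      using op_diff[OF G[OF \<mu>] h0 scale_mem[OF e]] right[OF \<mu> f] op_scale[OF G[OF \<mu>] e] by simp
    have \<phi>h: "\<phi> (\<lambda>x. d \<mu> * f x - \<phi> f * G \<mu> e x) = d \<mu> * \<phi> f - \<phi> f * \<phi> (G \<mu> e)"
      by (simp add: fn_diff[OF \<phi>] fn_scale[OF \<phi>] scale_mem f GV[OF \<mu> e])
    show "(\<lambda>x. ?a * G \<mu> ?h x + \<phi> (G \<mu> ?h) * G \<mu> e x) = (\<lambda>x. d \<mu> * (d \<mu> - \<phi> (G \<mu> e)) * f x)"
      unfolding Gh \<phi>h by (auto simp: fun_eq_iff algebra_simps)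
  next
    fix f z0 p assume f: "f \<in> V" and z0: "z0 \<in> U"
    show "jet p z0 (\<lambda>\<mu> x. (d \<mu> - \<phi> (G \<mu> e)) * G \<mu> f x + \<phi> (G \<mu> f) * G \<mu> e x)"
      by (intro jet_add jet_scale j f e z0 an holomorphic_intros d \<phi>G)
  qed
qed

text \<open>Induction on the rank. The start is determinant 1 with the resolvent of \<open>Q\<close>
  as adjugate, which the Neumann series provides on the whole exterior of the disc of radius
  \<open>q\<close>.\<close>

lemma fredholm_family_exists:
  fixes m :: nat
  assumes Q: "bounded_op V N Q" and q: "\<And>f. f \<in> V \<Longrightarrow> N (Q f) \<le> q * N f" "q \<ge> 0"
    and \<phi>: "\<And>i. i < m \<Longrightarrow> bounded_functional (\<phi> i)" and e: "\<And>i. i < m \<Longrightarrow> e i \<in> V"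
  shows "bounded_op V N (\<lambda>f x. Q f x + (\<Sum>i<m. \<phi> i f * e i x)) \<and>
    (\<exists>d G. fredholm_family {\<mu>. cmod \<mu> > q} (\<lambda>f x. Q f x + (\<Sum>i<m. \<phi> i f * e i x)) d G)"
  using \<phi> e
proof (induction m)
  case 0
  have sp: "{\<mu>. cmod \<mu> > q} \<inter> op_spectrum V N Q = {}" using neumann[OF Q q] by auto
  have op: "open {\<mu>. cmod \<mu> > q}" by (intro open_Collect_less continuous_intros)
  have "fredholm_family {\<mu>. cmod \<mu> > q} Q (\<lambda>\<mu>. 1) (resolvent Q)"
    unfolding fredholm_family_def
    using resolvent[OF Q neumann[OF Q q]] jet_resolvent[OF Q op sp] by auto
  thus ?case using Q by auto
next
  case (Suc m)
  have op: "open {\<mu>. cmod \<mu> > q}" by (intro open_Collect_less continuous_intros)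
  let ?S = "\<lambda>f x. Q f x + (\<Sum>i<m. \<phi> i f * e i x)"
  obtain d G where S: "bounded_op V N ?S" and fam: "fredholm_family {\<mu>. cmod \<mu> > q} ?S d G"
    using Suc by auto
  have \<phi>m: "bounded_functional (\<phi> m)" "e m \<in> V" using Suc.prems by auto
  obtain K where K: "K \<ge> 0" "\<And>f. f \<in> V \<Longrightarrow> cmod (\<phi> m f) \<le> K * N f" using fn_bound[OF \<phi>m(1)] by metis
  have "bounded_op V N (\<lambda>f x. \<phi> m f * e m x)"
  proof (rule bounded_opI[where C = "K * N (e m)"])
    fix f assume f: "f \<in> V"
    from mult_right_mono[OF K(2)[OF f] norm_nonneg[OF \<phi>m(2)]]
    show "N (\<lambda>x. \<phi> m f * e m x) \<le> K * N (e m) * N f"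
      using norm_scale[OF \<phi>m(2), of "\<phi> m f"] by (simp add: mult_ac)
  qed (simp_all add: scale_mem \<phi>m(2) fn_add[OF \<phi>m(1)] fn_scale[OF \<phi>m(1)] algebra_simps)
  from bounded_op_add[OF S this] fredholm_family_rank_one[OF fam op S \<phi>m]
  show ?case by (auto simp: add.assoc)
qed

end

section \<open>Finite rank operators and finite rank perturbations\<close>

context complex_function_space
begin

definition finite_rank :: "(('a \<Rightarrow> complex) \<Rightarrow> 'a \<Rightarrow> complex) \<Rightarrow> bool" where
  "finite_rank K \<longleftrightarrow> (\<exists>(m::nat) \<phi> e. (\<forall>i<m. bounded_functional (\<phi> i) \<and> e i \<in> V) \<and>
     (\<forall>f\<in>V. K f = (\<lambda>x. \<Sum>i<m. \<phi> i f * e i x)))"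

lemma finite_rank_zero: "(\<And>f. f \<in> V \<Longrightarrow> K f = (\<lambda>x. 0)) \<Longrightarrow> finite_rank K"
  unfolding finite_rank_def by (intro exI[of _ 0]) auto

lemma finite_rank_one:
  "bounded_functional \<phi> \<Longrightarrow> e \<in> V \<Longrightarrow> finite_rank (\<lambda>f x. \<phi> f * e x)"
  unfolding finite_rank_def by (intro exI[of _ 1] exI[of _ "\<lambda>i. \<phi>"] exI[of _ "\<lambda>i. e"]) auto

lemma finite_rank_cong:
  assumes "finite_rank K" "\<And>f. f \<in> V \<Longrightarrow> L f = K f"
  shows "finite_rank L"
  using assms unfolding finite_rank_def by auto

lemma finite_rank_add:
  assumes "finite_rank K" "finite_rank L"
  shows "finite_rank (\<lambda>f x. K f x + L f x)"
proof -
  obtain m :: nat and \<phi> e where K: "\<And>i. i < m \<Longrightarrow> bounded_functional (\<phi> i)" "\<And>i. i < m \<Longrightarrow> e i \<in> V"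
    "\<And>f. f \<in> V \<Longrightarrow> K f = (\<lambda>x. \<Sum>i<m. \<phi> i f * e i x)" using assms(1) unfolding finite_rank_def by blast
  obtain n :: nat and \<psi> v where L: "\<And>i. i < n \<Longrightarrow> bounded_functional (\<psi> i)" "\<And>i. i < n \<Longrightarrow> v i \<in> V"
    "\<And>f. f \<in> V \<Longrightarrow> L f = (\<lambda>x. \<Sum>i<n. \<psi> i f * v i x)" using assms(2) unfolding finite_rank_def by blast
  define \<phi>' where "\<phi>' i = (if i < m then \<phi> i else \<psi> (i - m))" for i
  define e' where "e' i = (if i < m then e i else v (i - m))" for i
  have "\<forall>i<m + n. bounded_functional (\<phi>' i) \<and> e' i \<in> V"
    unfolding \<phi>'_def e'_def using K L by auto
  moreover have "(\<lambda>x. K f x + L f x) = (\<lambda>x. \<Sum>i<m + n. \<phi>' i f * e' i x)" if "f \<in> V" for f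
    unfolding sum_lessThan_add K(3)[OF that] L(3)[OF that] by (simp add: \<phi>'_def e'_def)
  ultimately show ?thesis unfolding finite_rank_def by blast
qed

lemma finite_rank_sum:
  "(\<And>i. i \<in> I \<Longrightarrow> finite_rank (K i)) \<Longrightarrow> finite_rank (\<lambda>f x. \<Sum>i\<in>I. K i f x)"
  by (induction I rule: infinite_finite_induct) (auto intro: finite_rank_zero finite_rank_add)

lemma finite_rank_left:
  assumes "bounded_op V N T" "finite_rank K"
  shows "finite_rank (\<lambda>f. T (K f))"
proof -
  obtain m :: nat and \<phi> e where K: "\<And>i. i < m \<Longrightarrow> bounded_functional (\<phi> i)" "\<And>i. i < m \<Longrightarrow> e i \<in> V"
    "\<And>f. f \<in> V \<Longrightarrow> K f = (\<lambda>x. \<Sum>i<m. \<phi> i f * e i x)" using assms(2) unfolding finite_rank_def by blast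
  have "T (K f) = (\<lambda>x. \<Sum>i<m. \<phi> i f * T (e i) x)" if f: "f \<in> V" for f
    unfolding K(3)[OF f] using op_sum[OF assms(1), of "{..<m}" "\<lambda>i x. \<phi> i f * e i x"] K(2)
    by (simp add: scale_mem op_scale[OF assms(1)])
  thus ?thesis unfolding finite_rank_def using K op_mem[OF assms(1)]
    by (intro exI[of _ m] exI[of _ \<phi>] exI[of _ "\<lambda>i. T (e i)"]) auto
qed

lemma finite_rank_right:
  assumes "bounded_op V N T" "finite_rank K"
  shows "finite_rank (\<lambda>f. K (T f))"
proof -
  obtain m :: nat and \<phi> e where K: "\<And>i. i < m \<Longrightarrow> bounded_functional (\<phi> i)" "\<And>i. i < m \<Longrightarrow> e i \<in> V"
    "\<And>f. f \<in> V \<Longrightarrow> K f = (\<lambda>x. \<Sum>i<m. \<phi> i f * e i x)" using assms(2) unfolding finite_rank_def by blast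
  thus ?thesis unfolding finite_rank_def using op_mem[OF assms(1)] bounded_functional_comp[OF _ assms(1)]
    by (intro exI[of _ m] exI[of _ "\<lambda>i f. \<phi> i (T f)"] exI[of _ e]) auto
qed

lemma finite_rank_scale: "finite_rank K \<Longrightarrow> finite_rank (\<lambda>f x. c * K f x)"
  by (rule finite_rank_left[of "\<lambda>f x. c * f x"]) (rule bounded_op_scale[OF bounded_op_id])

lemma finite_rank_diff: "finite_rank K \<Longrightarrow> finite_rank L \<Longrightarrow> finite_rank (\<lambda>f x. K f x - L f x)"
  using finite_rank_add[OF _ finite_rank_scale, of K L "-1"] by simp

lemma finite_rank_bounded:
  assumes "finite_rank K"
  shows "bounded_op V N K"
proof -
  obtain m :: nat and \<phi> e where K: "\<And>i. i < m \<Longrightarrow> bounded_functional (\<phi> i)" "\<And>i. i < m \<Longrightarrow> e i \<in> V"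
    "\<And>f. f \<in> V \<Longrightarrow> K f = (\<lambda>x. \<Sum>i<m. \<phi> i f * e i x)" using assms unfolding finite_rank_def by blast
  have "bounded_op V N (\<lambda>f x. 0 + (\<Sum>i<m. \<phi> i f * e i x))"
    using fredholm_family_exists[OF bounded_op_zero, of 0 m \<phi> e] K by simp
  thus ?thesis by (rule bounded_op_cong) (simp add: K(3))
qed

text \<open>Finite rank operators form a two-sided ideal, and
  \<open>S^(n+1) - T^(n+1) = S (S^n - T^n) + (S - T) T^n\<close>.\<close>

lemma finite_rank_funpow_diff:
  assumes S: "bounded_op V N S" and T: "bounded_op V N T" and "finite_rank (\<lambda>f x. S f x - T f x)"
  shows "finite_rank (\<lambda>f x. (S ^^ n) f x - (T ^^ n) f x)"
proof (induction n)
  case 0 thus ?case by (intro finite_rank_zero) auto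
next
  case (Suc n)
  have "finite_rank (\<lambda>f x. S (\<lambda>x. (S ^^ n) f x - (T ^^ n) f x) x + (S ((T ^^ n) f) x - T ((T ^^ n) f) x))"
    by (intro finite_rank_add finite_rank_left[OF S Suc]
        finite_rank_right[OF bounded_op_funpow[OF T] assms(3)])
  thus ?case
    by (rule finite_rank_cong) (simp add: op_diff[OF S funpow_mem[OF S] funpow_mem[OF T]])
qed

lemma fredholm_family_finite_rank:
  assumes Q: "bounded_op V N Q" "\<And>f. f \<in> V \<Longrightarrow> N (Q f) \<le> q * N f" "q \<ge> 0"
    and K: "finite_rank K" and S: "\<And>f. f \<in> V \<Longrightarrow> S f = (\<lambda>x. Q f x + K f x)"
  shows "\<exists>d G. fredholm_family {\<mu>. cmod \<mu> > q} S d G"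
proof -
  obtain m :: nat and \<phi> e where K: "\<And>i. i < m \<Longrightarrow> bounded_functional (\<phi> i)" "\<And>i. i < m \<Longrightarrow> e i \<in> V"
    "\<And>f. f \<in> V \<Longrightarrow> K f = (\<lambda>x. \<Sum>i<m. \<phi> i f * e i x)" using K unfolding finite_rank_def by blast
  have "\<exists>d G. fredholm_family {\<mu>. cmod \<mu> > q} (\<lambda>f x. Q f x + (\<Sum>i<m. \<phi> i f * e i x)) d G"
    by (rule conjunct2[OF fredholm_family_exists[OF Q]]) (use K in auto)
  then obtain d G where
    fam: "fredholm_family {\<mu>. cmod \<mu> > q} (\<lambda>f x. Q f x + (\<Sum>i<m. \<phi> i f * e i x)) d G" by blast
  have "fredholm_family {\<mu>. cmod \<mu> > q} S d G"
    by (rule fredholm_family_cong[OF fam]) (simp add: S K(3))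
  thus ?thesis by blast
qed

text \<open>Cramer's rule.\<close>

lemma fredholm_resolvent:
  assumes S: "bounded_op V N S" and fam: "fredholm_family U S d G" and \<mu>: "\<mu> \<in> U" "d \<mu> \<noteq> 0"
  shows "\<mu> \<notin> op_spectrum V N S"
    and "f \<in> V \<Longrightarrow> resolvent S \<mu> f x = G \<mu> f x / d \<mu>"
proof -
  have G: "bounded_op V N (G \<mu>)"
    and left: "\<And>f x. f \<in> V \<Longrightarrow> S (G \<mu> f) x = \<mu> * G \<mu> f x - d \<mu> * f x"
    and right: "\<And>f. f \<in> V \<Longrightarrow> G \<mu> (\<lambda>x. \<mu> * f x - S f x) = (\<lambda>x. d \<mu> * f x)"
    using fam \<mu>(1) unfolding fredholm_family_def by (auto simp: fun_eq_iff algebra_simps)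
  let ?R = "\<lambda>f x. inverse (d \<mu>) * G \<mu> f x"
  have R: "bounded_op V N ?R" by (rule bounded_op_scale[OF G])
  have l: "\<mu> * ?R f x - S (?R f) x = f x" if f: "f \<in> V" for f x
    unfolding op_scale[OF S op_mem[OF G f]] left[OF f] using \<mu>(2) by (simp add: field_simps)
  have "is_resolvent S \<mu> ?R"
    unfolding is_resolvent_def using R l right \<mu>(2) by (auto simp: fun_eq_iff)
  thus sp: "\<mu> \<notin> op_spectrum V N S" using not_spectrum_iff[OF S] by blast
  show "resolvent S \<mu> f x = G \<mu> f x / d \<mu>" if f: "f \<in> V"
    using resolvent_unique[OF S sp f op_mem[OF R f] l[OF f]] by (simp add: fun_eq_iff field_simps)
qed

text \<open>The exterior of a disc is connected and \<open>d\<close> is nonzero far out, so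
  \<open>d\<close> is not identically zero and every zero has a finite order. The case
  \<open>p = 0\<close> covers points where \<open>d\<close> does not vanish, so later arguments need
  no case split.\<close>

lemma fredholm_order:
  assumes fam: "fredholm_family {\<mu>. cmod \<mu> > q} S d G" and "q \<ge> 0" "cmod \<mu>0 > q"
  obtains p g r where "r > 0" "ball \<mu>0 r \<subseteq> {\<mu>. cmod \<mu> > q}" "g holomorphic_on ball \<mu>0 r"
    "\<And>w. w \<in> ball \<mu>0 r \<Longrightarrow> d w = (w - \<mu>0) ^ p * g w \<and> g w \<noteq> 0"
proof -
  let ?U = "{\<mu>. cmod \<mu> > q}"
  have U: "open ?U" by (intro open_Collect_less continuous_intros)
  have "?U = - cball 0 q" by auto
  hence con: "connected ?U" using connected_complement_bounded_convex[of "cball (0::complex) q"] by simp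
  have hol: "d holomorphic_on ?U" using fam unfolding fredholm_family_def by blast
  obtain \<rho> where \<rho>: "\<And>\<mu>. \<mu> \<in> ?U \<Longrightarrow> cmod \<mu> > \<rho> \<Longrightarrow> d \<mu> \<noteq> 0" using fam unfolding fredholm_family_def by blast
  define w where "w = complex_of_real (max \<rho> q + 1)"
  have w: "w \<in> ?U" "d w \<noteq> 0" using \<rho>[of w] \<open>q \<ge> 0\<close> unfolding w_def by (auto simp: norm_of_real)
  show ?thesis
  proof (cases "d \<mu>0 = 0")
    case True
    have "\<not> d constant_on ?U" using w True assms(3) unfolding constant_on_def by (metis mem_Collect_eq)
    with holomorphic_factor_zero_nonconstant[OF hol U con, of \<mu>0] True assms(3)
    obtain g r n where "0 < r" "ball \<mu>0 r \<subseteq> ?U" "g holomorphic_on ball \<mu>0 r"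
      "\<And>w. w \<in> ball \<mu>0 r \<Longrightarrow> d w = (w - \<mu>0) ^ n * g w" "\<And>w. w \<in> ball \<mu>0 r \<Longrightarrow> g w \<noteq> 0"
      by (metis mem_Collect_eq)
    thus ?thesis using that by blast
  next
    case False
    have "isCont d \<mu>0" using hol U assms(3) by (metis (mono_tags) continuous_on_eq_continuous_at holomorphic_on_imp_continuous_on mem_Collect_eq)
    hence "\<forall>\<^sub>F w in nhds \<mu>0. d w \<noteq> 0"
      using False by (metis isCont_def tendsto_at_iff_tendsto_nhds tendsto_imp_eventually_ne)
    moreover have "\<forall>\<^sub>F w in nhds \<mu>0. w \<in> ?U" using eventually_nhds_in_open[OF U] assms(3) by blast
    ultimately have "\<forall>\<^sub>F w in nhds \<mu>0. d w \<noteq> 0 \<and> w \<in> ?U" by eventually_elim simp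
    then obtain r where r: "r > 0" "\<And>w. dist w \<mu>0 < r \<Longrightarrow> d w \<noteq> 0 \<and> w \<in> ?U"
      unfolding eventually_nhds_metric by blast
    have "ball \<mu>0 r \<subseteq> ?U" using r by (auto simp: dist_commute)
    thus ?thesis
      using that[of r d 0] r holomorphic_on_subset[OF hol] by (auto simp: dist_commute)
  qed
qed

text \<open>The order \<open>p\<close> of the zero of the determinant bounds the length of Jordan
  chains. A longer chain would make the polynomial \<open>F\<close> below vanish to order
  \<open>r - p\<close>, and one of its coefficients is \<open>A^p f\<close>.\<close>

lemma fredholm_ascent:
  assumes S: "bounded_op V N S" and fam: "fredholm_family {\<mu>. cmod \<mu> > q} S d G" and "q \<ge> 0" "cmod \<mu>0 > q"
  shows "\<exists>p. \<forall>r. \<forall>f\<in>V. (shift_op S \<mu>0 ^^ r) f = (\<lambda>x. 0) \<longrightarrow> (shift_op S \<mu>0 ^^ p) f = (\<lambda>x. 0)"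
proof -
  obtain p g r0 where r0: "r0 > 0" "ball \<mu>0 r0 \<subseteq> {\<mu>. cmod \<mu> > q}" "g holomorphic_on ball \<mu>0 r0"
    "\<And>w. w \<in> ball \<mu>0 r0 \<Longrightarrow> d w = (w - \<mu>0) ^ p * g w \<and> g w \<noteq> 0"
    using fredholm_order[OF fam assms(3,4)] by metis
  let ?A = "shift_op S \<mu>0"
  have A: "bounded_op V N ?A" by (rule bounded_op_shift[OF S])
  have main: "(?A ^^ p) f x = 0" if f: "f \<in> V" and z: "(?A ^^ r) f = (\<lambda>x. 0)" and rp: "r > p" for f r x
  proof -
    \<comment> \<open>On a chain with \<open>A^r f = 0\<close> this polynomial solves
      \<open>(\<mu> - S) F = (\<mu> - \<mu>0)^r f\<close>. The adjugate then gives
      \<open>d * F = (\<mu> - \<mu>0)^r * G f\<close>, and dividing by \<open>d\<close> costs only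
      \<open>p\<close> powers of \<open>\<mu> - \<mu>0\<close>.\<close>
    define F where "F \<mu> = geo_op ?A (\<mu> - \<mu>0) r f" for \<mu>
    have FV: "F \<mu> \<in> V" for \<mu> unfolding F_def by (rule op_mem[OF bounded_op_geo[OF A] f])
    have eq: "\<mu> * F \<mu> x - S (F \<mu>) x = (\<mu> - \<mu>0) ^ r * f x" for \<mu> x
      using geo_op_left[OF A f, of "\<mu> - \<mu>0" r x] z unfolding F_def[symmetric]
      by (simp add: shift_op_def algebra_simps)
    have GF: "d \<mu> * F \<mu> x = (\<mu> - \<mu>0) ^ r * G \<mu> f x" if "cmod \<mu> > q" for \<mu>
    proof -
      have Gop: "bounded_op V N (G \<mu>)" and "G \<mu> (\<lambda>x. \<mu> * F \<mu> x - S (F \<mu>) x) = (\<lambda>x. d \<mu> * F \<mu> x)"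
        using fam that FV[of \<mu>] unfolding fredholm_family_def by auto
      hence "(\<lambda>x. d \<mu> * F \<mu> x) = (\<lambda>x. (\<mu> - \<mu>0) ^ r * G \<mu> f x)"
        unfolding eq op_scale[OF Gop f] by simp
      thus ?thesis by meson
    qed
    have "jet 0 \<mu>0 (\<lambda>z. G z f)" using fam f assms(4) unfolding fredholm_family_def by blast
    then obtain C where C: "\<forall>\<^sub>F z in nhds \<mu>0. G z f \<in> V \<and> N (G z f) \<le> C" by auto
    have gc: "isCont g \<mu>0" using r0 by (metis centre_in_ball continuous_on_eq_continuous_at holomorphic_on_imp_continuous_on open_ball)
    have g0: "g \<mu>0 \<noteq> 0" using r0 by simp
    have "((\<lambda>z. inverse (cmod (g z))) \<longlongrightarrow> inverse (cmod (g \<mu>0))) (nhds \<mu>0)"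
      using gc g0 by (intro tendsto_intros) (auto simp: isCont_def tendsto_at_iff_tendsto_nhds)
    hence gb: "\<forall>\<^sub>F z in nhds \<mu>0. inverse (cmod (g z)) < inverse (cmod (g \<mu>0)) + 1"
      by (rule order_tendstoD) simp
    have "\<forall>\<^sub>F z in nhds \<mu>0. z \<in> ball \<mu>0 r0" using r0 by (intro eventually_nhds_in_open) auto
    with C gb have "\<forall>\<^sub>F z in nhds \<mu>0. z \<noteq> \<mu>0 \<longrightarrow> cmod (F z x) \<le> (inverse (cmod (g \<mu>0)) + 1) * C * cmod (z - \<mu>0) ^ (r - p)"
    proof eventually_elim
      case (elim z)
      show ?case
      proof
        assume ne: "z \<noteq> \<mu>0"
        have z: "d z = (z - \<mu>0) ^ p * g z" "g z \<noteq> 0" "cmod z > q" using r0 elim(3) by auto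
        have "r = p + (r - p)" using rp by simp
        hence "(z - \<mu>0) ^ r = (z - \<mu>0) ^ p * (z - \<mu>0) ^ (r - p)" by (metis power_add)
        hence "g z * F z x = (z - \<mu>0) ^ (r - p) * G z f x"
          using GF[OF z(3)] ne unfolding z(1) by simp
        hence "F z x = (z - \<mu>0) ^ (r - p) * G z f x * inverse (g z)"
          using z(2) by (simp add: field_simps)
        hence eq: "cmod (F z x) = cmod (z - \<mu>0) ^ (r - p) * (cmod (G z f x) * inverse (cmod (g z)))"
          by (simp add: norm_mult norm_power norm_inverse)
        have le: "cmod (G z f x) * inverse (cmod (g z)) \<le> C * (inverse (cmod (g \<mu>0)) + 1)"
          using eval_le[of "G z f" x] norm_nonneg[of "G z f"] elim by (intro mult_mono) auto
        show "cmod (F z x) \<le> (inverse (cmod (g \<mu>0)) + 1) * C * cmod (z - \<mu>0) ^ (r - p)"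
          unfolding eq using mult_left_mono[OF le, of "cmod (z - \<mu>0) ^ (r - p)"] by (simp add: mult_ac)
      qed
    qed
    hence "\<forall>\<^sub>F z in at \<mu>0. cmod (F z x) \<le> (inverse (cmod (g \<mu>0)) + 1) * C * cmod (z - \<mu>0) ^ (r - p)"
      by (simp add: eventually_at_filter)
    hence "\<forall>\<^sub>F w in at 0. cmod (F (w + \<mu>0) x) \<le> (inverse (cmod (g \<mu>0)) + 1) * C * cmod w ^ (r - p)"
      by (subst (asm) at_to_0) (simp add: eventually_filtermap)
    hence "\<forall>\<^sub>F w in at 0. cmod (\<Sum>i<r. w ^ i * (?A ^^ (r - 1 - i)) f x) \<le> (inverse (cmod (g \<mu>0)) + 1) * C * cmod w ^ (r - p)"
      unfolding F_def geo_op_def by simp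
    \<comment> \<open>The index \<open>i = r - p - 1\<close> is the last one below
      \<open>r - p\<close>, and the coefficient there is
      \<open>A^(r - 1 - i) f = A^p f\<close>.\<close>
    from coeffs_zero_if_small[OF this, of "r - p - 1"] show ?thesis
      using rp by (simp add: Suc_diff_Suc)
  qed
  have "(?A ^^ p) f = (\<lambda>x. 0)" if f: "f \<in> V" and z: "(?A ^^ r) f = (\<lambda>x. 0)" for f r
  proof (cases "r > p")
    case True thus ?thesis using main[OF f z] by auto
  next
    case False
    hence "(?A ^^ p) f = (?A ^^ (p - r)) ((?A ^^ r) f)"
      by (metis add.commute comp_apply funpow_add le_add_diff_inverse not_less)
    thus ?thesis unfolding z by (simp add: op_zero[OF bounded_op_funpow[OF A]])
  qed
  thus ?thesis by blast
qed

text \<open>If \<open>g = (S - \<mu>) f\<close> already lies in the span of the \<open>b i\<close>,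
  then \<open>(\<mu> - Q) f = K f - g\<close>; applying the resolvent of \<open>Q\<close> puts
  \<open>f\<close> in the span of the images of the \<open>e i\<close> and the
  \<open>b i\<close>.\<close>

lemma kernel_spanned:
  assumes S: "bounded_op V N S" and Q: "bounded_op V N Q" and \<mu>: "\<mu> \<notin> op_spectrum V N Q"
    and K: "finite_rank K" and SQ: "\<And>f. f \<in> V \<Longrightarrow> S f = (\<lambda>x. Q f x + K f x)"
  shows "\<exists>(m::nat) b. (\<forall>i<m. b i \<in> V) \<and>
    (\<forall>f\<in>V. (shift_op S \<mu> ^^ r) f = (\<lambda>x. 0) \<longrightarrow> (\<exists>c. f = (\<lambda>x. \<Sum>i<m. c i * b i x)))"
proof (induction r)
  case 0 thus ?case by (intro exI[of _ 0]) auto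
next
  case (Suc r)
  let ?R = "resolvent Q \<mu>"
  note R = resolvent[OF Q \<mu>]
  obtain m :: nat and b where b: "\<And>i. i < m \<Longrightarrow> b i \<in> V"
    "\<And>f. f \<in> V \<Longrightarrow> (shift_op S \<mu> ^^ r) f = (\<lambda>x. 0) \<Longrightarrow> (\<exists>c. f = (\<lambda>x. \<Sum>i<m. c i * b i x))"
    using Suc by blast
  obtain n :: nat and \<phi> e where K: "\<And>i. i < n \<Longrightarrow> bounded_functional (\<phi> i)" "\<And>i. i < n \<Longrightarrow> e i \<in> V"
    "\<And>f. f \<in> V \<Longrightarrow> K f = (\<lambda>x. \<Sum>i<n. \<phi> i f * e i x)" using K unfolding finite_rank_def by blast
  define b' where "b' i = (if i < n then ?R (e i) else ?R (b (i - n)))" for i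
  have "b' i \<in> V" if "i < n + m" for i
    unfolding b'_def using op_mem[OF R(1)] K(2) b(1) that by auto
  moreover have "\<exists>c. f = (\<lambda>x. \<Sum>i<n + m. c i * b' i x)"
    if f: "f \<in> V" and z: "(shift_op S \<mu> ^^ Suc r) f = (\<lambda>x. 0)" for f
  proof -
    let ?g = "shift_op S \<mu> f"
    have g: "?g \<in> V" by (rule op_mem[OF bounded_op_shift[OF S] f])
    have "(shift_op S \<mu> ^^ r) ?g = (\<lambda>x. 0)" using z by (simp add: funpow_swap1)
    then obtain c where c: "?g = (\<lambda>x. \<Sum>i<m. c i * b i x)" using b(2)[OF g] by blast
    let ?k = "\<lambda>x. \<Sum>i<n. \<phi> i f * e i x"
    have kV: "?k \<in> V" using K(2) by (intro sum_mem scale_mem) auto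
    have "(\<lambda>x. \<mu> * f x - Q f x) = (\<lambda>x. ?k x - ?g x)"
      unfolding shift_op_def SQ[OF f] K(3)[OF f] by auto
    hence "f = ?R (\<lambda>x. ?k x - ?g x)" using R(3)[OF f] by simp
    also have "\<dots> = (\<lambda>x. ?R ?k x - ?R ?g x)" by (rule op_diff[OF R(1) kV g])
    also have "?R ?k = (\<lambda>x. \<Sum>i<n. \<phi> i f * ?R (e i) x)"
      using op_sum[OF R(1), of "{..<n}" "\<lambda>i x. \<phi> i f * e i x"] K(2) by (simp add: scale_mem op_scale[OF R(1)])
    also have "?R ?g = (\<lambda>x. \<Sum>i<m. c i * ?R (b i) x)"
      unfolding c using op_sum[OF R(1), of "{..<m}" "\<lambda>i x. c i * b i x"] b(1) by (simp add: scale_mem op_scale[OF R(1)])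
    finally have "f = (\<lambda>x. (\<Sum>i<n. \<phi> i f * ?R (e i) x) - (\<Sum>i<m. c i * ?R (b i) x))" .
    also have "\<dots> = (\<lambda>x. \<Sum>i<n + m. (if i < n then \<phi> i f else - c (i - n)) * b' i x)"
      unfolding sum_lessThan_add b'_def by (simp add: sum_negf)
    finally show ?thesis by (intro exI[of _ "\<lambda>i. if i < n then \<phi> i f else - c (i - n)"])
  qed
  ultimately show ?case by blast
qed

text \<open>The family \<open>b\<close> may repeat itself while \<open>finite_dim\<close> asks for a
  set, so the coefficients of equal members are added up.\<close>

lemma finite_dim_if_spanned:
  assumes "\<And>f. f \<in> W \<Longrightarrow> \<exists>c. f = (\<lambda>x. \<Sum>i<m::nat. c i * b i x)"
  shows "finite_dim W"
  unfolding finite_dim_def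
proof (intro exI[of _ "b ` {..<m}"] conjI ballI)
  fix f assume "f \<in> W"
  then obtain c where c: "f = (\<lambda>x. \<Sum>i<m. c i * b i x)" using assms by blast
  have "f x = (\<Sum>v\<in>b ` {..<m}. (\<Sum>i | i \<in> {..<m} \<and> b i = v. c i) * v x)" for x
  proof -
    have "f x = (\<Sum>v\<in>b ` {..<m}. \<Sum>i | i \<in> {..<m} \<and> b i = v. c i * b i x)"
      unfolding c by (rule sum.image_gen) simp
    also have "\<dots> = (\<Sum>v\<in>b ` {..<m}. (\<Sum>i | i \<in> {..<m} \<and> b i = v. c i) * v x)"
      by (intro sum.cong refl) (simp add: sum_distrib_right)
    finally show ?thesis .
  qed
  thus "\<exists>c. f = (\<lambda>x. \<Sum>v\<in>b ` {..<m}. c v * v x)"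
    by (intro exI[of _ "\<lambda>v. \<Sum>i | i \<in> {..<m} \<and> b i = v. c i"]) auto
qed simp

text \<open>Gaussian elimination on the functionals.\<close>

lemma functionals_basis:
  assumes Y: "Y \<subseteq> V" "\<And>f g. f \<in> Y \<Longrightarrow> g \<in> Y \<Longrightarrow> (\<lambda>x. f x + g x) \<in> Y" "\<And>c f. f \<in> Y \<Longrightarrow> (\<lambda>x. c * f x) \<in> Y"
    and \<psi>: "\<And>j. j < m \<Longrightarrow> bounded_functional (\<psi> j)"
  shows "\<exists>(n::nat) \<theta> b. (\<forall>i<n. bounded_functional (\<theta> i) \<and> b i \<in> Y) \<and>
     (\<forall>y\<in>Y. \<forall>j<m::nat. \<psi> j y = (\<Sum>i<n. \<theta> i y * \<psi> j (b i)))"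
  using \<psi>
proof (induction m)
  case (Suc m)
  obtain n :: nat and \<theta> b where nb: "\<And>i. i < n \<Longrightarrow> bounded_functional (\<theta> i)" "\<And>i. i < n \<Longrightarrow> b i \<in> Y"
    "\<And>y j. y \<in> Y \<Longrightarrow> j < m \<Longrightarrow> \<psi> j y = (\<Sum>i<n. \<theta> i y * \<psi> j (b i))"
    using Suc.IH[OF Suc.prems[OF less_SucI]] by blast
  have \<psi>: "\<And>j. j < Suc m \<Longrightarrow> bounded_functional (\<psi> j)" using Suc.prems by blast
  have bV: "b i \<in> V" if "i < n" for i using nb(2) Y(1) that by blast
  show ?case
  \<comment> \<open>A new vector is needed only if some \<open>y0\<close> is killed by the first
    \<open>m\<close> functionals but not by \<open>\<psi> m\<close>. Its dual functional measures
    the defect of \<open>\<psi> m\<close> on the old basis, normalised by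
    \<open>\<psi> m y0\<close>; the old identities survive because \<open>y0\<close> is invisible to
    them.\<close>
  proof (cases "\<exists>y0\<in>Y. (\<forall>j<m. \<psi> j y0 = 0) \<and> \<psi> m y0 \<noteq> 0")
    case True
    then obtain y0 where y0: "y0 \<in> Y" "\<And>j. j < m \<Longrightarrow> \<psi> j y0 = 0" "\<psi> m y0 \<noteq> 0" by blast
    define b' where "b' = b(n := y0)"
    define \<theta>' where "\<theta>' = \<theta>(n := (\<lambda>y. inverse (\<psi> m y0) * (\<psi> m y - (\<Sum>i<n. \<psi> m (b i) * \<theta> i y))))"
    have "bounded_functional (\<theta>' i) \<and> b' i \<in> Y" if "i < Suc n" for i
      using that nb y0 \<psi> unfolding \<theta>'_def b'_def
      by (auto intro!: bounded_functional_scale bounded_functional_diff bounded_functional_sum simp: less_Suc_eq)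
    moreover have "\<psi> j y = (\<Sum>i<Suc n. \<theta>' i y * \<psi> j (b' i))" if "y \<in> Y" "j < Suc m" for y j
    proof (cases "j = m")
      case True
      have sw: "(\<Sum>i<n. \<theta> i y * \<psi> m (b i)) = (\<Sum>i<n. \<psi> m (b i) * \<theta> i y)" by (simp add: mult.commute)
      have c: "inverse (\<psi> m y0) * X * \<psi> m y0 = X" for X using y0(3) by simp
      show ?thesis using True sw by (simp add: \<theta>'_def b'_def c)
    next
      case False
      hence "j < m" using that by simp
      thus ?thesis using nb(3)[OF that(1)] y0(2) by (simp add: \<theta>'_def b'_def)
    qed
    ultimately show ?thesis by blast
  next
    case False
    have "\<psi> j y = (\<Sum>i<n. \<theta> i y * \<psi> j (b i))" if y: "y \<in> Y" and "j < Suc m" for y j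
    proof (cases "j = m")
      case True
      define w where "w = (\<lambda>x. y x + (-1) * (\<Sum>i<n. \<theta> i y * b i x))"
      have sY: "(\<lambda>x. \<Sum>i<k. \<theta> i y * b i x) \<in> Y" if "k \<le> n" for k
        using that
      proof (induction k)
        case 0 thus ?case using Y(3)[OF y, of 0] by simp
      next
        case (Suc k) thus ?case using Y(2)[OF Suc.IH Y(3)[OF nb(2)]] by simp
      qed
      have yV: "y \<in> V" and uV: "(\<lambda>x. \<Sum>i<n. \<theta> i y * b i x) \<in> V" using y sY[of n] Y(1) by auto
      have wY: "w \<in> Y" unfolding w_def using sY[of n] by (intro Y(2)[OF y] Y(3)) simp
      have \<psi>w: "\<psi> i w = \<psi> i y - (\<Sum>l<n. \<theta> l y * \<psi> i (b l))" if "i < Suc m" for i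
      proof -
        have "\<psi> i w = \<psi> i y + (-1) * \<psi> i (\<lambda>x. \<Sum>l<n. \<theta> l y * b l x)"
          unfolding w_def fn_add[OF \<psi>[OF that] yV scale_mem[OF uV]] fn_scale[OF \<psi>[OF that] uV] ..
        also have "\<psi> i (\<lambda>x. \<Sum>l<n. \<theta> l y * b l x) = (\<Sum>l<n. \<theta> l y * \<psi> i (b l))"
          using fn_sum[OF \<psi>[OF that], of "{..<n}" "\<lambda>l x. \<theta> l y * b l x"] bV
          by (simp add: scale_mem fn_scale[OF \<psi>[OF that]])
        finally show ?thesis by simp
      qed
      have "\<forall>i<m. \<psi> i w = 0" using \<psi>w nb(3)[OF y] by simp
      hence "\<psi> m w = 0" using False wY by blast
      thus ?thesis using \<psi>w[of m] True by simp
    next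
      case False thus ?thesis using nb(3)[OF y] that by simp
    qed
    thus ?thesis using nb by blast
  qed
qed (auto intro: exI[of _ 0])

text \<open>On \<open>Y\<close> each \<open>\<psi> j\<close> equals
  \<open>\<Sum> \<theta> i * \<psi> j (b i)\<close>, an identity between continuous functionals, so
  it passes to the limit \<open>g\<close>. Then \<open>g\<close> minus its combination of the
  \<open>b i\<close> is in the common kernel of the \<open>\<psi> j\<close>, which lies in
  \<open>Y\<close>.\<close>

lemma norm_closed_if_finite_codim:
  assumes Y: "Y \<subseteq> V" "\<And>f g. f \<in> Y \<Longrightarrow> g \<in> Y \<Longrightarrow> (\<lambda>x. f x + g x) \<in> Y" "\<And>c f. f \<in> Y \<Longrightarrow> (\<lambda>x. c * f x) \<in> Y"
    and \<psi>: "\<And>j. j < m \<Longrightarrow> bounded_functional (\<psi> j)"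
    and sub: "\<And>f. f \<in> V \<Longrightarrow> (\<forall>j<m::nat. \<psi> j f = 0) \<Longrightarrow> f \<in> Y"
  shows "norm_closed V N Y"
  unfolding norm_closed_def
proof (intro allI ballI impI)
  fix s :: "nat \<Rightarrow> 'a \<Rightarrow> complex" and g
  assume g: "g \<in> V" and "(\<forall>n. s n \<in> Y) \<and> (\<lambda>n. N (\<lambda>x. s n x - g x)) \<longlonglongrightarrow> 0"
  hence s: "\<And>n. s n \<in> Y" and lim: "(\<lambda>n. N (\<lambda>x. s n x - g x)) \<longlonglongrightarrow> 0" by auto
  have sV: "s n \<in> V" for n using s Y(1) by blast
  have "\<exists>(n::nat) \<theta> b. (\<forall>i<n. bounded_functional (\<theta> i) \<and> b i \<in> Y) \<and>
     (\<forall>y\<in>Y. \<forall>j<m. \<psi> j y = (\<Sum>i<n. \<theta> i y * \<psi> j (b i)))"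
    by (rule functionals_basis[OF Y(1)]) (simp_all add: Y(2,3) \<psi>)
  then obtain n :: nat and \<theta> b where nb: "\<And>i. i < n \<Longrightarrow> bounded_functional (\<theta> i)" "\<And>i. i < n \<Longrightarrow> b i \<in> Y"
    "\<And>y j. y \<in> Y \<Longrightarrow> j < m \<Longrightarrow> \<psi> j y = (\<Sum>i<n. \<theta> i y * \<psi> j (b i))" by blast
  have zero: "\<psi> j g - (\<Sum>i<n. \<psi> j (b i) * \<theta> i g) = 0" if j: "j < m" for j
  proof (rule fn_limit_zero[where \<phi> = "\<lambda>f. \<psi> j f - (\<Sum>i<n. \<psi> j (b i) * \<theta> i f)", OF _ sV g lim])
    show "bounded_functional (\<lambda>f. \<psi> j f - (\<Sum>i<n. \<psi> j (b i) * \<theta> i f))"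
      using nb \<psi> j by (auto intro!: bounded_functional_scale bounded_functional_diff bounded_functional_sum)
    show "\<psi> j (s k) - (\<Sum>i<n. \<psi> j (b i) * \<theta> i (s k)) = 0" for k
      using nb(3)[OF s j] by (simp add: mult.commute)
  qed
  have sY: "(\<lambda>x. \<Sum>i<k. \<theta> i g * b i x) \<in> Y" if "k \<le> n" for k
    using that
  proof (induction k)
    case 0 thus ?case using Y(3)[OF s, of 0] by simp
  next
    case (Suc k) thus ?case using Y(2)[OF Suc.IH Y(3)[OF nb(2)]] by simp
  qed
  let ?u = "\<lambda>x. \<Sum>i<n. \<theta> i g * b i x"
  have uY: "?u \<in> Y" using sY[of n] by simp
  have "\<psi> j (\<lambda>x. g x - ?u x) = 0" if j: "j < m" for j
  proof -
    have "\<psi> j (\<lambda>x. g x - ?u x) = \<psi> j g - \<psi> j ?u" using uY Y(1) by (intro fn_diff[OF \<psi>[OF j] g]) blast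
    also have "\<psi> j ?u = (\<Sum>i<n. \<theta> i g * \<psi> j (b i))"
      using fn_sum[OF \<psi>[OF j], of "{..<n}" "\<lambda>i x. \<theta> i g * b i x"] nb(2) Y(1)
      by (simp add: scale_mem fn_scale[OF \<psi>[OF j]] subset_iff)
    finally show ?thesis using zero[OF j] by (simp add: mult.commute)
  qed
  hence "(\<lambda>x. g x - ?u x) \<in> Y" using uY Y(1) by (intro sub diff_mem g) auto
  from Y(2)[OF this uY] show "g \<in> Y" by simp
qed

section \<open>Powers of an operator and the Browder essential spectrum\<close>

lemma power_not_spectrum:
  assumes T: "bounded_op V N T" and l: "l ^ n \<notin> op_spectrum V N (T ^^ n)"
  shows "l \<notin> op_spectrum V N T"
proof -
  let ?R = "resolvent (T ^^ n) (l ^ n)" and ?P = "geo_op T l n"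
  note Tn = bounded_op_funpow[OF T, of n]
  note R = resolvent[OF Tn l] and P = bounded_op_geo[OF T, of l n]
  have left: "?R (?P (\<lambda>x. l * f x - T f x)) = f" if f: "f \<in> V" for f
    unfolding geo_op_right[OF T f] by (rule R(3)[OF f])
  have right: "(\<lambda>x. l * ?P (?R f) x - T (?P (?R f)) x) = f" if f: "f \<in> V" for f
    unfolding geo_op_left[OF T op_mem[OF R(1) f]] using R(2)[OF f] by auto
  \<comment> \<open>The factorisation of \<open>l^n - T^n\<close> yields the left inverse
    \<open>R P\<close> and the right inverse \<open>P R\<close> of \<open>l - T\<close>; a left and
    a right inverse coincide.\<close>
  have "?R (?P f) = ?P (?R f)" if f: "f \<in> V" for f
    using left[OF op_mem[OF P op_mem[OF R(1) f]]] right[OF f] by simp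
  hence "is_resolvent T l (\<lambda>f. ?R (?P f))"
    unfolding is_resolvent_def using left right bounded_op_comp[OF R(1) P] by simp
  thus ?thesis using not_spectrum_iff[OF T] by blast
qed

text \<open>\<open>T^n - l^n = P (T - l)\<close> and \<open>P\<close> commutes with
  \<open>T - l\<close>, so the r-th power is \<open>P^r (T - l)^r\<close>. Hence generalised
  eigenvectors of \<open>T\<close> at \<open>l\<close> are ones of the power at
  \<open>l^n\<close>.\<close>

lemma shift_power_geo:
  assumes T: "bounded_op V N T" and f: "f \<in> V" and n: "n > 0"
  shows "(shift_op T l ^^ r) f = (\<lambda>x. 0) \<Longrightarrow> (shift_op (T ^^ n) (l ^ n) ^^ r) f = (\<lambda>x. 0)"
proof -
  let ?P = "geo_op T l n" and ?A = "shift_op T l" and ?B = "shift_op (T ^^ n) (l ^ n)"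
  note P = bounded_op_geo[OF T, of l n] and A = bounded_op_shift[OF T, of l]
  have B: "?B f = ?P (?A f)" if f: "f \<in> V" for f
  proof -
    have h: "(\<lambda>x. l * f x - T f x) \<in> V" by (intro diff_mem scale_mem f op_mem[OF T])
    have "?A f = (\<lambda>x. - (l * f x - T f x))" unfolding shift_op_def by auto
    hence "?P (?A f) = (\<lambda>x. - ?P (\<lambda>x. l * f x - T f x) x)" using op_uminus[OF P h] by simp
    thus ?thesis unfolding geo_op_right[OF T f] by (simp add: shift_op_def)
  qed
  have com: "?P (?A f) = ?A (?P f)" if f: "f \<in> V" for f
  proof -
    have "?P (?A f) = (\<lambda>x. ?P (T f) x - l * ?P f x)"
      unfolding shift_op_def using op_diff[OF P op_mem[OF T f] scale_mem[OF f]] op_scale[OF P f] by simp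
    thus ?thesis using geo_op_commute[OF T f] by (simp add: shift_op_def)
  qed
  have comr: "?P ((?A ^^ r) f) = (?A ^^ r) (?P f)" if f: "f \<in> V" for f r
    by (induction r) (simp_all add: com funpow_mem[OF A f])
  have "(?B ^^ r) f = (?P ^^ r) ((?A ^^ r) f)" for r
  proof (induction r)
    case (Suc r)
    have V1: "(?P ^^ r) ((?A ^^ r) f) \<in> V" by (intro funpow_mem[OF P] funpow_mem[OF A] f)
    have comp: "?A ((?P ^^ r) g) = (?P ^^ r) (?A g)" if "g \<in> V" for g r
      by (induction r) (simp_all add: com[symmetric] funpow_mem[OF P that])
    have "(?B ^^ Suc r) f = ?P (?A ((?P ^^ r) ((?A ^^ r) f)))" using B[OF V1] Suc by simp
    also have "\<dots> = (?P ^^ Suc r) ((?A ^^ Suc r) f)" using comp[OF funpow_mem[OF A f]] by simp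
    finally show ?case .
  qed simp
  thus "(shift_op T l ^^ r) f = (\<lambda>x. 0) \<Longrightarrow> (shift_op (T ^^ n) (l ^ n) ^^ r) f = (\<lambda>x. 0)"
    by (simp add: op_zero[OF bounded_op_funpow[OF P]])
qed

text \<open>Fredholm theory applies to the power \<open>T^n\<close> at \<open>l^n\<close> and is
  carried back to \<open>T\<close> by the factorisation of \<open>l^n - T^n\<close>. The three
  clauses of the Browder spectrum fail for separate reasons: finite ascent with spanned kernels,
  isolated zeros of the determinant, and a range of finite codimension.\<close>

theorem not_ess_spectrum_if_finite_rank_perturbation:
  assumes T: "bounded_op V N T" and n: "n > 0"
    and Q: "\<And>f. f \<in> V \<Longrightarrow> N (\<lambda>x. (T ^^ n) f x - K f x) \<le> q * N f" "q \<ge> 0"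
    and K: "finite_rank K" and l: "cmod l ^ n > q"
  shows "l \<notin> ess_spectrum V N T"
proof -
  let ?S = "T ^^ n" and ?\<mu> = "l ^ n" and ?Q = "\<lambda>f x. (T ^^ n) f x - K f x"
  have S: "bounded_op V N ?S" by (rule bounded_op_funpow[OF T])
  have Qop: "bounded_op V N ?Q" by (intro bounded_op_diff S finite_rank_bounded K)
  have SQ: "?S f = (\<lambda>x. ?Q f x + K f x)" for f by auto
  have \<mu>: "cmod ?\<mu> > q" using l by (simp add: norm_power)
  obtain d G where fam: "fredholm_family {\<mu>. cmod \<mu> > q} ?S d G"
    using fredholm_family_finite_rank[OF Qop Q K SQ] by blast
  have \<mu>Q: "?\<mu> \<notin> op_spectrum V N ?Q" by (rule neumann[OF Qop Q \<mu>])
  have fin: "finite_dim (gen_eigenspace V T l)"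
  proof -
    obtain p where p: "\<And>r f. f \<in> V \<Longrightarrow> (shift_op ?S ?\<mu> ^^ r) f = (\<lambda>x. 0) \<Longrightarrow> (shift_op ?S ?\<mu> ^^ p) f = (\<lambda>x. 0)"
      using fredholm_ascent[OF S fam Q(2) \<mu>] by blast
    obtain m :: nat and b where b: "\<And>f. f \<in> V \<Longrightarrow> (shift_op ?S ?\<mu> ^^ p) f = (\<lambda>x. 0) \<Longrightarrow> (\<exists>c. f = (\<lambda>x. \<Sum>i<m. c i * b i x))"
      using kernel_spanned[OF S Qop \<mu>Q K SQ, of p] by blast
    show ?thesis
    proof (rule finite_dim_if_spanned[where m = m and b = b])
      fix f assume "f \<in> gen_eigenspace V T l"
      then obtain r where f: "f \<in> V" "(shift_op T l ^^ r) f = (\<lambda>x. 0)" unfolding gen_eigenspace_def by blast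
      show "\<exists>c. f = (\<lambda>x. \<Sum>i<m. c i * b i x)" by (rule b[OF f(1) p[OF f(1) shift_power_geo[OF T f(1) n f(2)]]])
    qed
  qed
  have iso: "\<not> l islimpt op_spectrum V N T"
  proof -
    obtain p g r where r: "r > 0" "ball ?\<mu> r \<subseteq> {\<mu>. cmod \<mu> > q}"
      "\<And>w. w \<in> ball ?\<mu> r \<Longrightarrow> d w = (w - ?\<mu>) ^ p * g w \<and> g w \<noteq> 0"
      using fredholm_order[OF fam Q(2) \<mu>] by metis
    have "((\<lambda>z. z ^ n) \<longlongrightarrow> ?\<mu>) (at l)" by (intro tendsto_intros)
    hence "\<forall>\<^sub>F z in at l. z ^ n \<in> ball ?\<mu> r" using tendstoD[OF _ r(1)] by (fastforce simp: dist_commute)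
    \<comment> \<open>The determinant is nonzero near \<open>l^n\<close> except possibly at
      \<open>l^n\<close> itself, so the other n-th roots must be avoided too; they are finitely many
      and do not accumulate at \<open>l\<close>.\<close>
    moreover have "\<forall>\<^sub>F z in at l. z \<notin> {z. z ^ n = ?\<mu>}"
      using islimpt_iff_eventually[of l "{z. z ^ n = ?\<mu>}"] islimpt_finite[OF finite_nth_roots[OF n]] by blast
    ultimately have "\<forall>\<^sub>F z in at l. z \<notin> op_spectrum V N T"
    proof eventually_elim
      case (elim z)
      have "d (z ^ n) \<noteq> 0" using r(3)[OF elim(1)] elim(2) by auto
      moreover have "z ^ n \<in> {\<mu>. cmod \<mu> > q}" using r(2) elim(1) by blast
      ultimately have "z ^ n \<notin> op_spectrum V N ?S" using fredholm_resolvent(1)[OF S fam] by blast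
      thus ?case by (rule power_not_spectrum[OF T])
    qed
    thus ?thesis by (simp add: islimpt_iff_eventually)
  qed
  have "norm_closed V N (shift_op T l ` V)"
  proof -
    obtain m :: nat and \<phi> e where K': "\<And>i. i < m \<Longrightarrow> bounded_functional (\<phi> i)" "\<And>i. i < m \<Longrightarrow> e i \<in> V"
      "\<And>f. f \<in> V \<Longrightarrow> K f = (\<lambda>x. \<Sum>i<m. \<phi> i f * e i x)" using K unfolding finite_rank_def by blast
    let ?R = "resolvent ?Q ?\<mu>" and ?A = "shift_op T l" and ?P = "geo_op T l n"
    note R = resolvent[OF Qop \<mu>Q] and A = bounded_op_shift[OF T, of l] and P = bounded_op_geo[OF T, of l n]
    show ?thesis
    proof (rule norm_closed_if_finite_codim[where m = m and \<psi> = "\<lambda>i f. \<phi> i (?R f)"])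
      show "?A ` V \<subseteq> V" using op_mem[OF A] by blast
      show "(\<lambda>x. f x + g x) \<in> ?A ` V" if "f \<in> ?A ` V" "g \<in> ?A ` V" for f g
      proof -
        obtain u v where "u \<in> V" "v \<in> V" "f = ?A u" "g = ?A v" using \<open>f \<in> ?A ` V\<close> \<open>g \<in> ?A ` V\<close> by blast
        thus ?thesis by (intro image_eqI[of _ _ "\<lambda>x. u x + v x"]) (simp_all add: op_add[OF A] add_mem)
      qed
      show "(\<lambda>x. c * f x) \<in> ?A ` V" if fA: "f \<in> ?A ` V" for c f
      proof -
        obtain u where "u \<in> V" "f = ?A u" using fA by blast
        thus ?thesis by (intro image_eqI[of _ _ "\<lambda>x. c * u x"]) (simp_all add: op_scale[OF A] scale_mem)
      qed
      show "bounded_functional (\<lambda>f. \<phi> i (?R f))" if "i < m" for i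
        by (rule bounded_functional_comp[OF K'(1)[OF that] R(1)])
      \<comment> \<open>These finitely many conditions say that \<open>K\<close> kills
        \<open>h = R f\<close>. Then \<open>h\<close> solves the equation for the unperturbed power
        \<open>T^n\<close>, and the cofactor \<open>P\<close> turns it into a preimage of
        \<open>f\<close> under \<open>T - l\<close>.\<close>
      fix f assume f: "f \<in> V" and z: "\<forall>i<m. \<phi> i (?R f) = 0"
      let ?h = "?R f"
      have h: "?h \<in> V" by (rule op_mem[OF R(1) f])
      have "K ?h = (\<lambda>x. 0)" using K'(3)[OF h] z by simp
      hence eq: "?\<mu> * ?h x - ?S ?h x = f x" for x using R(2)[OF f, of x] by simp
      have Ph: "?P ?h \<in> V" by (rule op_mem[OF P h])
      have "?A (\<lambda>x. - ?P ?h x) = (\<lambda>x. l * ?P ?h x - T (?P ?h) x)"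
        unfolding shift_op_def op_uminus[OF T Ph] by auto
      also have "\<dots> = f" unfolding geo_op_left[OF T h] eq ..
      finally show "f \<in> ?A ` V" using uminus_mem[OF Ph] by (intro image_eqI[of _ _ "\<lambda>x. - ?P ?h x"]) simp_all
    qed
  qed
  with fin iso show ?thesis unfolding ess_spectrum_def by blast
qed

end

text \<open>The given polynomial and the Taylor polynomial both approximate \<open>h\<close> to
  order \<open>p\<close>, so their difference, of degree below \<open>p\<close>, is O(|z - z0|^p)
  and vanishes. This reads Taylor coefficients off a jet.\<close>

lemma higher_deriv_from_expansion:
  fixes h R :: "complex \<Rightarrow> complex"
  assumes hol: "h holomorphic_on ball z0 r" and "r > 0"
    and ev: "\<forall>\<^sub>F z in nhds z0. h z = (\<Sum>j<p. (z - z0) ^ j * a j) + (z - z0) ^ p * R z \<and> cmod (R z) \<le> C"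
    and k: "k < p"
  shows "(deriv ^^ k) h z0 = fact k * a k"
proof -
  obtain n where p: "p = Suc n" using k by (cases p) auto
  define b where "b j = (deriv ^^ j) h z0 / fact j" for j
  have holi: "(deriv ^^ i) h holomorphic_on ball z0 r" for i
    by (rule holomorphic_higher_deriv[OF hol open_ball])
  have sub: "cball z0 (r/2) \<subseteq> ball z0 r" using \<open>r > 0\<close> by auto
  have "compact ((deriv ^^ Suc n) h ` cball z0 (r/2))"
    by (intro compact_continuous_image holomorphic_on_imp_continuous_on holomorphic_on_subset[OF holi sub]) auto
  then obtain B where B: "\<And>z. z \<in> cball z0 (r/2) \<Longrightarrow> cmod ((deriv ^^ Suc n) h z) \<le> B"
    using compact_imp_bounded bounded_iff by (metis imageI)
  have T: "cmod (h z - (\<Sum>i\<le>n. (deriv ^^ i) h z0 * (z - z0) ^ i / fact i)) \<le> B * cmod (z - z0) ^ Suc n / fact n"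
    if "z \<in> cball z0 (r/2)" for z
  proof -
    have "cmod ((deriv ^^ 0) h z - (\<Sum>i\<le>n. (deriv ^^ i) h z0 * (z - z0) ^ i / fact i)) \<le> B * cmod (z - z0) ^ Suc n / fact n"
    proof (rule complex_Taylor[OF convex_cball, where f = "\<lambda>i. (deriv ^^ i) h"])
      fix i x assume "x \<in> cball z0 (r/2)" "i \<le> n"
      hence "x \<in> ball z0 r" using sub by blast
      hence "((deriv ^^ i) h has_field_derivative deriv ((deriv ^^ i) h) x) (at x)"
        using holomorphic_derivI[OF holi open_ball] by blast
      thus "((deriv ^^ i) h has_field_derivative (deriv ^^ Suc i) h x) (at x within cball z0 (r/2))"
        by (simp add: has_field_derivative_at_within)
    qed (use B that \<open>r > 0\<close> in auto)
    thus ?thesis by simp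
  qed
  have "\<forall>\<^sub>F z in nhds z0. z \<in> ball z0 (r/2)" using \<open>r > 0\<close> by (intro eventually_nhds_in_open) auto
  with ev have "\<forall>\<^sub>F z in nhds z0. cmod (\<Sum>j<p. (z - z0) ^ j * (b j - a j)) \<le> (C + B / fact n) * cmod (z - z0) ^ p"
  proof eventually_elim
    case (elim z)
    have 1: "cmod (h z - (\<Sum>j<p. (z - z0) ^ j * b j)) \<le> B / fact n * cmod (z - z0) ^ p"
      using T[of z] elim(2) by (simp add: p lessThan_Suc_atMost b_def mult.commute)
    have "(\<Sum>j<p. (z - z0) ^ j * (b j - a j)) = (z - z0) ^ p * R z - (h z - (\<Sum>j<p. (z - z0) ^ j * b j))"
      using elim(1) by (simp add: algebra_simps sum_subtractf)
    also have "cmod \<dots> \<le> cmod (z - z0) ^ p * cmod (R z) + cmod (h z - (\<Sum>j<p. (z - z0) ^ j * b j))"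
      using norm_triangle_ineq4 by (metis norm_mult norm_power)
    also have "\<dots> \<le> cmod (z - z0) ^ p * C + B / fact n * cmod (z - z0) ^ p"
      using elim(1) by (intro add_mono mult_left_mono 1) auto
    finally show ?case by (simp add: algebra_simps)
  qed
  hence "\<forall>\<^sub>F z in at z0. cmod (\<Sum>j<p. (z - z0) ^ j * (b j - a j)) \<le> (C + B / fact n) * cmod (z - z0) ^ p"
    unfolding eventually_at_filter by (rule eventually_mono) auto
  hence "\<forall>\<^sub>F w in at 0. cmod (\<Sum>j<p. w ^ j * (b j - a j)) \<le> (C + B / fact n) * cmod w ^ p"
    by (subst (asm) at_to_0) (simp add: eventually_filtermap)
  from coeffs_zero_if_small[OF this k k] show ?thesis by (simp add: b_def field_simps)
qed

text \<open>A finite dimensional space is closed under convergence at the points of \<open>X\<close>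
  alone. The induction normalises some \<open>u\<close> in \<open>W\<close> at a point
  \<open>x0\<close>, subtracts multiples of \<open>u\<close> to pass to the functions vanishing at
  \<open>x0\<close>, and saves one spanning function.\<close>

lemma pointwise_limit_in_span:
  fixes W :: "('a \<Rightarrow> complex) set" and s :: "nat \<Rightarrow> 'a \<Rightarrow> complex"
  assumes "finite I"
    and "\<And>f g. f \<in> W \<Longrightarrow> g \<in> W \<Longrightarrow> (\<lambda>x. f x + g x) \<in> W" "\<And>c f. f \<in> W \<Longrightarrow> (\<lambda>x. c * f x) \<in> W"
    and "\<And>w. w \<in> W \<Longrightarrow> \<exists>c. w = (\<lambda>x. \<Sum>i\<in>I. c i * b i x)"
    and "\<And>m. s m \<in> W" and "\<And>x. x \<in> X \<Longrightarrow> (\<lambda>m. s m x) \<longlonglongrightarrow> f x"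
  shows "\<exists>w\<in>W. \<forall>x\<in>X. w x = f x"
  using assms
proof (induction I arbitrary: W b s f rule: finite_psubset_induct)
  case (psubset I)
  note add = psubset.prems(1) and scale = psubset.prems(2) and span = psubset.prems(3)
    and s = psubset.prems(4) and lim = psubset.prems(5)
  show ?case
  proof (cases "\<forall>w\<in>W. \<forall>x\<in>X. w x = 0")
    case True
    have "f x = 0" if "x \<in> X" for x
    proof -
      have "s m x = 0" for m using True s that by blast
      thus ?thesis using lim[OF that] by (simp add: LIMSEQ_const_iff)
    qed
    thus ?thesis using True s by (intro bexI[of _ "s 0"]) auto
  next
    case False
    then obtain v x0 where v: "v \<in> W" "x0 \<in> X" "v x0 \<noteq> 0" by blast
    define u where "u = (\<lambda>x. inverse (v x0) * v x)"
    have u: "u \<in> W" "u x0 = 1" using scale[OF v(1)] v(3) unfolding u_def by auto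
    obtain c where c: "u = (\<lambda>x. \<Sum>i\<in>I. c i * b i x)" using span[OF u(1)] by blast
    have "\<exists>i0\<in>I. c i0 \<noteq> 0"
    proof (rule ccontr)
      assume "\<not> ?thesis"
      hence "u x0 = 0" unfolding c by simp
      thus False using u(2) by simp
    qed
    then obtain i0 where i0: "i0 \<in> I" "c i0 \<noteq> 0" by blast
    define W' where "W' = {w \<in> W. w x0 = 0}"
    define b' where "b' i = (\<lambda>x. b i x - b i x0 * u x)" for i
    define s' where "s' m = (\<lambda>x. s m x + (- s m x0) * u x)" for m
    have "\<exists>w\<in>W'. \<forall>x\<in>X. w x = f x - f x0 * u x"
    proof (rule psubset.IH[of "I - {i0}" W' b' s'])
      show "I - {i0} \<subset> I" using i0 by blast
      show "(\<lambda>x. f x + g x) \<in> W'" if "f \<in> W'" "g \<in> W'" for f g using that add unfolding W'_def by auto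
      show "(\<lambda>x. c * f x) \<in> W'" if "f \<in> W'" for c f using that scale unfolding W'_def by auto
      show "s' m \<in> W'" for m
        using add[OF s[of m] scale[OF u(1), of "- s m x0"]] u(2) unfolding W'_def s'_def by simp
      show "(\<lambda>m. s' m x) \<longlonglongrightarrow> f x - f x0 * u x" if "x \<in> X" for x
      proof -
        have "(\<lambda>m. s m x - s m x0 * u x) \<longlonglongrightarrow> f x - f x0 * u x"
          by (intro tendsto_intros lim that v(2))
        thus ?thesis unfolding s'_def by simp
      qed
      fix w assume w: "w \<in> W'"
      then obtain a where a: "w = (\<lambda>x. \<Sum>i\<in>I. a i * b i x)" using span unfolding W'_def by blast
      \<comment> \<open>Subtracting \<open>t * u\<close> cancels the coefficient at
        \<open>i0\<close>; since \<open>w\<close> vanishes at \<open>x0\<close>, evaluating there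
        recovers \<open>t\<close> from the other coefficients, and these express \<open>w\<close>
        through the corrected functions \<open>b'\<close>.\<close>
      define t where "t = a i0 / c i0"
      define a' where "a' i = a i - t * c i" for i
      have 1: "w x = t * u x + (\<Sum>i\<in>I - {i0}. a' i * b i x)" for x
      proof -
        have "w x - t * u x = (\<Sum>i\<in>I. a' i * b i x)"
          unfolding a c a'_def by (simp add: sum_distrib_left sum_subtractf algebra_simps)
        also have "\<dots> = a' i0 * b i0 x + (\<Sum>i\<in>I - {i0}. a' i * b i x)"
          using i0 psubset.hyps by (intro sum.remove) auto
        also have "a' i0 = 0" unfolding a'_def t_def using i0 by simp
        finally show ?thesis by (simp add: algebra_simps)
      qed
      have 2: "0 = t + (\<Sum>i\<in>I - {i0}. a' i * b i x0)" using 1[of x0] w u unfolding W'_def by simp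
      have "w x = (\<Sum>i\<in>I - {i0}. a' i * b' i x)" for x
      proof -
        have "(\<Sum>i\<in>I - {i0}. a' i * b' i x) = (\<Sum>i\<in>I - {i0}. a' i * b i x) - (\<Sum>i\<in>I - {i0}. a' i * b i x0) * u x"
          unfolding b'_def by (simp add: algebra_simps sum_subtractf sum_distrib_right sum_distrib_left)
        also have "(\<Sum>i\<in>I - {i0}. a' i * b i x0) = - t" using 2 by (simp add: eq_neg_iff_add_eq_0 add.commute)
        finally show ?thesis using 1[of x] by simp
      qed
      thus "\<exists>c. w = (\<lambda>x. \<Sum>i\<in>I - {i0}. c i * b' i x)" by (intro exI[of _ a']) auto
    qed
    then obtain w where w: "w \<in> W'" "\<And>x. x \<in> X \<Longrightarrow> w x = f x - f x0 * u x" by blast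
    have "(\<lambda>x. w x + f x0 * u x) \<in> W" using w(1) unfolding W'_def by (intro add scale[OF u(1)]) auto
    thus ?thesis using w(2) by (intro bexI[of _ "\<lambda>x. w x + f x0 * u x"]) auto
  qed
qed

section \<open>Residues of the resolvent and growth of powers\<close>

context complex_function_space
begin

lemma gen_eigenspace_subspace:
  assumes T: "bounded_op V N T"
  shows "f \<in> gen_eigenspace V T l \<Longrightarrow> g \<in> gen_eigenspace V T l \<Longrightarrow> (\<lambda>x. f x + g x) \<in> gen_eigenspace V T l"
    and "f \<in> gen_eigenspace V T l \<Longrightarrow> (\<lambda>x. c * f x) \<in> gen_eigenspace V T l"
proof -
  let ?A = "shift_op T l"
  have A: "bounded_op V N (?A ^^ r)" for r by (rule bounded_op_funpow[OF bounded_op_shift[OF T]])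
  have mono: "(?A ^^ (r + n)) f = (\<lambda>x. 0)" if "(?A ^^ r) f = (\<lambda>x. 0)" for r n f
    using that op_zero[OF A] by (simp add: add.commute[of r] funpow_add)
  show "(\<lambda>x. f x + g x) \<in> gen_eigenspace V T l"
    if fg: "f \<in> gen_eigenspace V T l" "g \<in> gen_eigenspace V T l"
  proof -
    obtain r n where r: "r \<ge> 1" "f \<in> V" "(?A ^^ r) f = (\<lambda>x. 0)" and n: "g \<in> V" "(?A ^^ n) g = (\<lambda>x. 0)"
      using fg unfolding gen_eigenspace_def by blast
    have "(?A ^^ (r + n)) (\<lambda>x. f x + g x) = (\<lambda>x. 0)"
      using mono[OF r(3), of n] mono[OF n(2), of r] op_add[OF A r(2) n(1), of "r + n"]
      by (simp add: add.commute)
    thus ?thesis using r n add_mem unfolding gen_eigenspace_def by (auto intro!: bexI[of _ "r + n"])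
  qed
  show "(\<lambda>x. c * f x) \<in> gen_eigenspace V T l" if "f \<in> gen_eigenspace V T l"
  proof -
    obtain r where r: "r \<ge> 1" "f \<in> V" "(?A ^^ r) f = (\<lambda>x. 0)"
      using \<open>f \<in> gen_eigenspace V T l\<close> unfolding gen_eigenspace_def by blast
    thus ?thesis using op_scale[OF A r(2), of r c] scale_mem[OF r(2)] unfolding gen_eigenspace_def
      by (auto intro!: bexI[of _ r])
  qed
qed

text \<open>Let \<open>H\<close> be the resolvent of \<open>f\<close> times
  \<open>(z - z0)^(p+1)\<close>, with Taylor coefficients \<open>c j\<close>. Comparing coefficients
  in \<open>(z - T) H = (z - z0)^(p+1) f\<close> gives \<open>A (c 0) = 0\<close> and
  \<open>A (c (j+1)) = c j\<close>, a Jordan chain whose last member \<open>c p\<close> is the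
  residue.\<close>

lemma fredholm_residue:
  assumes T: "bounded_op V N T" and fam: "fredholm_family {\<mu>. cmod \<mu> > q} T d G" and "q \<ge> 0" "cmod z0 > q"
  obtains \<delta> where "\<delta> > 0" "\<And>z. z \<in> ball z0 \<delta> - {z0} \<Longrightarrow> z \<notin> op_spectrum V N T"
    "\<And>f r. f \<in> V \<Longrightarrow> 0 < r \<Longrightarrow> r < \<delta> \<Longrightarrow> \<exists>e\<in>gen_eigenspace V T z0.
       \<forall>x. ((\<lambda>z. resolvent T z f x) has_contour_integral (2 * of_real pi * \<i> * e x)) (circlepath z0 r)"
proof -
  obtain p g \<delta> where \<delta>: "\<delta> > 0" "ball z0 \<delta> \<subseteq> {\<mu>. cmod \<mu> > q}" "g holomorphic_on ball z0 \<delta>"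
    "\<And>w. w \<in> ball z0 \<delta> \<Longrightarrow> d w = (w - z0) ^ p * g w \<and> g w \<noteq> 0"
    using fredholm_order[OF fam assms(3,4)] by metis
  let ?U = "{\<mu>. cmod \<mu> > q}" and ?A = "shift_op T z0"
  have A: "bounded_op V N ?A" by (rule bounded_op_shift[OF T])
  have fz: "z \<in> ?U" "d z \<noteq> 0" if "z \<in> ball z0 \<delta> - {z0}" for z
    using that \<delta>(2) \<delta>(4)[of z] by auto
  have sp: "z \<notin> op_spectrum V N T" if "z \<in> ball z0 \<delta> - {z0}" for z
    using fredholm_resolvent(1)[OF T fam fz[OF that]] .
  have ex: "\<exists>e\<in>gen_eigenspace V T z0.
       \<forall>x. ((\<lambda>z. resolvent T z f x) has_contour_integral (2 * of_real pi * \<i> * e x)) (circlepath z0 r)"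
    if f: "f \<in> V" and r: "0 < r" "r < \<delta>" for f r
  proof -
    \<comment> \<open>The extra factor \<open>z - z0\<close> makes the exponent
      \<open>Suc p\<close>, so the Cauchy formula and the eigenspace, which starts at the first
      power, also cover \<open>p = 0\<close>.\<close>
    define H where "H z = (\<lambda>x. ((z - z0) * inverse (g z)) * G z f x)" for z
    have hg: "(\<lambda>z. (z - z0) * inverse (g z)) holomorphic_on ball z0 \<delta>"
      using \<delta>(3,4) by (intro holomorphic_intros) auto
    have jG: "jet j w (\<lambda>z. G z f)" if "w \<in> ball z0 \<delta>" for w j
      using fam f \<delta>(2) that unfolding fredholm_family_def by blast
    have GV: "G z f \<in> V" if "z \<in> ball z0 \<delta>" for z
      using fam f \<delta>(2) that op_mem unfolding fredholm_family_def by blast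
    have HV: "H z \<in> V" if "z \<in> ball z0 \<delta>" for z unfolding H_def by (intro scale_mem GV that)
    have "jet (Suc p) z0 H" unfolding H_def
      using hg \<delta>(1) by (intro jet_scale jG) (auto simp: analytic_at intro!: exI[of _ "ball z0 \<delta>"])
    then obtain c R C where c: "\<And>j. c j \<in> V" and
      ev: "\<forall>\<^sub>F z in nhds z0. R z \<in> V \<and> N (R z) \<le> C \<and> H z = (\<lambda>x. (\<Sum>j<Suc p. (z - z0) ^ j * c j x) + (z - z0) ^ Suc p * R z x)"
      using jet_expansion by blast
    have TH: "z * H z x - T (H z) x = (z - z0) ^ Suc p * f x" if z: "z \<in> ball z0 \<delta>" for z x
    proof -
      have "(\<lambda>x. z * G z f x - T (G z f) x) = (\<lambda>x. d z * f x)"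
        using fam f \<delta>(2) z unfolding fredholm_family_def by blast
      hence "z * G z f x - T (G z f) x = d z * f x" by meson
      hence "((z - z0) * inverse (g z)) * (z * G z f x - T (G z f) x) = (z - z0) ^ Suc p * f x"
        using \<delta>(4)[OF z] by simp
      thus ?thesis unfolding H_def op_scale[OF T GV[OF z]] by (simp add: algebra_simps)
    qed
    obtain K where K: "K \<ge> 0" "\<And>f. f \<in> V \<Longrightarrow> N (T f) \<le> K * N f" using op_bound[OF T] by metis
    \<comment> \<open>The coefficient of \<open>(z - z0)^j\<close> in \<open>(z - T) P\<close>, with
      \<open>P\<close> the Taylor polynomial of \<open>H\<close> and
      \<open>z - T = (z - z0) - A\<close>.\<close>
    define a where "a j x = (if j = 0 then 0 else c (j - 1) x) - (if j < Suc p then ?A (c j) x else 0)" for j x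
    have "\<forall>\<^sub>F z in nhds z0. z \<in> ball z0 \<delta> \<inter> ball z0 1" using \<delta>(1) by (intro eventually_nhds_in_open) auto
    with ev have "\<forall>\<^sub>F z in nhds z0. \<forall>x. cmod (\<Sum>j<Suc (Suc p). (z - z0) ^ j * a j x) \<le> (N f + (cmod z0 + 1) * C + K * C) * cmod (z - z0) ^ Suc p"
    proof eventually_elim
      case (elim z)
      show ?case
      proof
        fix x
        let ?w = "z - z0"
        define P where "P = (\<lambda>x. \<Sum>j<Suc p. ?w ^ j * c j x)"
        have PV: "P \<in> V" unfolding P_def by (intro sum_mem scale_mem c)
        have RV: "R z \<in> V" and RC: "N (R z) \<le> C" using elim by auto
        have Hz: "H z = (\<lambda>x. P x + ?w ^ Suc p * R z x)" using elim unfolding P_def by blast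
        have "T (H z) = (\<lambda>x. T P x + ?w ^ Suc p * T (R z) x)"
          unfolding Hz by (simp only: op_add[OF T PV scale_mem[OF RV]] op_scale[OF T RV])
        with TH[of z x] elim(2) Hz have eq: "z * P x - T P x = ?w ^ Suc p * (f x - z * R z x + T (R z) x)"
          by (simp add: algebra_simps)
        have TP: "T P x = (\<Sum>j<Suc p. ?w ^ j * T (c j) x)"
          unfolding P_def using op_sum[OF T, of "{..<Suc p}" "\<lambda>j x. ?w ^ j * c j x"]
          by (simp add: scale_mem c op_scale[OF T c])
        have "(\<Sum>j<Suc (Suc p). ?w ^ j * a j x)
          = (\<Sum>j<Suc (Suc p). ?w ^ j * (if j = 0 then 0 else c (j - 1) x)) - (\<Sum>j<Suc (Suc p). ?w ^ j * (if j < Suc p then ?A (c j) x else 0))"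
          unfolding a_def by (simp only: right_diff_distrib sum_subtractf)
        also have "(\<Sum>j<Suc (Suc p). ?w ^ j * (if j = 0 then 0 else c (j - 1) x)) = ?w * P x"
          unfolding P_def by (subst sum.lessThan_Suc_shift) (simp add: sum_distrib_left mult.assoc algebra_simps)
        also have "(\<Sum>j<Suc (Suc p). ?w ^ j * (if j < Suc p then ?A (c j) x else 0)) = T P x - z0 * P x"
          unfolding TP unfolding P_def shift_op_def
          by (subst sum.lessThan_Suc) (simp add: algebra_simps sum_subtractf sum_distrib_left)
        finally have "(\<Sum>j<Suc (Suc p). ?w ^ j * a j x) = ?w ^ Suc p * (f x - z * R z x + T (R z) x)"
          using eq by (simp add: algebra_simps)
        hence e1: "cmod (\<Sum>j<Suc (Suc p). ?w ^ j * a j x) = cmod (f x - z * R z x + T (R z) x) * cmod ?w ^ Suc p"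
          by (simp only: norm_mult norm_power mult.commute)
        have e2: "cmod (f x - z * R z x + T (R z) x) \<le> N f + (cmod z0 + 1) * C + K * C"
        proof -
          have "cmod (f x) \<le> N f" by (rule eval_le[OF f])
          moreover have "cmod (z * R z x) \<le> (cmod z0 + 1) * C"
          proof -
            have "cmod z \<le> cmod z0 + 1" using elim(2) norm_triangle_ineq3[of z z0]
              by (auto simp: dist_norm norm_minus_commute)
            thus ?thesis using eval_le[OF RV, of x] RC by (simp add: norm_mult mult_mono)
          qed
          moreover have "cmod (T (R z) x) \<le> K * C"
            using eval_le[OF op_mem[OF T RV], of x] K(2)[OF RV] mult_left_mono[OF RC K(1)] by linarith
          ultimately show ?thesis
            using norm_triangle_ineq[of "f x - z * R z x" "T (R z) x"] norm_triangle_ineq4[of "f x" "z * R z x"] by linarith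
        qed
        show "cmod (\<Sum>j<Suc (Suc p). ?w ^ j * a j x) \<le> (N f + (cmod z0 + 1) * C + K * C) * cmod ?w ^ Suc p"
          unfolding e1 by (rule mult_right_mono[OF e2]) simp
      qed
    qed
    hence "\<forall>\<^sub>F z in at z0. \<forall>x. cmod (\<Sum>j<Suc (Suc p). (z - z0) ^ j * a j x) \<le> (N f + (cmod z0 + 1) * C + K * C) * cmod (z - z0) ^ Suc p"
      unfolding eventually_at_filter by (rule eventually_mono) auto
    hence ev0: "\<forall>\<^sub>F w in at 0. \<forall>x. cmod (\<Sum>j<Suc (Suc p). w ^ j * a j x) \<le> (N f + (cmod z0 + 1) * C + K * C) * cmod w ^ Suc p"
      by (subst (asm) at_to_0) (simp only: eventually_filtermap add_diff_cancel_right')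
    have a0: "a j x = 0" if "j < Suc p" for j x
    proof (rule coeffs_zero_if_small[OF _ that])
      show "\<forall>\<^sub>F w in at 0. cmod (\<Sum>j<Suc (Suc p). w ^ j * a j x) \<le> (N f + (cmod z0 + 1) * C + K * C) * cmod w ^ Suc p"
        using ev0 by (rule eventually_mono) blast
    qed (use that in simp)
    have Ac0: "?A (c 0) = (\<lambda>x. 0)" using a0[of 0] unfolding a_def by (auto simp: fun_eq_iff)
    have Acj: "?A (c (Suc j)) = c j" if "Suc j < Suc p" for j
    proof
      fix x show "?A (c (Suc j)) x = c j x" using a0[OF that, of x] that unfolding a_def by simp
    qed
    have Aj: "j < Suc p \<Longrightarrow> (?A ^^ Suc j) (c j) = (\<lambda>x. 0)" for j
    proof (induction j)
      case 0 thus ?case using Ac0 by simp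
    next
      case (Suc j)
      have "(?A ^^ Suc (Suc j)) (c (Suc j)) = (?A ^^ Suc j) (?A (c (Suc j)))" by (simp only: funpow_Suc_right comp_apply)
      thus ?case using Suc Acj[OF Suc.prems] by simp
    qed
    have e: "c p \<in> gen_eigenspace V T z0"
      unfolding gen_eigenspace_def using c Aj[of p] by (intro UN_I[of "Suc p"]) (auto simp del: funpow.simps)
    have "((\<lambda>z. resolvent T z f x) has_contour_integral (2 * of_real pi * \<i> * c p x)) (circlepath z0 r)" for x
    proof -
      have "(\<lambda>z. G z f x) holomorphic_on ball z0 \<delta>"
        by (rule jet_functional[OF bounded_functional_eval open_ball jG])
      hence hH: "(\<lambda>z. H z x) holomorphic_on ball z0 \<delta>"
        unfolding H_def by (intro holomorphic_on_mult hg)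
      have "\<forall>\<^sub>F z in nhds z0. H z x = (\<Sum>j<Suc p. (z - z0) ^ j * c j x) + (z - z0) ^ Suc p * R z x \<and> cmod (R z x) \<le> C"
        using ev
      proof eventually_elim
        case (elim z) thus ?case using eval_le[of "R z" x] by fastforce
      qed
      from higher_deriv_from_expansion[OF hH \<delta>(1) this, of p]
      have hd: "(deriv ^^ p) (\<lambda>z. H z x) z0 = fact p * c p x" by simp
      have sub: "cball z0 r \<subseteq> ball z0 \<delta>" using r by auto
      have "continuous_on (cball z0 r) (\<lambda>z. H z x)"
        by (intro holomorphic_on_imp_continuous_on holomorphic_on_subset[OF hH sub])
      moreover have "(\<lambda>z. H z x) holomorphic_on ball z0 r" using sub by (intro holomorphic_on_subset[OF hH]) auto
      ultimately have "((\<lambda>u. H u x / (u - z0) ^ Suc p) has_contour_integral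
          (2 * of_real pi * \<i>) / fact p * (deriv ^^ p) (\<lambda>z. H z x) z0) (circlepath z0 r)"
        using Cauchy_has_contour_integral_higher_derivative_circlepath[of z0 r "\<lambda>z. H z x" z0 p] r(1) by simp
      hence 1: "((\<lambda>u. H u x / (u - z0) ^ Suc p) has_contour_integral 2 * of_real pi * \<i> * c p x) (circlepath z0 r)"
        unfolding hd by (simp add: mult.assoc)
      show ?thesis
      proof (rule has_contour_integral_eq[OF 1])
        fix z assume "z \<in> path_image (circlepath z0 r)"
        hence z: "z \<in> ball z0 \<delta> - {z0}" using r by (auto simp: sphere_def dist_norm)
        have "resolvent T z f x = G z f x / d z" by (rule fredholm_resolvent(2)[OF T fam fz[OF z] f])
        thus "H z x / (z - z0) ^ Suc p = resolvent T z f x"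
          using \<delta>(4)[of z] z unfolding H_def by (simp add: field_simps)
      qed
    qed
    with e show ?thesis by blast
  qed
  show ?thesis by (rule that[OF \<delta>(1)]) (use sp ex in auto)
qed

text \<open>A pointwise half of the spectral radius formula. The function
  \<open>h w = R(1/w) f x / w\<close> is holomorphic on the disc of radius \<open>1 / r1\<close> and
  has the Taylor coefficients \<open>(T^n) f x\<close>; Cauchy's inequality on the smaller circle of
  radius \<open>1 / r\<close> gives the bound.\<close>

lemma spectral_growth:
  assumes T: "bounded_op V N T" and f: "f \<in> V" and "\<rho> \<ge> 0"
    and sp: "\<And>l. cmod l > \<rho> \<Longrightarrow> l \<notin> op_spectrum V N T" and r: "r > \<rho>"
  obtains C where "\<And>n. cmod ((T ^^ n) f x) \<le> C * r ^ n"
proof -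
  obtain r1 where r1: "\<rho> < r1" "r1 < r" using dense[OF r] by blast
  have pos: "r1 > 0" "r > 0" using r1 \<open>\<rho> \<ge> 0\<close> by auto
  define h where "h w = (if w = 0 then f x else resolvent T (1 / w) f x / w)" for w
  obtain K0 where K0: "K0 \<ge> 0" "\<And>f. f \<in> V \<Longrightarrow> N (T f) \<le> K0 * N f" using op_bound[OF T] by metis
  \<comment> \<open>Adding \<open>r\<close> makes \<open>K\<close> positive and ensures that
    \<open>cmod l > 2 * K\<close> lies beyond the spectrum.\<close>
  define K where "K = K0 + r"
  have K: "K > 0" "K \<ge> r" using K0(1) pos unfolding K_def by auto
  have TK: "N (T f) \<le> K * N f" if "f \<in> V" for f
    using K0(2)[OF that] norm_nonneg[OF that] pos unfolding K_def by (smt (verit) mult_right_mono)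
  have TpK: "N ((T ^^ p) f) \<le> K ^ p * N f" if "f \<in> V" for f p
  proof (induction p)
    case (Suc p)
    have "N ((T ^^ Suc p) f) \<le> K * N ((T ^^ p) f)" using TK[OF funpow_mem[OF T that]] by simp
    also have "\<dots> \<le> K * (K ^ p * N f)" using Suc K(1) by (intro mult_left_mono) auto
    finally show ?case by simp
  qed simp
  have exp: "\<exists>R C. \<forall>\<^sub>F w in nhds 0. h w = (\<Sum>j<p. (w - 0) ^ j * (T ^^ j) f x) + (w - 0) ^ p * R w \<and> cmod (R w) \<le> C"
    if "p > 0" for p
  proof -
    define R where "R w = (if w = 0 then 0 else (1 / w) * (T ^^ p) (resolvent T (1 / w) f) x)" for w
    have "\<forall>\<^sub>F w in nhds 0. w \<in> ball 0 (1 / (2 * K))" using K by (intro eventually_nhds_in_open) auto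
    hence "\<forall>\<^sub>F w in nhds 0. h w = (\<Sum>j<p. (w - 0) ^ j * (T ^^ j) f x) + (w - 0) ^ p * R w \<and> cmod (R w) \<le> 2 * K ^ p * N f"
    proof eventually_elim
      case (elim w)
      show ?case
      proof (cases "w = 0")
        case True
        have "(\<Sum>j<p. 0 ^ j * (T ^^ j) f x) = f x"
          using \<open>p > 0\<close> by (cases p) (simp, simp add: sum.lessThan_Suc_shift del: sum.lessThan_Suc funpow.simps)
        thus ?thesis using True K \<open>p > 0\<close> norm_nonneg[OF f] by (simp add: h_def R_def)
      next
        case False
        define l where "l = 1 / w"
        have l: "l \<noteq> 0" "w = 1 / l" using False unfolding l_def by auto
        have cl: "cmod l > 2 * K" using elim False K unfolding l_def by (simp add: norm_divide field_simps)
        hence lsp: "l \<notin> op_spectrum V N T" using K r by (intro sp) linarith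
        let ?u = "resolvent T l f"
        have u: "?u \<in> V" by (rule op_mem[OF resolvent(1)[OF T lsp] f])
        have "(\<lambda>x. l * ?u x - T ?u x) = f" using resolvent(2)[OF T lsp f] by auto
        hence "geo_op T l p f = (\<lambda>x. l ^ p * ?u x - (T ^^ p) ?u x)" using geo_op_right[OF T u, of l p] by simp
        hence 1: "l ^ p * ?u x = (\<Sum>i<p. l ^ i * (T ^^ (p - 1 - i)) f x) + (T ^^ p) ?u x"
          unfolding geo_op_def by (auto simp: fun_eq_iff algebra_simps)
        have "h w = l * ?u x" using False unfolding h_def l_def by simp
        also have "\<dots> = w ^ p * l * (l ^ p * ?u x)" using l by (simp add: power_divide)
        also have "\<dots> = (\<Sum>i<p. w ^ (p - 1 - i) * (T ^^ (p - 1 - i)) f x) + w ^ p * (l * (T ^^ p) ?u x)"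
        proof -
          have c: "w ^ p * l * (l ^ i * X) = w ^ (p - 1 - i) * X" if "i < p" for i X
          proof -
            have "p = Suc i + (p - 1 - i)" using that by simp
            hence "w ^ p = w ^ Suc i * w ^ (p - 1 - i)" by (metis power_add)
            thus ?thesis using l by (simp add: power_divide)
          qed
          have "(\<Sum>i<p. w ^ p * l * (l ^ i * (T ^^ (p - 1 - i)) f x)) = (\<Sum>i<p. w ^ (p - 1 - i) * (T ^^ (p - 1 - i)) f x)"
            by (rule sum.cong[OF refl], rule c) simp
          thus ?thesis unfolding 1 distrib_left sum_distrib_left by (simp only: mult.assoc)
        qed
        also have "(\<Sum>i<p. w ^ (p - 1 - i) * (T ^^ (p - 1 - i)) f x) = (\<Sum>j<p. w ^ j * (T ^^ j) f x)"
          using sum.nat_diff_reindex[of "\<lambda>j. w ^ j * (T ^^ j) f x" p] by simp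
        finally have eq: "h w = (\<Sum>j<p. w ^ j * (T ^^ j) f x) + w ^ p * R w" using False by (simp add: R_def l_def)
        have "cmod (R w) = cmod l * cmod ((T ^^ p) ?u x)" using False by (simp add: R_def l_def norm_mult norm_divide)
        also have "\<dots> \<le> cmod l * (K ^ p * N ?u)"
          using eval_le[OF funpow_mem[OF T u], of p x] TpK[OF u, of p] by (intro mult_left_mono) auto
        finally have 3: "cmod (R w) \<le> cmod l * (K ^ p * N ?u)" .
        have "cmod l * N ?u \<le> 2 * N f"
        proof -
          have "(cmod l - K) * N ?u \<le> N f" by (rule resolvent_large[OF T lsp f TK])
          moreover have "cmod l / 2 * N ?u \<le> (cmod l - K) * N ?u"
            using cl norm_nonneg[OF u] by (intro mult_right_mono) auto
          ultimately show ?thesis by simp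
        qed
        hence "cmod l * (K ^ p * N ?u) \<le> 2 * K ^ p * N f"
          using mult_left_mono[of "cmod l * N ?u" "2 * N f" "K ^ p"] K(1) by (simp add: mult_ac)
        thus ?thesis using eq 3 by simp
      qed
    qed
    thus ?thesis by blast
  qed
  have hol: "h holomorphic_on ball 0 (1 / r1)"
  proof -
    have "h field_differentiable (at w)" if w: "w \<in> ball 0 (1 / r1)" for w
    proof (cases "w = 0")
      case True
      obtain R C where "\<forall>\<^sub>F w in nhds 0. h w = (\<Sum>j<2. (w - 0) ^ j * (T ^^ j) f x) + (w - 0) ^ 2 * R w \<and> cmod (R w) \<le> C"
        using exp[of 2] by auto
      hence "\<forall>\<^sub>F w in nhds 0. h w = f x + (w - 0) * T f x + (w - 0)\<^sup>2 * R w \<and> cmod (R w) \<le> C"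
        by (simp add: numeral_2_eq_2)
      from has_field_derivative_from_expansion[OF this] show ?thesis using True field_differentiable_def by blast
    next
      case False
      let ?U = "{l. cmod l > \<rho>}"
      have U: "open ?U" by (intro open_Collect_less continuous_intros)
      have hr: "(\<lambda>l. resolvent T l f x) holomorphic_on ?U"
        by (rule jet_functional[OF bounded_functional_eval U jet_resolvent[OF T U _ f]]) (use sp in auto)
      have "cmod w < 1 / r1" "cmod w > 0" using w False by auto
      hence "r1 < 1 / cmod w" using pos by (simp add: field_simps)
      hence wU: "1 / w \<in> ?U" using r1 by (simp add: norm_divide)
      have "(\<lambda>l. resolvent T l f x) field_differentiable at (1 / w)"
        using hr U wU by (simp add: holomorphic_on_imp_differentiable_at)
      moreover have "(\<lambda>w. 1 / w) field_differentiable at w"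
        using False by (intro field_differentiable_divide) auto
      ultimately have "(\<lambda>w. resolvent T (1 / w) f x) field_differentiable at w"
        using field_differentiable_compose[of "\<lambda>w. 1 / w" w "\<lambda>l. resolvent T l f x"] by (simp add: o_def)
      hence "(\<lambda>w. resolvent T (1 / w) f x / w) field_differentiable at w"
        using False by (intro field_differentiable_divide) auto
      then obtain D where D: "((\<lambda>w. resolvent T (1 / w) f x / w) has_field_derivative D) (at w)"
        unfolding field_differentiable_def by blast
      have "\<forall>\<^sub>F u in nhds w. u \<noteq> 0" using t1_space_nhds[OF False] .
      hence ev: "\<forall>\<^sub>F u in nhds w. h u = resolvent T (1 / u) f x / u" by eventually_elim (simp add: h_def)
      show ?thesis
        unfolding field_differentiable_def by (rule exI[of _ D]) (use DERIV_cong_ev[OF refl ev refl] D in blast)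
    qed
    thus ?thesis by (auto simp: holomorphic_on_def intro: field_differentiable_at_within)
  qed
  have sub: "cball 0 (1 / r) \<subseteq> ball (0::complex) (1 / r1)" 
  proof -
    have "1 / r < 1 / r1" using r1 pos by (simp add: frac_less2)
    thus ?thesis by auto
  qed
  have cont: "continuous_on (cball 0 (1 / r)) h" by (intro holomorphic_on_imp_continuous_on holomorphic_on_subset[OF hol sub])
  have "compact (h ` cball 0 (1 / r))" by (intro compact_continuous_image cont compact_cball)
  then obtain B where B: "\<And>w. w \<in> cball 0 (1 / r) \<Longrightarrow> cmod (h w) \<le> B"
    using compact_imp_bounded bounded_iff by (metis imageI)
  have "cmod ((T ^^ n) f x) \<le> (B + cmod (f x)) * r ^ n" for n
  proof (cases "n = 0")
    case True
    have "0 \<le> B" using order_trans[OF norm_ge_zero B[of 0]] pos by simp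
    thus ?thesis using True by simp
  next
    case False
    obtain R C where "\<forall>\<^sub>F w in nhds 0. h w = (\<Sum>j<Suc n. (w - 0) ^ j * (T ^^ j) f x) + (w - 0) ^ Suc n * R w \<and> cmod (R w) \<le> C"
      using exp[of "Suc n"] by blast
    from higher_deriv_from_expansion[OF hol _ this, of n]
    have hd: "(deriv ^^ n) h 0 = fact n * (T ^^ n) f x" using pos by simp
    have "cmod ((deriv ^^ n) h 0) \<le> fact n * B / (1 / r) ^ n"
      by (rule Cauchy_inequality[OF holomorphic_on_subset[OF hol] cont]) (use sub pos B in auto)
    hence "fact n * cmod ((T ^^ n) f x) \<le> fact n * (B * r ^ n)"
      unfolding hd by (simp add: norm_mult power_divide)
    hence "cmod ((T ^^ n) f x) \<le> B * r ^ n" by simp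
    also have "\<dots> \<le> (B + cmod (f x)) * r ^ n" using pos by (intro mult_right_mono) auto
    finally show ?thesis .
  qed
  thus ?thesis using that by blast
qed

end

section \<open>Hoelder spaces\<close>

text \<open>Derivatives on [0,1] are never computed directly: a tower \<open>F\<close> of candidates
  is differentiated once, and this lemma identifies it with the iterated
  \<open>deriv01\<close>.\<close>

lemma deriv01_jet:
  assumes "\<And>x. x \<in> {0..1} \<Longrightarrow> f x = F 0 x"
    and "\<And>j x. j < m \<Longrightarrow> x \<in> {0..1} \<Longrightarrow> (F j has_vector_derivative F (Suc j) x) (at x within {0..1})"
  shows "j \<le> m \<Longrightarrow> x \<in> {0..1} \<Longrightarrow> (deriv01 ^^ j) f x = F j x"
proof (induction j arbitrary: x)
  case 0 thus ?case using assms(1) by simp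
next
  case (Suc j)
  have "((deriv01 ^^ j) f has_vector_derivative F (Suc j) x) (at x within {0..1})"
    by (rule has_vector_derivative_transform[OF _ _ assms(2)]) (use Suc in auto)
  hence "vector_derivative ((deriv01 ^^ j) f) (at x within {0..1}) = F (Suc j) x"
    using Suc.prems by (intro vector_derivative_within_closed_interval) auto
  thus ?case using Suc.prems by (simp add: deriv01_def[of "(deriv01 ^^ j) f"])
qed

locale holder_space =
  fixes \<alpha> :: real
  assumes \<alpha>_pos: "\<alpha> > 0"
begin

abbreviation k :: nat where "k \<equiv> nat \<lfloor>\<alpha>\<rfloor>"
abbreviation \<eta> :: real where "\<eta> \<equiv> frac \<alpha>"
abbreviation D :: "nat \<Rightarrow> (real \<Rightarrow> complex) \<Rightarrow> real \<Rightarrow> complex" where "D j f \<equiv> (deriv01 ^^ j) f"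

lemma \<alpha>_eq: "\<alpha> = real k + \<eta>"
  using \<alpha>_pos by (simp add: frac_def)

lemma \<eta>_nonneg: "0 \<le> \<eta>" and \<eta>_less: "\<eta> < 1"
  by (auto simp: frac_lt_1)

definition sup_norm :: "nat \<Rightarrow> (real \<Rightarrow> complex) \<Rightarrow> real" where
  "sup_norm j f = (SUP x\<in>{0..1}. cmod (D j f x))"

definition holder_const :: "(real \<Rightarrow> complex) \<Rightarrow> real" where
  "holder_const f = (if \<eta> = 0 then 0
      else SUP (x, y)\<in>{(x, y). x \<in> {0..1} \<and> y \<in> {0..1} \<and> x \<noteq> y}.
        cmod (D k f x - D k f y) / \<bar>x - y\<bar> powr \<eta>)"

lemma C_norm_eq: "C_norm \<alpha> f = (\<Sum>j\<le>k. sup_norm j f) + holder_const f"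
  unfolding C_norm_def sup_norm_def holder_const_def by simp

lemma sup_norm_le: "(\<And>x. x \<in> {0..1} \<Longrightarrow> cmod (D j f x) \<le> B) \<Longrightarrow> sup_norm j f \<le> B"
  unfolding sup_norm_def by (rule cSUP_least) auto

lemma holder_const_le:
  assumes "\<And>x y. x \<in> {0..1} \<Longrightarrow> y \<in> {0..1} \<Longrightarrow> cmod (D k f x - D k f y) \<le> B * \<bar>x - y\<bar> powr \<eta>" "B \<ge> 0"
  shows "holder_const f \<le> B"
proof (cases "\<eta> = 0")
  case False
  have ne: "{(x, y). x \<in> {0..1} \<and> y \<in> {0..1} \<and> x \<noteq> (y::real)} \<noteq> {}"

  proof -
    have "(0, 1) \<in> {(x, y). x \<in> {0..1} \<and> y \<in> {0..1} \<and> x \<noteq> (y::real)}" by simp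
    thus ?thesis by blast
  qed
  have "(SUP (x, y)\<in>{(x, y). x \<in> {0..1} \<and> y \<in> {0..1} \<and> x \<noteq> y}.
        cmod (D k f x - D k f y) / \<bar>x - y\<bar> powr \<eta>) \<le> B"
    by (rule cSUP_least[OF ne]) (use assms in \<open>auto simp: field_simps\<close>)
  thus ?thesis using False unfolding holder_const_def by simp
qed (use assms in \<open>simp add: holder_const_def\<close>)

text \<open>Treats integer and fractional \<open>\<alpha>\<close> together. For
  \<open>\<eta> = 0\<close> the Hoelder inequality merely bounds the oscillation and continuity
  carries the content; as \<open>0 powr 0 = 0\<close>, the inequality remains true at
  \<open>x = y\<close>.\<close>

lemma C_spaceI:
  assumes out: "\<And>x. x \<notin> {0..1} \<Longrightarrow> f x = 0" and F0: "\<And>x. x \<in> {0..1} \<Longrightarrow> f x = F 0 x"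
    and der: "\<And>j x. j < k \<Longrightarrow> x \<in> {0..1} \<Longrightarrow> (F j has_vector_derivative F (Suc j) x) (at x within {0..1})"
    and cont: "continuous_on {0..1} (F k)"
    and hol: "\<And>x y. x \<in> {0..1} \<Longrightarrow> y \<in> {0..1} \<Longrightarrow> cmod (F k x - F k y) \<le> B * \<bar>x - y\<bar> powr \<eta>"
  shows "f \<in> C_space \<alpha>"
proof -
  have D: "D j f x = F j x" if "j \<le> k" "x \<in> {0..1}" for j x
    by (rule deriv01_jet[of f F k, OF F0 der that])
  have "D j f differentiable_on {0..1}" if "j < k" for j
    unfolding differentiable_on_def
  proof
    fix x :: real assume x: "x \<in> {0..1}"
    have "(D j f has_vector_derivative F (Suc j) x) (at x within {0..1})"
      by (rule has_vector_derivative_transform[OF x _ der[OF that x]]) (use D that in auto)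
    thus "D j f differentiable (at x within {0..1})" by (rule differentiableI_vector)
  qed
  moreover have "continuous_on {0..1} (D k f)"
    using cont by (rule continuous_on_eq) (simp add: D)
  moreover have "\<exists>C. \<forall>x\<in>{0..1}. \<forall>y\<in>{0..1}. cmod (D k f x - D k f y) \<le> C * \<bar>x - y\<bar> powr \<eta>"
    by (rule exI[of _ B]) (use hol D in auto)
  ultimately show ?thesis unfolding C_space_def using out by auto
qed

text \<open>\<open>k + 1\<close> sup norms and one Hoelder constant, each at most
  \<open>B\<close>.\<close>

lemma C_norm_le:
  assumes F0: "\<And>x. x \<in> {0..1} \<Longrightarrow> f x = F 0 x"
    and der: "\<And>j x. j < k \<Longrightarrow> x \<in> {0..1} \<Longrightarrow> (F j has_vector_derivative F (Suc j) x) (at x within {0..1})"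
    and bd: "\<And>j x. j \<le> k \<Longrightarrow> x \<in> {0..1} \<Longrightarrow> cmod (F j x) \<le> B"
    and hol: "\<And>x y. x \<in> {0..1} \<Longrightarrow> y \<in> {0..1} \<Longrightarrow> cmod (F k x - F k y) \<le> B * \<bar>x - y\<bar> powr \<eta>"
  shows "C_norm \<alpha> f \<le> (real k + 2) * B"
proof -
  have D: "D j f x = F j x" if "j \<le> k" "x \<in> {0..1}" for j x
    by (rule deriv01_jet[of f F k, OF F0 der that])
  have B: "B \<ge> 0" using order_trans[OF norm_ge_zero bd[of 0 0]] by simp
  have "(\<Sum>j\<le>k. sup_norm j f) \<le> (\<Sum>j\<le>k. B)"
    by (intro sum_mono sup_norm_le) (use D bd in auto)
  moreover have "holder_const f \<le> B"
    by (rule holder_const_le) (use D hol B in auto)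
  ultimately show ?thesis unfolding C_norm_eq by (simp add: algebra_simps)
qed

lemma C_space_outside: "f \<in> C_space \<alpha> \<Longrightarrow> x \<notin> {0..1} \<Longrightarrow> f x = 0"
  unfolding C_space_def by blast

lemma C_space_deriv:
  assumes "f \<in> C_space \<alpha>" "j < k" "x \<in> {0..1}"
  shows "(D j f has_vector_derivative D (Suc j) f x) (at x within {0..1})"
proof -
  have "D j f differentiable (at x within {0..1})"
    using assms unfolding C_space_def differentiable_on_def by blast
  thus ?thesis using assms(3) by (simp add: deriv01_def vector_derivative_works)
qed

lemma C_space_holder:
  assumes "f \<in> C_space \<alpha>"
  shows "\<exists>C. \<forall>x\<in>{0..1}. \<forall>y\<in>{0..1}. \<eta> \<noteq> 0 \<longrightarrow> cmod (D k f x - D k f y) \<le> C * \<bar>x - y\<bar> powr \<eta>"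
  using assms unfolding C_space_def by (cases "\<eta> = 0") auto

lemma C_space_continuous:
  assumes f: "f \<in> C_space \<alpha>" and j: "j \<le> k"
  shows "continuous_on {0..1} (D j f)"
proof (cases "j < k")
  case True
  thus ?thesis using C_space_deriv[OF f True]
    by (meson continuous_on_eq_continuous_within has_vector_derivative_continuous)
next
  case False
  hence [simp]: "j = k" using j by simp
  show ?thesis
  proof (cases "\<eta> = 0")
    case True thus ?thesis using f unfolding C_space_def by simp
  next
    case False
    then obtain C where C: "\<And>x y. x \<in> {0..1} \<Longrightarrow> y \<in> {0..1} \<Longrightarrow> cmod (D k f x - D k f y) \<le> C * \<bar>x - y\<bar> powr \<eta>"
      using C_space_holder[OF f] by blast
    have \<eta>: "\<eta> > 0" using False \<eta>_nonneg by simp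
    show ?thesis unfolding continuous_on_def
    proof
      fix x :: real assume x: "x \<in> {0..1}"
      have "((\<lambda>y. C * \<bar>y - x\<bar> powr \<eta>) \<longlongrightarrow> C * \<bar>x - x\<bar> powr \<eta>) (at x within {0..1})"
        by (intro tendsto_mult tendsto_const tendsto_powr' tendsto_intros) (use \<eta> in auto)
      hence l: "((\<lambda>y. C * \<bar>y - x\<bar> powr \<eta>) \<longlongrightarrow> 0) (at x within {0..1})" by simp
      have "((\<lambda>y. D k f y - D k f x) \<longlongrightarrow> 0) (at x within {0..1})"
        by (rule Lim_null_comparison[OF _ l]) (use C x in \<open>auto simp: eventually_at_filter\<close>)
      thus "(D j f \<longlongrightarrow> D j f x) (at x within {0..1})" by (auto intro: LIM_zero_cancel)
    qed
  qed
qed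

lemma sup_norm_upper:
  assumes f: "f \<in> C_space \<alpha>" and j: "j \<le> k" and x: "x \<in> {0..1}"
  shows "cmod (D j f x) \<le> sup_norm j f"
proof -
  have "compact ((\<lambda>x. cmod (D j f x)) ` {0..1})"
    by (intro compact_continuous_image continuous_intros C_space_continuous f j) auto
  hence "bdd_above ((\<lambda>x. cmod (D j f x)) ` {0..1})" by (simp add: bounded_imp_bdd_above compact_imp_bounded)
  thus ?thesis unfolding sup_norm_def using x by (intro cSUP_upper) auto
qed

lemma sup_norm_nonneg: "f \<in> C_space \<alpha> \<Longrightarrow> j \<le> k \<Longrightarrow> 0 \<le> sup_norm j f"
  using order_trans[OF norm_ge_zero sup_norm_upper[of f j 0]] by simp

lemma holder_const_upper:
  assumes f: "f \<in> C_space \<alpha>" and \<eta>: "\<eta> \<noteq> 0" and xy: "x \<in> {0..1}" "y \<in> {0..1}"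
  shows "cmod (D k f x - D k f y) \<le> holder_const f * \<bar>x - y\<bar> powr \<eta>"
proof (cases "x = y")
  case False
  obtain C where C: "\<And>x y. x \<in> {0..1} \<Longrightarrow> y \<in> {0..1} \<Longrightarrow> cmod (D k f x - D k f y) \<le> C * \<bar>x - y\<bar> powr \<eta>"
    using C_space_holder[OF f] \<eta> by blast
  let ?h = "\<lambda>(x, y). cmod (D k f x - D k f y) / \<bar>x - y\<bar> powr \<eta>"
  have "bdd_above (?h ` {(x, y). x \<in> {0..1} \<and> y \<in> {0..1} \<and> x \<noteq> y})"
    by (rule bdd_aboveI2[where M = C]) (use C in \<open>auto simp: field_simps\<close>)
  hence "?h (x, y) \<le> (SUP p\<in>{(x, y). x \<in> {0..1} \<and> y \<in> {0..1} \<and> x \<noteq> y}. ?h p)"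
    by (rule cSUP_upper[rotated]) (use xy False in auto)
  hence "cmod (D k f x - D k f y) / \<bar>x - y\<bar> powr \<eta> \<le> holder_const f"
    unfolding holder_const_def using \<eta> by simp
  thus ?thesis using False by (simp add: field_simps)
qed simp

lemma holder_const_nonneg: "f \<in> C_space \<alpha> \<Longrightarrow> 0 \<le> holder_const f"
  using order_trans[OF norm_ge_zero holder_const_upper[of f 0 1]] by (cases "\<eta> = 0") (auto simp: holder_const_def)

lemma C_norm_upper:
  assumes f: "f \<in> C_space \<alpha>" and j: "j \<le> k" and x: "x \<in> {0..1}"
  shows "cmod (D j f x) \<le> C_norm \<alpha> f"
proof -
  have "sup_norm j f \<le> (\<Sum>j\<le>k. sup_norm j f)"
    by (rule member_le_sum) (use j sup_norm_nonneg[OF f] in auto)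
  thus ?thesis using sup_norm_upper[OF assms] holder_const_nonneg[OF f] unfolding C_norm_eq by linarith
qed

text \<open>The factor 2 lets one inequality serve every \<open>\<alpha>\<close>: for
  \<open>\<eta> = 0\<close> the difference is bounded by two sup norms.\<close>

lemma C_norm_holder:
  assumes f: "f \<in> C_space \<alpha>" and xy: "x \<in> {0..1}" "y \<in> {0..1}"
  shows "cmod (D k f x - D k f y) \<le> 2 * C_norm \<alpha> f * \<bar>x - y\<bar> powr \<eta>"
proof (cases "\<eta> = 0")
  case True
  show ?thesis
  proof (cases "x = y")
    case False
    have "cmod (D k f x - D k f y) \<le> cmod (D k f x) + cmod (D k f y)" by (rule norm_triangle_ineq4)
    also have "\<dots> \<le> 2 * C_norm \<alpha> f" using C_norm_upper[OF f, of k x] C_norm_upper[OF f, of k y] xy by simp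
    finally show ?thesis using True False by (simp del: frac_eq_0_iff)
  qed simp
next
  case False
  have "0 \<le> (\<Sum>j\<le>k. sup_norm j f)" by (intro sum_nonneg sup_norm_nonneg f) auto
  hence "holder_const f \<le> 2 * C_norm \<alpha> f" using holder_const_nonneg[OF f] unfolding C_norm_eq by simp
  thus ?thesis using holder_const_upper[OF f False xy] by (smt (verit) mult_right_mono powr_ge_zero)
qed

lemma C_norm_nonneg: "f \<in> C_space \<alpha> \<Longrightarrow> 0 \<le> C_norm \<alpha> f"
  using order_trans[OF norm_ge_zero C_norm_upper[of f 0 0]] by simp

section \<open>The Hoelder space as a complete function space\<close>

lemma C_space_zero: "(\<lambda>x. 0) \<in> C_space \<alpha>"
  by (rule C_spaceI[where F = "\<lambda>j x. 0" and B = 0]) auto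

lemma
  assumes f: "f \<in> C_space \<alpha>" and g: "g \<in> C_space \<alpha>"
  shows C_space_add: "(\<lambda>x. f x + g x) \<in> C_space \<alpha>"
    and D_add: "j \<le> k \<Longrightarrow> x \<in> {0..1} \<Longrightarrow> D j (\<lambda>x. f x + g x) x = D j f x + D j g x"
    and C_norm_add: "C_norm \<alpha> (\<lambda>x. f x + g x) \<le> C_norm \<alpha> f + C_norm \<alpha> g"
proof -
  let ?F = "\<lambda>j x. D j f x + D j g x"
  have der: "(?F j has_vector_derivative ?F (Suc j) x) (at x within {0..1})" if "j < k" "x \<in> {0..1}" for j x
    by (intro has_vector_derivative_add C_space_deriv f g that)
  have hol: "cmod (?F k x - ?F k y) \<le> (2 * C_norm \<alpha> f + 2 * C_norm \<alpha> g) * \<bar>x - y\<bar> powr \<eta>"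
    if "x \<in> {0..1}" "y \<in> {0..1}" for x y
  proof -
    have "cmod (?F k x - ?F k y) \<le> cmod (D k f x - D k f y) + cmod (D k g x - D k g y)"
      using norm_triangle_ineq[of "D k f x - D k f y" "D k g x - D k g y"] by (simp add: algebra_simps)
    thus ?thesis using C_norm_holder[OF f that] C_norm_holder[OF g that] by (simp add: distrib_right)
  qed
  show "(\<lambda>x. f x + g x) \<in> C_space \<alpha>"
    by (rule C_spaceI[of _ ?F, OF _ _ der _ hol])
       (auto intro!: continuous_intros C_space_continuous f g simp: C_space_outside[OF f] C_space_outside[OF g])
  show D: "D j (\<lambda>x. f x + g x) x = ?F j x" if "j \<le> k" "x \<in> {0..1}" for j x
    by (rule deriv01_jet[of _ ?F k, OF _ der that]) auto
  have "sup_norm j (\<lambda>x. f x + g x) \<le> sup_norm j f + sup_norm j g" if "j \<le> k" for j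
    by (rule sup_norm_le) (use D that sup_norm_upper[OF f that] sup_norm_upper[OF g that] in \<open>auto intro!: norm_triangle_mono\<close>)
  hence "(\<Sum>j\<le>k. sup_norm j (\<lambda>x. f x + g x)) \<le> (\<Sum>j\<le>k. sup_norm j f) + (\<Sum>j\<le>k. sup_norm j g)"
    unfolding sum.distrib[symmetric] by (intro sum_mono) auto
  moreover have "holder_const (\<lambda>x. f x + g x) \<le> holder_const f + holder_const g"
  proof (cases "\<eta> = 0")
    case False
    show ?thesis
    proof (rule holder_const_le)
      fix x y :: real assume xy: "x \<in> {0..1}" "y \<in> {0..1}"
      have "cmod (?F k x - ?F k y) \<le> cmod (D k f x - D k f y) + cmod (D k g x - D k g y)"
        using norm_triangle_ineq[of "D k f x - D k f y" "D k g x - D k g y"] by (simp add: algebra_simps)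
      thus "cmod (D k (\<lambda>x. f x + g x) x - D k (\<lambda>x. f x + g x) y) \<le> (holder_const f + holder_const g) * \<bar>x - y\<bar> powr \<eta>"
        using holder_const_upper[OF f False xy] holder_const_upper[OF g False xy] D xy by (simp add: distrib_right)
    qed (use holder_const_nonneg f g in simp)
  qed (simp add: holder_const_def)
  ultimately show "C_norm \<alpha> (\<lambda>x. f x + g x) \<le> C_norm \<alpha> f + C_norm \<alpha> g" unfolding C_norm_eq by linarith
qed

lemma
  assumes f: "f \<in> C_space \<alpha>"
  shows C_space_scale: "(\<lambda>x. c * f x) \<in> C_space \<alpha>"
    and D_scale: "j \<le> k \<Longrightarrow> x \<in> {0..1} \<Longrightarrow> D j (\<lambda>x. c * f x) x = c * D j f x"
    and C_norm_scale_le: "C_norm \<alpha> (\<lambda>x. c * f x) \<le> cmod c * C_norm \<alpha> f"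
proof -
  let ?F = "\<lambda>j x. c * D j f x"
  have der: "(?F j has_vector_derivative ?F (Suc j) x) (at x within {0..1})" if "j < k" "x \<in> {0..1}" for j x
    by (intro has_vector_derivative_mult_right C_space_deriv f that)
  have e: "cmod (?F k x - ?F k y) = cmod c * cmod (D k f x - D k f y)" for x y
    by (metis norm_mult right_diff_distrib)
  have hol: "cmod (?F k x - ?F k y) \<le> (cmod c * (2 * C_norm \<alpha> f)) * \<bar>x - y\<bar> powr \<eta>"
    if "x \<in> {0..1}" "y \<in> {0..1}" for x y
    unfolding e using mult_left_mono[OF C_norm_holder[OF f that], of "cmod c"] by (simp add: mult.assoc)
  show "(\<lambda>x. c * f x) \<in> C_space \<alpha>"
    by (rule C_spaceI[of _ ?F, OF _ _ der _ hol])
       (auto intro!: continuous_intros C_space_continuous f simp: C_space_outside[OF f])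
  show D: "D j (\<lambda>x. c * f x) x = ?F j x" if "j \<le> k" "x \<in> {0..1}" for j x
    by (rule deriv01_jet[of _ ?F k, OF _ der that]) auto
  have "sup_norm j (\<lambda>x. c * f x) \<le> cmod c * sup_norm j f" if "j \<le> k" for j
    by (rule sup_norm_le) (use D that sup_norm_upper[OF f that] in \<open>auto simp: norm_mult mult_left_mono\<close>)
  hence "(\<Sum>j\<le>k. sup_norm j (\<lambda>x. c * f x)) \<le> cmod c * (\<Sum>j\<le>k. sup_norm j f)"
    unfolding sum_distrib_left by (intro sum_mono) auto
  moreover have "holder_const (\<lambda>x. c * f x) \<le> cmod c * holder_const f"
  proof (cases "\<eta> = 0")
    case False
    show ?thesis
    proof (rule holder_const_le)
      fix x y :: real assume xy: "x \<in> {0..1}" "y \<in> {0..1}"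
      show "cmod (D k (\<lambda>x. c * f x) x - D k (\<lambda>x. c * f x) y) \<le> cmod c * holder_const f * \<bar>x - y\<bar> powr \<eta>"
        using mult_left_mono[OF holder_const_upper[OF f False xy], of "cmod c"] D xy e by (simp add: mult.assoc)
    qed (use holder_const_nonneg f in simp)
  qed (simp add: holder_const_def)
  ultimately show "C_norm \<alpha> (\<lambda>x. c * f x) \<le> cmod c * C_norm \<alpha> f" unfolding C_norm_eq by (simp add: distrib_left)
qed

lemma C_norm_scale:
  assumes f: "f \<in> C_space \<alpha>"
  shows "C_norm \<alpha> (\<lambda>x. c * f x) = cmod c * C_norm \<alpha> f"
proof (cases "c = 0")
  case True
  thus ?thesis using C_norm_scale_le[OF f, of c] C_norm_nonneg[OF C_space_scale[OF f, of c]] by simp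
next
  case False
  have "C_norm \<alpha> (\<lambda>x. inverse c * (c * f x)) \<le> cmod (inverse c) * C_norm \<alpha> (\<lambda>x. c * f x)"
    by (rule C_norm_scale_le[OF C_space_scale[OF f]])
  hence "cmod c * C_norm \<alpha> f \<le> C_norm \<alpha> (\<lambda>x. c * f x)"
    using False by (simp add: norm_divide norm_inverse field_simps)
  thus ?thesis using C_norm_scale_le[OF f, of c] by simp
qed

lemma
  assumes f: "f \<in> C_space \<alpha>" and g: "g \<in> C_space \<alpha>"
  shows C_space_diff: "(\<lambda>x. f x - g x) \<in> C_space \<alpha>"
    and D_diff: "j \<le> k \<Longrightarrow> x \<in> {0..1} \<Longrightarrow> D j (\<lambda>x. f x - g x) x = D j f x - D j g x"
  using C_space_add[OF f C_space_scale[OF g, of "-1"]] D_add[OF f C_space_scale[OF g, of "-1"], of j x]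
    D_scale[OF g, of j x "-1"] by auto

text \<open>Uniform limits of the derivatives stay in the space when the norms are bounded, although
  convergence in norm may fail. With a small \<open>B\<close> this proves completeness; with a large
  one it identifies the limits produced by compactness. The 2 comes from
  \<open>C_norm_holder\<close>.\<close>

lemma C_limit:
  assumes s: "\<And>n. s n \<in> C_space \<alpha>" "\<And>n. C_norm \<alpha> (s n) \<le> B"
    and lim: "\<And>j. j \<le> k \<Longrightarrow> uniform_limit {0..1} (\<lambda>n. D j (s n)) (G j) sequentially"
    and g: "\<And>x. x \<in> {0..1} \<Longrightarrow> g x = G 0 x" "\<And>x. x \<notin> {0..1} \<Longrightarrow> g x = 0"
  shows "g \<in> C_space \<alpha>" "C_norm \<alpha> g \<le> (real k + 2) * (2 * B)"
    "j \<le> k \<Longrightarrow> x \<in> {0..1} \<Longrightarrow> D j g x = G j x"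
proof -
  have pl: "(\<lambda>n. D j (s n) x) \<longlonglongrightarrow> G j x" if "j \<le> k" "x \<in> {0..1}" for j x
    by (rule tendsto_uniform_limitI[OF lim[OF that(1)] that(2)])
  have der: "(G j has_vector_derivative G (Suc j) x) (at x within {0..1})" if j: "j < k" and x: "x \<in> {0..1}" for j x
  proof -
    have "\<exists>g. \<forall>x\<in>{0..1}. (\<lambda>n. D j (s n) x) \<longlonglongrightarrow> g x \<and> (g has_derivative (\<lambda>h. h *\<^sub>R G (Suc j) x)) (at x within {0..1})"
    proof (rule has_derivative_sequence[where ?x0.0 = 0 and l = "G j 0" and f' = "\<lambda>n x h. h *\<^sub>R D (Suc j) (s n) x"])
      show "(D j (s n) has_derivative (\<lambda>h. h *\<^sub>R D (Suc j) (s n) x)) (at x within {0..1})" if "x \<in> {0..1}" for n x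
        using C_space_deriv[OF s(1) j that] unfolding has_vector_derivative_def .
      fix e :: real assume "e > 0"
      from uniform_limitD[OF lim[of "Suc j"] this] j
      have "\<forall>\<^sub>F n in sequentially. \<forall>x\<in>{0..1}. dist (D (Suc j) (s n) x) (G (Suc j) x) < e" by simp
      thus "\<forall>\<^sub>F n in sequentially. \<forall>x\<in>{0..1}. \<forall>h. norm (h *\<^sub>R D (Suc j) (s n) x - h *\<^sub>R G (Suc j) x) \<le> e * norm h"
      proof eventually_elim
        case (elim n)
        show ?case
        proof (intro ballI allI)
          fix x h :: real assume "x \<in> {0..1}"
          hence le: "norm (D (Suc j) (s n) x - G (Suc j) x) \<le> e" using elim by (simp add: dist_norm less_imp_le)
          show "norm (h *\<^sub>R D (Suc j) (s n) x - h *\<^sub>R G (Suc j) x) \<le> e * norm h"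
            unfolding scaleR_diff_right[symmetric] norm_scaleR
            using mult_left_mono[OF le, of "\<bar>h\<bar>"] by (simp add: mult.commute[of e])
        qed
      qed
    qed (use pl j in auto)
    then obtain h where h: "\<And>x. x \<in> {0..1} \<Longrightarrow> (\<lambda>n. D j (s n) x) \<longlonglongrightarrow> h x"
      "\<And>x. x \<in> {0..1} \<Longrightarrow> (h has_vector_derivative G (Suc j) x) (at x within {0..1})"
      unfolding has_vector_derivative_def by blast
    have "G j y = h y" if "y \<in> {0..1}" for y using LIMSEQ_unique[OF pl h(1)] that j by simp
    thus ?thesis by (rule has_vector_derivative_transform[OF x _ h(2)[OF x]])
  qed
  have cont: "continuous_on {0..1} (G k)"
    by (rule uniform_limit_theorem[OF _ lim[of k]]) (auto intro!: always_eventually C_space_continuous s)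
  have bd: "cmod (G j x) \<le> 2 * B" if "j \<le> k" "x \<in> {0..1}" for j x
  proof -
    have "cmod (D j (s n) x) \<le> 2 * B" for n using C_norm_upper[OF s(1) that, of n] s(2)[of n] C_norm_nonneg[OF s(1), of n] by linarith
    thus ?thesis by (intro tendsto_upperbound[OF tendsto_norm[OF pl[OF that]]] always_eventually) auto
  qed
  have hol: "cmod (G k x - G k y) \<le> (2 * B) * \<bar>x - y\<bar> powr \<eta>" if "x \<in> {0..1}" "y \<in> {0..1}" for x y
  proof -
    have "cmod (D k (s n) x - D k (s n) y) \<le> (2 * B) * \<bar>x - y\<bar> powr \<eta>" for n
      using C_norm_holder[OF s(1) that, of n] mult_right_mono[OF s(2)[of n], of "2 * \<bar>x - y\<bar> powr \<eta>"] by (simp add: mult_ac)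
    thus ?thesis using that by (intro tendsto_upperbound[OF tendsto_norm[OF tendsto_diff[OF pl pl]]] always_eventually) auto
  qed
  show "g \<in> C_space \<alpha>" by (rule C_spaceI[of g G, OF g(2) g(1) der cont hol])
  show "C_norm \<alpha> g \<le> (real k + 2) * (2 * B)" by (rule C_norm_le[of g G, OF g(1) der bd hol])
  show "j \<le> k \<Longrightarrow> x \<in> {0..1} \<Longrightarrow> D j g x = G j x" by (rule deriv01_jet[of g G k, OF g(1) der])
qed

sublocale complex_function_space "C_space \<alpha>" "C_norm \<alpha>"
proof
  show "(\<lambda>x. 0) \<in> C_space \<alpha>" by (rule C_space_zero)
  fix f g c x assume f: "f \<in> C_space \<alpha>"
  show "(\<lambda>x. c * f x) \<in> C_space \<alpha>" by (rule C_space_scale[OF f])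
  show "C_norm \<alpha> (\<lambda>x. c * f x) = cmod c * C_norm \<alpha> f" by (rule C_norm_scale[OF f])
  show "cmod (f x) \<le> C_norm \<alpha> f"
    using C_norm_upper[OF f, of 0 x] C_space_outside[OF f, of x] C_norm_nonneg[OF f] by (cases "x \<in> {0..1}") auto
  assume g: "g \<in> C_space \<alpha>"
  show "(\<lambda>x. f x + g x) \<in> C_space \<alpha>" by (rule C_space_add[OF f g])
  show "C_norm \<alpha> (\<lambda>x. f x + g x) \<le> C_norm \<alpha> f + C_norm \<alpha> g" by (rule C_norm_add[OF f g])
next
  fix s :: "nat \<Rightarrow> real \<Rightarrow> complex"
  assume s: "\<And>n. s n \<in> C_space \<alpha>" and cauchy: "\<And>e. e > 0 \<Longrightarrow> \<exists>M. \<forall>m\<ge>M. \<forall>n\<ge>M. C_norm \<alpha> (\<lambda>x. s m x - s n x) < e"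
  have "\<exists>G. uniform_limit {0..1} (\<lambda>n. D j (s n)) G sequentially" if j: "j \<le> k" for j
  proof -
    have "uniformly_Cauchy_on {0..1} (\<lambda>n. D j (s n))"
    proof (rule uniformly_Cauchy_onI)
      fix e :: real assume "e > 0"
      then obtain M where M: "\<forall>m\<ge>M. \<forall>n\<ge>M. C_norm \<alpha> (\<lambda>x. s m x - s n x) < e" using cauchy by blast
      have "dist (D j (s m) x) (D j (s n) x) < e" if "x \<in> {0..1}" "m \<ge> M" "n \<ge> M" for x m n
      proof -
        have "dist (D j (s m) x) (D j (s n) x) = cmod (D j (\<lambda>x. s m x - s n x) x)"
          using D_diff[OF s s j that(1)] by (simp add: dist_norm)
        also have "\<dots> \<le> C_norm \<alpha> (\<lambda>x. s m x - s n x)" by (rule C_norm_upper[OF C_space_diff[OF s s] j that(1)])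
        finally show ?thesis using M that by fastforce
      qed
      thus "\<exists>M. \<forall>x\<in>{0..1}. \<forall>m\<ge>M. \<forall>n\<ge>M. dist (D j (s m) x) (D j (s n) x) < e" by blast
    qed
    thus ?thesis by (metis Cauchy_uniformly_convergent uniformly_convergent_on_def)
  qed
  then obtain G where G: "\<And>j. j \<le> k \<Longrightarrow> uniform_limit {0..1} (\<lambda>n. D j (s n)) (G j) sequentially" by metis
  obtain M0 where M0: "\<forall>m\<ge>M0. \<forall>n\<ge>M0. C_norm \<alpha> (\<lambda>x. s m x - s n x) < 1" using cauchy[of 1] by auto
  define g where "g x = (if x \<in> {0..1} then G 0 x else 0)" for x
  have shift: "uniform_limit {0..1} (\<lambda>n. D j (s (n + M))) (G j) sequentially" if "j \<le> k" for j M
    using G[OF that] unfolding uniform_limit_iff by (auto intro: sequentially_offset)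
  have bd: "C_norm \<alpha> (s (n + M0)) \<le> C_norm \<alpha> (s M0) + 1" for n
  proof -
    have "C_norm \<alpha> (\<lambda>x. s M0 x + (s (n + M0) x - s M0 x)) \<le> C_norm \<alpha> (s M0) + C_norm \<alpha> (\<lambda>x. s (n + M0) x - s M0 x)"
      by (rule C_norm_add[OF s C_space_diff[OF s s]])
    moreover have "C_norm \<alpha> (\<lambda>x. s (n + M0) x - s M0 x) < 1" using M0 by simp
    ultimately show ?thesis by simp
  qed
  have gV: "g \<in> C_space \<alpha>" by (rule C_limit(1)[of "\<lambda>n. s (n + M0)" _ G g, OF s bd shift]) (auto simp: g_def)
  have Dg: "D j g x = G j x" if "j \<le> k" "x \<in> {0..1}" for j x
    by (rule C_limit(3)[of "\<lambda>n. s (n + M0)" _ G g, OF s bd shift _ _ that]) (auto simp: g_def)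
  have "(\<lambda>n. C_norm \<alpha> (\<lambda>x. s n x - g x)) \<longlonglongrightarrow> 0"
  proof (rule LIMSEQ_I)
    fix e :: real assume e: "e > 0"
    \<comment> \<open>Chosen so that the bound \<open>(k + 2) * (2 * e')\<close> from
      \<open>C_limit\<close> is \<open>e / 2\<close>, strictly below \<open>e\<close>.\<close>
    define e' where "e' = e / ((real k + 2) * 2 * 2)"
    have e': "e' > 0" using e unfolding e'_def by simp
    then obtain M where M: "\<forall>m\<ge>M. \<forall>n\<ge>M. C_norm \<alpha> (\<lambda>x. s m x - s n x) < e'" using cauchy by blast
    have "norm (C_norm \<alpha> (\<lambda>x. s n x - g x) - 0) < e" if n: "n \<ge> M" for n
    proof -
      have "C_norm \<alpha> (\<lambda>x. s n x - g x) \<le> (real k + 2) * (2 * e')"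
      \<comment> \<open>With \<open>n\<close> fixed, the differences to later members are small in
        norm and tend to \<open>s n - g\<close>, so the bound survives in the limit.\<close>
      proof (rule C_limit(2)[of "\<lambda>m x. s n x - s (m + M) x" e' "\<lambda>j x. D j (s n) x - G j x"])
        show "(\<lambda>x. s n x - s (m + M) x) \<in> C_space \<alpha>" for m by (rule C_space_diff[OF s s])
        show "C_norm \<alpha> (\<lambda>x. s n x - s (m + M) x) \<le> e'" for m using M n by (simp add: less_imp_le)
        fix j assume j: "j \<le> k"
        have "uniform_limit {0..1} (\<lambda>m x. D j (s n) x - D j (s (m + M)) x) (\<lambda>x. D j (s n) x - G j x) sequentially"
          by (intro uniform_limit_intros shift j)
        thus "uniform_limit {0..1} (\<lambda>m. D j (\<lambda>x. s n x - s (m + M) x)) (\<lambda>x. D j (s n) x - G j x) sequentially"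
          by (rule uniform_limit_cong'[THEN iffD1, rotated -1]) (auto simp: D_diff[OF s s j])
      next
        show "s n x - g x = D 0 (s n) x - G 0 x" if "x \<in> {0..1}" for x using that by (auto simp: g_def)
        show "s n x - g x = 0" if "x \<notin> {0..1}" for x using that C_space_outside[OF s, of x] by (auto simp: g_def)
      qed
      also have "\<dots> = e / 2" unfolding e'_def by (simp add: field_simps)
      finally show ?thesis using e C_norm_nonneg[OF C_space_diff[OF s gV]] by simp
    qed
    thus "\<exists>M. \<forall>n\<ge>M. norm (C_norm \<alpha> (\<lambda>x. s n x - g x) - 0) < e" by blast
  qed
  with gV show "\<exists>g\<in>C_space \<alpha>. (\<lambda>n. C_norm \<alpha> (\<lambda>x. s n x - g x)) \<longlonglongrightarrow> 0" by blast
qed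

end

section \<open>The Hurwitz zeta function\<close>

lemma holomorphic_suminf:
  fixes f :: "nat \<Rightarrow> complex \<Rightarrow> complex"
  assumes "open S" and hol: "\<And>n. f n holomorphic_on S"
    and bd: "\<And>x. x \<in> S \<Longrightarrow> \<exists>d>0. \<exists>M. summable M \<and> (\<forall>n. \<forall>y\<in>S \<inter> ball x d. cmod (f n y) \<le> M n)"
  shows "(\<lambda>z. \<Sum>n. f n z) holomorphic_on S"
proof (rule holomorphic_uniform_sequence[OF \<open>open S\<close>])
  show "(\<lambda>z. \<Sum>i<n. f i z) holomorphic_on S" for n by (intro holomorphic_intros hol)
  fix x assume x: "x \<in> S"
  obtain d M where d: "d > 0" "summable M" "\<And>n y. y \<in> S \<inter> ball x d \<Longrightarrow> cmod (f n y) \<le> M n"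
    using bd[OF x] by blast
  obtain e where e: "e > 0" "cball x e \<subseteq> S" using \<open>open S\<close> x open_contains_cball by blast
  define r where "r = min e (d / 2)"
  have r: "r > 0" "cball x r \<subseteq> S \<inter> ball x d" using d e unfolding r_def by auto
  have "uniform_limit (cball x r) (\<lambda>n z. \<Sum>i<n. f i z) (\<lambda>z. \<Sum>n. f n z) sequentially"
    by (rule Weierstrass_m_test[OF _ d(2)], rule d(3)) (use r in blast)
  thus "\<exists>d>0. cball x d \<subseteq> S \<and> uniform_limit (cball x d) (\<lambda>n z. \<Sum>i<n. f i z) (\<lambda>z. \<Sum>n. f n z) sequentially"
    using r by (intro exI[of _ r]) auto
qed

lemma not_nonpos_Reals_if_Re_pos: "Re z > 0 \<Longrightarrow> z \<notin> \<real>\<^sub>\<le>\<^sub>0"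
  by (auto simp: complex_nonpos_Reals_iff)

lemma norm_powr_le:
  fixes v a :: complex
  assumes "v \<noteq> 0"
  shows "cmod (v powr a) \<le> cmod v powr Re a * exp (pi * \<bar>Im a\<bar>)"
proof -
  have "cmod (v powr a) = exp (Re a * ln (cmod v) - Im a * Im (Ln v))"
    using assms by (simp add: powr_def)
  also have "\<dots> = cmod v powr Re a * exp (- (Im a * Im (Ln v)))"
    using assms by (simp add: powr_def exp_diff exp_minus field_simps)
  also have "- (Im a * Im (Ln v)) \<le> pi * \<bar>Im a\<bar>"
  proof -
    have "\<bar>Im (Ln v)\<bar> \<le> pi" using mpi_less_Im_Ln[OF assms] Im_Ln_le_pi[OF assms] by simp
    hence "\<bar>Im a\<bar> * \<bar>Im (Ln v)\<bar> \<le> \<bar>Im a\<bar> * pi" by (intro mult_left_mono) auto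
    thus ?thesis using abs_ge_minus_self[of "Im a * Im (Ln v)"] by (simp add: abs_mult mult.commute)
  qed
  finally show ?thesis by (simp add: mult_left_mono)
qed

text \<open>\<open>bern_quot m\<close> is the Bernoulli number \<open>B m\<close> divided by \<open>m!\<close>.\<close>

fun bern_quot :: "nat \<Rightarrow> complex" where
  "bern_quot m = (if m = 0 then 1 else - (\<Sum>j<m. bern_quot j / fact (Suc m - j)))"

declare bern_quot.simps [simp del]

text \<open>Coefficients of the product of t/(e^t - 1) and (e^t - 1)/t, which is 1. This
  cancellation is what makes the Euler-Maclaurin expansion work.\<close>

lemma sum_bern_quot: "(\<Sum>j\<le>m. bern_quot j / fact (Suc m - j)) = (if m = 0 then 1 else 0)"
proof (cases "m = 0")
  case False
  have "(\<Sum>j\<le>m. bern_quot j / fact (Suc m - j)) = (\<Sum>j<m. bern_quot j / fact (Suc m - j)) + bern_quot m"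
    by (simp add: lessThan_Suc_atMost[symmetric])
  also have "bern_quot m = - (\<Sum>j<m. bern_quot j / fact (Suc m - j))"
    using False by (subst bern_quot.simps) simp
  finally show ?thesis using False by simp
qed (simp add: bern_quot.simps)

text \<open>The falling factorial: \<open>ffact m x * v powr (x - of_nat m)\<close> is the m-th
  derivative of \<open>v powr x\<close>.\<close>

definition ffact :: "nat \<Rightarrow> complex \<Rightarrow> complex" where
  "ffact m x = (\<Prod>i<m. x - of_nat i)"

lemma ffact_0 [simp]: "ffact 0 x = 1" and ffact_Suc: "ffact (Suc m) x = ffact m x * (x - of_nat m)"
  by (auto simp: ffact_def)

lemma ffact_add: "ffact j x * ffact i (x - of_nat j) = ffact (j + i) x"
  by (induction i) (simp_all add: ffact_Suc algebra_simps)

lemma holomorphic_on_ffact [holomorphic_intros]: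
  "f holomorphic_on S \<Longrightarrow> (\<lambda>z. ffact m (f z)) holomorphic_on S"
  unfolding ffact_def by (intro holomorphic_intros)

lemma continuous_on_ffact [continuous_intros]:
  "continuous_on S f \<Longrightarrow> continuous_on S (\<lambda>z. ffact m (f z))"
  unfolding ffact_def by (intro continuous_intros)

lemma powr_ffact_deriv:
  assumes "Re v > 0"
  shows "((\<lambda>v. ffact i x * v powr (x - of_nat i)) has_field_derivative
    ffact (Suc i) x * v powr (x - of_nat (Suc i))) (at v within S)"
proof -
  have "((\<lambda>v. v powr (x - of_nat i)) has_field_derivative (x - of_nat i) * v powr (x - of_nat i - 1)) (at v)"
    using assms by (intro has_field_derivative_powr not_nonpos_Reals_if_Re_pos)
  from DERIV_cmult[OF this, of "ffact i x"]
  have "((\<lambda>v. ffact i x * v powr (x - of_nat i)) has_field_derivative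
    ffact (Suc i) x * v powr (x - of_nat (Suc i))) (at v)"
    by (simp add: ffact_Suc mult.assoc diff_diff_eq add.commute)
  thus ?thesis by (rule has_field_derivative_at_within)
qed

text \<open>Partial sums of the Euler-Maclaurin expansion of \<open>(s - 1) * (\<Sum>n. (n + w) powr - s)\<close>.\<close>

definition em_main :: "nat \<Rightarrow> complex \<Rightarrow> complex \<Rightarrow> complex" where
  "em_main J s w = (\<Sum>j<J. bern_quot j * ffact j (1 - s) * w powr (1 - s - of_nat j))"

text \<open>The difference of \<open>em_main\<close> at \<open>w\<close> and \<open>w + 1\<close>
  reproduces \<open>(s - 1) * w powr (- s)\<close> up to this error. Summed over
  \<open>w = n + z\<close> the main parts telescope, and the errors remain summable to the left of
  the line Re s = 1.\<close>

definition em_rem :: "nat \<Rightarrow> complex \<Rightarrow> complex \<Rightarrow> complex" where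
  "em_rem J s w = (s - 1) * w powr (- s) - em_main J s w + em_main J s (w + 1)"

text \<open>Collects the constants of the Taylor remainders in \<open>em_rem_bound\<close>. It is
  continuous in \<open>s\<close>, which yields bounds uniform on compact sets of
  \<open>s\<close>.\<close>

definition em_const :: "nat \<Rightarrow> complex \<Rightarrow> real" where
  "em_const J s = (\<Sum>j<J. cmod (bern_quot j * ffact j (1 - s)) *
     (cmod (ffact (Suc (J - j)) (1 - s - of_nat j)) * exp (pi * \<bar>Im s\<bar>) / fact (J - j)))"

text \<open>Put \<open>x = 1 - s\<close> and expand each power of \<open>w + 1\<close> at
  \<open>w\<close>, the j-th one to order \<open>J - j\<close>. Grouped by total order, the terms
  cancel by \<open>sum_bern_quot\<close> except the first, which is
  \<open>x * w powr (x - 1)\<close>. Only the Taylor remainders are left, and each has the exponent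
  \<open>- s - J\<close>.\<close>

lemma em_rem_bound:
  assumes w: "Re w > 0" and s: "Re s + real J \<ge> 0" and J: "J > 0"
  shows "cmod (em_rem J s w) \<le> em_const J s * cmod w powr (- Re s - real J)"
proof -
  define x where "x = 1 - s"
  define T where "T j = (w + 1) powr (x - of_nat j) - (\<Sum>i\<le>J - j. ffact i (x - of_nat j) * w powr (x - of_nat j - of_nat i) / fact i)" for j
  define g where "g j i = bern_quot j * (ffact (j + i) x / fact i * w powr (x - of_nat (j + i)))" for j i
  have split: "(\<Sum>j<J. bern_quot j * ffact j x * (\<Sum>i\<le>J - j. ffact i (x - of_nat j) * w powr (x - of_nat j - of_nat i) / fact i))
     = em_main J s w + x * w powr (x - 1)"
  proof -
    have "(\<Sum>j<J. bern_quot j * ffact j x * (\<Sum>i\<le>J - j. ffact i (x - of_nat j) * w powr (x - of_nat j - of_nat i) / fact i))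
       = (\<Sum>j<J. \<Sum>i\<le>J - j. g j i)"
    proof (intro sum.cong refl)
      fix j
      have "bern_quot j * ffact j x * (ffact i (x - of_nat j) * w powr (x - of_nat j - of_nat i) / fact i) = g j i" for i
        unfolding g_def ffact_add[symmetric] by (simp add: algebra_simps)
      thus "bern_quot j * ffact j x * (\<Sum>i\<le>J - j. ffact i (x - of_nat j) * w powr (x - of_nat j - of_nat i) / fact i) = (\<Sum>i\<le>J - j. g j i)"
        by (simp add: sum_distrib_left)
    qed
    also have "\<dots> = (\<Sum>j<J. g j 0 + (\<Sum>i<J - j. g j (Suc i)))"
      by (intro sum.cong refl) (simp add: sum.lessThan_Suc_shift lessThan_Suc_atMost[symmetric] del: sum.lessThan_Suc)
    also have "\<dots> = (\<Sum>j<J. g j 0) + (\<Sum>j<J. \<Sum>i<J - j. g j (Suc i))" by (rule sum.distrib)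
    also have "(\<Sum>j<J. g j 0) = em_main J s w"
      unfolding em_main_def g_def x_def by (simp add: mult.assoc)
    also have "(\<Sum>j<J. \<Sum>i<J - j. g j (Suc i)) = (\<Sum>(j, i)\<in>{(j, i). j + i < J}. g j (Suc i))"
      by (subst sum.Sigma) (auto intro!: sum.cong)
    also have "\<dots> = (\<Sum>m<J. \<Sum>j\<le>m. g j (Suc (m - j)))" by (rule sum.triangle_reindex)
    also have "\<dots> = (\<Sum>m<J. ffact (Suc m) x * w powr (x - of_nat (Suc m)) * (\<Sum>j\<le>m. bern_quot j / fact (Suc m - j)))"
    proof (intro sum.cong refl)
      fix m
      have "g j (Suc (m - j)) = ffact (Suc m) x * w powr (x - of_nat (Suc m)) * (bern_quot j / fact (Suc m - j))" if "j \<le> m" for j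
        using that unfolding g_def by (simp add: Suc_diff_le)
      thus "(\<Sum>j\<le>m. g j (Suc (m - j))) = ffact (Suc m) x * w powr (x - of_nat (Suc m)) * (\<Sum>j\<le>m. bern_quot j / fact (Suc m - j))"
        by (simp add: sum_distrib_left)
    qed
    also have "\<dots> = (\<Sum>m<J. if m = 0 then x * w powr (x - 1) else 0)"
      by (intro sum.cong refl) (auto simp: sum_bern_quot ffact_Suc)
    also have "\<dots> = x * w powr (x - 1)" using J by simp
    finally show ?thesis .
  qed
  have "em_rem J s w = em_main J s (w + 1) - (em_main J s w + x * w powr (x - 1))"
    unfolding em_rem_def x_def by (simp add: algebra_simps)
  also have "\<dots> = (\<Sum>j<J. bern_quot j * ffact j x * T j)"
    unfolding split[symmetric] unfolding T_def em_main_def x_def[symmetric] by (simp add: right_diff_distrib sum_subtractf)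
  finally have eq: "em_rem J s w = (\<Sum>j<J. bern_quot j * ffact j x * T j)" .
  have T: "cmod (T j) \<le> cmod (ffact (Suc (J - j)) (x - of_nat j)) * exp (pi * \<bar>Im s\<bar>) / fact (J - j) * cmod w powr (- Re s - real J)"
    if j: "j < J" for j
  proof -
    define a where "a = x - of_nat j"
    define n where "n = J - j"
    define B where "B = cmod (ffact (Suc n) a) * (cmod w powr (- Re s - real J) * exp (pi * \<bar>Im s\<bar>))"
    let ?f = "\<lambda>i v. ffact i a * v powr (a - of_nat i)"
    have "cmod (?f 0 (w + 1) - (\<Sum>i\<le>n. ?f i w * (w + 1 - w) ^ i / fact i)) \<le> B * cmod (w + 1 - w) ^ Suc n / fact n"
    proof (rule complex_Taylor[where S = "closed_segment w (w + 1)"])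
      have seg: "\<exists>t. 0 \<le> t \<and> v = w + of_real t" if "v \<in> closed_segment w (w + 1)" for v
        using that unfolding closed_segment_def by (auto simp: algebra_simps scaleR_conv_of_real)
      fix v assume v: "v \<in> closed_segment w (w + 1)"
      then obtain t where t: "0 \<le> t" "v = w + of_real t" using seg by blast
      have Rv: "Re v > 0" using t w by simp
      hence v0: "v \<noteq> 0" by force
      show "(?f i has_field_derivative ?f (Suc i) v) (at v within closed_segment w (w + 1))" for i
        by (rule powr_ffact_deriv[OF Rv])
      have ex: "a - of_nat (Suc n) = - s - of_nat J"
        unfolding a_def n_def x_def using j by (simp add: of_nat_diff)
      have "(Re w)\<^sup>2 \<le> (Re v)\<^sup>2" using t w by (intro power_mono) auto
      moreover have "Im v = Im w" using t by simp
      ultimately have "cmod w \<le> cmod v" unfolding cmod_def by simp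
      moreover have w0: "cmod w > 0" using w by auto
      ultimately have "cmod v powr (- Re s - real J) \<le> cmod w powr (- Re s - real J)"
        using s by (intro powr_mono2') auto
      moreover have "cmod (v powr (- s - of_nat J)) \<le> cmod v powr (- Re s - real J) * exp (pi * \<bar>Im s\<bar>)"
        using norm_powr_le[of v "- s - of_nat J"] v0 by simp
      ultimately have "cmod (v powr (- s - of_nat J)) \<le> cmod w powr (- Re s - real J) * exp (pi * \<bar>Im s\<bar>)"
        by (smt (verit) exp_gt_zero mult_right_mono)
      thus "cmod (?f (Suc n) v) \<le> B" unfolding ex B_def by (simp add: norm_mult mult_left_mono)
    qed auto
    thus ?thesis unfolding T_def a_def[symmetric] n_def[symmetric] B_def by (simp add: mult_ac)
  qed
  have "cmod (em_rem J s w) \<le> (\<Sum>j<J. cmod (bern_quot j * ffact j x) * cmod (T j))"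
    unfolding eq by (rule order_trans[OF norm_sum]) (simp add: norm_mult)
  also have "\<dots> \<le> (\<Sum>j<J. cmod (bern_quot j * ffact j x) * (cmod (ffact (Suc (J - j)) (x - of_nat j)) * exp (pi * \<bar>Im s\<bar>) / fact (J - j) * cmod w powr (- Re s - real J)))"
    by (intro sum_mono mult_left_mono T) auto
  also have "\<dots> = em_const J s * cmod w powr (- Re s - real J)"
    unfolding em_const_def x_def by (simp add: sum_distrib_right mult.assoc)
  finally show ?thesis .
qed

lemma continuous_on_em_const: "continuous_on UNIV (em_const J)"
  unfolding em_const_def by (intro continuous_intros) auto

lemma em_const_nonneg: "em_const J s \<ge> 0"
  unfolding em_const_def by (intro sum_nonneg mult_nonneg_nonneg divide_nonneg_nonneg) auto

lemma em_rem_bound_Suc: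
  assumes z: "Re z > 0" and s: "Re s + real J \<ge> p" and p: "p > 0" and J: "J > 0" and K: "em_const J s \<le> K"
  shows "cmod (em_rem J s (of_nat (Suc n) + z)) \<le> K * real (Suc n) powr (- p)"
proof -
  let ?w = "of_nat (Suc n) + z"
  have "real (Suc n) \<le> Re ?w" using z by simp
  hence le: "real (Suc n) \<le> cmod ?w" using complex_Re_le_cmod[of ?w] by linarith
  have "cmod (em_rem J s ?w) \<le> em_const J s * cmod ?w powr (- Re s - real J)"
    using z s p by (intro em_rem_bound J) auto
  also have "\<dots> \<le> em_const J s * cmod ?w powr (- p)"
    using le s by (intro mult_left_mono powr_mono em_const_nonneg) auto
  also have "\<dots> \<le> em_const J s * real (Suc n) powr (- p)"
    using le p by (intro mult_left_mono powr_mono2' em_const_nonneg) auto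
  also have "\<dots> \<le> K * real (Suc n) powr (- p)" by (intro mult_right_mono K) auto
  finally show ?thesis .
qed

section \<open>Continuation of the Hurwitz zeta function in both variables\<close>

lemma summable_Suc_powr: "p > 1 \<Longrightarrow> summable (\<lambda>n. real (Suc n) powr (- p))"
  using summable_Suc_iff[of "\<lambda>n. real n powr (- p)"] by (simp add: summable_real_powr_iff)

text \<open>For Re s > 1 - J this is \<open>s - 1\<close> times the zeta value, so the pole is
  removed. The term \<open>n = 0\<close> is kept apart: the remainder is then only evaluated at
  points of real part above \<open>n + 1\<close>, and its bound is uniform in Re z > 0.\<close>

definition hz :: "nat \<Rightarrow> complex \<Rightarrow> complex \<Rightarrow> complex" where
  "hz J s z = (s - 1) * z powr (- s) + em_main J s (z + 1) + (\<Sum>n. em_rem J s (of_nat (Suc n) + z))"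

lemma holomorphic_em_main_s: "Re w > 0 \<Longrightarrow> (\<lambda>s. em_main J s w) holomorphic_on S"
  unfolding em_main_def by (intro holomorphic_intros) (auto simp: not_nonpos_Reals_if_Re_pos)

lemma holomorphic_em_main_w: "(\<lambda>w. em_main J s (f w)) holomorphic_on S" if "f holomorphic_on S" "\<And>w. w \<in> S \<Longrightarrow> Re (f w) > 0"
  unfolding em_main_def using that by (intro holomorphic_intros) (auto simp: not_nonpos_Reals_if_Re_pos)

lemma holomorphic_em_rem_s: "Re w > 0 \<Longrightarrow> (\<lambda>s. em_rem J s w) holomorphic_on S"
  unfolding em_rem_def by (intro holomorphic_intros holomorphic_em_main_s) (auto simp: not_nonpos_Reals_if_Re_pos)

lemma holomorphic_em_rem_w: "(\<lambda>w. em_rem J s (f w)) holomorphic_on S" if "f holomorphic_on S" "\<And>w. w \<in> S \<Longrightarrow> Re (f w) > 0"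
  unfolding em_rem_def using that
  by (intro holomorphic_intros holomorphic_em_main_w) (auto simp: not_nonpos_Reals_if_Re_pos intro!: add_pos_pos)

lemma hz_holomorphic_s:
  assumes z: "Re z > 0" and J: "J > 0"
  shows "(\<lambda>s. hz J s z) holomorphic_on {s. Re s > 1 - real J}"
  unfolding hz_def
proof (intro holomorphic_intros holomorphic_em_main_s holomorphic_suminf)
  show "open {s. Re s > 1 - real J}" by (simp add: open_halfspace_Re_gt)
  show "(\<lambda>s. em_rem J s (of_nat (Suc n) + z)) holomorphic_on {s. Re s > 1 - real J}" for n
    using z by (intro holomorphic_em_rem_s) auto
  fix s0 assume s0: "s0 \<in> {s. Re s > 1 - real J}"
  define d where "d = (Re s0 + real J - 1) / 2"
  have d: "d > 0" using s0 unfolding d_def by auto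
  have "compact (em_const J ` cball s0 d)"
    by (intro compact_continuous_image continuous_on_subset[OF continuous_on_em_const]) auto
  then obtain K where K: "\<And>s. s \<in> cball s0 d \<Longrightarrow> norm (em_const J s) \<le> K"
    using compact_imp_bounded bounded_iff by (metis imageI)
  have "cmod (em_rem J s (of_nat (Suc n) + z)) \<le> K * real (Suc n) powr (- (1 + d))" if "s \<in> ball s0 d" for s n
  proof (rule em_rem_bound_Suc[OF z _ _ J])
    have "\<bar>Re (s0 - s)\<bar> < d" using that abs_Re_le_cmod[of "s0 - s"] by (auto simp: dist_norm)
    moreover have "Re s0 + real J = 1 + 2 * d" unfolding d_def by (simp add: field_simps)
    ultimately show "1 + d \<le> Re s + real J" by auto
    show "em_const J s \<le> K" using K[of s] that by auto
  qed (use d in auto)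
  moreover have "summable (\<lambda>n. K * real (Suc n) powr (- (1 + d)))"
    using d by (intro summable_mult summable_Suc_powr) auto
  ultimately show "\<exists>d>0. \<exists>M. summable M \<and> (\<forall>n. \<forall>y\<in>{s. Re s > 1 - real J} \<inter> ball s0 d. cmod (em_rem J y (of_nat (Suc n) + z)) \<le> M n)"
    using d by (intro exI[of _ d] conjI exI[of _ "\<lambda>n. K * real (Suc n) powr (- (1 + d))"]) auto
qed (use z in \<open>auto simp: not_nonpos_Reals_if_Re_pos\<close>)

lemma hz_holomorphic_z:
  assumes s: "Re s > 1 - real J" and J: "J > 0"
  shows "(\<lambda>z. hz J s z) holomorphic_on {z. Re z > 0}"
  unfolding hz_def
proof (intro holomorphic_intros holomorphic_em_main_w holomorphic_suminf)
  show "open {z. Re z > 0}" by (simp add: open_halfspace_Re_gt)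
  show "(\<lambda>z. em_rem J s (of_nat (Suc n) + z)) holomorphic_on {z. Re z > 0}" for n
    by (intro holomorphic_em_rem_w holomorphic_intros) auto
  have "cmod (em_rem J s (of_nat (Suc n) + z)) \<le> em_const J s * real (Suc n) powr (- (Re s + real J))" if "Re z > 0" for z n
    using s by (intro em_rem_bound_Suc that J) auto
  moreover have "summable (\<lambda>n. em_const J s * real (Suc n) powr (- (Re s + real J)))"
    using s by (intro summable_mult summable_Suc_powr) auto
  ultimately show "\<exists>d>0. \<exists>M. summable M \<and> (\<forall>n. \<forall>y\<in>{z. Re z > 0} \<inter> ball z0 d. cmod (em_rem J s (of_nat (Suc n) + y)) \<le> M n)" for z0
    by (intro exI[of _ 1] conjI exI[of _ "\<lambda>n. em_const J s * real (Suc n) powr (- (Re s + real J))"]) auto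
qed (auto simp: not_nonpos_Reals_if_Re_pos)

text \<open>The sum of the remainders telescopes, and the boundary term \<open>em_main\<close> at
  \<open>N + 1 + z\<close> tends to 0 because its exponents have negative real part.\<close>

lemma hz_sums:
  assumes z: "Re z > 0" and s: "Re s > 1" and J: "J > 0"
  shows "(\<lambda>n. (of_nat n + z) powr (- s)) sums (hz J s z / (s - 1))"
proof -
  have s1: "s \<noteq> 1" using s by auto
  let ?R = "\<lambda>n. em_rem J s (of_nat (Suc n) + z)"
  have "summable ?R"
  proof (rule summable_comparison_test')
    show "summable (\<lambda>n. em_const J s * real (Suc n) powr (- (Re s + real J)))"
      using s by (intro summable_mult summable_Suc_powr) auto
    show "norm (?R n) \<le> em_const J s * real (Suc n) powr (- (Re s + real J))" for n
      using s by (intro em_rem_bound_Suc z J) auto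
  qed
  hence R: "(\<lambda>N. \<Sum>n<N. ?R n) \<longlonglongrightarrow> (\<Sum>n. ?R n)" by (rule summable_LIMSEQ)
  have tel: "(\<Sum>n<N. ?R n) = (s - 1) * (\<Sum>n<N. (of_nat (Suc n) + z) powr (- s)) - em_main J s (z + 1) + em_main J s (of_nat (Suc N) + z)" for N
  proof (induction N)
    case 0 show ?case by (simp add: add.commute)
  next
    case (Suc N)
    have "of_nat (Suc N) + z + 1 = of_nat (Suc (Suc N)) + z" by simp
    thus ?case using Suc by (simp add: em_rem_def algebra_simps)
  qed
  have em0: "(\<lambda>N. em_main J s (of_nat (Suc N) + z)) \<longlonglongrightarrow> 0"
  proof -
    have "(\<lambda>N. (of_nat (Suc N) + z) powr (1 - s - of_nat j)) \<longlonglongrightarrow> 0" for j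
    proof (rule Lim_null_comparison)
      have "filterlim (\<lambda>N. real (Suc N)) at_top sequentially"
        by (rule filterlim_compose[OF filterlim_real_sequentially filterlim_Suc])
      hence "(\<lambda>N. real (Suc N) powr (1 - Re s)) \<longlonglongrightarrow> 0" using s by (intro tendsto_neg_powr) auto
      from tendsto_mult_right[OF this, of "exp (pi * \<bar>Im s\<bar>)"]
      show "(\<lambda>N. real (Suc N) powr (1 - Re s) * exp (pi * \<bar>Im s\<bar>)) \<longlonglongrightarrow> 0" by simp
      show "\<forall>\<^sub>F N in sequentially. norm ((of_nat (Suc N) + z) powr (1 - s - of_nat j)) \<le> real (Suc N) powr (1 - Re s) * exp (pi * \<bar>Im s\<bar>)"
      proof (rule always_eventually, rule allI)
        fix N
        let ?w = "of_nat (Suc N) + z"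
        have Rw: "real (Suc N) \<le> Re ?w" using z by simp
        hence le: "real (Suc N) \<le> cmod ?w" using complex_Re_le_cmod[of ?w] by linarith
        have "?w \<noteq> 0" using le by (metis norm_zero not_less of_nat_0_less_iff zero_less_Suc)
        from norm_powr_le[OF this, of "1 - s - of_nat j"]
        have "norm (?w powr (1 - s - of_nat j)) \<le> cmod ?w powr (1 - Re s - real j) * exp (pi * \<bar>Im s\<bar>)" by simp
        also have "cmod ?w powr (1 - Re s - real j) \<le> cmod ?w powr (1 - Re s)"
          using le by (intro powr_mono) auto
        also have "\<dots> \<le> real (Suc N) powr (1 - Re s)" using le s by (intro powr_mono2') auto
        finally show "norm (?w powr (1 - s - of_nat j)) \<le> real (Suc N) powr (1 - Re s) * exp (pi * \<bar>Im s\<bar>)"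
          by (simp add: mult_right_mono)
      qed
    qed
    hence "(\<lambda>N. \<Sum>j<J. bern_quot j * ffact j (1 - s) * (of_nat (Suc N) + z) powr (1 - s - of_nat j)) \<longlonglongrightarrow> (\<Sum>j<J. bern_quot j * ffact j (1 - s) * 0)"
      by (intro tendsto_sum tendsto_mult tendsto_const)
    thus ?thesis unfolding em_main_def by simp
  qed
  have "(\<lambda>N. (s - 1) * z powr (- s) + em_main J s (z + 1) + (\<Sum>n<N. ?R n) - em_main J s (of_nat (Suc N) + z)) \<longlonglongrightarrow> hz J s z"
    unfolding hz_def using tendsto_diff[OF tendsto_add[OF tendsto_const R] em0] by simp
  moreover have "(s - 1) * z powr (- s) + em_main J s (z + 1) + (\<Sum>n<N. ?R n) - em_main J s (of_nat (Suc N) + z)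
     = (s - 1) * (\<Sum>n<Suc N. (of_nat n + z) powr (- s))" for N
    unfolding tel by (subst sum.lessThan_Suc_shift) (simp add: algebra_simps)
  ultimately have "(\<lambda>N. (s - 1) * (\<Sum>n<Suc N. (of_nat n + z) powr (- s))) \<longlonglongrightarrow> hz J s z" by simp
  from tendsto_divide[OF this tendsto_const[of "s - 1"]] s1
  have "(\<lambda>N. \<Sum>n<Suc N. (of_nat n + z) powr (- s)) \<longlonglongrightarrow> hz J s z / (s - 1)" by simp
  thus ?thesis unfolding sums_def by (rule LIMSEQ_imp_Suc)
qed

lemma hz_independent:
  assumes z: "Re z > 0" and J: "J > 0" "J' > 0" and s: "Re s > 1 - real J" "Re s > 1 - real J'"
  shows "hz J s z = hz J' s z"
proof (rule analytic_continuation_open[of "{s. Re s > 1}" "{s. Re s > 1 - real (min J J')}" "\<lambda>s. hz J s z" "\<lambda>s. hz J' s z"])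
  show "{s. Re s > 1} \<noteq> {}" by (auto intro!: exI[of _ 2])
  show "connected {s. Re s > 1 - real (min J J')}" by (intro convex_connected convex_halfspace_Re_gt)
  show "(\<lambda>s. hz J s z) holomorphic_on {s. Re s > 1 - real (min J J')}"
    by (rule holomorphic_on_subset[OF hz_holomorphic_s[OF z J(1)]]) auto
  show "(\<lambda>s. hz J' s z) holomorphic_on {s. Re s > 1 - real (min J J')}"
    by (rule holomorphic_on_subset[OF hz_holomorphic_s[OF z J(2)]]) auto
  show "hz J s z = hz J' s z" if "s \<in> {s. Re s > 1}" for s
    using sums_unique2[OF hz_sums[OF z _ J(1), of s] hz_sums[OF z _ J(2), of s]] that by auto
qed (use s in \<open>auto simp: open_halfspace_Re_gt\<close>)

text \<open>Resolves the definite description: existence by patching the functions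
  \<open>hz J\<close> over all \<open>J\<close>, uniqueness by the identity theorem on the connected
  complement of 1.\<close>

lemma hurwitz_zeta_eq:
  assumes z: "Re z > 0" and J: "J > 0" and s: "Re s > 1 - real J"
  shows "hurwitz_zeta s z = hz J s z / (s - 1)"
proof -
  \<comment> \<open>\<open>J\<close> follows \<open>s\<close> so that every \<open>s\<close> is
    covered; near a given point \<open>F\<close> equals the quotient with a fixed \<open>J\<close>.
    At \<open>s = 1\<close> the division by 0 gives the value 0 prescribed in
    \<open>hurwitz_zeta\<close>.\<close>
  define F where "F s = hz (nat \<lceil>2 - Re s\<rceil> + 1) s z / (s - 1)" for s
  have Feq: "F s = hz J s z / (s - 1)" if "J > 0" "Re s > 1 - real J" for s J
    unfolding F_def using that by (subst hz_independent[OF z _ that(1) _ that(2)]) (auto, linarith)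
  have hol: "F holomorphic_on (- {1})"
  proof (rule holomorphic_onI)
    fix s :: complex assume s: "s \<in> - {1}"
    define J where "J = nat \<lceil>2 - Re s\<rceil> + 1"
    have J: "J > 0" "Re s > 1 - real J" unfolding J_def by (auto, linarith)
    let ?U = "{s. Re s > 1 - real J} \<inter> - {1}"
    have "(\<lambda>s. hz J s z / (s - 1)) holomorphic_on ?U"
      by (intro holomorphic_intros holomorphic_on_subset[OF hz_holomorphic_s[OF z J(1)]]) auto
    hence "F holomorphic_on ?U" by (rule holomorphic_transform) (use Feq J in auto)
    moreover have "open ?U" by (intro open_Int open_halfspace_Re_gt) auto
    ultimately have "F field_differentiable at s" using J s by (intro holomorphic_on_imp_differentiable_at) auto
    thus "F field_differentiable at s within - {1}" by (rule field_differentiable_at_within)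
  qed
  have sums: "(\<lambda>n. (of_nat n + z) powr (- w)) sums F w" if "Re w > 1" for w
    using hz_sums[OF z that, of 1] Feq[of 1 w] that by simp
  have "(THE F. F holomorphic_on (- {1}) \<and> F 1 = 0 \<and>
        (\<forall>w. Re w > 1 \<longrightarrow> (\<lambda>n. (of_nat n + z) powr (- w)) sums F w)) = F"
  proof (rule the_equality)
    show "F holomorphic_on (- {1}) \<and> F 1 = 0 \<and> (\<forall>w. Re w > 1 \<longrightarrow> (\<lambda>n. (of_nat n + z) powr (- w)) sums F w)"
      using hol sums by (auto simp: F_def)
    fix G assume G: "G holomorphic_on (- {1}) \<and> G 1 = 0 \<and> (\<forall>w. Re w > 1 \<longrightarrow> (\<lambda>n. (of_nat n + z) powr (- w)) sums G w)"
    show "G = F"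
    proof
      fix w
      show "G w = F w"
      proof (cases "w = 1")
        case True thus ?thesis using G by (simp add: F_def)
      next
        case False
        show ?thesis
        proof (rule analytic_continuation_open[of "{s. Re s > 1}" "- {1}" G F])
          show "{s. Re s > 1} \<noteq> {}" by (auto intro!: exI[of _ 2])
          show "connected (- {1::complex})" by (rule connected_punctured_universe) simp
          show "G s = F s" if "s \<in> {s. Re s > 1}" for s
            using sums_unique2[OF _ sums, of s "G s"] G that by auto
        qed (use G hol False in \<open>auto simp: open_halfspace_Re_gt\<close>)
      qed
    qed
  qed
  thus ?thesis unfolding hurwitz_zeta_def using Feq[OF J s] by simp
qed

lemma hurwitz_zeta_sums:
  assumes "Re z > 0" "Re s > 1"
  shows "(\<lambda>n. (of_nat n + z) powr (- s)) sums hurwitz_zeta s z"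
  using hz_sums[OF assms, of 1] hurwitz_zeta_eq[OF assms(1), of 1 s] assms by simp

lemma hurwitz_zeta_holomorphic: "hurwitz_zeta s holomorphic_on {z. Re z > 0}"
proof -
  define J where "J = nat \<lceil>2 - Re s\<rceil> + 1"
  have J: "J > 0" "Re s > 1 - real J" unfolding J_def by (auto, linarith)
  show ?thesis
  proof (cases "s = 1")
    case True
    have "(\<lambda>z. 0) holomorphic_on {z. Re z > 0}" by (intro holomorphic_intros)
    thus ?thesis by (rule holomorphic_transform) (use True hurwitz_zeta_eq[OF _ J] in auto)
  next
    case False
    have "(\<lambda>z. hz J s z / (s - 1)) holomorphic_on {z. Re z > 0}"
      using False by (intro holomorphic_intros hz_holomorphic_z[OF J(2,1)]) auto
    thus ?thesis by (rule holomorphic_transform) (use hurwitz_zeta_eq[OF _ J] in auto)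
  qed
qed

section \<open>The Mayer operator on the disc\<close>

abbreviation (input) cdisc :: "complex set" where "cdisc \<equiv> cball 1 (3/2)"
abbreviation (input) disc :: "complex set" where "disc \<equiv> ball 1 (3/2)"

lemma A_spaceI:
  assumes "g holomorphic_on disc" "continuous_on cdisc g"
  shows "(\<lambda>z. if z \<in> cdisc then g z else 0) \<in> A_space"
proof -
  have "(\<lambda>z. if z \<in> cdisc then g z else 0) holomorphic_on disc"
    using assms(1) by (rule holomorphic_transform) auto
  moreover have "continuous_on cdisc (\<lambda>z. if z \<in> cdisc then g z else 0)"
    using assms(2) by (rule continuous_on_eq) auto
  ultimately show ?thesis unfolding A_space_def by auto
qed

lemma A_space_holomorphic: "f \<in> A_space \<Longrightarrow> f holomorphic_on disc"
  and A_space_continuous: "f \<in> A_space \<Longrightarrow> continuous_on cdisc f"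
  and A_space_outside: "f \<in> A_space \<Longrightarrow> z \<notin> cdisc \<Longrightarrow> f z = 0"
  unfolding A_space_def by auto

lemma A_norm_upper:
  assumes "f \<in> A_space" "z \<in> cdisc"
  shows "cmod (f z) \<le> A_norm f"
proof -
  have "compact ((\<lambda>z. cmod (f z)) ` cdisc)"
    by (intro compact_continuous_image continuous_intros A_space_continuous assms compact_cball)
  hence "bdd_above ((\<lambda>z. cmod (f z)) ` cdisc)" by (simp add: bounded_imp_bdd_above compact_imp_bounded)
  thus ?thesis unfolding A_norm_def by (rule cSUP_upper[OF assms(2)])
qed

lemma A_norm_le: "(\<And>z. z \<in> cdisc \<Longrightarrow> cmod (f z) \<le> B) \<Longrightarrow> A_norm f \<le> B"
  unfolding A_norm_def by (rule cSUP_least) (auto intro: exI[of _ 1])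

interpretation A: complex_function_space A_space A_norm
proof
  show "(\<lambda>x. 0) \<in> A_space" unfolding A_space_def by auto
  fix f g :: "complex \<Rightarrow> complex" and c x assume f: "f \<in> A_space"
  show cf: "(\<lambda>x. c * f x) \<in> A_space" for c
    using f unfolding A_space_def by (auto intro!: holomorphic_intros continuous_intros)
  show eval: "cmod (f x) \<le> A_norm f"
  proof (cases "x \<in> cdisc")
    case False
    have "0 \<le> A_norm f" using order_trans[OF norm_ge_zero A_norm_upper[OF f, of 1]] by simp
    thus ?thesis using A_space_outside[OF f False] by simp
  qed (rule A_norm_upper[OF f])
  have le: "A_norm (\<lambda>x. c * f x) \<le> cmod c * A_norm f" if "f \<in> A_space" for c f
    by (rule A_norm_le) (auto simp: norm_mult intro!: mult_left_mono A_norm_upper[OF that])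
  show "A_norm (\<lambda>x. c * f x) = cmod c * A_norm f"
  proof (cases "c = 0")
    case True thus ?thesis unfolding A_norm_def by simp
  next
    case False
    have "A_norm (\<lambda>x. inverse c * (c * f x)) \<le> cmod (inverse c) * A_norm (\<lambda>x. c * f x)" by (rule le[OF cf])
    hence "cmod c * A_norm f \<le> A_norm (\<lambda>x. c * f x)"
      using False by (simp add: norm_divide norm_inverse field_simps)
    thus ?thesis using le[OF f, of c] by simp
  qed
  assume g: "g \<in> A_space"
  show "(\<lambda>x. f x + g x) \<in> A_space"
    using f g unfolding A_space_def by (auto intro!: holomorphic_intros continuous_intros)
  show "A_norm (\<lambda>x. f x + g x) \<le> A_norm f + A_norm g"
    by (rule A_norm_le) (auto intro!: norm_triangle_mono A_norm_upper f g)
next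
  fix s :: "nat \<Rightarrow> complex \<Rightarrow> complex"
  assume s: "\<And>n. s n \<in> A_space" and cauchy: "\<And>e. e > 0 \<Longrightarrow> \<exists>M. \<forall>m\<ge>M. \<forall>n\<ge>M. A_norm (\<lambda>x. s m x - s n x) < e"
  have dV: "(\<lambda>x. s m x - s n x) \<in> A_space" for m n
    using s[of m] s[of n] unfolding A_space_def by (auto intro!: holomorphic_intros continuous_intros)
  have "uniformly_Cauchy_on cdisc s"
  proof (rule uniformly_Cauchy_onI)
    fix e :: real assume "e > 0"
    then obtain M where M: "\<forall>m\<ge>M. \<forall>n\<ge>M. A_norm (\<lambda>x. s m x - s n x) < e" using cauchy by blast
    have "dist (s m x) (s n x) < e" if "x \<in> cdisc" "m \<ge> M" "n \<ge> M" for x m n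
      using A_norm_upper[OF dV that(1), of m n] M that by (fastforce simp: dist_norm)
    thus "\<exists>M. \<forall>x\<in>cdisc. \<forall>m\<ge>M. \<forall>n\<ge>M. dist (s m x) (s n x) < e" by blast
  qed
  then obtain G where G: "uniform_limit cdisc s G sequentially"
    by (metis Cauchy_uniformly_convergent uniformly_convergent_on_def)
  define g where "g z = (if z \<in> cdisc then G z else 0)" for z
  have ul: "uniform_limit cdisc s g sequentially"
    using G unfolding uniform_limit_iff g_def by simp
  have cont: "continuous_on cdisc g"
    by (rule uniform_limit_theorem[OF _ ul]) (auto intro!: always_eventually A_space_continuous s)
  have hol: "g holomorphic_on disc"
  proof (rule holomorphic_uniform_sequence[OF open_ball])
    show "s n holomorphic_on disc" for n by (rule A_space_holomorphic[OF s])
    fix x :: complex assume "x \<in> disc"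
    then obtain d where d: "d > 0" "cball x d \<subseteq> disc" using open_contains_cball[of disc] open_ball by blast
    moreover have "cball x d \<subseteq> cdisc" using d(2) ball_subset_cball by blast
    hence "uniform_limit (cball x d) s g sequentially" by (rule uniform_limit_on_subset[OF ul])
    ultimately show "\<exists>d>0. cball x d \<subseteq> disc \<and> uniform_limit (cball x d) s g sequentially" by blast
  qed
  have gA: "g \<in> A_space" using cont hol unfolding A_space_def g_def by auto
  have "(\<lambda>n. A_norm (\<lambda>x. s n x - g x)) \<longlonglongrightarrow> 0"
  proof (rule LIMSEQ_I)
    fix e :: real assume e: "e > 0"
    hence "\<forall>\<^sub>F n in sequentially. \<forall>x\<in>cdisc. dist (s n x) (g x) < e / 2" using uniform_limitD[OF ul, of "e / 2"] by simp
    then obtain M where M: "\<And>n x. n \<ge> M \<Longrightarrow> x \<in> cdisc \<Longrightarrow> dist (s n x) (g x) < e / 2"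
      unfolding eventually_sequentially by blast
    have "norm (A_norm (\<lambda>x. s n x - g x) - 0) < e" if "n \<ge> M" for n
    proof -
      have dg: "(\<lambda>x. s n x - g x) \<in> A_space"
        using s[of n] gA unfolding A_space_def by (auto intro!: holomorphic_intros continuous_intros)
      have "A_norm (\<lambda>x. s n x - g x) \<le> e / 2"
        by (rule A_norm_le) (use M[OF that] in \<open>simp add: dist_norm less_imp_le\<close>)
      moreover have "0 \<le> A_norm (\<lambda>x. s n x - g x)" using order_trans[OF norm_ge_zero A_norm_upper[OF dg, of 1]] by simp
      ultimately show ?thesis using e by simp
    qed
    thus "\<exists>M. \<forall>n\<ge>M. norm (A_norm (\<lambda>x. s n x - g x) - 0) < e" by blast
  qed
  with gA show "\<exists>g\<in>A_space. (\<lambda>n. A_norm (\<lambda>x. s n x - g x)) \<longlonglongrightarrow> 0" by blast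
qed

section \<open>Taylor expansions on the disc\<close>

definition taylor_coeff :: "(complex \<Rightarrow> complex) \<Rightarrow> complex \<Rightarrow> nat \<Rightarrow> complex" where
  "taylor_coeff f w n = (deriv ^^ n) f w / fact n"

text \<open>Cauchy's inequality. The closed ball may touch the boundary circle because
  \<open>f\<close> is continuous there: the radii used below are 1/2 about 0 and 3/2 about 1, both
  extremal.\<close>

lemma taylor_coeff_le:
  assumes f: "f \<in> A_space" and r: "r > 0" "cball w r \<subseteq> cdisc"
  shows "cmod (taylor_coeff f w n) \<le> A_norm f / r ^ n"
proof (cases "n = 0")
  case True
  have "w \<in> cdisc" using r by (auto simp: subset_iff)
  thus ?thesis using True A_norm_upper[OF f] by (simp add: taylor_coeff_def)
next
  case False
  have "interior (cball w r) \<subseteq> interior cdisc" by (rule interior_mono[OF r(2)])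
  hence sub: "ball w r \<subseteq> disc" by simp
  have "cmod ((deriv ^^ n) f w) \<le> fact n * A_norm f / r ^ n"
    by (rule Cauchy_inequality[OF holomorphic_on_subset[OF A_space_holomorphic[OF f] sub]
        continuous_on_subset[OF A_space_continuous[OF f] r(2)] r(1)])
       (use A_norm_upper[OF f] r False in \<open>auto simp: dist_norm subset_iff\<close>)
  thus ?thesis unfolding taylor_coeff_def by (simp add: norm_divide divide_le_eq mult.commute)
qed

lemma taylor_remainder_le:
  assumes f: "f \<in> A_space" and r: "r > 0" "cball w r \<subseteq> cdisc" and v: "cmod (v - w) \<le> \<theta> * r" "0 \<le> \<theta>" "\<theta> < 1"
  shows "cmod (f v - (\<Sum>n<m. taylor_coeff f w n * (v - w) ^ n)) \<le> A_norm f * \<theta> ^ m / (1 - \<theta>)"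
proof -
  have "interior (cball w r) \<subseteq> interior cdisc" by (rule interior_mono[OF r(2)])
  hence sub: "ball w r \<subseteq> disc" by simp
  have "\<theta> * r < r" using v r by simp
  hence vb: "v \<in> ball w r" using v by (auto simp: dist_norm norm_minus_commute)
  let ?t = "\<lambda>n. taylor_coeff f w n * (v - w) ^ n"
  have sums: "?t sums f v"
    unfolding taylor_coeff_def
    by (rule holomorphic_power_series[OF holomorphic_on_subset[OF A_space_holomorphic[OF f] sub] vb])
  have bd: "cmod (?t n) \<le> A_norm f * \<theta> ^ n" for n
  proof -
    have "cmod (?t n) \<le> A_norm f / r ^ n * (\<theta> * r) ^ n"
      unfolding norm_mult norm_power using taylor_coeff_le[OF f r, of n] v
      by (intro mult_mono power_mono) (auto intro: order_trans[OF norm_ge_zero])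
    thus ?thesis using r by (simp add: power_mult_distrib)
  qed
  have geo: "(\<lambda>n. A_norm f * \<theta> ^ m * \<theta> ^ n) sums (A_norm f * \<theta> ^ m * (1 / (1 - \<theta>)))"
    using v by (intro sums_mult geometric_sums) auto
  have "(\<lambda>n. ?t (n + m)) sums (f v - (\<Sum>n<m. ?t n))" by (rule sums_split_initial_segment[OF sums])
  hence "f v - (\<Sum>n<m. ?t n) = (\<Sum>n. ?t (n + m))" by (simp add: sums_iff)
  also have "cmod \<dots> \<le> (\<Sum>n. A_norm f * \<theta> ^ m * \<theta> ^ n)"
    by (rule norm_suminf_le[OF _ sums_summable[OF geo]], rule order_trans[OF bd]) (simp add: power_add mult_ac)
  also have "\<dots> = A_norm f * \<theta> ^ m / (1 - \<theta>)" using geo by (simp add: sums_iff)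
  finally show ?thesis .
qed

lemma cball_0_half: "cball 0 (1/2) \<subseteq> cdisc"
proof
  fix z :: complex assume "z \<in> cball 0 (1/2)"
  hence "cmod z \<le> 1/2" by simp
  thus "z \<in> cdisc" using norm_triangle_ineq4[of 1 z] by (simp add: dist_norm)
qed

lemma bounded_functional_taylor:
  assumes w: "w \<in> disc"
  shows "A.bounded_functional (\<lambda>f. taylor_coeff f w n)"
proof -
  obtain r where r: "r > 0" "cball w r \<subseteq> cdisc" using w open_contains_cball[of disc] ball_subset_cball by (metis open_ball subset_trans)
  show ?thesis
  proof (rule A.bounded_functionalI[where C = "1 / r ^ n"])
    fix f g assume fg: "f \<in> A_space" "g \<in> A_space"
    show "taylor_coeff (\<lambda>x. f x + g x) w n = taylor_coeff f w n + taylor_coeff g w n"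
      unfolding taylor_coeff_def
      by (subst higher_deriv_add[OF A_space_holomorphic[OF fg(1)] A_space_holomorphic[OF fg(2)] open_ball w])
         (simp add: add_divide_distrib)
  next
    fix c f assume f: "f \<in> A_space"
    show "taylor_coeff (\<lambda>x. c * f x) w n = c * taylor_coeff f w n"
      unfolding taylor_coeff_def
      by (subst higher_deriv_cmult[OF A_space_holomorphic[OF f] w open_ball]) simp
    show "cmod (taylor_coeff f w n) \<le> 1 / r ^ n * A_norm f" using taylor_coeff_le[OF f r, of n] by simp
  qed
qed

text \<open>Removes the terms of degree below \<open>K\<close>: \<open>K = k + 1\<close> gives the
  function written with a star in the theorem, and \<open>K = 0\<close> leaves \<open>f\<close>
  alone and so gives the plain series.\<close>

definition star :: "nat \<Rightarrow> (complex \<Rightarrow> complex) \<Rightarrow> complex \<Rightarrow> complex" where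
  "star K f w = f w - (\<Sum>n<K. taylor_coeff f 0 n * w ^ n)"

definition star_const :: "nat \<Rightarrow> real" where
  "star_const K = 2 * 2 ^ K + (1 + (\<Sum>n<K. 4 ^ n)) * 4 ^ K"

text \<open>For \<open>cmod w\<close> up to 1/4 the Taylor remainder on the ball of radius 1/2
  applies with ratio \<open>2 * cmod w\<close>. Beyond that, \<open>(4 * cmod w)^K\<close> is at
  least 1 and a crude bound suffices, with coefficients at most \<open>2^n\<close> times the norm
  and \<open>cmod w\<close> at most 2. \<open>star_const\<close> adds the two constants.\<close>

lemma star_bound:
  assumes f: "f \<in> A_space" and w: "w \<in> cball 1 1"
  shows "cmod (star K f w) \<le> star_const K * A_norm f * cmod w ^ K"
proof -
  have N0: "0 \<le> A_norm f" by (rule A.norm_nonneg[OF f])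
  have w2: "cmod w \<le> 2" using w norm_triangle_ineq2[of w 1] by (auto simp: dist_norm norm_minus_commute)
  have S0: "(0::real) \<le> (\<Sum>n<K. 4 ^ n)" by (intro sum_nonneg) auto
  show ?thesis
  proof (cases "cmod w \<le> 1/4")
    case True
    have "cmod (f w - (\<Sum>n<K. taylor_coeff f 0 n * (w - 0) ^ n)) \<le> A_norm f * (2 * cmod w) ^ K / (1 - 2 * cmod w)"
      by (rule taylor_remainder_le[OF f _ cball_0_half]) (use True in auto)
    also have "\<dots> \<le> A_norm f * (2 * cmod w) ^ K / (1/2)"
      using True N0 by (intro divide_left_mono) auto
    also have "\<dots> = 2 * 2 ^ K * (A_norm f * cmod w ^ K)" by (simp add: power_mult_distrib)
    also have "\<dots> \<le> star_const K * (A_norm f * cmod w ^ K)"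
      unfolding star_const_def using N0 S0 by (intro mult_right_mono mult_nonneg_nonneg) auto
    finally show ?thesis by (simp add: star_def mult.assoc)
  next
    case False
    have wd: "w \<in> cdisc" using w by auto
    have "cmod (star K f w) \<le> A_norm f + (\<Sum>n<K. A_norm f * 4 ^ n)"
      unfolding star_def
    proof (rule order_trans[OF norm_triangle_ineq4], rule add_mono[OF A_norm_upper[OF f wd]],
        rule order_trans[OF norm_sum], rule sum_mono)
      fix n
      have "cmod (taylor_coeff f 0 n * w ^ n) \<le> A_norm f / (1/2) ^ n * 2 ^ n"
        unfolding norm_mult norm_power using N0 w2
        by (intro mult_mono power_mono taylor_coeff_le[OF f _ cball_0_half]) auto
      also have "\<dots> = A_norm f * (2 * 2) ^ n" unfolding power_mult_distrib by (simp add: power_divide)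
      finally show "cmod (taylor_coeff f 0 n * w ^ n) \<le> A_norm f * 4 ^ n" by simp
    qed
    also have "\<dots> = (1 + (\<Sum>n<K. 4 ^ n)) * A_norm f" by (simp add: sum_distrib_left algebra_simps)
    also have "\<dots> \<le> (1 + (\<Sum>n<K. 4 ^ n)) * A_norm f * (4 * cmod w) ^ K"
    proof -
      have "1 \<le> (4 * cmod w) ^ K" using False by (intro one_le_power) auto
      moreover have "0 \<le> (1 + (\<Sum>n<K. 4 ^ n)) * A_norm f" using N0 S0 by (intro mult_nonneg_nonneg) auto
      ultimately show ?thesis by (metis mult.right_neutral mult_left_mono)
    qed
    also have "\<dots> = (1 + (\<Sum>n<K. 4 ^ n)) * 4 ^ K * (A_norm f * cmod w ^ K)" by (simp add: power_mult_distrib)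
    also have "\<dots> \<le> star_const K * (A_norm f * cmod w ^ K)"
      unfolding star_const_def using N0 by (intro mult_right_mono mult_nonneg_nonneg) auto
    finally show ?thesis by (simp add: mult.assoc)
  qed
qed

lemma shift_Re: "z \<in> cdisc \<Longrightarrow> Re (of_nat (Suc m) + z) \<ge> real m + 1/2"
  using abs_Re_le_cmod[of "1 - z"] by (auto simp: dist_norm)

lemma shift_norm:
  assumes "z \<in> cdisc"
  shows "cmod (of_nat (Suc m) + z) \<ge> real (Suc m) / 2" "cmod (of_nat (Suc m) + z) \<le> 4 * real (Suc m)"
    "of_nat (Suc m) + z \<noteq> 0" "Re (of_nat (Suc m) + z) > 0"
proof -
  have R: "Re (of_nat (Suc m) + z) \<ge> real m + 1/2" by (rule shift_Re[OF assms])
  thus "cmod (of_nat (Suc m) + z) \<ge> real (Suc m) / 2" using complex_Re_le_cmod[of "of_nat (Suc m) + z"] by simp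
  show "Re (of_nat (Suc m) + z) > 0" using R by linarith
  thus "of_nat (Suc m) + z \<noteq> 0" by (metis less_irrefl zero_complex.simps(1))
  have "cmod z \<le> 5/2" using assms norm_triangle_ineq2[of z 1] by (auto simp: dist_norm norm_minus_commute)
  thus "cmod (of_nat (Suc m) + z) \<le> 4 * real (Suc m)"
    using norm_triangle_ineq[of "of_nat (Suc m)" z] by (simp del: of_nat_Suc) simp
qed

text \<open>Inversion sends the half plane Re w >= 1/2 into the disc of radius 1 about 1. Thus each
  branch maps the closed disc of radius 3/2 into one of radius 1, and this gain makes the Mayer
  operator compact.\<close>

lemma inverse_mem_cball_1:
  assumes "Re w \<ge> 1/2"
  shows "1 / w \<in> cball 1 1"
proof -
  have w: "w \<noteq> 0" using assms by auto
  have "(Re w - 1)\<^sup>2 + (Im w)\<^sup>2 \<le> (Re w)\<^sup>2 + (Im w)\<^sup>2"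
    using assms by (simp add: power2_eq_square algebra_simps)
  hence "cmod (w - 1) \<le> cmod w" unfolding cmod_def by simp
  moreover have "1 - 1 / w = (w - 1) / w" using w by (simp add: field_simps)
  ultimately show ?thesis using w by (simp add: dist_norm norm_divide)
qed

lemma inverse_shift_mem: "z \<in> cdisc \<Longrightarrow> 1 / (of_nat (Suc m) + z) \<in> cball 1 1"
  by (rule inverse_mem_cball_1, rule order_trans[OF _ shift_Re]) auto

lemma weighted_comp_mem:
  assumes g: "g holomorphic_on disc"
  shows "(\<lambda>z. if z \<in> cdisc then (of_nat (Suc m) + z) powr a * g (1 / (of_nat (Suc m) + z)) else 0) \<in> A_space"
proof (rule A_spaceI)
  have sub: "cball 1 1 \<subseteq> disc" by auto
  have im: "(\<lambda>z. 1 / (of_nat (Suc m) + z)) ` cdisc \<subseteq> disc" using inverse_shift_mem sub by blast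
  have nz: "z \<in> cdisc \<Longrightarrow> of_nat (Suc m) + z \<noteq> 0" "z \<in> cdisc \<Longrightarrow> of_nat (Suc m) + z \<notin> \<real>\<^sub>\<le>\<^sub>0" for z
    using shift_norm(3,4) not_nonpos_Reals_if_Re_pos by blast+
  have bc: "z \<in> disc \<Longrightarrow> z \<in> cdisc" for z by auto
  show "continuous_on cdisc (\<lambda>z. (of_nat (Suc m) + z) powr a * g (1 / (of_nat (Suc m) + z)))"
  proof (intro continuous_on_mult continuous_on_compose2[OF holomorphic_on_imp_continuous_on[OF g] _ im])
    have "(\<lambda>z. (of_nat (Suc m) + z) powr a) holomorphic_on cdisc" "(\<lambda>z. 1 / (of_nat (Suc m) + z)) holomorphic_on cdisc"
      by (intro holomorphic_intros nz; assumption)+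
    thus "continuous_on cdisc (\<lambda>z. (of_nat (Suc m) + z) powr a)" "continuous_on cdisc (\<lambda>z. 1 / (of_nat (Suc m) + z))"
      by (auto intro: holomorphic_on_imp_continuous_on)
  qed
  have "(\<lambda>z. g (1 / (of_nat (Suc m) + z))) holomorphic_on disc"
  proof (rule holomorphic_on_compose_gen[OF _ g, unfolded o_def])
    show "(\<lambda>z. 1 / (of_nat (Suc m) + z)) holomorphic_on disc" by (intro holomorphic_intros nz bc)
    show "(\<lambda>z. 1 / (of_nat (Suc m) + z)) ` disc \<subseteq> disc" using im by (force simp: image_subset_iff)
  qed
  thus "(\<lambda>z. (of_nat (Suc m) + z) powr a * g (1 / (of_nat (Suc m) + z))) holomorphic_on disc"
    by (intro holomorphic_intros nz bc)
qed

text \<open>The exponent may have either sign, so the modulus of \<open>Suc m + z\<close> is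
  compared with \<open>Suc m\<close> from below or from above; the constant with base 4 covers
  both.\<close>

lemma weight_bound:
  assumes z: "z \<in> cdisc"
  shows "cmod ((of_nat (Suc m) + z) powr (- (2 * \<beta>))) * cmod (1 / (of_nat (Suc m) + z)) ^ K
    \<le> exp (pi * \<bar>2 * Im \<beta>\<bar>) * 4 powr \<bar>2 * Re \<beta> + real K\<bar> * real (Suc m) powr (- (2 * Re \<beta> + real K))"
proof -
  let ?w = "of_nat (Suc m) + z" and ?p = "2 * Re \<beta> + real K"
  note w = shift_norm[OF z, of m]
  have "cmod (?w powr (- (2 * \<beta>))) \<le> cmod ?w powr (- (2 * Re \<beta>)) * exp (pi * \<bar>2 * Im \<beta>\<bar>)"
    using norm_powr_le[OF w(3), of "- (2 * \<beta>)"] by simp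
  moreover have "cmod (1 / ?w) ^ K = cmod ?w powr (- real K)"
    using w(3) by (simp add: norm_divide power_one_over powr_minus powr_realpow inverse_eq_divide)
  ultimately have "cmod (?w powr (- (2 * \<beta>))) * cmod (1 / ?w) ^ K \<le> cmod ?w powr (- (2 * Re \<beta>)) * exp (pi * \<bar>2 * Im \<beta>\<bar>) * cmod ?w powr (- real K)"
    by (simp add: mult_right_mono)
  also have "\<dots> = exp (pi * \<bar>2 * Im \<beta>\<bar>) * (cmod ?w powr (- (2 * Re \<beta>)) * cmod ?w powr (- real K))"
    by (simp only: mult_ac)
  also have "cmod ?w powr (- (2 * Re \<beta>)) * cmod ?w powr (- real K) = cmod ?w powr (- ?p)"
    unfolding powr_add[symmetric] by (simp only: minus_add_distrib)
  also have "cmod ?w powr (- ?p) \<le> 4 powr \<bar>?p\<bar> * real (Suc m) powr (- ?p)"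
  proof (cases "?p \<ge> 0")
    case True
    have "cmod ?w powr (- ?p) \<le> (real (Suc m) / 2) powr (- ?p)"
      using w True by (intro powr_mono2') auto
    also have "\<dots> = 2 powr ?p * real (Suc m) powr (- ?p)"
    proof -
      have "(x / 2) powr (- p) = 2 powr p * x powr (- p)" if "x > 0" for x p :: real
        using that by (simp add: powr_divide powr_minus field_simps)
      from this[of "real (Suc m)" ?p] show ?thesis by (simp only: of_nat_0_less_iff zero_less_Suc)
    qed
    also have "\<dots> \<le> 4 powr \<bar>?p\<bar> * real (Suc m) powr (- ?p)"
      using True by (intro mult_right_mono) (auto intro!: powr_mono2)
    finally show ?thesis .
  next
    case False
    have "cmod ?w powr (- ?p) \<le> (4 * real (Suc m)) powr (- ?p)"
      using w False by (intro powr_mono2) auto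
    also have "\<dots> = 4 powr (- ?p) * real (Suc m) powr (- ?p)"
      by (simp only: powr_mult zero_le_numeral of_nat_0_le_iff)
    also have "- ?p = \<bar>?p\<bar>" using False by simp
    finally have "cmod ?w powr (- ?p) \<le> 4 powr \<bar>?p\<bar> * real (Suc m) powr \<bar>?p\<bar>" using False by simp
    moreover have "\<bar>?p\<bar> = - ?p" using False by simp
    ultimately show ?thesis by simp
  qed
  finally show ?thesis by (simp add: mult_left_mono mult.assoc)
qed

section \<open>The regularised Mayer operator and its compactness\<close>

definition mterm :: "complex \<Rightarrow> nat \<Rightarrow> nat \<Rightarrow> (complex \<Rightarrow> complex) \<Rightarrow> complex \<Rightarrow> complex" where
  "mterm \<beta> K m f = (\<lambda>z. if z \<in> cdisc then
     (of_nat (Suc m) + z) powr (- (2 * \<beta>)) * star K f (1 / (of_nat (Suc m) + z)) else 0)"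

definition zeta_fun :: "complex \<Rightarrow> nat \<Rightarrow> complex \<Rightarrow> complex" where
  "zeta_fun \<beta> n = (\<lambda>z. if z \<in> cdisc then hurwitz_zeta (of_nat n + 2 * \<beta>) (z + 1) else 0)"

text \<open>The Mayer operator with an arbitrary number \<open>K\<close> of Taylor terms summed by
  zeta values. The free \<open>K\<close> links the plain series, the continuation in
  \<open>mayer_op\<close>, and the formula on the Hoelder space, where
  \<open>K = Suc k\<close>.\<close>

definition mayer_reg :: "complex \<Rightarrow> nat \<Rightarrow> (complex \<Rightarrow> complex) \<Rightarrow> complex \<Rightarrow> complex" where
  "mayer_reg \<beta> K f = (\<lambda>z. (\<Sum>n<K. taylor_coeff f 0 n * zeta_fun \<beta> n z) + (\<Sum>m. mterm \<beta> K m f z))"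

definition mterm_const :: "complex \<Rightarrow> nat \<Rightarrow> real" where
  "mterm_const \<beta> K = star_const K * (exp (pi * \<bar>2 * Im \<beta>\<bar>) * 4 powr \<bar>2 * Re \<beta> + real K\<bar>)"

lemma zeta_fun_mem: "zeta_fun \<beta> n \<in> A_space"
  unfolding zeta_fun_def
proof (rule A_spaceI)
  have "Re (z + 1) > 0" if "z \<in> cdisc" for z using shift_norm(4)[OF that, of 0] by (simp add: add.commute)
  hence "(\<lambda>z. z + 1) ` cdisc \<subseteq> {z. Re z > 0}" by blast
  hence h: "(\<lambda>z. hurwitz_zeta (of_nat n + 2 * \<beta>) (z + 1)) holomorphic_on S" if "S \<subseteq> cdisc" for S
    using that by (intro holomorphic_on_compose_gen[OF _ hurwitz_zeta_holomorphic, unfolded o_def] holomorphic_intros) auto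
  show "(\<lambda>z. hurwitz_zeta (of_nat n + 2 * \<beta>) (z + 1)) holomorphic_on disc" by (rule h) auto
  show "continuous_on cdisc (\<lambda>z. hurwitz_zeta (of_nat n + 2 * \<beta>) (z + 1))"
    by (rule holomorphic_on_imp_continuous_on[OF h]) simp
qed

lemma star_holomorphic: "f \<in> A_space \<Longrightarrow> star K f holomorphic_on disc"
  unfolding star_def[abs_def] by (intro holomorphic_intros A_space_holomorphic)

lemma zero_in_disc: "(0::complex) \<in> disc" by simp

lemma star_add: "f \<in> A_space \<Longrightarrow> g \<in> A_space \<Longrightarrow> star K (\<lambda>x. f x + g x) w = star K f w + star K g w"
  unfolding star_def by (simp add: A.fn_add[OF bounded_functional_taylor[OF zero_in_disc]] algebra_simps sum.distrib)

lemma star_scale: "f \<in> A_space \<Longrightarrow> star K (\<lambda>x. c * f x) w = c * star K f w"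
  unfolding star_def by (simp add: A.fn_scale[OF bounded_functional_taylor[OF zero_in_disc]] algebra_simps sum_distrib_left)

lemma mterm_mem: "f \<in> A_space \<Longrightarrow> mterm \<beta> K m f \<in> A_space"
  unfolding mterm_def by (intro weighted_comp_mem star_holomorphic)

lemma mterm_bound:
  assumes f: "f \<in> A_space"
  shows "A_norm (mterm \<beta> K m f) \<le> mterm_const \<beta> K * A_norm f * real (Suc m) powr (- (2 * Re \<beta> + real K))"
proof (rule A_norm_le)
  fix z :: complex assume z: "z \<in> cdisc"
  let ?w = "of_nat (Suc m) + z"
  have "0 \<le> star_const K * A_norm f"
    unfolding star_const_def by (intro mult_nonneg_nonneg A.norm_nonneg[OF f] add_nonneg_nonneg sum_nonneg) auto
  have "cmod (mterm \<beta> K m f z) \<le> cmod (?w powr (- (2 * \<beta>))) * (star_const K * A_norm f * cmod (1 / ?w) ^ K)"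
    unfolding mterm_def using z star_bound[OF f inverse_shift_mem[OF z]] by (simp add: norm_mult mult_left_mono)
  also have "\<dots> = star_const K * A_norm f * (cmod (?w powr (- (2 * \<beta>))) * cmod (1 / ?w) ^ K)" by (simp only: mult_ac)
  also have "\<dots> \<le> star_const K * A_norm f * (exp (pi * \<bar>2 * Im \<beta>\<bar>) * 4 powr \<bar>2 * Re \<beta> + real K\<bar> * real (Suc m) powr (- (2 * Re \<beta> + real K)))"
    by (rule mult_left_mono[OF weight_bound[OF z]]) fact
  also have "\<dots> = mterm_const \<beta> K * A_norm f * real (Suc m) powr (- (2 * Re \<beta> + real K))"
    unfolding mterm_const_def by (simp only: mult_ac)
  finally show "cmod (mterm \<beta> K m f z) \<le> mterm_const \<beta> K * A_norm f * real (Suc m) powr (- (2 * Re \<beta> + real K))" .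
qed

lemma bounded_op_mterm: "bounded_op A_space A_norm (mterm \<beta> K m)"
proof (rule A.bounded_opI[where C = "mterm_const \<beta> K * real (Suc m) powr (- (2 * Re \<beta> + real K))"])
  show "A_norm (mterm \<beta> K m f) \<le> mterm_const \<beta> K * real (Suc m) powr (- (2 * Re \<beta> + real K)) * A_norm f" if "f \<in> A_space" for f
    using mterm_bound[OF that, of \<beta> K m] by (simp only: mult_ac)
  show "mterm \<beta> K m f \<in> A_space" if "f \<in> A_space" for f by (rule mterm_mem[OF that])
qed (auto simp: mterm_def star_add star_scale algebra_simps)

lemma mterm_series:
  assumes f: "f \<in> A_space" and K: "2 * Re \<beta> + real K > 1"
  shows "(\<lambda>z. \<Sum>m. mterm \<beta> K (m + M) f z) \<in> A_space"
    "A_norm (\<lambda>z. \<Sum>m. mterm \<beta> K (m + M) f z) \<le> (\<Sum>m. mterm_const \<beta> K * real (Suc (m + M)) powr (- (2 * Re \<beta> + real K))) * A_norm f"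
    "summable (\<lambda>m. mterm \<beta> K m f z)"
proof -
  let ?b = "\<lambda>m. mterm_const \<beta> K * A_norm f * real (Suc m) powr (- (2 * Re \<beta> + real K))"
  let ?c = "\<lambda>m. mterm_const \<beta> K * real (Suc m) powr (- (2 * Re \<beta> + real K))"
  have sc: "summable ?c" using K by (intro summable_mult summable_Suc_powr)
  have sb: "summable ?b" using K by (intro summable_mult summable_Suc_powr)
  hence sbM: "summable (\<lambda>m. ?b (m + M))" by (rule summable_ignore_initial_segment)
  note S = A.series[of "\<lambda>m. mterm \<beta> K (m + M) f", OF mterm_mem[OF f] mterm_bound[OF f] sbM]
  show "(\<lambda>z. \<Sum>m. mterm \<beta> K (m + M) f z) \<in> A_space" by (rule S(1))
  have "(\<Sum>m. ?b (m + M)) = (\<Sum>m. ?c (m + M)) * A_norm f"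
    using suminf_mult2[OF summable_ignore_initial_segment[OF sc, of M], of "A_norm f"] by (simp add: mult_ac)
  thus "A_norm (\<lambda>z. \<Sum>m. mterm \<beta> K (m + M) f z) \<le> (\<Sum>m. ?c (m + M)) * A_norm f" using S(2) by simp
  show "summable (\<lambda>m. mterm \<beta> K m f z)"
    using A.series(3)[of "\<lambda>m. mterm \<beta> K m f", OF mterm_mem[OF f] mterm_bound[OF f] sb] .
qed

lemma bounded_op_tail:
  assumes K: "2 * Re \<beta> + real K > 1"
  shows "bounded_op A_space A_norm (\<lambda>f z. \<Sum>m. mterm \<beta> K (m + M) f z)"
proof (rule A.bounded_opI[OF mterm_series(1)[OF _ K] _ _ mterm_series(2)[OF _ K]])
  have sm: "summable (\<lambda>m. mterm \<beta> K (m + M) f z)" if "f \<in> A_space" for f z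
    by (rule summable_ignore_initial_segment[OF mterm_series(3)[OF that K]])
  fix f g assume fg: "f \<in> A_space" "g \<in> A_space"
  show "(\<lambda>z. \<Sum>m. mterm \<beta> K (m + M) (\<lambda>x. f x + g x) z) = (\<lambda>z. (\<Sum>m. mterm \<beta> K (m + M) f z) + (\<Sum>m. mterm \<beta> K (m + M) g z))"
    using suminf_add[OF sm[OF fg(1)] sm[OF fg(2)]] by (simp add: A.op_add[OF bounded_op_mterm fg])
next
  have sm: "summable (\<lambda>m. mterm \<beta> K (m + M) f z)" if "f \<in> A_space" for f z
    by (rule summable_ignore_initial_segment[OF mterm_series(3)[OF that K]])
  fix c f assume f: "f \<in> A_space"
  show "(\<lambda>z. \<Sum>m. mterm \<beta> K (m + M) (\<lambda>x. c * f x) z) = (\<lambda>z. c * (\<Sum>m. mterm \<beta> K (m + M) f z))"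
    using suminf_mult[OF sm[OF f]] by (simp add: A.op_scale[OF bounded_op_mterm f])
qed

lemma finite_rank_zeta_part: "A.finite_rank (\<lambda>f z. \<Sum>n<K. taylor_coeff f 0 n * zeta_fun \<beta> n z)"
  by (intro A.finite_rank_sum A.finite_rank_one bounded_functional_taylor zeta_fun_mem zero_in_disc)

lemma bounded_op_mayer_reg:
  assumes K: "2 * Re \<beta> + real K > 1"
  shows "bounded_op A_space A_norm (mayer_reg \<beta> K)"
  unfolding mayer_reg_def[abs_def]
  using A.bounded_op_add[OF A.finite_rank_bounded[OF finite_rank_zeta_part] bounded_op_tail[OF K, of 0]] by simp

text \<open>Replace \<open>f\<close> by its Taylor polynomial of degree below \<open>J\<close> at 1.
  Since \<open>1 / (Suc m + z)\<close> stays within distance 1 of the centre and \<open>f\<close>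
  lives on radius 3/2, the error is a multiple of \<open>(2/3)^J\<close>; the Taylor part at 0
  subtracted in \<open>star\<close> already has finite rank.\<close>

lemma mterm_approx:
  assumes "\<epsilon> > 0"
  shows "\<exists>F. A.finite_rank F \<and> (\<forall>f\<in>A_space. A_norm (\<lambda>z. mterm \<beta> K m f z - F f z) \<le> \<epsilon> * A_norm f)"
proof -
  define C where "C = exp (pi * \<bar>2 * Im \<beta>\<bar>) * 4 powr \<bar>2 * Re \<beta> + real 0\<bar> * real (Suc m) powr (- (2 * Re \<beta> + real 0))"
  have C: "C > 0" unfolding C_def by (intro mult_pos_pos) auto
  have "(\<lambda>J. (2/3) ^ J :: real) \<longlonglongrightarrow> 0" by (intro LIMSEQ_realpow_zero) auto
  hence "\<forall>\<^sub>F J in sequentially. (2/3) ^ J < \<epsilon> / (3 * C)" using C assms by (intro order_tendstoD) auto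
  then obtain J :: nat where J: "(2/3) ^ J < \<epsilon> / (3 * C)" by (auto simp: eventually_sequentially)
  define v where "v p i = (\<lambda>z. if z \<in> cdisc then (of_nat (Suc m) + z) powr (- (2 * \<beta>)) * (1 / (of_nat (Suc m) + z) - p) ^ i else 0)" for p :: complex and i
  have vA: "v p i \<in> A_space" for p i
    unfolding v_def by (rule weighted_comp_mem[of "\<lambda>w. (w - p) ^ i"]) (intro holomorphic_intros)
  define F where "F = (\<lambda>f z. (\<Sum>i<J. taylor_coeff f 1 i * v 1 i z) - (\<Sum>i<K. taylor_coeff f 0 i * v 0 i z))"
  have "A.finite_rank F" unfolding F_def
    by (intro A.finite_rank_diff A.finite_rank_sum A.finite_rank_one bounded_functional_taylor vA zero_in_disc) auto
  moreover have "A_norm (\<lambda>z. mterm \<beta> K m f z - F f z) \<le> \<epsilon> * A_norm f" if f: "f \<in> A_space" for f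
  proof (rule A_norm_le)
    fix z :: complex assume z: "z \<in> cdisc"
    let ?w = "of_nat (Suc m) + z"
    let ?u = "?w powr (- (2 * \<beta>))"
    have "mterm \<beta> K m f z - F f z = ?u * (f (1 / ?w) - (\<Sum>i<J. taylor_coeff f 1 i * (1 / ?w - 1) ^ i))"
      using z unfolding mterm_def F_def v_def star_def by (simp add: algebra_simps sum_distrib_left)
    moreover have "cmod (f (1 / ?w) - (\<Sum>i<J. taylor_coeff f 1 i * (1 / ?w - 1) ^ i)) \<le> A_norm f * (2/3) ^ J / (1 - 2/3)"
    proof (rule taylor_remainder_le[OF f, where r = "3/2"])
      show "cmod (1 / ?w - 1) \<le> 2/3 * (3/2)" using inverse_shift_mem[OF z, of m] by (simp add: dist_norm norm_minus_commute)
    qed auto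
    moreover have "cmod ?u \<le> C" using weight_bound[OF z, of m \<beta> 0] unfolding C_def by simp
    ultimately have "cmod (mterm \<beta> K m f z - F f z) \<le> C * (A_norm f * (2/3) ^ J / (1 - 2/3))"
      using C by (simp add: norm_mult mult_mono)
    also have "\<dots> = 3 * C * (2/3) ^ J * A_norm f" by simp
    also have "\<dots> \<le> \<epsilon> * A_norm f"
      using J C by (intro mult_right_mono A.norm_nonneg f) (simp add: field_simps)
    finally show "cmod (mterm \<beta> K m f z - F f z) \<le> \<epsilon> * A_norm f" .
  qed
  ultimately show ?thesis by blast
qed

text \<open>Compactness in the form used here: the tail of the series takes half of
  \<open>\<epsilon>\<close>, and the \<open>M\<close> remaining terms share the other half through
  \<open>mterm_approx\<close>.\<close>

lemma mayer_reg_approx: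
  assumes K: "2 * Re \<beta> + real K > 1" and \<epsilon>: "\<epsilon> > 0"
  shows "\<exists>F. A.finite_rank F \<and> (\<forall>f\<in>A_space. A_norm (\<lambda>z. mayer_reg \<beta> K f z - F f z) \<le> \<epsilon> * A_norm f)"
proof -
  let ?c = "\<lambda>m. mterm_const \<beta> K * real (Suc m) powr (- (2 * Re \<beta> + real K))"
  have sc: "summable ?c" using K by (intro summable_mult summable_Suc_powr)
  have "(\<lambda>M. \<Sum>m. ?c (m + M)) \<longlonglongrightarrow> 0" by (rule suminf_exist_split2[OF sc])
  hence "\<forall>\<^sub>F M in sequentially. (\<Sum>m. ?c (m + M)) < \<epsilon> / 2" using \<epsilon> by (intro order_tendstoD) auto
  then obtain M where M: "(\<Sum>m. ?c (m + M)) < \<epsilon> / 2" by (auto simp: eventually_sequentially)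
  define e where "e = \<epsilon> / (2 * (real M + 1))"
  have e: "e > 0" using \<epsilon> unfolding e_def by simp
  obtain F where F: "\<And>m. A.finite_rank (F m)" "\<And>m f. f \<in> A_space \<Longrightarrow> A_norm (\<lambda>z. mterm \<beta> K m f z - F m f z) \<le> e * A_norm f"
    using mterm_approx[OF e, of \<beta> K] by metis
  define G where "G = (\<lambda>f z. (\<Sum>n<K. taylor_coeff f 0 n * zeta_fun \<beta> n z) + (\<Sum>m<M. F m f z))"
  have "A.finite_rank G" unfolding G_def
    by (intro A.finite_rank_add finite_rank_zeta_part A.finite_rank_sum F(1))
  moreover have "A_norm (\<lambda>z. mayer_reg \<beta> K f z - G f z) \<le> \<epsilon> * A_norm f" if f: "f \<in> A_space" for f
  proof -
    have FA: "F m f \<in> A_space" for m by (rule A.op_mem[OF A.finite_rank_bounded[OF F(1)] f])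
    have dA: "(\<lambda>z. mterm \<beta> K m f z - F m f z) \<in> A_space" for m by (intro A.diff_mem mterm_mem f FA)
    have "mayer_reg \<beta> K f z - G f z = (\<Sum>m<M. mterm \<beta> K m f z - F m f z) + (\<Sum>m. mterm \<beta> K (m + M) f z)" for z
      unfolding mayer_reg_def G_def using suminf_split_initial_segment[OF mterm_series(3)[OF f K], of z M]
      by (simp add: sum_subtractf)
    hence "A_norm (\<lambda>z. mayer_reg \<beta> K f z - G f z) = A_norm (\<lambda>z. (\<Sum>m<M. mterm \<beta> K m f z - F m f z) + (\<Sum>m. mterm \<beta> K (m + M) f z))" by simp
    also have "\<dots> \<le> A_norm (\<lambda>z. \<Sum>m<M. mterm \<beta> K m f z - F m f z) + A_norm (\<lambda>z. \<Sum>m. mterm \<beta> K (m + M) f z)"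
      by (intro A.norm_add A.sum_mem dA mterm_series(1)[OF f K])
    also have "A_norm (\<lambda>z. \<Sum>m<M. mterm \<beta> K m f z - F m f z) \<le> (\<Sum>m<M. e * A_norm f)"
      by (rule order_trans[OF A.norm_sum[OF dA]]) (intro sum_mono F(2) f)
    also have "(\<Sum>m<M. e * A_norm f) \<le> \<epsilon> / 2 * A_norm f"
    proof -
      have "real M * e \<le> \<epsilon> / 2" unfolding e_def using \<epsilon> by (simp add: field_simps)
      from mult_right_mono[OF this A.norm_nonneg[OF f]] show ?thesis by simp
    qed
    also have "A_norm (\<lambda>z. \<Sum>m. mterm \<beta> K (m + M) f z) \<le> \<epsilon> / 2 * A_norm f"
      using mterm_series(2)[OF f K, of M] mult_right_mono[OF less_imp_le[OF M] A.norm_nonneg[OF f]] by linarith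
    finally show ?thesis by (simp add: field_simps)
  qed
  ultimately show ?thesis by blast
qed

text \<open>Removing the Taylor term of degree \<open>K\<close> changes the series by that
  coefficient times the sum of \<open>(n + z) powr (- (2 * \<beta> + K))\<close>. This sum converges
  under the hypothesis and equals the zeta value that is added.\<close>

lemma mayer_reg_Suc:
  assumes f: "f \<in> A_space" and K: "2 * Re \<beta> + real K > 1"
  shows "mayer_reg \<beta> (Suc K) f = mayer_reg \<beta> K f"
proof
  fix z
  show "mayer_reg \<beta> (Suc K) f z = mayer_reg \<beta> K f z"
  proof (cases "z \<in> cdisc")
    case False
    thus ?thesis unfolding mayer_reg_def mterm_def zeta_fun_def by simp
  next
    case True
    have K': "2 * Re \<beta> + real (Suc K) > 1" using K by simp
    let ?a = "taylor_coeff f 0 K"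
    have "Re (z + 1) > 0" using shift_norm(4)[OF True, of 0] by (simp add: add.commute)
    moreover have "Re (of_nat K + 2 * \<beta>) > 1" using K by simp
    ultimately have sums: "(\<lambda>m. (of_nat m + (z + 1)) powr (- (of_nat K + 2 * \<beta>))) sums zeta_fun \<beta> K z"
      using hurwitz_zeta_sums[of "z + 1" "of_nat K + 2 * \<beta>"] True by (simp add: zeta_fun_def)
    have tm: "mterm \<beta> K m f z - mterm \<beta> (Suc K) m f z = ?a * (of_nat m + (z + 1)) powr (- (of_nat K + 2 * \<beta>))" for m
    proof -
      let ?w = "of_nat (Suc m) + z"
      have w: "?w \<noteq> 0" by (rule shift_norm(3)[OF True])
      have "?w powr (- (2 * \<beta>)) * (1 / ?w) ^ K = ?w powr (- (2 * \<beta>)) * ?w powr (- of_nat K)"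
        using w by (simp add: powr_minus powr_nat power_divide divide_inverse power_inverse)
      also have "\<dots> = ?w powr (- (of_nat K + 2 * \<beta>))"
        unfolding powr_add[symmetric] by (simp only: minus_add_distrib add.commute)
      finally have "?w powr (- (2 * \<beta>)) * (?a * (1 / ?w) ^ K) = ?a * ?w powr (- (of_nat K + 2 * \<beta>))"
        by (simp add: mult.left_commute)
      moreover have "mterm \<beta> K m f z - mterm \<beta> (Suc K) m f z = ?w powr (- (2 * \<beta>)) * (?a * (1 / ?w) ^ K)"
        using True unfolding mterm_def star_def by (simp add: algebra_simps)
      moreover have "?w = of_nat m + (z + 1)" by simp
      ultimately show ?thesis by metis
    qed
    have "(\<Sum>m. mterm \<beta> K m f z) - (\<Sum>m. mterm \<beta> (Suc K) m f z) = (\<Sum>m. mterm \<beta> K m f z - mterm \<beta> (Suc K) m f z)"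
      by (rule suminf_diff[OF mterm_series(3)[OF f K] mterm_series(3)[OF f K']])
    also have "\<dots> = ?a * zeta_fun \<beta> K z"
      unfolding tm using sums_mult[OF sums, of ?a] by (simp add: sums_iff)
    finally show ?thesis unfolding mayer_reg_def by (simp add: algebra_simps)
  qed
qed

lemma mayer_reg_independent:
  assumes f: "f \<in> A_space" and K: "2 * Re \<beta> + real K > 1" and "K \<le> K'"
  shows "mayer_reg \<beta> K' f = mayer_reg \<beta> K f"
  using assms(3)
proof (induction rule: dec_induct)
  case (step n)
  have "2 * Re \<beta> + real n > 1" using K step by simp
  from mayer_reg_Suc[OF f this] step show ?case by simp
qed simp

lemma mayer_continued_eq:
  assumes "z \<in> cdisc"
  shows "mayer_continued k \<beta> f z = mayer_reg \<beta> (Suc k) f z"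
  using assms unfolding mayer_continued_def mayer_reg_def mayer_series_def mterm_def star_def zeta_fun_def taylor_coeff_def
  by (simp add: Let_def lessThan_Suc_atMost)

lemma mayer_op_eq:
  assumes f: "f \<in> A_space" and K: "2 * Re \<beta> + real K > 1"
  shows "mayer_op \<beta> f = mayer_reg \<beta> K f"
proof
  fix z
  have indep: "mayer_reg \<beta> K' f = mayer_reg \<beta> K f" if "2 * Re \<beta> + real K' > 1" for K'
    using mayer_reg_independent[OF f K, of K'] mayer_reg_independent[OF f that, of K] by (cases "K \<le> K'") auto
  show "mayer_op \<beta> f z = mayer_reg \<beta> K f z"
  proof (cases "z \<in> cdisc")
    case False
    thus ?thesis unfolding mayer_op_def mayer_reg_def mterm_def zeta_fun_def by simp
  next
    case True
    show ?thesis
    proof (cases "Re \<beta> > 1/2")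
      case b: True
      have "mayer_op \<beta> f z = mayer_reg \<beta> 0 f z"
        using True b unfolding mayer_op_def mayer_series_def mayer_reg_def mterm_def star_def by simp
      thus ?thesis using indep[of 0] b by simp
    next
      case b: False
      have "2 * Re \<beta> + real (Suc (nat \<lfloor>- 2 * Re \<beta>\<rfloor> + 1)) > 1" using b by linarith
      thus ?thesis using True b indep mayer_continued_eq[OF True] unfolding mayer_op_def by simp
    qed
  qed
qed

lemma exists_admissible: "\<exists>K. 2 * Re \<beta> + real K > 1"
  using reals_Archimedean2[of "1 - 2 * Re \<beta>"] by (auto simp: algebra_simps)

lemma bounded_op_mayer: "bounded_op A_space A_norm (mayer_op \<beta>)"
proof -
  obtain K where K: "2 * Re \<beta> + real K > 1" using exists_admissible by blast
  show ?thesis by (rule A.bounded_op_cong[OF bounded_op_mayer_reg[OF K] mayer_op_eq[OF _ K]])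
qed

text \<open>By compactness every positive radius is allowed, so a determinant exists around any
  nonzero point.\<close>

lemma mayer_fredholm:
  assumes "q > 0"
  shows "\<exists>d G. A.fredholm_family {\<mu>. cmod \<mu> > q} (mayer_op \<beta>) d G"
proof -
  obtain K where K: "2 * Re \<beta> + real K > 1" using exists_admissible by blast
  obtain F where F: "A.finite_rank F" "\<And>f. f \<in> A_space \<Longrightarrow> A_norm (\<lambda>z. mayer_reg \<beta> K f z - F f z) \<le> q * A_norm f"
    using mayer_reg_approx[OF K assms] by blast
  show ?thesis
  proof (rule A.fredholm_family_finite_rank[OF _ _ _ F(1)])
    show "bounded_op A_space A_norm (\<lambda>f z. mayer_reg \<beta> K f z - F f z)"
      by (intro A.bounded_op_diff bounded_op_mayer_reg[OF K] A.finite_rank_bounded F(1))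
    show "mayer_op \<beta> f = (\<lambda>x. mayer_reg \<beta> K f x - F f x + F f x)" if "f \<in> A_space" for f
      by (simp add: mayer_op_eq[OF that K])
  qed (use F(2) assms in auto)
qed

section \<open>Weighted composition with Moebius maps\<close>

lemma vector_mvt_bound:
  fixes f :: "real \<Rightarrow> complex"
  assumes "convex S" "\<And>x. x \<in> S \<Longrightarrow> (f has_vector_derivative f' x) (at x within S)"
    and "\<And>x. x \<in> S \<Longrightarrow> cmod (f' x) \<le> B" "x \<in> S" "y \<in> S"
  shows "cmod (f x - f y) \<le> B * \<bar>x - y\<bar>"
proof -
  have "norm (f x - f y) \<le> B * norm (x - y)"
  proof (rule differentiable_bound[OF assms(1) _ _ assms(4,5)])
    fix u assume u: "u \<in> S"
    show "(f has_derivative (\<lambda>h. h *\<^sub>R f' u)) (at u within S)"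
      using assms(2)[OF u] unfolding has_vector_derivative_def .
    show "onorm (\<lambda>h. h *\<^sub>R f' u) \<le> B"
      by (rule onorm_le) (use mult_left_mono[OF assms(3)[OF u]] in \<open>simp add: mult.commute[of B]\<close>)
  qed
  thus ?thesis by simp
qed

lemma abs_le_powr: "\<bar>x - y\<bar> \<le> 1 \<Longrightarrow> e < 1 \<Longrightarrow> \<bar>x - y\<bar> \<le> \<bar>x - y\<bar> powr e" for x y e :: real
proof (cases "x = y")
  case False
  assume "\<bar>x - y\<bar> \<le> 1" "e < 1"
  hence "\<bar>x - y\<bar> powr 1 \<le> \<bar>x - y\<bar> powr e" using False by (intro powr_mono') auto
  thus ?thesis using False by simp
qed simp

definition restrict01 :: "(complex \<Rightarrow> complex) \<Rightarrow> real \<Rightarrow> complex" where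
  "restrict01 g x = (if x \<in> {0..1} then g (of_real x) else 0)"

section \<open>Restrictions of analytic functions and Taylor remainders\<close>

context holder_space
begin

lemma
  assumes g: "g holomorphic_on S" and S: "open S" "\<And>x. x \<in> {0..1} \<Longrightarrow> of_real x \<in> S"
  shows restrict01_mem: "restrict01 g \<in> C_space \<alpha>"
    and D_restrict01: "j \<le> k \<Longrightarrow> x \<in> {0..1} \<Longrightarrow> D j (restrict01 g) x = (deriv ^^ j) g (of_real x)"
proof -
  let ?F = "\<lambda>j x. (deriv ^^ j) g (of_real x)"
  have der: "(?F j has_vector_derivative ?F (Suc j) x) (at x within {0..1})" if "x \<in> {0..1}" for j x
  proof -
    have "((deriv ^^ j) g has_field_derivative deriv ((deriv ^^ j) g) (of_real x)) (at (of_real x))"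
      by (rule holomorphic_derivI[OF holomorphic_higher_deriv[OF g S(1)] S(1) S(2)[OF that]])
    thus ?thesis using has_vector_derivative_real_field by (simp add: has_vector_derivative_real_field)
  qed
  have cont: "continuous_on {0..1} (?F j)" for j
    using der by (meson continuous_on_eq_continuous_within has_vector_derivative_continuous)
  have "compact (?F (Suc k) ` {0..1})" by (intro compact_continuous_image cont) auto
  then obtain B where B: "\<And>x. x \<in> {0..1} \<Longrightarrow> cmod (?F (Suc k) x) \<le> B"
    using compact_imp_bounded bounded_iff by (metis imageI)
  have B0: "B \<ge> 0" using order_trans[OF norm_ge_zero B[of 0]] by simp
  have hol: "cmod (?F k x - ?F k y) \<le> B * \<bar>x - y\<bar> powr \<eta>" if "x \<in> {0..1}" "y \<in> {0..1}" for x y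
  proof -
    have "cmod (?F k x - ?F k y) \<le> B * \<bar>x - y\<bar>"
      by (rule vector_mvt_bound[OF _ der B that]) auto
    also have "\<dots> \<le> B * \<bar>x - y\<bar> powr \<eta>" using that \<eta>_less by (intro mult_left_mono abs_le_powr B0) auto
    finally show ?thesis .
  qed
  show "restrict01 g \<in> C_space \<alpha>"
    by (rule C_spaceI[of _ ?F, OF _ _ der cont hol]) (auto simp: restrict01_def)
  show "D j (restrict01 g) x = (deriv ^^ j) g (of_real x)" if "j \<le> k" "x \<in> {0..1}"
    by (rule deriv01_jet[of _ ?F k, OF _ der that]) (auto simp: restrict01_def)
qed

lemma bounded_functional_D:
  assumes "j \<le> k" "p \<in> {0..1}"
  shows "bounded_functional (\<lambda>f. D j f p)"
  by (rule bounded_functionalI[where C = 1]) (use assms in \<open>auto simp: D_add D_scale C_norm_upper\<close>)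

text \<open>\<^term>\<open>i = 0\<close> gives the Taylor remainder of order \<open>k\<close>, and \<^term>\<open>i\<close> its \<^term>\<open>i\<close>-th derivative.\<close>

definition taylor_rem :: "real \<Rightarrow> (real \<Rightarrow> complex) \<Rightarrow> nat \<Rightarrow> real \<Rightarrow> complex" where
  "taylor_rem p f i x = D i f x - (\<Sum>j\<le>k - i. D (i + j) f p * of_real (x - p) ^ j / fact j)"

lemma taylor_rem_deriv:
  assumes f: "f \<in> C_space \<alpha>" and i: "i < k" and x: "x \<in> {0..1}"
  shows "(taylor_rem p f i has_vector_derivative taylor_rem p f (Suc i) x) (at x within {0..1})"
proof -
  obtain m where m: "k - i = Suc m" using i by (cases "k - i") auto
  have pow: "((\<lambda>x. D (i + Suc j) f p * of_real (x - p) ^ Suc j / fact (Suc j)) has_vector_derivative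
     D (i + Suc j) f p * of_real (x - p) ^ j / fact j) (at x within {0..1})" for j
  proof -
    have "((\<lambda>w. D (i + Suc j) f p * (w - of_real p) ^ Suc j / fact (Suc j)) has_field_derivative
       D (i + Suc j) f p * (of_nat (Suc j) * (of_real x - of_real p) ^ j) / fact (Suc j)) (at (of_real x))"
    proof (intro DERIV_cdivide DERIV_cmult)
      have "((\<lambda>w. w - of_real p) has_field_derivative 1) (at (of_real x :: complex))"
        by (rule derivative_eq_intros refl | simp)+
      from DERIV_power[OF this, of "Suc j"]
      show "((\<lambda>w. (w - of_real p) ^ Suc j) has_field_derivative of_nat (Suc j) * (of_real x - of_real p) ^ j) (at (of_real x :: complex))"
        by simp
    qed
    moreover have "D (i + Suc j) f p * (of_nat (Suc j) * (of_real x - of_real p) ^ j) / fact (Suc j)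
       = D (i + Suc j) f p * of_real (x - p) ^ j / fact j"
      by (simp add: field_simps del: of_nat_Suc)
    ultimately show ?thesis using has_vector_derivative_real_field by fastforce
  qed
  have "((\<lambda>x. \<Sum>j\<le>m. D (i + Suc j) f p * of_real (x - p) ^ Suc j / fact (Suc j)) has_vector_derivative
     (\<Sum>j\<le>m. D (i + Suc j) f p * of_real (x - p) ^ j / fact j)) (at x within {0..1})"
    by (intro has_vector_derivative_sum pow)
  from has_vector_derivative_add[OF has_vector_derivative_const[of "D i f p"] this]
  have "((\<lambda>x. \<Sum>j\<le>k - i. D (i + j) f p * of_real (x - p) ^ j / fact j) has_vector_derivative
     (\<Sum>j\<le>m. D (i + Suc j) f p * of_real (x - p) ^ j / fact j)) (at x within {0..1})"
    unfolding m by (subst sum.atMost_Suc_shift) (simp del: of_nat_Suc fact_Suc power_Suc)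
  note d = has_vector_derivative_diff[OF C_space_deriv[OF f i x] this]
  have km: "k - Suc i = m" using m by simp
  have e: "taylor_rem p f (Suc i) x = D (Suc i) f x - (\<Sum>j\<le>m. D (i + Suc j) f p * of_real (x - p) ^ j / fact j)"
    unfolding taylor_rem_def km by simp
  show ?thesis unfolding e using d unfolding taylor_rem_def[abs_def] .
qed

lemma taylor_rem_k: "taylor_rem p f k x = D k f x - D k f p"
  unfolding taylor_rem_def by simp

text \<open>Downward induction from order \<open>k\<close>, where it is the Hoelder bound. The
  remainder vanishes at \<open>p\<close>, so the mean value inequality on the segment from
  \<open>p\<close> to \<open>x\<close>, rather than on [0,1], gains one factor
  \<open>\<bar>x - p\<bar>\<close> without changing the constant.\<close>

lemma taylor_rem_bound:
  assumes f: "f \<in> C_space \<alpha>" and p: "p \<in> {0..1}" and "i \<le> k" and x: "x \<in> {0..1}"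
  shows "cmod (taylor_rem p f i x) \<le> 2 * C_norm \<alpha> f * \<bar>x - p\<bar> powr (\<alpha> - real i)"
  using assms(3) x
proof (induction i arbitrary: x rule: inc_induct)
  case base
  have "\<alpha> - real k = \<eta>" using \<alpha>_eq by simp
  thus ?case unfolding taylor_rem_k using C_norm_holder[OF f base p] by simp
next
  case (step i)
  let ?S = "closed_segment p x"
  have sub: "?S \<subseteq> {0..1}" using p step.prems by (simp add: closed_segment_subset)
  have e: "\<alpha> - real (Suc i) \<ge> 0" using step.hyps \<alpha>_eq \<eta>_nonneg by linarith
  have N0: "C_norm \<alpha> f \<ge> 0" by (rule C_norm_nonneg[OF f])
  have zero: "taylor_rem p f i p = 0"
  proof -
    have "(\<Sum>j\<le>k - i. D (i + j) f p * of_real (p - p) ^ j / fact j) = (\<Sum>j\<le>k - i. if j = 0 then D i f p else 0)"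
      by (intro sum.cong) auto
    thus ?thesis unfolding taylor_rem_def by simp
  qed
  have "cmod (taylor_rem p f i x - taylor_rem p f i p) \<le> (2 * C_norm \<alpha> f * \<bar>x - p\<bar> powr (\<alpha> - real (Suc i))) * \<bar>x - p\<bar>"
  proof (rule vector_mvt_bound[where S = ?S])
    show "(taylor_rem p f i has_vector_derivative taylor_rem p f (Suc i) u) (at u within ?S)" if "u \<in> ?S" for u
      by (rule has_vector_derivative_within_subset[OF taylor_rem_deriv[OF f _ ] sub]) (use step.hyps sub that in auto)
    fix u assume u: "u \<in> ?S"
    have "\<bar>u - p\<bar> \<le> \<bar>x - p\<bar>" using u by (auto simp: closed_segment_eq_real_ivl split: if_splits)
    hence "\<bar>u - p\<bar> powr (\<alpha> - real (Suc i)) \<le> \<bar>x - p\<bar> powr (\<alpha> - real (Suc i))" using e by (intro powr_mono2) auto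
    moreover have "cmod (taylor_rem p f (Suc i) u) \<le> 2 * C_norm \<alpha> f * \<bar>u - p\<bar> powr (\<alpha> - real (Suc i))"
      using sub u by (intro step.IH) auto
    ultimately show "cmod (taylor_rem p f (Suc i) u) \<le> 2 * C_norm \<alpha> f * \<bar>x - p\<bar> powr (\<alpha> - real (Suc i))"
      using N0 by (smt (verit) mult_left_mono)
  qed auto
  also have "\<dots> = 2 * C_norm \<alpha> f * (\<bar>x - p\<bar> powr (\<alpha> - real (Suc i)) * \<bar>x - p\<bar> powr 1)" by simp
  also have "\<bar>x - p\<bar> powr (\<alpha> - real (Suc i)) * \<bar>x - p\<bar> powr 1 = \<bar>x - p\<bar> powr (\<alpha> - real i)"
    unfolding powr_add[symmetric] by simp
  finally show ?case using zero by simp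
qed

lemma taylor_rem_continuous: "f \<in> C_space \<alpha> \<Longrightarrow> continuous_on {0..1} (taylor_rem p f k)"
  unfolding taylor_rem_k[abs_def] by (intro continuous_intros C_space_continuous) auto

end

text \<open>The numbers \<open>kap s j i\<close> are the coefficients in
  \<open>(d/dz)^j ((c z + d)^(- s) g (h z)) = (\<Sum>i\<le>j. kap s j i * e^i * c^(j - i) * (c z + d)^(- s - j - i) * g^(i) (h z))\<close>
  for the Moebius map \<open>h z = (a z + b) / (c z + d)\<close> of determinant \<open>e\<close>.\<close>

fun kap :: "complex \<Rightarrow> nat \<Rightarrow> nat \<Rightarrow> complex" where
  "kap s 0 i = (if i = 0 then 1 else 0)"
| "kap s (Suc j) i = - (s + of_nat j + of_nat i) * kap s j i + (if i = 0 then 0 else kap s j (i - 1))"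

lemma kap_zero: "i > j \<Longrightarrow> kap s j i = 0"
  by (induction j arbitrary: i) auto

section \<open>Moebius maps with bounded distortion\<close>

definition lin :: "real \<Rightarrow> real \<Rightarrow> real \<Rightarrow> real" where "lin c d z = c * z + d"

definition moebius_map :: "real \<Rightarrow> real \<Rightarrow> real \<Rightarrow> real \<Rightarrow> real \<Rightarrow> real" where
  "moebius_map a b c d z = (a * z + b) / lin c d z"

text \<open>Isolates what is used of continued fraction matrices. From \<open>c \<le> d\<close> the
  denominator lies between \<open>d\<close> and \<open>2 * d\<close> on [0,1], so \<open>d\<close>
  alone measures the weight, and determinant of modulus 1 makes the derivative comparable to
  \<open>d powr (-2)\<close>.\<close>

definition good_moebius :: "real \<Rightarrow> real \<Rightarrow> real \<Rightarrow> real \<Rightarrow> bool" where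
  "good_moebius a b c d \<longleftrightarrow> 0 \<le> c \<and> c \<le> d \<and> 1 \<le> d \<and> \<bar>a * d - b * c\<bar> = 1 \<and> (\<forall>z\<in>{0..1}. moebius_map a b c d z \<in> {0..1})"

text \<open>\<open>G\<close> is a tower of derivatives rather than a function, so that the tower of
  Taylor remainders can be inserted directly.\<close>

definition moebius_jet :: "complex \<Rightarrow> real \<Rightarrow> real \<Rightarrow> real \<Rightarrow> real \<Rightarrow> (nat \<Rightarrow> real \<Rightarrow> complex) \<Rightarrow> nat \<Rightarrow> real \<Rightarrow> complex" where
  "moebius_jet s a b c d G j z = (\<Sum>i\<le>j. kap s j i * (of_real ((a * d - b * c) ^ i * c ^ (j - i)) *
     (of_real (lin c d z) powr (- (s + of_nat j + of_nat i)) * G i (moebius_map a b c d z))))"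

lemma lin_bounds:
  assumes "0 \<le> c" "c \<le> d" "1 \<le> d" "z \<in> {0..1}"
  shows "d \<le> lin c d z" "lin c d z \<le> 2 * d" "lin c d z > 0"
proof -
  have "c * z \<le> d * 1" using assms by (intro mult_mono) auto
  moreover have "0 \<le> c * z" using assms by auto
  ultimately show "d \<le> lin c d z" "lin c d z \<le> 2 * d" "lin c d z > 0" using assms unfolding lin_def by linarith+
qed

lemma lin_powr_deriv:
  assumes "lin c d z > 0"
  shows "((\<lambda>z. of_real (lin c d z) powr a :: complex) has_vector_derivative
    a * of_real c * of_real (lin c d z) powr (a - 1)) (at z within S)"
proof -
  have "((\<lambda>w. (of_real c * w + of_real d) powr a) has_field_derivative
      a * (of_real c * of_real z + of_real d) powr (a - 1) * of_real c) (at (of_real z))"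
  proof -
    have "((\<lambda>w. of_real c * w + of_real d) has_field_derivative of_real c) (at (of_real z :: complex))"
      by (rule derivative_eq_intros refl | simp)+
    moreover have "of_real c * of_real z + of_real d \<notin> (\<real>\<^sub>\<le>\<^sub>0 :: complex set)"
      using assms by (intro not_nonpos_Reals_if_Re_pos) (simp add: lin_def)
    ultimately show ?thesis by (rule DERIV_chain2[OF has_field_derivative_powr, rotated -1])
  qed
  from has_vector_derivative_real_field[OF this] show ?thesis
    by (simp add: lin_def mult_ac)
qed

lemma moebius_deriv:
  assumes "lin c d z > 0"
  shows "(moebius_map a b c d has_vector_derivative (a * d - b * c) / (lin c d z)\<^sup>2) (at z within S)"
proof -
  have "(moebius_map a b c d has_real_derivative (a * d - b * c) / (lin c d z)\<^sup>2) (at z within S)"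
    unfolding moebius_map_def[abs_def] lin_def using assms unfolding lin_def
    by (auto intro!: derivative_eq_intros simp: field_simps power2_eq_square)
  thus ?thesis by (simp add: has_real_derivative_iff_has_vector_derivative)
qed

lemma moebius_comp_deriv:
  assumes gm: "good_moebius a b c d" and z: "z \<in> {0..1}"
    and G: "(g has_vector_derivative g') (at (moebius_map a b c d z) within {0..1})"
  shows "((\<lambda>z. g (moebius_map a b c d z)) has_vector_derivative ((a * d - b * c) / (lin c d z)\<^sup>2) *\<^sub>R g') (at z within {0..1})"
proof -
  have pos: "lin c d z > 0" using gm z lin_bounds(3) unfolding good_moebius_def by blast
  have sub: "moebius_map a b c d ` {0..1} \<subseteq> {0..1}" using gm unfolding good_moebius_def by blast
  from vector_diff_chain_within[OF moebius_deriv[OF pos] has_vector_derivative_within_subset[OF G sub]]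
  show ?thesis by (simp add: o_def)
qed

text \<open>Differentiating the i-th term produces the factor \<open>- (s + j + i)\<close> at index
  \<open>i\<close> from the power of the denominator, and a term at index \<open>i + 1\<close> from
  the chain rule with derivative \<open>(a * d - b * c) / (lin c d z)^2\<close>. This is the
  recursion of \<open>kap\<close>.\<close>

lemma moebius_jet_deriv:
  assumes gm: "good_moebius a b c d" and z: "z \<in> {0..1}"
    and G: "\<And>i x. i \<le> j \<Longrightarrow> x \<in> {0..1} \<Longrightarrow> (G i has_vector_derivative G (Suc i) x) (at x within {0..1})"
  shows "(moebius_jet s a b c d G j has_vector_derivative moebius_jet s a b c d G (Suc j) z) (at z within {0..1})"
proof -
  let ?h = "moebius_map a b c d" and ?l = "lin c d z" and ?e = "a * d - b * c"
  have pos: "?l > 0" using gm z lin_bounds(3) unfolding good_moebius_def by blast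
  have l0: "complex_of_real ?l \<noteq> 0" using pos by simp
  have hz: "?h z \<in> {0..1}" using gm z unfolding good_moebius_def by blast
  define Y where "Y i = of_real (?e ^ i * c ^ (Suc j - i)) * (of_real ?l powr (- (s + of_nat (Suc j) + of_nat i)) * G i (?h z))" for i
  have t: "((\<lambda>z. kap s j i * (of_real (?e ^ i * c ^ (j - i)) * (of_real (lin c d z) powr (- (s + of_nat j + of_nat i)) * G i (?h z))))
     has_vector_derivative kap s j i * (- (s + of_nat j + of_nat i) * Y i + Y (Suc i))) (at z within {0..1})" if i: "i \<le> j" for i
  proof -
    let ?a = "- (s + of_nat j + of_nat i)"
    have 1: "of_real ?l powr ?a * (of_real (?e / ?l\<^sup>2) * G (Suc i) (?h z)) =
      of_real ?e * (of_real ?l powr (- (s + of_nat (Suc j) + of_nat (Suc i))) * G (Suc i) (?h z))"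
    proof -
      have "- (s + of_nat (Suc j) + of_nat (Suc i)) = ?a - of_nat 2" by simp
      hence "of_real ?l powr (- (s + of_nat (Suc j) + of_nat (Suc i))) = of_real ?l powr ?a / of_real ?l ^ 2"
        using l0 by (simp only: powr_diff powr_nat if_False)
      thus ?thesis by (simp add: field_simps)
    qed
    have 2: "?a - 1 = - (s + of_nat (Suc j) + of_nat i)" by simp
    have "((\<lambda>z. of_real (lin c d z) powr ?a * G i (?h z)) has_vector_derivative
       of_real ?l powr ?a * ((?e / ?l\<^sup>2) *\<^sub>R G (Suc i) (?h z)) + (?a * of_real c * of_real ?l powr (?a - 1)) * G i (?h z)) (at z within {0..1})"
      by (intro has_vector_derivative_mult lin_powr_deriv pos moebius_comp_deriv[OF gm z G[OF i hz]])
    hence "((\<lambda>z. kap s j i * (of_real (?e ^ i * c ^ (j - i)) * (of_real (lin c d z) powr ?a * G i (?h z)))) has_vector_derivative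
       kap s j i * (of_real (?e ^ i * c ^ (j - i)) * (of_real ?l powr ?a * ((?e / ?l\<^sup>2) *\<^sub>R G (Suc i) (?h z)) + (?a * of_real c * of_real ?l powr (?a - 1)) * G i (?h z)))) (at z within {0..1})"
      by (intro has_vector_derivative_mult_right)
    moreover have "of_real (?e ^ i * c ^ (j - i)) * (of_real ?l powr ?a * ((?e / ?l\<^sup>2) *\<^sub>R G (Suc i) (?h z)) + (?a * of_real c * of_real ?l powr (?a - 1)) * G i (?h z))
       = ?a * Y i + Y (Suc i)"
      unfolding scaleR_conv_of_real 1 2 distrib_left Y_def using i by (simp add: Suc_diff_le del: of_nat_Suc)
    ultimately show ?thesis by simp
  qed
  have "(moebius_jet s a b c d G j has_vector_derivative (\<Sum>i\<le>j. kap s j i * (- (s + of_nat j + of_nat i) * Y i + Y (Suc i)))) (at z within {0..1})"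
    unfolding moebius_jet_def[abs_def] by (intro has_vector_derivative_sum t) auto
  moreover have "(\<Sum>i\<le>j. kap s j i * (- (s + of_nat j + of_nat i) * Y i + Y (Suc i))) = moebius_jet s a b c d G (Suc j) z"
  proof -
    have "moebius_jet s a b c d G (Suc j) z = (\<Sum>i\<le>Suc j. kap s (Suc j) i * Y i)"
      unfolding moebius_jet_def Y_def by simp
    also have "\<dots> = (\<Sum>i\<le>Suc j. - (s + of_nat j + of_nat i) * kap s j i * Y i) + (\<Sum>i\<le>Suc j. (if i = 0 then 0 else kap s j (i - 1)) * Y i)"
      unfolding sum.distrib[symmetric] by (intro sum.cong) (simp_all only: kap.simps distrib_right)
    also have "(\<Sum>i\<le>Suc j. - (s + of_nat j + of_nat i) * kap s j i * Y i) = (\<Sum>i\<le>j. - (s + of_nat j + of_nat i) * kap s j i * Y i)"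
      by (simp add: kap_zero)
    also have "(\<Sum>i\<le>Suc j. (if i = 0 then 0 else kap s j (i - 1)) * Y i) = (\<Sum>i\<le>j. kap s j i * Y (Suc i))"
      by (subst sum.atMost_Suc_shift) simp
    finally show ?thesis by (simp add: sum.distrib[symmetric] algebra_simps)
  qed
  ultimately show ?thesis by simp
qed

lemma lin_powr_bound:
  assumes "0 \<le> c" "c \<le> d" "1 \<le> d" "z \<in> {0..1}" and p: "\<bar>Re a\<bar> \<le> q"
  shows "cmod (of_real (lin c d z) powr a) \<le> 2 powr q * d powr Re a"
proof -
  note l = lin_bounds[OF assms(1-4)]
  have "cmod (of_real (lin c d z) powr a) = lin c d z powr Re a"
    using l by (simp add: norm_powr_real_powr)
  also have "\<dots> \<le> 2 powr q * d powr Re a"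
  proof (cases "Re a \<ge> 0")
    case True
    have "lin c d z powr Re a \<le> (2 * d) powr Re a" using l True by (intro powr_mono2) auto
    also have "\<dots> = 2 powr Re a * d powr Re a" using assms by (simp add: powr_mult)
    also have "\<dots> \<le> 2 powr q * d powr Re a" using True p by (intro mult_right_mono powr_mono) auto
    finally show ?thesis .
  next
    case False
    have "lin c d z powr Re a \<le> 1 * d powr Re a" using l False assms by (simp add: powr_mono2')
    also have "\<dots> \<le> 2 powr q * d powr Re a" using p by (intro mult_right_mono ge_one_powr_ge_zero) auto
    finally show ?thesis .
  qed
  finally show ?thesis .
qed

context holder_space
begin

text \<open>Depends on \<open>s\<close> and \<open>k\<close> but not on the map, hence is common to
  all words of all lengths.\<close>

definition moebius_const :: "complex \<Rightarrow> real" where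
  "moebius_const s = (\<Sum>j\<le>k. \<Sum>i\<le>k. cmod (kap s j i)) * ((cmod s + 2 * real k + 1) * 2 powr (\<bar>Re s\<bar> + 2 * real k + 1))"

text \<open>The i-th derivative of \<open>G\<close> contributes
  \<open>\<delta> powr (\<alpha> - i)\<close>, and its coefficient
  \<open>d powr (- Re s - 2 * i)\<close>, at most \<open>d powr (- Re s) * \<delta> powr i\<close>.
  So every order yields the same product, as computed in \<open>key\<close>. The parameter
  \<open>\<delta>\<close> is \<open>d powr (-2)\<close> for expansion at the base point of a
  cylinder and \<open>1 / d\<close> for expansion at 0.\<close>

lemma moebius_jet_bounds:
  fixes G :: "nat \<Rightarrow> real \<Rightarrow> complex" and s :: complex
  assumes gm: "good_moebius a b c d" and \<delta>: "d powr (-2) \<le> \<delta>" "\<delta> \<le> 1" and \<Gamma>: "\<Gamma> \<ge> 0"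
    and G: "\<And>i x. i < k \<Longrightarrow> x \<in> {0..1} \<Longrightarrow> (G i has_vector_derivative G (Suc i) x) (at x within {0..1})"
    and Gb: "\<And>i z. i \<le> k \<Longrightarrow> z \<in> {0..1} \<Longrightarrow> cmod (G i (moebius_map a b c d z)) \<le> \<Gamma> * \<delta> powr (\<alpha> - real i)"
    and Gh: "\<And>x y. x \<in> {0..1} \<Longrightarrow> y \<in> {0..1} \<Longrightarrow> cmod (G k x - G k y) \<le> \<Gamma> * \<bar>x - y\<bar> powr \<eta>"
  defines "B \<equiv> moebius_const s * (\<Gamma> * d powr (- Re s) * \<delta> powr \<alpha>)"
  shows "j \<le> k \<Longrightarrow> z \<in> {0..1} \<Longrightarrow> cmod (moebius_jet s a b c d G j z) \<le> B"
    and "z \<in> {0..1} \<Longrightarrow> y \<in> {0..1} \<Longrightarrow> cmod (moebius_jet s a b c d G k z - moebius_jet s a b c d G k y) \<le> B * \<bar>z - y\<bar> powr \<eta>"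
proof -
  have cd: "0 \<le> c" "c \<le> d" "1 \<le> d" and e1: "\<bar>a * d - b * c\<bar> = 1" using gm unfolding good_moebius_def by auto
  have dpos: "d > 0" using cd by simp
  have \<delta>pos: "\<delta> > 0" using \<delta> dpos by (smt (verit) powr_gt_zero)
  let ?e = "a * d - b * c" and ?h = "moebius_map a b c d"
  define P where "P j i z = of_real (?e ^ i * c ^ (j - i)) * of_real (lin c d z) powr (- (s + of_nat j + of_nat i))" for j i z
  define q where "q = \<bar>Re s\<bar> + 2 * real k + 1"
  have ei: "\<bar>?e ^ i\<bar> = 1" for i using e1 by (simp add: power_abs)
  have key: "d powr (- Re s - 2 * real i) * (\<Gamma> * \<delta> powr (\<alpha> - real i)) \<le> \<Gamma> * d powr (- Re s) * \<delta> powr \<alpha>" if "i \<le> k" for i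
  proof -
    have "d powr (- 2 * real i) = (d powr (-2)) powr real i" by (simp add: powr_powr)
    also have "\<dots> \<le> \<delta> powr real i" using \<delta> by (intro powr_mono2) auto
    finally have 1: "d powr (- 2 * real i) \<le> \<delta> powr real i" .
    have "d powr (- Re s - 2 * real i) = d powr (- Re s) * d powr (- 2 * real i)" by (simp add: powr_add[symmetric])
    also have "\<dots> \<le> d powr (- Re s) * \<delta> powr real i" by (intro mult_left_mono 1) auto
    finally have "d powr (- Re s - 2 * real i) * (\<Gamma> * \<delta> powr (\<alpha> - real i)) \<le> (d powr (- Re s) * \<delta> powr real i) * (\<Gamma> * \<delta> powr (\<alpha> - real i))"
      using \<Gamma> by (intro mult_right_mono) auto
    also have "\<dots> = \<Gamma> * d powr (- Re s) * (\<delta> powr real i * \<delta> powr (\<alpha> - real i))" by (simp only: mult_ac)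
    also have "\<delta> powr real i * \<delta> powr (\<alpha> - real i) = \<delta> powr \<alpha>" by (simp add: powr_add[symmetric])
    finally show ?thesis .
  qed
  have cpow: "c ^ n \<le> d ^ n" for n using cd by (intro power_mono) auto
  have Pb: "cmod (P j i z) \<le> 2 powr q * d powr (- Re s - 2 * real i)" if ij: "i \<le> j" "j \<le> k" and z: "z \<in> {0..1}" for i j z
  proof -
    have "cmod (of_real (lin c d z) powr (- (s + of_nat j + of_nat i))) \<le> 2 powr q * d powr Re (- (s + of_nat j + of_nat i))"
      by (rule lin_powr_bound[OF cd z]) (use ij in \<open>auto simp: q_def\<close>)
    hence 1: "cmod (of_real (lin c d z) powr (- (s + of_nat j + of_nat i))) \<le> 2 powr q * d powr (- Re s - real j - real i)" by simp
    have "cmod (P j i z) = c ^ (j - i) * cmod (of_real (lin c d z) powr (- (s + of_nat j + of_nat i)))"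
      unfolding P_def norm_mult norm_of_real abs_mult ei using cd by simp
    also have "\<dots> \<le> d ^ (j - i) * (2 powr q * d powr (- Re s - real j - real i))"
      using cpow 1 cd by (intro mult_mono) auto
    also have "d ^ (j - i) = d powr (real j - real i)" using ij dpos by (simp add: powr_realpow[symmetric] of_nat_diff)
    also have "d powr (real j - real i) * (2 powr q * d powr (- Re s - real j - real i)) = 2 powr q * (d powr (real j - real i) * d powr (- Re s - real j - real i))"
      by (simp only: mult_ac)
    also have "d powr (real j - real i) * d powr (- Re s - real j - real i) = d powr (- Re s - 2 * real i)"
      unfolding powr_add[symmetric] by (rule arg_cong[of _ _ "(powr) d"]) simp
    finally show ?thesis .
  qed
  have Pd: "cmod (P k i z - P k i y) \<le> (cmod s + 2 * real k) * 2 powr q * d powr (- Re s - 2 * real i) * \<bar>z - y\<bar>"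
    if i: "i \<le> k" and zy: "z \<in> {0..1}" "y \<in> {0..1}" for i z y
  proof (rule vector_mvt_bound[where S = "{0..1}"])
    let ?p = "- (s + of_nat k + of_nat i)"
    fix u :: real assume u: "u \<in> {0..1}"
    show "(P k i has_vector_derivative of_real (?e ^ i * c ^ (k - i)) * (?p * of_real c * of_real (lin c d u) powr (?p - 1))) (at u within {0..1})"
      unfolding P_def[abs_def] using lin_bounds(3)[OF cd u] by (intro has_vector_derivative_mult_right lin_powr_deriv)
    have "cmod (of_real (lin c d u) powr (?p - 1)) \<le> 2 powr q * d powr Re (?p - 1)"
      by (rule lin_powr_bound[OF cd u]) (use i in \<open>auto simp: q_def\<close>)
    hence 1: "cmod (of_real (lin c d u) powr (?p - 1)) \<le> 2 powr q * d powr (- Re s - real k - real i - 1)" by simp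
    have 2: "cmod ?p \<le> cmod s + 2 * real k"
    proof -
      have "cmod ?p \<le> cmod s + real k + real i"
        unfolding norm_minus_cancel
        using norm_triangle_ineq[of "s + of_nat k" "of_nat i"] norm_triangle_ineq[of s "of_nat k"] by simp
      thus ?thesis using i by simp
    qed
    have "cmod (of_real (?e ^ i * c ^ (k - i)) * (?p * of_real c * of_real (lin c d u) powr (?p - 1)))
       = cmod ?p * (c ^ Suc (k - i) * cmod (of_real (lin c d u) powr (?p - 1)))"
      unfolding norm_mult norm_of_real abs_mult ei using cd by simp
    also have "\<dots> \<le> (cmod s + 2 * real k) * (d ^ Suc (k - i) * (2 powr q * d powr (- Re s - real k - real i - 1)))"
      using cd by (intro mult_mono 1 2 cpow mult_nonneg_nonneg) auto
    also have "d ^ Suc (k - i) = d powr (real k - real i + 1)"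
      using i dpos by (subst powr_realpow[symmetric]) (auto simp: of_nat_diff add.commute)
    also have "(cmod s + 2 * real k) * (d powr (real k - real i + 1) * (2 powr q * d powr (- Re s - real k - real i - 1)))
      = (cmod s + 2 * real k) * 2 powr q * (d powr (real k - real i + 1) * d powr (- Re s - real k - real i - 1))" by (simp only: mult_ac)
    also have "d powr (real k - real i + 1) * d powr (- Re s - real k - real i - 1) = d powr (- Re s - 2 * real i)"
      unfolding powr_add[symmetric] by (rule arg_cong[of _ _ "(powr) d"]) simp
    finally show "cmod (of_real (?e ^ i * c ^ (k - i)) * (?p * of_real c * of_real (lin c d u) powr (?p - 1)))
       \<le> (cmod s + 2 * real k) * 2 powr q * d powr (- Re s - 2 * real i)" .
  qed (use zy in auto)
  \<comment> \<open>For a Moebius map of determinant 1 or -1 the difference quotient is exactly the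
    inverse product of the two denominators, up to sign.\<close>
  have hdiff: "\<bar>?h z - ?h y\<bar> \<le> \<delta> * \<bar>z - y\<bar>" if zy: "z \<in> {0..1}" "y \<in> {0..1}" for z y
  proof -
    have lz: "lin c d z \<ge> d" "lin c d y \<ge> d" using lin_bounds(1)[OF cd] zy by auto
    have "?h z - ?h y = ?e * (z - y) / (lin c d z * lin c d y)"
      unfolding moebius_map_def using lz dpos by (simp add: field_simps) (simp add: lin_def algebra_simps)
    hence "\<bar>?h z - ?h y\<bar> = \<bar>z - y\<bar> / (lin c d z * lin c d y)" using e1 lz dpos by (simp add: abs_mult)
    also have "\<dots> \<le> \<bar>z - y\<bar> / (d * d)" using lz dpos by (intro divide_left_mono mult_mono) auto
    also have "\<dots> = d powr (-2) * \<bar>z - y\<bar>" using dpos by (simp add: powr_minus powr_numeral power2_eq_square field_simps)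
    also have "\<dots> \<le> \<delta> * \<bar>z - y\<bar>" using \<delta> by (intro mult_right_mono) auto
    finally show ?thesis .
  qed
  \<comment> \<open>Below order \<open>k\<close> the next derivative gives a Lipschitz bound, and
    the factor \<open>\<delta>\<close> from the derivative of the map restores the lost power of
    \<open>\<delta>\<close>. At order \<open>k\<close> the contraction enters the Hoelder bound and
    supplies \<open>\<delta> powr \<eta>\<close>.\<close>
  have Gd: "cmod (G i (?h z) - G i (?h y)) \<le> \<Gamma> * \<delta> powr (\<alpha> - real i) * \<bar>z - y\<bar> powr \<eta>"
    if i: "i \<le> k" and zy: "z \<in> {0..1}" "y \<in> {0..1}" for i z y
  proof (cases "i < k")
    case True
    have "cmod (G i (?h z) - G i (?h y)) \<le> (\<Gamma> * \<delta> powr (\<alpha> - real i)) * \<bar>z - y\<bar>"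
    proof (rule vector_mvt_bound[where S = "{0..1}"])
      fix u :: real assume u: "u \<in> {0..1}"
      have hu: "?h u \<in> {0..1}" using gm u unfolding good_moebius_def by blast
      show "((\<lambda>z. G i (?h z)) has_vector_derivative (?e / (lin c d u)\<^sup>2) *\<^sub>R G (Suc i) (?h u)) (at u within {0..1})"
        by (rule moebius_comp_deriv[OF gm u G[OF True hu]])
      have lu: "lin c d u \<ge> d" using lin_bounds(1)[OF cd u] .
      have "1 / (lin c d u)\<^sup>2 \<le> 1 / d\<^sup>2" using lu dpos by (intro divide_left_mono power_mono) auto
      also have "1 / d\<^sup>2 = d powr (-2)" using dpos by (simp add: powr_minus powr_numeral field_simps)
      finally have 1: "1 / (lin c d u)\<^sup>2 \<le> \<delta>" using \<delta> by linarith
      have "cmod ((?e / (lin c d u)\<^sup>2) *\<^sub>R G (Suc i) (?h u)) = 1 / (lin c d u)\<^sup>2 * cmod (G (Suc i) (?h u))"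
        using e1 by (simp add: abs_divide)
      also have "\<dots> \<le> \<delta> * (\<Gamma> * \<delta> powr (\<alpha> - real (Suc i)))"
        using True u \<Gamma> \<delta>pos by (intro mult_mono 1 Gb) auto
      also have "\<dots> = \<Gamma> * (\<delta> powr 1 * \<delta> powr (\<alpha> - real (Suc i)))" using \<delta>pos by simp
      also have "\<delta> powr 1 * \<delta> powr (\<alpha> - real (Suc i)) = \<delta> powr (\<alpha> - real i)" unfolding powr_add[symmetric] by simp
      finally show "cmod ((?e / (lin c d u)\<^sup>2) *\<^sub>R G (Suc i) (?h u)) \<le> \<Gamma> * \<delta> powr (\<alpha> - real i)" .
    qed (use zy in auto)
    also have "\<dots> \<le> \<Gamma> * \<delta> powr (\<alpha> - real i) * \<bar>z - y\<bar> powr \<eta>"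
      using zy \<eta>_less \<Gamma> by (intro mult_left_mono abs_le_powr) auto
    finally show ?thesis .
  next
    case False
    hence ik: "i = k" using i by simp
    have "cmod (G k (?h z) - G k (?h y)) \<le> \<Gamma> * \<bar>?h z - ?h y\<bar> powr \<eta>"
      using gm zy unfolding good_moebius_def by (intro Gh) auto
    also have "\<dots> \<le> \<Gamma> * (\<delta> * \<bar>z - y\<bar>) powr \<eta>"
      using hdiff[OF zy] \<eta>_nonneg \<Gamma> by (intro mult_left_mono powr_mono2) auto
    also have "\<dots> = \<Gamma> * \<delta> powr \<eta> * \<bar>z - y\<bar> powr \<eta>" using \<delta>pos by (simp add: powr_mult)
    finally have le: "cmod (G k (?h z) - G k (?h y)) \<le> \<Gamma> * \<delta> powr \<eta> * \<bar>z - y\<bar> powr \<eta>" .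
    have e: "\<alpha> - real k = \<eta>" using \<alpha>_eq by linarith
    show ?thesis unfolding ik e by (rule le)
  qed
  have jet: "moebius_jet s a b c d G j z = (\<Sum>i\<le>j. kap s j i * (P j i z * G i (?h z)))" for j z
    unfolding moebius_jet_def P_def by (simp add: mult.assoc)
  define X where "X = \<Gamma> * d powr (- Re s) * \<delta> powr \<alpha>"
  have X0: "X \<ge> 0" unfolding X_def using \<Gamma> by auto
  have q0: "2 powr q \<ge> 0" by simp
  have kap_le: "(\<Sum>i\<le>j. cmod (kap s j i)) \<le> (\<Sum>j\<le>k. \<Sum>i\<le>k. cmod (kap s j i))" if "j \<le> k" for j
  proof -
    have "(\<Sum>i\<le>j. cmod (kap s j i)) \<le> (\<Sum>i\<le>k. cmod (kap s j i))" using that by (intro sum_mono2) auto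
    also have "\<dots> \<le> (\<Sum>j\<le>k. \<Sum>i\<le>k. cmod (kap s j i))"
      using that by (intro member_le_sum[of j "{..k}" "\<lambda>j. \<Sum>i\<le>k. cmod (kap s j i)"] sum_nonneg) auto
    finally show ?thesis .
  qed
  show "cmod (moebius_jet s a b c d G j z) \<le> B" if j: "j \<le> k" and z: "z \<in> {0..1}" for j z
  proof -
    have t: "cmod (kap s j i * (P j i z * G i (?h z))) \<le> cmod (kap s j i) * (2 powr q * X)" if i: "i \<le> j" for i
    proof -
      have "cmod (P j i z) * cmod (G i (?h z)) \<le> (2 powr q * d powr (- Re s - 2 * real i)) * (\<Gamma> * \<delta> powr (\<alpha> - real i))"
        using i j z by (intro mult_mono Pb Gb) auto
      also have "\<dots> \<le> 2 powr q * X" using key[of i] i j unfolding X_def by (simp add: mult.assoc)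
      finally show ?thesis unfolding norm_mult by (intro mult_left_mono) auto
    qed
    have "cmod (moebius_jet s a b c d G j z) \<le> (\<Sum>i\<le>j. cmod (kap s j i) * (2 powr q * X))"
      unfolding jet by (rule sum_norm_le, rule t) simp
    also have "\<dots> = (\<Sum>i\<le>j. cmod (kap s j i)) * (2 powr q * X)" by (simp only: sum_distrib_right)
    also have "\<dots> \<le> (\<Sum>j\<le>k. \<Sum>i\<le>k. cmod (kap s j i)) * (((cmod s + 2 * real k + 1) * 2 powr q) * X)"
    proof (rule mult_mono[OF kap_le[OF j]])
      have "1 * (2 powr q * X) \<le> (cmod s + 2 * real k + 1) * (2 powr q * X)" using X0 by (intro mult_right_mono) auto
      thus "2 powr q * X \<le> (cmod s + 2 * real k + 1) * 2 powr q * X" by (simp add: mult.assoc)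
    qed (use X0 in \<open>auto intro!: sum_nonneg\<close>)
    also have "\<dots> = B" unfolding B_def moebius_const_def X_def q_def by (simp only: mult.assoc)
    finally show ?thesis .
  qed
  show "cmod (moebius_jet s a b c d G k z - moebius_jet s a b c d G k y) \<le> B * \<bar>z - y\<bar> powr \<eta>"
    if zy: "z \<in> {0..1}" "y \<in> {0..1}" for z y
  proof -
    let ?c = "(cmod s + 2 * real k + 1) * 2 powr q" and ?r = "\<bar>z - y\<bar> powr \<eta>"
    have t: "cmod (kap s k i * (P k i z * G i (?h z)) - kap s k i * (P k i y * G i (?h y))) \<le> cmod (kap s k i) * (?c * X * ?r)" if i: "i \<le> k" for i
    proof -
      have r: "\<bar>z - y\<bar> \<le> ?r" using zy \<eta>_less by (intro abs_le_powr) auto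
      have kk: "d powr (- Re s - 2 * real i) * (\<Gamma> * \<delta> powr (\<alpha> - real i)) \<le> X" using key[OF i] unfolding X_def .
      have eq: "P k i z * G i (?h z) - P k i y * G i (?h y) = (P k i z - P k i y) * G i (?h z) + P k i y * (G i (?h z) - G i (?h y))"
        by (simp add: algebra_simps)
      have "cmod ((P k i z - P k i y) * G i (?h z)) \<le> ((cmod s + 2 * real k) * 2 powr q * d powr (- Re s - 2 * real i) * \<bar>z - y\<bar>) * (\<Gamma> * \<delta> powr (\<alpha> - real i))"
        unfolding norm_mult using zy i by (intro mult_mono Pd Gb) auto
      also have "\<dots> = (cmod s + 2 * real k) * 2 powr q * \<bar>z - y\<bar> * (d powr (- Re s - 2 * real i) * (\<Gamma> * \<delta> powr (\<alpha> - real i)))" by (simp only: mult_ac)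
      also have "\<dots> \<le> (cmod s + 2 * real k) * 2 powr q * ?r * X" using r kk \<Gamma> by (intro mult_mono) auto
      finally have 1: "cmod ((P k i z - P k i y) * G i (?h z)) \<le> (cmod s + 2 * real k) * 2 powr q * ?r * X" .
      have "cmod (P k i y * (G i (?h z) - G i (?h y))) \<le> (2 powr q * d powr (- Re s - 2 * real i)) * (\<Gamma> * \<delta> powr (\<alpha> - real i) * ?r)"
        unfolding norm_mult using zy i by (intro mult_mono Pb Gd) auto
      also have "\<dots> = 2 powr q * ?r * (d powr (- Re s - 2 * real i) * (\<Gamma> * \<delta> powr (\<alpha> - real i)))" by (simp only: mult_ac)
      also have "\<dots> \<le> 2 powr q * ?r * X" using kk by (intro mult_left_mono) auto
      finally have 2: "cmod (P k i y * (G i (?h z) - G i (?h y))) \<le> 2 powr q * ?r * X" .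
      have "cmod (P k i z * G i (?h z) - P k i y * G i (?h y)) \<le> ?c * X * ?r"
        unfolding eq using norm_triangle_ineq[of "(P k i z - P k i y) * G i (?h z)" "P k i y * (G i (?h z) - G i (?h y))"] 1 2
        by (simp add: algebra_simps)
      thus ?thesis unfolding right_diff_distrib[symmetric] norm_mult by (intro mult_left_mono) auto
    qed
    have "cmod (moebius_jet s a b c d G k z - moebius_jet s a b c d G k y) \<le> (\<Sum>i\<le>k. cmod (kap s k i) * (?c * X * ?r))"
      unfolding jet sum_subtractf[symmetric] by (rule sum_norm_le, rule t) simp
    also have "\<dots> = (\<Sum>i\<le>k. cmod (kap s k i)) * (?c * X * ?r)" by (simp only: sum_distrib_right)
    also have "\<dots> \<le> (\<Sum>j\<le>k. \<Sum>i\<le>k. cmod (kap s j i)) * (?c * X * ?r)"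
      using X0 by (intro mult_right_mono kap_le) auto
    also have "\<dots> = B * ?r" unfolding B_def moebius_const_def X_def q_def by (simp only: mult.assoc)
    finally show ?thesis .
  qed
qed

end

section \<open>The transfer operator on Hoelder spaces\<close>

lemma moebius_jet_continuous:
  assumes gm: "good_moebius a b c d" and G: "\<And>i. i \<le> j \<Longrightarrow> continuous_on {0..1} (G i)"
  shows "continuous_on {0..1} (moebius_jet s a b c d G j)"
proof -
  have cd: "0 \<le> c" "c \<le> d" "1 \<le> d" using gm unfolding good_moebius_def by auto
  have h: "continuous_on {0..1} (moebius_map a b c d)"
    using moebius_deriv[OF lin_bounds(3)[OF cd]]
    by (meson continuous_on_eq_continuous_within has_vector_derivative_continuous)
  have l: "continuous_on {0..1} (\<lambda>z. of_real (lin c d z) powr x :: complex)" for x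
    using lin_powr_deriv[OF lin_bounds(3)[OF cd]]
    by (meson continuous_on_eq_continuous_within has_vector_derivative_continuous)
  have "moebius_map a b c d ` {0..1} \<subseteq> {0..1}" using gm unfolding good_moebius_def by blast
  hence "continuous_on {0..1} (\<lambda>z. G i (moebius_map a b c d z))" if "i \<le> j" for i
    by (rule continuous_on_compose2[OF G[OF that] h])
  thus ?thesis unfolding moebius_jet_def[abs_def]
    by (intro continuous_on_sum continuous_on_mult continuous_on_const l) auto
qed

text \<open>\<open>b / d\<close> is the image of 0, and the distance to it is exactly
  \<open>z\<close> over the product of the denominators at \<open>z\<close> and at 0.\<close>

lemma moebius_dist:
  assumes gm: "good_moebius a b c d" and z: "z \<in> {0..1}"
  shows "\<bar>moebius_map a b c d z - b / d\<bar> \<le> d powr (-2)" "b / d \<in> {0..1}"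
proof -
  have cd: "0 \<le> c" "c \<le> d" "1 \<le> d" and e: "\<bar>a * d - b * c\<bar> = 1" using gm unfolding good_moebius_def by auto
  have l: "d \<le> lin c d z" by (rule lin_bounds(1)[OF cd z])
  have dp: "d > 0" using cd by simp
  have "moebius_map a b c d z - b / d = (a * d - b * c) * z / (lin c d z * d)"
    unfolding moebius_map_def using l dp by (simp add: field_simps) (simp add: lin_def algebra_simps)
  hence "\<bar>moebius_map a b c d z - b / d\<bar> = z / (lin c d z * d)" using e l dp z by (simp add: abs_mult)
  also have "\<dots> \<le> 1 / (d * d)" using l dp z by (intro frac_le mult_mono) auto
  also have "\<dots> = d powr (-2)" using dp by (simp add: powr_minus powr_numeral power2_eq_square field_simps)
  finally show "\<bar>moebius_map a b c d z - b / d\<bar> \<le> d powr (-2)" .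
  have "moebius_map a b c d 0 \<in> {0..1}" using gm unfolding good_moebius_def by auto
  thus "b / d \<in> {0..1}" by (simp add: moebius_map_def lin_def)
qed

text \<open>
  A word \<open>[m1, m2, ...]\<close> stands for the inverse branch \<open>z \<mapsto> 1 / (m1 + 1 + 1 / (m2 + 1 + ...))\<close> read from
  the inside out, i.e. the letter \<open>m1\<close> acts first; its matrix has the rows \<open>cf_row (1, 0)\<close> and \<open>cf_row (0, 1)\<close>.
\<close>

fun cf_row :: "real \<times> real \<Rightarrow> nat list \<Rightarrow> real \<times> real" where
  "cf_row p [] = p"
| "cf_row p (m # w) = (snd (cf_row p w), fst (cf_row p w) + real (Suc m) * snd (cf_row p w))"

abbreviation cf_a where "cf_a w \<equiv> fst (cf_row (1, 0) w)"
abbreviation cf_b where "cf_b w \<equiv> snd (cf_row (1, 0) w)"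
abbreviation cf_c where "cf_c w \<equiv> fst (cf_row (0, 1) w)"
abbreviation cf_d where "cf_d w \<equiv> snd (cf_row (0, 1) w)"

abbreviation cf_map :: "nat list \<Rightarrow> real \<Rightarrow> real" where
  "cf_map w \<equiv> moebius_map (cf_a w) (cf_b w) (cf_c w) (cf_d w)"
abbreviation cf_den :: "nat list \<Rightarrow> real \<Rightarrow> real" where
  "cf_den w \<equiv> lin (cf_c w) (cf_d w)"

lemma inverse_Suc_mem: "z \<in> {0..1} \<Longrightarrow> 1 / (z + real (Suc m)) \<in> {0..1}"
  by (auto simp: field_simps)

text \<open>The cocycle rule for denominators: weights multiply along a word, which is why a product
  of weighted compositions is again one.\<close>

lemma cf_den_Cons:
  assumes "z \<in> {0..1}"
  shows "cf_den (m # w) z = (z + real (Suc m)) * cf_den w (1 / (z + real (Suc m)))"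
proof -
  have "z + real (Suc m) \<noteq> 0" using assms by auto
  thus ?thesis by (simp add: lin_def field_simps)
qed

lemma cf_map_Cons:
  assumes "z \<in> {0..1}"
  shows "cf_map (m # w) z = cf_map w (1 / (z + real (Suc m)))"
proof -
  let ?u = "z + real (Suc m)"
  have u: "?u \<noteq> 0" using assms by auto
  have n: "cf_a (m # w) * z + cf_b (m # w) = ?u * (cf_a w * (1 / ?u) + cf_b w)"
    using u by (simp add: field_simps)
  show ?thesis unfolding moebius_map_def cf_den_Cons[OF assms] n using u by simp
qed

text \<open>Each letter flips the sign of the determinant, which is why \<open>good_moebius\<close>
  asks only for its modulus. The inequality \<open>cf_c \<le> cf_d\<close> persists because a letter
  adds at least one old \<open>cf_d\<close>, which becomes the new \<open>cf_c\<close>.\<close>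

lemma cf_good: "good_moebius (cf_a w) (cf_b w) (cf_c w) (cf_d w)"
proof (induction w)
  case Nil show ?case unfolding good_moebius_def by (simp add: moebius_map_def lin_def)
next
  case (Cons m w)
  have IH: "0 \<le> cf_c w" "cf_c w \<le> cf_d w" "1 \<le> cf_d w" "\<bar>cf_a w * cf_d w - cf_b w * cf_c w\<bar> = 1"
    and map: "\<And>z. z \<in> {0..1} \<Longrightarrow> cf_map w z \<in> {0..1}" using Cons unfolding good_moebius_def by auto
  have "cf_map (m # w) z \<in> {0..1}" if "z \<in> {0..1}" for z
    unfolding cf_map_Cons[OF that] by (rule map[OF inverse_Suc_mem[OF that]])
  moreover have "0 \<le> cf_c (m # w)" using IH by simp
  moreover have "1 * cf_d w \<le> real (Suc m) * cf_d w" using IH by (intro mult_right_mono) auto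
  hence "cf_c (m # w) \<le> cf_d (m # w)" "1 \<le> cf_d (m # w)" unfolding cf_row.simps fst_conv snd_conv using IH by linarith+
  moreover have "cf_a (m # w) * cf_d (m # w) - cf_b (m # w) * cf_c (m # w) = - (cf_a w * cf_d w - cf_b w * cf_c w)"
    by (simp add: algebra_simps)
  ultimately show ?case using IH(4) unfolding good_moebius_def by (metis abs_minus_cancel)
qed

text \<open>The alphabet is cut off at \<open>M\<close> letters to keep the sums finite; the bounds
  on them do not involve \<open>M\<close>.\<close>

definition words :: "nat \<Rightarrow> nat \<Rightarrow> nat list set" where
  "words n M = {w. set w \<subseteq> {..<M} \<and> length w = n}"

lemma sum_words_Suc:
  "(\<Sum>w\<in>words (Suc n) M. F w) = (\<Sum>m<M. \<Sum>w\<in>words n M. F (m # w))" for F :: "nat list \<Rightarrow> 'b::comm_monoid_add"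
proof -
  have eq: "words (Suc n) M = (\<lambda>(m, w). m # w) ` ({..<M} \<times> words n M)"
    unfolding words_def by (auto simp: length_Suc_conv image_iff)
  have "(\<Sum>w\<in>words (Suc n) M. F w) = (\<Sum>(m, w)\<in>{..<M} \<times> words n M. F (m # w))"
    unfolding eq by (subst sum.reindex) (auto simp: inj_on_def case_prod_unfold)
  thus ?thesis by (simp add: sum.cartesian_product)
qed

lemma words_0: "words 0 M = {[]}"
  unfolding words_def by auto

definition one_disc :: "complex \<Rightarrow> complex" where
  "one_disc z = (if z \<in> cball 1 (3/2) then 1 else 0)"

lemma one_disc_mem: "one_disc \<in> A_space"
  unfolding one_disc_def[abs_def] by (rule A_spaceI) (auto intro: holomorphic_intros)

lemma interval_in_cdisc: "x \<in> {0..1} \<Longrightarrow> complex_of_real x \<in> cball 1 (3/2)"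
proof -
  assume "x \<in> {0..1}"
  hence "cmod (of_real (1 - x)) \<le> 3/2" unfolding norm_of_real by auto
  thus ?thesis by (simp add: dist_norm)
qed

text \<open>Unrolling \<open>n\<close> applications of the Mayer operator to 1 gives the positive
  series of \<open>cf_den w x powr (- 2 * t)\<close> over all words, and the truncated sum is part
  of it. The real witness \<open>y\<close> carries positivity through an operator on complex
  functions; the induction needs all \<open>x\<close> because a letter moves \<open>x\<close> to
  \<open>1 / (x + Suc m)\<close>.\<close>

lemma sum_words_le_mayer:
  assumes t: "t > 1/2" and x: "x \<in> {0..1}"
  shows "\<exists>y. (mayer_op (of_real t) ^^ n) one_disc (of_real x) = of_real y \<and>
     (\<Sum>w\<in>words n M. cf_den w x powr (- 2 * t)) \<le> y"
  using x
proof (induction n arbitrary: x)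
  case 0
  thus ?case using interval_in_cdisc[OF 0] by (intro exI[of _ 1]) (simp add: words_0 lin_def one_disc_def)
next
  case (Suc n)
  let ?T = "mayer_op (of_real t)" and ?g = "(mayer_op (of_real t) ^^ n) one_disc"
  have gA: "?g \<in> A_space" by (rule A.funpow_mem[OF bounded_op_mayer one_disc_mem])
  define S where "S x = (\<Sum>w\<in>words n M. cf_den w x powr (- 2 * t))" for x
  obtain y where y: "\<And>x. x \<in> {0..1} \<Longrightarrow> ?g (of_real x) = of_real (y x)" "\<And>x. x \<in> {0..1} \<Longrightarrow> S x \<le> y x"
    using bchoice[of "{0..1}" "\<lambda>x y. ?g (of_real x) = of_real y \<and> S x \<le> y"] Suc.IH unfolding S_def by blast
  have S0: "S x \<ge> 0" for x unfolding S_def by (intro sum_nonneg) auto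
  define q where "q m = (x + real (Suc m)) powr (- 2 * t) * y (1 / (x + real (Suc m)))" for m
  have xm: "1 / (x + real (Suc m)) \<in> {0..1}" for m by (rule inverse_Suc_mem[OF Suc.prems])
  have tm: "mterm (of_real t) 0 m ?g (of_real x) = of_real (q m)" for m
  proof -
    have e: "complex_of_nat (Suc m) + of_real x = of_real (x + real (Suc m))" by simp
    have "of_real (x + real (Suc m)) powr (- (2 * of_real t)) = (of_real ((x + real (Suc m)) powr (- 2 * t)) :: complex)"
      using Suc.prems powr_of_real[of "x + real (Suc m)" "- 2 * t"] by simp
    moreover have "?g (1 / of_real (x + real (Suc m))) = of_real (y (1 / (x + real (Suc m))))"
      using y(1)[OF xm, of m] by (simp only: of_real_divide of_real_1)
    ultimately show ?thesis unfolding mterm_def star_def e q_def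
      using interval_in_cdisc[OF Suc.prems] by (simp only: if_True lessThan_0 sum.empty diff_zero of_real_mult)
  qed
  have K: "2 * Re (of_real t) + real 0 > 1" using t by simp
  have "summable (\<lambda>m. mterm (of_real t) 0 m ?g (of_real x))" by (rule mterm_series(3)[OF gA K])
  hence sq: "summable q" unfolding tm by (simp add: summable_of_real_iff)
  have "(?T ^^ Suc n) one_disc (of_real x) = (\<Sum>m. mterm (of_real t) 0 m ?g (of_real x))"
    using mayer_op_eq[OF gA K] by (simp add: mayer_reg_def)
  also have "\<dots> = of_real (\<Sum>m. q m)" unfolding tm by (rule suminf_of_real[OF sq, symmetric])
  finally have 1: "(?T ^^ Suc n) one_disc (of_real x) = of_real (\<Sum>m. q m)" .
  have q0: "q m \<ge> 0" for m
    unfolding q_def using y(2)[OF xm] S0[of "1 / (x + real (Suc m))"] by (intro mult_nonneg_nonneg) (auto intro: order_trans)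
  have "(\<Sum>w\<in>words (Suc n) M. cf_den w x powr (- 2 * t)) = (\<Sum>m<M. (x + real (Suc m)) powr (- 2 * t) * S (1 / (x + real (Suc m))))"
  proof -
    have "cf_den (m # w) x powr (- 2 * t) = (x + real (Suc m)) powr (- 2 * t) * cf_den w (1 / (x + real (Suc m))) powr (- 2 * t)" for m w
    proof -
      have "cf_den w (1 / (x + real (Suc m))) > 0"
        using cf_good[of w] lin_bounds(3)[OF _ _ _ xm] unfolding good_moebius_def by blast
      thus ?thesis unfolding cf_den_Cons[OF Suc.prems] by (intro powr_mult)
    qed
    thus ?thesis unfolding sum_words_Suc S_def by (simp only: sum_distrib_left)
  qed
  also have "\<dots> \<le> (\<Sum>m<M. q m)" unfolding q_def by (intro sum_mono mult_left_mono y(2) xm) auto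
  also have "\<dots> \<le> (\<Sum>m. q m)" by (rule sum_le_suminf[OF sq]) (auto simp: q0)
  finally show ?case using 1 by blast
qed

text \<open>The hypothesis is the convergence condition of the regularised series: the weight has
  order \<open>- 2 * Re \<beta>\<close> in \<open>n\<close>, and the Taylor remainder at 0, taken at
  a point of size \<open>1 / n\<close>, contributes \<open>- \<alpha>\<close>.\<close>

locale holder_transfer = holder_space +
  fixes \<beta> :: complex
  assumes \<beta>: "2 * Re \<beta> + \<alpha> > 1"
begin

definition U :: "real \<Rightarrow> real \<Rightarrow> real \<Rightarrow> real \<Rightarrow> (real \<Rightarrow> complex) \<Rightarrow> real \<Rightarrow> complex" where
  "U a b c d f = (\<lambda>z. if z \<in> {0..1} then of_real (lin c d z) powr (- (2 * \<beta>)) * f (moebius_map a b c d z) else 0)"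

text \<open>The part of \<open>U\<close> that is small: it differs from \<open>U\<close> by a finite
  rank operator, which evaluates the derivatives of \<open>f\<close> at \<open>p\<close>.\<close>

definition W :: "real \<Rightarrow> real \<Rightarrow> real \<Rightarrow> real \<Rightarrow> real \<Rightarrow> (real \<Rightarrow> complex) \<Rightarrow> real \<Rightarrow> complex" where
  "W a b c d p f = U a b c d (taylor_rem p f 0)"

definition W_const :: real where
  "W_const = (real k + 2) * (moebius_const (2 * \<beta>) * 2)"

lemma moebius_const_nonneg: "moebius_const s \<ge> 0"
  unfolding moebius_const_def by (intro mult_nonneg_nonneg sum_nonneg) auto

lemma W_const_nonneg: "W_const \<ge> 0"
  unfolding W_const_def using moebius_const_nonneg by auto

text \<open>\<open>moebius_jet_bounds\<close> applied to the tower of Taylor remainders. The 2 in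
  \<open>W_const\<close> comes from \<open>taylor_rem_bound\<close>, and \<open>k + 2\<close> counts
  the parts of the norm.\<close>

lemma W_bound:
  assumes gm: "good_moebius a b c d" and p: "p \<in> {0..1}" and \<delta>: "d powr (-2) \<le> \<delta>" "\<delta> \<le> 1"
    and hp: "\<And>z. z \<in> {0..1} \<Longrightarrow> \<bar>moebius_map a b c d z - p\<bar> \<le> \<delta>" and f: "f \<in> C_space \<alpha>"
  shows "W a b c d p f \<in> C_space \<alpha>"
    and "C_norm \<alpha> (W a b c d p f) \<le> W_const * (d powr (- 2 * Re \<beta>) * \<delta> powr \<alpha>) * C_norm \<alpha> f"
proof -
  let ?G = "taylor_rem p f" and ?h = "moebius_map a b c d"
  let ?F = "moebius_jet (2 * \<beta>) a b c d ?G"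
  define \<Gamma> where "\<Gamma> = 2 * C_norm \<alpha> f"
  have \<Gamma>: "\<Gamma> \<ge> 0" unfolding \<Gamma>_def using C_norm_nonneg[OF f] by simp
  define B where "B = moebius_const (2 * \<beta>) * (\<Gamma> * d powr (- Re (2 * \<beta>)) * \<delta> powr \<alpha>)"
  have hz: "?h z \<in> {0..1}" if "z \<in> {0..1}" for z using gm that unfolding good_moebius_def by blast
  have Gder: "(?G i has_vector_derivative ?G (Suc i) x) (at x within {0..1})" if "i < k" "x \<in> {0..1}" for i x
    by (rule taylor_rem_deriv[OF f that])
  have Gb: "cmod (?G i (?h z)) \<le> \<Gamma> * \<delta> powr (\<alpha> - real i)" if i: "i \<le> k" and z: "z \<in> {0..1}" for i z
  proof -
    have "cmod (?G i (?h z)) \<le> \<Gamma> * \<bar>?h z - p\<bar> powr (\<alpha> - real i)"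
      unfolding \<Gamma>_def by (rule taylor_rem_bound[OF f p i hz[OF z]])
    also have "\<dots> \<le> \<Gamma> * \<delta> powr (\<alpha> - real i)"
    proof (intro mult_left_mono powr_mono2 hp z \<Gamma>)
      show "0 \<le> \<alpha> - real i" using i \<alpha>_eq \<eta>_nonneg by linarith
    qed simp
    finally show ?thesis .
  qed
  have Gh: "cmod (?G k x - ?G k y) \<le> \<Gamma> * \<bar>x - y\<bar> powr \<eta>" if "x \<in> {0..1}" "y \<in> {0..1}" for x y
    unfolding taylor_rem_k \<Gamma>_def using C_norm_holder[OF f that] by simp
  note bd = moebius_jet_bounds[OF gm \<delta> \<Gamma> Gder Gb Gh, where s = "2 * \<beta>", folded B_def]
  have der: "(?F j has_vector_derivative ?F (Suc j) x) (at x within {0..1})" if "j < k" "x \<in> {0..1}" for j x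
    by (rule moebius_jet_deriv[OF gm that(2)]) (use Gder that in auto)
  have F0: "W a b c d p f z = ?F 0 z" if "z \<in> {0..1}" for z
    using that unfolding W_def U_def moebius_jet_def by simp
  have "continuous_on {0..1} (?G i)" if "i \<le> k" for i
  proof (cases "i = k")
    case True thus ?thesis using taylor_rem_continuous[OF f] by simp
  next
    case False
    hence "i < k" using that by simp
    thus ?thesis using Gder by (meson continuous_on_eq_continuous_within has_vector_derivative_continuous)
  qed
  hence cont: "continuous_on {0..1} (?F k)" by (intro moebius_jet_continuous[OF gm])
  show "W a b c d p f \<in> C_space \<alpha>"
    by (rule C_spaceI[of _ ?F, OF _ F0 der cont bd(2)]) (auto simp: W_def U_def)
  have "C_norm \<alpha> (W a b c d p f) \<le> (real k + 2) * B"
    by (rule C_norm_le[of _ ?F, OF F0 der bd])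
  also have "\<dots> = W_const * (d powr (- 2 * Re \<beta>) * \<delta> powr \<alpha>) * C_norm \<alpha> f"
    unfolding B_def \<Gamma>_def W_const_def by (simp add: mult_ac)
  finally show "C_norm \<alpha> (W a b c d p f) \<le> W_const * (d powr (- 2 * Re \<beta>) * \<delta> powr \<alpha>) * C_norm \<alpha> f" .
qed

lemma taylor_rem_0: "taylor_rem p f 0 x = f x - (\<Sum>j\<le>k. D j f p * of_real (x - p) ^ j / fact j)"
  unfolding taylor_rem_def by simp

lemma bounded_op_W:
  assumes gm: "good_moebius a b c d" and p: "p \<in> {0..1}" and \<delta>: "d powr (-2) \<le> \<delta>" "\<delta> \<le> 1"
    and hp: "\<And>z. z \<in> {0..1} \<Longrightarrow> \<bar>moebius_map a b c d z - p\<bar> \<le> \<delta>"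
  shows "bounded_op (C_space \<alpha>) (C_norm \<alpha>) (W a b c d p)"
proof (rule bounded_opI[OF W_bound(1)[OF assms] _ _ W_bound(2)[OF assms]])
  fix f g assume fg: "f \<in> C_space \<alpha>" "g \<in> C_space \<alpha>"
  show "W a b c d p (\<lambda>x. f x + g x) = (\<lambda>x. W a b c d p f x + W a b c d p g x)"
    unfolding W_def U_def taylor_rem_0 using p
    by (auto simp: D_add[OF fg] fun_eq_iff algebra_simps sum.distrib add_divide_distrib)
next
  fix e f assume f: "f \<in> C_space \<alpha>"
  show "W a b c d p (\<lambda>x. e * f x) = (\<lambda>x. e * W a b c d p f x)"
    unfolding W_def U_def taylor_rem_0 using p
    by (auto simp: D_scale[OF f] fun_eq_iff algebra_simps sum_distrib_left)
qed

definition poly_vec :: "real \<Rightarrow> real \<Rightarrow> real \<Rightarrow> real \<Rightarrow> real \<Rightarrow> nat \<Rightarrow> real \<Rightarrow> complex" where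
  "poly_vec a b c d p j = U a b c d (\<lambda>x. of_real (x - p) ^ j)"

lemma poly_vec_mem:
  assumes gm: "good_moebius a b c d"
  shows "poly_vec a b c d p j \<in> C_space \<alpha>"
proof -
  have cd: "0 \<le> c" "c \<le> d" "1 \<le> d" using gm unfolding good_moebius_def by auto
  let ?l = "\<lambda>w. of_real c * w + of_real d :: complex"
  let ?S = "{w. Re (?l w) > 0}"
  let ?g = "\<lambda>w. ?l w powr (- (2 * \<beta>)) * ((of_real a * w + of_real b) / ?l w - of_real p) ^ j"
  have "open ?S" by (intro open_Collect_less continuous_intros)
  moreover have "?g holomorphic_on ?S"
    by (intro holomorphic_intros) (auto simp: complex_nonpos_Reals_iff complex_eq_iff)
  moreover have "of_real x \<in> ?S" if "x \<in> {0..1}" for x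
    using lin_bounds(3)[OF cd that] by (simp add: lin_def)
  ultimately have "restrict01 ?g \<in> C_space \<alpha>" by (intro restrict01_mem)
  moreover have "restrict01 ?g = poly_vec a b c d p j"
    unfolding poly_vec_def U_def restrict01_def moebius_map_def lin_def by (auto simp: fun_eq_iff)
  ultimately show ?thesis by simp
qed

lemma U_split:
  "U a b c d f = (\<lambda>z. W a b c d p f z + (\<Sum>j\<le>k. (D j f p / fact j) * poly_vec a b c d p j z))"
  unfolding W_def poly_vec_def U_def taylor_rem_0
  by (auto simp: fun_eq_iff algebra_simps sum_distrib_left)

lemma finite_rank_U_W:
  assumes gm: "good_moebius a b c d" and p: "p \<in> {0..1}"
  shows "finite_rank (\<lambda>f z. U a b c d f z - W a b c d p f z)"
proof -
  have "finite_rank (\<lambda>f z. \<Sum>j\<le>k. (1 / fact j * D j f p) * poly_vec a b c d p j z)"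
    by (intro finite_rank_sum finite_rank_one bounded_functional_scale bounded_functional_D p poly_vec_mem[OF gm]) auto
  thus ?thesis by (rule finite_rank_cong) (subst U_split[of _ _ _ _ _ p], simp)
qed

text \<open>With \<open>\<delta> = d powr (-2)\<close> the weight
  \<open>d powr (- 2 * Re \<beta>)\<close> and \<open>\<delta> powr \<alpha>\<close> combine to the
  exponent \<open>- 2 * (Re \<beta> + \<alpha>)\<close>. This is the origin of the parameter of the
  comparison operator.\<close>

lemma
  assumes gm: "good_moebius a b c d"
  shows bounded_op_U: "bounded_op (C_space \<alpha>) (C_norm \<alpha>) (U a b c d)"
    and W_base_bound: "f \<in> C_space \<alpha> \<Longrightarrow> C_norm \<alpha> (W a b c d (b / d) f) \<le> W_const * d powr (- 2 * (Re \<beta> + \<alpha>)) * C_norm \<alpha> f"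
    and bounded_op_W_base: "bounded_op (C_space \<alpha>) (C_norm \<alpha>) (W a b c d (b / d))"
proof -
  have d: "1 \<le> d" using gm unfolding good_moebius_def by auto
  have p: "b / d \<in> {0..1}" using moebius_dist(2)[OF gm, of 0] by simp
  have \<delta>: "d powr (-2) \<le> d powr (-2)" "d powr (-2) \<le> 1" using d powr_mono[of "-2" 0 d] by auto
  note hp = moebius_dist(1)[OF gm]
  show Wop: "bounded_op (C_space \<alpha>) (C_norm \<alpha>) (W a b c d (b / d))" by (rule bounded_op_W[OF gm p \<delta> hp])
  have "bounded_op (C_space \<alpha>) (C_norm \<alpha>) (\<lambda>f z. W a b c d (b / d) f z + (U a b c d f z - W a b c d (b / d) f z))"
    by (intro bounded_op_add Wop finite_rank_bounded finite_rank_U_W gm p)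
  thus "bounded_op (C_space \<alpha>) (C_norm \<alpha>) (U a b c d)" by simp
  have "d powr (- 2 * Re \<beta>) * (d powr (-2)) powr \<alpha> = d powr (- 2 * (Re \<beta> + \<alpha>))"
    by (simp add: powr_powr powr_add[symmetric] algebra_simps)
  thus "C_norm \<alpha> (W a b c d (b / d) f) \<le> W_const * d powr (- 2 * (Re \<beta> + \<alpha>)) * C_norm \<alpha> f" if "f \<in> C_space \<alpha>"
    using W_bound(2)[OF gm p \<delta> hp that] by simp
qed

section \<open>Operators indexed by words\<close>

abbreviation Uw :: "nat list \<Rightarrow> (real \<Rightarrow> complex) \<Rightarrow> real \<Rightarrow> complex" where
  "Uw w \<equiv> U (cf_a w) (cf_b w) (cf_c w) (cf_d w)"

abbreviation Ww :: "nat list \<Rightarrow> (real \<Rightarrow> complex) \<Rightarrow> real \<Rightarrow> complex" where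
  "Ww w \<equiv> W (cf_a w) (cf_b w) (cf_c w) (cf_d w) (cf_b w / cf_d w)"

lemma Uw_Cons: "Uw [m] (Uw w f) = Uw (m # w) f"
proof
  fix z
  show "Uw [m] (Uw w f) z = Uw (m # w) f z"
  proof (cases "z \<in> {0..1}")
    case True
    let ?u = "z + real (Suc m)" and ?y = "1 / (z + real (Suc m))"
    have y: "?y \<in> {0..1}" by (rule inverse_Suc_mem[OF True])
    have u: "?u > 0" using True by auto
    have den: "cf_den w ?y > 0" using cf_good[of w] lin_bounds(3)[OF _ _ _ y] unfolding good_moebius_def by blast
    have 1: "cf_den [m] z = ?u" "cf_map [m] z = ?y" by (auto simp: lin_def moebius_map_def)
    have "of_real ?u powr (- (2 * \<beta>)) * of_real (cf_den w ?y) powr (- (2 * \<beta>)) = (of_real (cf_den (m # w) z) :: complex) powr (- (2 * \<beta>))"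
      unfolding cf_den_Cons[OF True] of_real_mult using u den by (subst powr_times_real) auto
    thus ?thesis using True y unfolding U_def unfolding 1 unfolding cf_map_Cons[OF True]
      by (simp only: if_True mult.assoc[symmetric])
  qed (simp only: U_def if_False)
qed

text \<open>The truncated transfer operator without any Taylor subtraction: being multiplicative
  along words, it is the one whose powers expand as sums over words.\<close>

definition A_op :: "nat \<Rightarrow> (real \<Rightarrow> complex) \<Rightarrow> real \<Rightarrow> complex" where
  "A_op M f = (\<lambda>z. \<Sum>m<M. Uw [m] f z)"

lemma bounded_op_A: "bounded_op (C_space \<alpha>) (C_norm \<alpha>) (A_op M)"
  unfolding A_op_def[abs_def] by (intro bounded_op_sum bounded_op_U cf_good)

lemma A_op_funpow:
  assumes f: "f \<in> C_space \<alpha>"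
  shows "(A_op M ^^ n) f = (\<lambda>z. \<Sum>w\<in>words n M. Uw w f z)"
proof (induction n)
  case 0
  have "Uw [] f = f" using C_space_outside[OF f] by (auto simp: U_def lin_def moebius_map_def fun_eq_iff)
  thus ?case by (simp add: words_0)
next
  case (Suc n)
  have UV: "Uw w f \<in> C_space \<alpha>" for w by (rule op_mem[OF bounded_op_U[OF cf_good] f])
  have 1: "Uw [m] (\<lambda>z. \<Sum>w\<in>words n M. Uw w f z) = (\<lambda>z. \<Sum>w\<in>words n M. Uw [m] (Uw w f) z)" for m
    by (rule op_sum[OF bounded_op_U[OF cf_good] UV])
  have "(A_op M ^^ Suc n) f = A_op M (\<lambda>z. \<Sum>w\<in>words n M. Uw w f z)" using Suc by simp
  also have "\<dots> = (\<lambda>z. \<Sum>m<M. \<Sum>w\<in>words n M. Uw (m # w) f z)"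
    unfolding A_op_def 1 Uw_Cons ..
  finally show ?case unfolding sum_words_Suc .
qed

text \<open>The Taylor point is 0 and not the base point \<open>1 / Suc m\<close> of the branch,
  because \<open>L_op\<close> subtracts the Taylor polynomial at 0.\<close>

definition branch :: "nat \<Rightarrow> (real \<Rightarrow> complex) \<Rightarrow> real \<Rightarrow> complex" where
  "branch m = W 0 1 1 (real (Suc m)) 0"

definition decay :: "nat \<Rightarrow> real" where
  "decay m = W_const * real (Suc m) powr (- (2 * Re \<beta> + \<alpha>))"

lemma branch_good: "good_moebius 0 1 1 (real (Suc m))"
  using cf_good[of "[m]"] by simp

text \<open>The branch takes values of size at most \<open>1 / Suc m\<close>, so
  \<open>\<delta> = 1 / d\<close> serves. The gain is weaker than at the base point of the cylinder,
  but it makes the branches summable.\<close>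

lemma
  shows bounded_op_branch: "bounded_op (C_space \<alpha>) (C_norm \<alpha>) (branch m)"
    and branch_bound: "f \<in> C_space \<alpha> \<Longrightarrow> C_norm \<alpha> (branch m f) \<le> decay m * C_norm \<alpha> f"
proof -
  let ?d = "real (Suc m)"
  have \<delta>: "?d powr (-2) \<le> 1 / ?d" "1 / ?d \<le> 1"
  proof -
    have "?d powr (-2) \<le> ?d powr (-1)" by (intro powr_mono) auto
    thus "?d powr (-2) \<le> 1 / ?d" by (simp add: powr_minus field_simps)
  qed auto
  have hp: "\<bar>moebius_map 0 1 1 ?d z - 0\<bar> \<le> 1 / ?d" if "z \<in> {0..1}" for z
    using that by (auto simp: moebius_map_def lin_def field_simps)
  show "bounded_op (C_space \<alpha>) (C_norm \<alpha>) (branch m)"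
    unfolding branch_def by (rule bounded_op_W[OF branch_good _ \<delta> hp]) auto
  have "?d powr (- 2 * Re \<beta>) * (1 / ?d) powr \<alpha> = ?d powr (- 2 * Re \<beta>) * ?d powr (- \<alpha>)"
    by (simp add: powr_divide powr_minus field_simps)
  also have "\<dots> = ?d powr (- (2 * Re \<beta> + \<alpha>))" unfolding powr_add[symmetric] by simp
  finally show "C_norm \<alpha> (branch m f) \<le> decay m * C_norm \<alpha> f" if "f \<in> C_space \<alpha>"
    using W_bound(2)[OF branch_good _ \<delta> hp that] unfolding branch_def decay_def by simp
qed

lemma summable_decay: "summable decay"
  unfolding decay_def[abs_def] using \<beta> by (intro summable_mult summable_Suc_powr)

lemma decay_nonneg: "decay m \<ge> 0"
  unfolding decay_def using W_const_nonneg by simp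

definition branch_tail :: "nat \<Rightarrow> (real \<Rightarrow> complex) \<Rightarrow> real \<Rightarrow> complex" where
  "branch_tail M f = (\<lambda>z. \<Sum>m. branch (m + M) f z)"

lemma
  assumes f: "f \<in> C_space \<alpha>"
  shows branch_tail_mem: "branch_tail M f \<in> C_space \<alpha>"
    and branch_tail_bound: "C_norm \<alpha> (branch_tail M f) \<le> (\<Sum>m. decay (m + M)) * C_norm \<alpha> f"
    and branch_summable: "summable (\<lambda>m. branch m f z)"
proof -
  have sm: "summable (\<lambda>m. decay (m + M) * C_norm \<alpha> f)" for M
    by (intro summable_mult2 summable_ignore_initial_segment summable_decay)
  note S = series[of "\<lambda>m. branch (m + M) f", OF op_mem[OF bounded_op_branch f] branch_bound[OF f] sm]
  show "branch_tail M f \<in> C_space \<alpha>" unfolding branch_tail_def by (rule S(1))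
  show "C_norm \<alpha> (branch_tail M f) \<le> (\<Sum>m. decay (m + M)) * C_norm \<alpha> f"
    unfolding branch_tail_def using S(2) suminf_mult2[OF summable_ignore_initial_segment[OF summable_decay, of M], of "C_norm \<alpha> f"] by simp
  show "summable (\<lambda>m. branch m f z)"
    using series(3)[of "\<lambda>m. branch (m + 0) f", OF op_mem[OF bounded_op_branch f] branch_bound[OF f] sm] by simp
qed

lemma bounded_op_branch_tail: "bounded_op (C_space \<alpha>) (C_norm \<alpha>) (branch_tail M)"
proof (rule bounded_opI[OF branch_tail_mem _ _ branch_tail_bound])
  have sm: "summable (\<lambda>m. branch (m + M) f z)" if "f \<in> C_space \<alpha>" for f z
    by (rule summable_ignore_initial_segment[OF branch_summable[OF that]])
  show "branch_tail M (\<lambda>x. f x + g x) = (\<lambda>x. branch_tail M f x + branch_tail M g x)"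
    if fg: "f \<in> C_space \<alpha>" "g \<in> C_space \<alpha>" for f g
    unfolding branch_tail_def using suminf_add[OF sm[OF fg(1)] sm[OF fg(2)]]
    by (simp add: op_add[OF bounded_op_branch fg])
  show "branch_tail M (\<lambda>x. c * f x) = (\<lambda>x. c * branch_tail M f x)" if f: "f \<in> C_space \<alpha>" for c f
    unfolding branch_tail_def using suminf_mult[OF sm[OF f]] by (simp add: op_scale[OF bounded_op_branch f])
qed

section \<open>The transfer operator as finite rank part plus branch series\<close>

definition zeta_vec :: "nat \<Rightarrow> real \<Rightarrow> complex" where
  "zeta_vec n = restrict01 (\<lambda>w. hurwitz_zeta (of_nat n + 2 * \<beta>) (w + 1))"

lemma zeta_vec_mem: "zeta_vec n \<in> C_space \<alpha>"
  unfolding zeta_vec_def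
proof (rule restrict01_mem)
  show "open {w. Re (w + 1) > 0}" by (intro open_Collect_less continuous_intros)
  show "(\<lambda>w. hurwitz_zeta (of_nat n + 2 * \<beta>) (w + 1)) holomorphic_on {w. Re (w + 1) > 0}"
    by (rule holomorphic_on_compose_gen[OF _ hurwitz_zeta_holomorphic, unfolded o_def]) (auto intro: holomorphic_intros)
qed auto

lemma L_op_eq: "L_op \<alpha> \<beta> f = (\<lambda>z. (\<Sum>n\<le>k. (1 / fact n * D n f 0) * zeta_vec n z) + branch_tail 0 f z)"
proof
  fix z
  show "L_op \<alpha> \<beta> f z = (\<Sum>n\<le>k. (1 / fact n * D n f 0) * zeta_vec n z) + branch_tail 0 f z"
  proof (cases "z \<in> {0..1}")
    case True
    have "lin 1 (real (Suc m)) z = real (Suc m) + z" "moebius_map 0 1 1 (real (Suc m)) z = 1 / (real (Suc m) + z)" for m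
      by (auto simp: lin_def moebius_map_def)
    thus ?thesis using True
      unfolding L_op_def Let_def branch_tail_def branch_def W_def U_def taylor_rem_0 zeta_vec_def restrict01_def
      by simp
  next
    case False
    have "L_op \<alpha> \<beta> f z = 0" unfolding L_op_def Let_def using False by (simp only: if_False)
    moreover have "branch m f z = 0" for m unfolding branch_def W_def U_def using False by (simp only: if_False)
    moreover have "zeta_vec n z = 0" for n unfolding zeta_vec_def restrict01_def using False by (simp only: if_False)
    ultimately show ?thesis unfolding branch_tail_def by simp
  qed
qed

lemma finite_rank_zeta: "finite_rank (\<lambda>f z. \<Sum>n\<le>k. (1 / fact n * D n f 0) * zeta_vec n z)"
  by (intro finite_rank_sum finite_rank_one bounded_functional_scale bounded_functional_D zeta_vec_mem) auto

lemma bounded_op_L: "bounded_op (C_space \<alpha>) (C_norm \<alpha>) (L_op \<alpha> \<beta>)"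
  unfolding L_op_eq[abs_def]
  by (intro bounded_op_add bounded_op_branch_tail finite_rank_bounded finite_rank_zeta)

section \<open>Truncation to finitely many branches\<close>

definition B_op :: "nat \<Rightarrow> (real \<Rightarrow> complex) \<Rightarrow> real \<Rightarrow> complex" where
  "B_op M f = (\<lambda>z. \<Sum>m<M. branch m f z)"

lemma bounded_op_B: "bounded_op (C_space \<alpha>) (C_norm \<alpha>) (B_op M)"
  unfolding B_op_def[abs_def] by (intro bounded_op_sum bounded_op_branch)

lemma branch_tail_split: "f \<in> C_space \<alpha> \<Longrightarrow> branch_tail 0 f = (\<lambda>z. B_op M f z + branch_tail M f z)"
  unfolding branch_tail_def B_op_def
  using suminf_split_initial_segment[OF branch_summable, of f _ M] by (simp add: fun_eq_iff add.commute)

lemma B_op_bound: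
  assumes f: "f \<in> C_space \<alpha>"
  shows "C_norm \<alpha> (B_op M f) \<le> suminf decay * C_norm \<alpha> f"
proof -
  have "C_norm \<alpha> (B_op M f) \<le> (\<Sum>m<M. C_norm \<alpha> (branch m f))"
    unfolding B_op_def by (rule norm_sum) (rule op_mem[OF bounded_op_branch f])
  also have "\<dots> \<le> (\<Sum>m<M. decay m * C_norm \<alpha> f)" by (intro sum_mono branch_bound f)
  also have "\<dots> = (\<Sum>m<M. decay m) * C_norm \<alpha> f" by (simp add: sum_distrib_right)
  also have "\<dots> \<le> suminf decay * C_norm \<alpha> f"
    by (intro mult_right_mono sum_le_suminf summable_decay C_norm_nonneg f) (auto simp: decay_nonneg)
  finally show ?thesis .
qed

lemma finite_rank_B_A: "finite_rank (\<lambda>f z. B_op M f z - A_op M f z)"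
proof -
  have "finite_rank (\<lambda>f z. \<Sum>m<M. (-1) * (U 0 1 1 (real (Suc m)) f z - W 0 1 1 (real (Suc m)) 0 f z))"
    by (intro finite_rank_sum finite_rank_scale finite_rank_U_W branch_good) auto
  thus ?thesis
    by (rule finite_rank_cong) (simp add: B_op_def A_op_def branch_def sum_subtractf[symmetric])
qed

text \<open>With \<open>T\<close> the full series and \<open>B\<close> its truncation, the error
  splits as \<open>T^(n+1) - B^(n+1) = T (T^n - B^n) + (T - B) B^n\<close>, and \<open>T - B\<close>
  is the tail beyond \<open>M\<close>. All truncations share the norm bound
  \<open>suminf decay\<close>, so for fixed \<open>n\<close> the error is a constant times the tail
  of \<open>decay\<close>.\<close>

lemma B_op_funpow_approx:
  assumes "\<epsilon> > 0"
  shows "\<exists>M. \<forall>f\<in>C_space \<alpha>. C_norm \<alpha> (\<lambda>z. (branch_tail 0 ^^ n) f z - (B_op M ^^ n) f z) \<le> \<epsilon> * C_norm \<alpha> f"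
proof -
  define b where "b = suminf decay"
  have b0: "b \<ge> 0" unfolding b_def by (intro suminf_nonneg summable_decay decay_nonneg)
  define tl where "tl M = (\<Sum>m. decay (m + M))" for M
  have tl: "tl \<longlonglongrightarrow> 0" unfolding tl_def by (rule suminf_exist_split2[OF summable_decay])
  have tl0: "tl M \<ge> 0" for M
    unfolding tl_def by (intro suminf_nonneg summable_ignore_initial_segment summable_decay decay_nonneg)
  note T = bounded_op_branch_tail[of 0]
  \<comment> \<open>\<open>C\<close> depends on \<open>n\<close> but not on \<open>M\<close>; this
    order of quantifiers allows \<open>M\<close> to be chosen at the end.\<close>
  have "\<exists>C\<ge>0. \<forall>M. \<forall>f\<in>C_space \<alpha>. C_norm \<alpha> (\<lambda>z. (branch_tail 0 ^^ n) f z - (B_op M ^^ n) f z) \<le> C * tl M * C_norm \<alpha> f"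
  proof (induction n)
    case 0 thus ?case by (intro exI[of _ 0]) auto
  next
    case (Suc n)
    then obtain C where C: "C \<ge> 0" "\<And>M f. f \<in> C_space \<alpha> \<Longrightarrow> C_norm \<alpha> (\<lambda>z. (branch_tail 0 ^^ n) f z - (B_op M ^^ n) f z) \<le> C * tl M * C_norm \<alpha> f"
      by blast
    have "C_norm \<alpha> (\<lambda>z. (branch_tail 0 ^^ Suc n) f z - (B_op M ^^ Suc n) f z) \<le> (b * C + b ^ n) * tl M * C_norm \<alpha> f"
      if f: "f \<in> C_space \<alpha>" for f M
    proof -
      let ?g = "(B_op M ^^ n) f" and ?u = "\<lambda>z. (branch_tail 0 ^^ n) f z - (B_op M ^^ n) f z"
      have gV: "?g \<in> C_space \<alpha>" by (rule funpow_mem[OF bounded_op_B f])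
      have tV: "(branch_tail 0 ^^ n) f \<in> C_space \<alpha>" by (rule funpow_mem[OF T f])
      have uV: "?u \<in> C_space \<alpha>" by (rule diff_mem[OF tV gV])
      have gb: "C_norm \<alpha> ?g \<le> b ^ n * C_norm \<alpha> f"
      proof (induction n)
        case (Suc n)
        have "C_norm \<alpha> ((B_op M ^^ Suc n) f) \<le> b * C_norm \<alpha> ((B_op M ^^ n) f)"
          using B_op_bound[OF funpow_mem[OF bounded_op_B f]] unfolding b_def by simp
        also have "\<dots> \<le> b * (b ^ n * C_norm \<alpha> f)" by (intro mult_left_mono Suc b0)
        finally show ?case by simp
      qed simp
      have "(\<lambda>z. (branch_tail 0 ^^ Suc n) f z - (B_op M ^^ Suc n) f z) = (\<lambda>z. branch_tail 0 ?u z + branch_tail M ?g z)"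
        using branch_tail_split[OF gV, of M] op_diff[OF T tV gV] by (auto simp: fun_eq_iff)
      hence "C_norm \<alpha> (\<lambda>z. (branch_tail 0 ^^ Suc n) f z - (B_op M ^^ Suc n) f z) \<le> C_norm \<alpha> (branch_tail 0 ?u) + C_norm \<alpha> (branch_tail M ?g)"
        using norm_add[OF branch_tail_mem[OF uV] branch_tail_mem[OF gV]] by simp
      also have "C_norm \<alpha> (branch_tail 0 ?u) \<le> b * C_norm \<alpha> ?u"
        using branch_tail_bound[OF uV, of 0] unfolding b_def by simp
      also have "b * C_norm \<alpha> ?u \<le> b * (C * tl M * C_norm \<alpha> f)" by (intro mult_left_mono C(2) f b0)
      also have "C_norm \<alpha> (branch_tail M ?g) \<le> tl M * C_norm \<alpha> ?g"
        using branch_tail_bound[OF gV] unfolding tl_def .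
      also have "tl M * C_norm \<alpha> ?g \<le> tl M * (b ^ n * C_norm \<alpha> f)" by (intro mult_left_mono gb tl0)
      finally show ?thesis by (simp add: algebra_simps)
    qed
    thus ?case using C(1) b0 by (intro exI[of _ "b * C + b ^ n"]) auto
  qed
  then obtain C where C: "C \<ge> 0" "\<And>M f. f \<in> C_space \<alpha> \<Longrightarrow> C_norm \<alpha> (\<lambda>z. (branch_tail 0 ^^ n) f z - (B_op M ^^ n) f z) \<le> C * tl M * C_norm \<alpha> f"
    by blast
  have "(\<lambda>M. C * tl M) \<longlonglongrightarrow> 0" using tendsto_mult_left[OF tl, of C] by simp
  hence "\<forall>\<^sub>F M in sequentially. C * tl M < \<epsilon>" using assms by (intro order_tendstoD) auto
  then obtain M where "C * tl M < \<epsilon>" by (auto simp: eventually_sequentially)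
  hence "C_norm \<alpha> (\<lambda>z. (branch_tail 0 ^^ n) f z - (B_op M ^^ n) f z) \<le> \<epsilon> * C_norm \<alpha> f" if "f \<in> C_space \<alpha>" for f
    using C(2)[OF that, of M] mult_right_mono[of "C * tl M" \<epsilon> "C_norm \<alpha> f"] C_norm_nonneg[OF that] by linarith
  thus ?thesis by blast
qed

lemma A_op_funpow_finite_rank: "finite_rank (\<lambda>f z. (A_op M ^^ n) f z - (\<Sum>w\<in>words n M. Ww w f z))"
proof -
  have "cf_b w / cf_d w \<in> {0..1}" for w using moebius_dist(2)[OF cf_good, of 0] by simp
  hence "finite_rank (\<lambda>f z. \<Sum>w\<in>words n M. (Uw w f z - Ww w f z))"
    by (intro finite_rank_sum finite_rank_U_W cf_good)
  thus ?thesis by (rule finite_rank_cong) (simp add: A_op_funpow sum_subtractf)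
qed

text \<open>At \<open>x = 0\<close> the denominator of a word is \<open>cf_d w\<close>, so the sum
  of the error bounds is the word sum compared with the Mayer iterate in
  \<open>sum_words_le_mayer\<close>. The result does not depend on \<open>M\<close>.\<close>

lemma sum_Ww_bound:
  assumes f: "f \<in> C_space \<alpha>"
  shows "C_norm \<alpha> (\<lambda>z. \<Sum>w\<in>words n M. Ww w f z) \<le>
    W_const * cmod ((mayer_op (of_real (Re \<beta> + \<alpha>)) ^^ n) one_disc 0) * C_norm \<alpha> f"
proof -
  let ?t = "Re \<beta> + \<alpha>"
  have t: "?t > 1/2" using \<beta> \<alpha>_pos by simp
  obtain y where y: "(mayer_op (of_real ?t) ^^ n) one_disc (of_real 0) = of_real y"
    "(\<Sum>w\<in>words n M. cf_den w 0 powr (- 2 * ?t)) \<le> y"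
    using sum_words_le_mayer[OF t, of 0 n M] by auto
  have "C_norm \<alpha> (\<lambda>z. \<Sum>w\<in>words n M. Ww w f z) \<le> (\<Sum>w\<in>words n M. C_norm \<alpha> (Ww w f))"
    by (rule norm_sum) (rule op_mem[OF bounded_op_W_base[OF cf_good] f])
  also have "\<dots> \<le> (\<Sum>w\<in>words n M. W_const * cf_d w powr (- 2 * ?t) * C_norm \<alpha> f)"
    by (intro sum_mono W_base_bound cf_good f)
  also have "\<dots> = W_const * (\<Sum>w\<in>words n M. cf_den w 0 powr (- 2 * ?t)) * C_norm \<alpha> f"
    by (simp add: sum_distrib_left sum_distrib_right lin_def)
  also have "\<dots> \<le> W_const * y * C_norm \<alpha> f"
    by (intro mult_right_mono mult_left_mono y(2) W_const_nonneg C_norm_nonneg f)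
  also have "\<dots> \<le> W_const * cmod ((mayer_op (of_real ?t) ^^ n) one_disc 0) * C_norm \<alpha> f"
    using y(1) by (intro mult_right_mono mult_left_mono W_const_nonneg C_norm_nonneg f) simp
  finally show ?thesis .
qed

text \<open>Choose \<open>r\<close> between \<open>\<rho>\<close> and \<open>cmod l\<close>, then
  \<open>n\<close> so large that \<open>r^n\<close> beats the fixed constants against
  \<open>cmod l ^ n\<close>, and only then \<open>M\<close> for that \<open>n\<close>. The abstract
  perturbation theorem does the rest.\<close>

theorem L_not_ess_spectrum:
  assumes sp: "\<And>l. cmod l > \<rho> \<Longrightarrow> l \<notin> op_spectrum A_space A_norm (mayer_op (of_real (Re \<beta> + \<alpha>)))"
    and \<rho>: "\<rho> \<ge> 0" and l: "cmod l > \<rho>"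
  shows "l \<notin> ess_spectrum (C_space \<alpha>) (C_norm \<alpha>) (L_op \<alpha> \<beta>)"
proof -
  let ?T = "mayer_op (of_real (Re \<beta> + \<alpha>))"
  obtain r where r: "\<rho> < r" "r < cmod l" using dense[OF l] by blast
  have rpos: "r > 0" "cmod l > 0" using r \<rho> by auto
  obtain C where C: "\<And>n. cmod ((?T ^^ n) one_disc 0) \<le> C * r ^ n"
    using A.spectral_growth[OF bounded_op_mayer one_disc_mem \<rho> sp r(1)] by metis
  have C0: "C \<ge> 0" using order_trans[OF norm_ge_zero C[of 0]] by simp
  have "(\<lambda>n. W_const * C * (r / cmod l) ^ n) \<longlonglongrightarrow> W_const * C * 0"
    using r rpos by (intro tendsto_mult tendsto_const LIMSEQ_realpow_zero) auto
  hence "\<forall>\<^sub>F n in sequentially. W_const * C * (r / cmod l) ^ n < 1/2" by (intro order_tendstoD) auto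
  with eventually_gt_at_top[of 0] have "\<forall>\<^sub>F n in sequentially. n > 0 \<and> W_const * C * (r / cmod l) ^ n < 1/2"
    by eventually_elim auto
  then obtain n where n: "n > 0" "W_const * C * (r / cmod l) ^ n < 1/2"
    using eventually_happens' trivial_limit_sequentially by blast
  \<comment> \<open>Half of \<open>cmod l ^ n\<close> is granted to the truncation error; the choice
    of \<open>n\<close> keeps the sum over words strictly below the other half.\<close>
  define \<epsilon> where "\<epsilon> = cmod l ^ n / 2"
  have \<epsilon>: "\<epsilon> > 0" using rpos unfolding \<epsilon>_def by simp
  obtain M where M: "\<And>f. f \<in> C_space \<alpha> \<Longrightarrow> C_norm \<alpha> (\<lambda>z. (branch_tail 0 ^^ n) f z - (B_op M ^^ n) f z) \<le> \<epsilon> * C_norm \<alpha> f"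
    using B_op_funpow_approx[OF \<epsilon>] by blast
  define q where "q = W_const * C * r ^ n + \<epsilon>"
  have q0: "q \<ge> 0" unfolding q_def using W_const_nonneg C0 rpos \<epsilon> by simp
  have ql: "q < cmod l ^ n"
  proof -
    have "W_const * C * r ^ n < cmod l ^ n / 2" using n(2) rpos by (simp add: power_divide field_simps)
    thus ?thesis unfolding q_def \<epsilon>_def by simp
  qed
  note T = bounded_op_branch_tail[of 0]
  \<comment> \<open>The three finite rank differences along the chain: dropping the zeta terms,
    undoing the Taylor subtraction at 0, and subtracting Taylor polynomials at the base points of
    the cylinders.\<close>
  define K where "K = (\<lambda>f z. ((L_op \<alpha> \<beta> ^^ n) f z - (branch_tail 0 ^^ n) f z) + (((B_op M ^^ n) f z - (A_op M ^^ n) f z)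
     + ((A_op M ^^ n) f z - (\<Sum>w\<in>words n M. Ww w f z))))"
  have "finite_rank (\<lambda>f z. L_op \<alpha> \<beta> f z - branch_tail 0 f z)"
    by (rule finite_rank_cong[OF finite_rank_zeta]) (simp add: L_op_eq)
  hence K: "finite_rank K" unfolding K_def
    by (intro finite_rank_add finite_rank_funpow_diff bounded_op_L T bounded_op_B bounded_op_A finite_rank_B_A A_op_funpow_finite_rank)
  have bd: "C_norm \<alpha> (\<lambda>x. (L_op \<alpha> \<beta> ^^ n) f x - K f x) \<le> q * C_norm \<alpha> f" if f: "f \<in> C_space \<alpha>" for f
  proof -
    have sV: "(\<lambda>z. \<Sum>w\<in>words n M. Ww w f z) \<in> C_space \<alpha>" by (intro sum_mem op_mem[OF bounded_op_W_base[OF cf_good] f])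
    have dV: "(\<lambda>z. (branch_tail 0 ^^ n) f z - (B_op M ^^ n) f z) \<in> C_space \<alpha>"
      by (intro diff_mem funpow_mem[OF T f] funpow_mem[OF bounded_op_B f])
    have "(\<lambda>x. (L_op \<alpha> \<beta> ^^ n) f x - K f x) = (\<lambda>z. (\<Sum>w\<in>words n M. Ww w f z) + ((branch_tail 0 ^^ n) f z - (B_op M ^^ n) f z))"
      unfolding K_def by (simp add: algebra_simps)
    hence "C_norm \<alpha> (\<lambda>x. (L_op \<alpha> \<beta> ^^ n) f x - K f x) \<le> C_norm \<alpha> (\<lambda>z. \<Sum>w\<in>words n M. Ww w f z) + C_norm \<alpha> (\<lambda>z. (branch_tail 0 ^^ n) f z - (B_op M ^^ n) f z)"
      using norm_add[OF sV dV] by simp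
    also have "C_norm \<alpha> (\<lambda>z. \<Sum>w\<in>words n M. Ww w f z) \<le> W_const * (C * r ^ n) * C_norm \<alpha> f"
      by (rule order_trans[OF sum_Ww_bound[OF f]]) (intro mult_right_mono mult_left_mono C W_const_nonneg C_norm_nonneg f)
    also have "C_norm \<alpha> (\<lambda>z. (branch_tail 0 ^^ n) f z - (B_op M ^^ n) f z) \<le> \<epsilon> * C_norm \<alpha> f" by (rule M[OF f])
    finally show ?thesis unfolding q_def by (simp add: algebra_simps)
  qed
  show ?thesis by (rule not_ess_spectrum_if_finite_rank_perturbation[OF bounded_op_L n(1) bd q0 K ql])
qed

end

section \<open>Approximation by polynomials and regularity of eigenfunctions\<close>

lemma pderiv_setsum: "pderiv (\<Sum>i\<in>I. p i) = (\<Sum>i\<in>I. pderiv (p i))" for p :: "'i \<Rightarrow> complex poly"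
  by (induction I rule: infinite_finite_induct) (auto simp: pderiv_add)

lemma poly_holomorphic: "poly p holomorphic_on S" for p :: "complex poly"
  unfolding holomorphic_on_def field_differentiable_def using poly_DERIV has_field_derivative_at_within by blast

lemma poly_antideriv: "\<exists>q :: complex poly. pderiv q = p \<and> poly q 0 = c"
proof -
  let ?q = "monom c 0 + (\<Sum>i\<le>degree p. monom (coeff p i / of_nat (Suc i)) (Suc i))"
  have "pderiv (monom (coeff p i / of_nat (Suc i)) (Suc i)) = monom (coeff p i) i" for i
    by (simp add: pderiv_monom del: of_nat_Suc)
  hence "pderiv ?q = (\<Sum>i\<le>degree p. monom (coeff p i) i)"
    by (simp add: pderiv_add pderiv_setsum pderiv_monom del: of_nat_Suc)
  hence "pderiv ?q = p" by (simp add: poly_as_sum_of_monoms)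
  moreover have "poly ?q 0 = c" by (simp add: poly_sum poly_monom)
  ultimately show ?thesis by blast
qed

lemma poly_iterated_antideriv:
  "\<exists>Q :: complex poly. (pderiv ^^ n) Q = P \<and> (\<forall>j<n. poly ((pderiv ^^ j) Q) 0 = a j)"
proof (induction n arbitrary: P)
  case (Suc n)
  obtain P1 where P1: "pderiv P1 = P" "poly P1 0 = a n" using poly_antideriv by blast
  obtain Q where "(pderiv ^^ n) Q = P1" "\<forall>j<n. poly ((pderiv ^^ j) Q) 0 = a j" using Suc by blast
  thus ?case using P1 by (intro exI[of _ Q]) (auto simp: less_Suc_eq)
qed simp

lemma complex_poly_approx:
  fixes \<psi> :: "real \<Rightarrow> complex"
  assumes "continuous_on {0..1} \<psi>" "e > 0"
  shows "\<exists>p. \<forall>x\<in>{0..1}. cmod (\<psi> x - poly p (of_real x)) \<le> e"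
proof -
  obtain g1 where g1: "real_polynomial_function g1" "\<And>x. x \<in> {0..1} \<Longrightarrow> \<bar>Re (\<psi> x) - g1 x\<bar> < e / 2"
    using Stone_Weierstrass_real_polynomial_function[of "{0..1}" "\<lambda>x. Re (\<psi> x)" "e / 2"] assms
    by (auto intro: continuous_intros)
  obtain g2 where g2: "real_polynomial_function g2" "\<And>x. x \<in> {0..1} \<Longrightarrow> \<bar>Im (\<psi> x) - g2 x\<bar> < e / 2"
    using Stone_Weierstrass_real_polynomial_function[of "{0..1}" "\<lambda>x. Im (\<psi> x)" "e / 2"] assms
    by (auto intro: continuous_intros)
  obtain a1 n1 where a1: "g1 = (\<lambda>x. \<Sum>i\<le>n1. a1 i * x ^ i)" using g1(1) real_polynomial_function_iff_sum by blast
  obtain a2 n2 where a2: "g2 = (\<lambda>x. \<Sum>i\<le>n2. a2 i * x ^ i)" using g2(1) real_polynomial_function_iff_sum by blast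
  let ?p = "(\<Sum>i\<le>n1. monom (complex_of_real (a1 i)) i) + (\<Sum>i\<le>n2. monom (\<i> * of_real (a2 i)) i)"
  have p: "poly ?p (of_real x) = Complex (g1 x) (g2 x)" for x
    unfolding a1 a2 by (simp add: poly_sum poly_monom Complex_eq sum_distrib_left mult.assoc)
  have "cmod (\<psi> x - poly ?p (of_real x)) \<le> e" if "x \<in> {0..1}" for x
    unfolding p using cmod_le[of "\<psi> x - Complex (g1 x) (g2 x)"] g1(2)[OF that] g2(2)[OF that] by simp
  thus ?thesis by blast
qed

lemma higher_deriv_poly: "(deriv ^^ j) (poly Q) = poly ((pderiv ^^ j) Q)" for Q :: "complex poly"
proof (induction j)
  case (Suc j)
  have "deriv (poly p) = poly (pderiv p)" for p :: "complex poly"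
    by (rule ext, rule DERIV_imp_deriv, rule poly_DERIV)
  with Suc show ?case by simp
qed simp

lemma not_tendsto_subseq:
  fixes X :: "nat \<Rightarrow> 'a::metric_space"
  assumes "\<not> X \<longlonglongrightarrow> l"
  obtains e r where "e > 0" "strict_mono (r :: nat \<Rightarrow> nat)" "\<And>n. dist (X (r n)) l \<ge> e"
proof -
  obtain e where e: "e > 0" "\<not> (\<forall>\<^sub>F n in sequentially. dist (X n) l < e)"
    using assms unfolding tendsto_iff by blast
  hence "infinite {n. \<not> dist (X n) l < e}"
    unfolding cofinite_eq_sequentially[symmetric] eventually_cofinite by simp
  from infinite_enumerate[OF this] obtain r :: "nat \<Rightarrow> nat" where r: "strict_mono r" "\<forall>n. r n \<in> {n. \<not> dist (X n) l < e}"
    by auto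
  show ?thesis by (rule that[OF e(1) r(1)]) (use r(2) in \<open>simp add: not_less\<close>)
qed

lemma poly_has_vector_derivative:
  "((\<lambda>x. poly p (of_real x) :: complex) has_vector_derivative poly (pderiv p) (of_real x)) (at x within S)"
  by (rule has_vector_derivative_real_field[OF poly_DERIV])

lemma interval_in_disc: "x \<in> {0..1} \<Longrightarrow> complex_of_real x \<in> ball 1 (3/2)"
proof -
  assume "x \<in> {0..1}"
  hence "cmod (of_real (1 - x)) < 3/2" unfolding norm_of_real by auto
  thus ?thesis by (simp add: dist_norm)
qed

section \<open>Polynomial approximation and compactness in Hoelder spaces\<close>

context holder_space
begin

text \<open>Uniform approximation alone would lose the Hoelder constant. The k-th derivative is
  first averaged over intervals of length \<open>h\<close>, which keeps its Hoelder constant and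
  makes it continuously differentiable; approximating the derivative of the average by a polynomial
  then gives an error that is Lipschitz with a small constant.\<close>

lemma poly_approx:
  assumes f: "f \<in> C_space \<alpha>" and e: "e > 0"
  shows "\<exists>Q. (\<forall>j\<le>k. \<forall>x\<in>{0..1}. cmod (D j f x - poly ((pderiv ^^ j) Q) (of_real x)) \<le> e) \<and>
    (\<forall>x\<in>{0..1}. \<forall>y\<in>{0..1}. cmod (poly ((pderiv ^^ k) Q) (of_real x) - poly ((pderiv ^^ k) Q) (of_real y))
       \<le> (2 * C_norm \<alpha> f + e) * \<bar>x - y\<bar> powr \<eta>)"
proof -
  define N where "N = 2 * C_norm \<alpha> f"
  have N: "N \<ge> 0" unfolding N_def using C_norm_nonneg[OF f] by simp
  \<comment> \<open>Clamping to [0,1] extends the k-th derivative constantly, so that averages may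
    reach beyond 1; it does not increase distances and so keeps the Hoelder bound.\<close>
  define cl where "cl x = max 0 (min 1 x)" for x :: real
  have cl: "cl x \<in> {0..1}" "\<bar>cl x - cl y\<bar> \<le> \<bar>x - y\<bar>" for x y unfolding cl_def by (auto simp: max_def min_def)
  have cl_id: "cl x = x" if "x \<in> {0..1}" for x using that unfolding cl_def by auto
  define \<phi> where "\<phi> x = D k f (cl x)" for x
  have \<phi>H: "cmod (\<phi> x - \<phi> y) \<le> N * \<bar>x - y\<bar> powr \<eta>" for x y
  proof -
    have "cmod (\<phi> x - \<phi> y) \<le> N * \<bar>cl x - cl y\<bar> powr \<eta>"
      unfolding \<phi>_def N_def by (rule C_norm_holder[OF f cl(1) cl(1)])
    also have "\<dots> \<le> N * \<bar>x - y\<bar> powr \<eta>" using cl(2) \<eta>_nonneg N by (intro mult_left_mono powr_mono2) auto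
    finally show ?thesis .
  qed
  have "continuous_on UNIV cl" unfolding cl_def by (intro continuous_intros)
  hence \<phi>c: "continuous_on S \<phi>" for S
    unfolding \<phi>_def using cl(1)
    by (intro continuous_on_compose2[OF C_space_continuous[OF f order_refl]]) (auto intro: continuous_on_subset)
  have "uniformly_continuous_on {0..1} (D k f)"
    by (intro compact_uniformly_continuous C_space_continuous f) auto
  then obtain h0 where h0: "h0 > 0" "\<And>x y. x \<in> {0..1} \<Longrightarrow> y \<in> {0..1} \<Longrightarrow> dist y x < h0 \<Longrightarrow> dist (D k f y) (D k f x) < e / 2"
    using e unfolding uniformly_continuous_on_def by (metis half_gt_zero)
  \<comment> \<open>At most 1, so that \<open>x + h\<close> stays in [0,2], where the antiderivative
    \<open>F\<close> is available, and below the modulus of uniform continuity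
    \<open>h0\<close>.\<close>
  define h where "h = min 1 (h0 / 2)"
  have h: "h > 0" "h \<le> 1" "h < h0" using h0(1) unfolding h_def by auto
  have \<phi>u: "cmod (\<phi> x - \<phi> y) \<le> e / 2" if "\<bar>x - y\<bar> \<le> h" for x y
  proof -
    have "dist (cl x) (cl y) < h0" using cl(2)[of x y] that h by (simp add: dist_real_def)
    thus ?thesis using h0(2)[OF cl(1) cl(1)] unfolding \<phi>_def by (simp add: dist_norm less_imp_le)
  qed
  obtain F where F: "\<And>x. x \<in> {0..2} \<Longrightarrow> (F has_vector_derivative \<phi> x) (at x within {0..2})"
    using antiderivative_continuous[OF \<phi>c] by blast
  have Ft: "((\<lambda>u. F (c + u)) has_vector_derivative \<phi> (c + u)) (at u within S)"
    if "(\<lambda>u. c + u) ` S \<subseteq> {0..2}" "u \<in> S" for c u S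
  proof -
    have "((\<lambda>u. c + u) has_vector_derivative 1) (at u within S)" by (auto intro!: derivative_eq_intros)
    moreover have "(F has_vector_derivative \<phi> (c + u)) (at (c + u) within (\<lambda>u. c + u) ` S)"
      using that by (intro has_vector_derivative_within_subset[OF F that(1)]) auto
    ultimately show ?thesis using vector_diff_chain_within[of "\<lambda>u. c + u" 1 u S F "\<phi> (c + u)"] by (simp add: o_def)
  qed
  \<comment> \<open>The mean of \<open>\<phi>\<close> over the interval from \<open>x\<close> to
    \<open>x + h\<close>. Its derivative is the difference quotient \<open>\<psi>\<close>, which is
    continuous although \<open>\<phi>\<close> need not be differentiable.\<close>
  define \<phi>h where "\<phi>h x = (F (x + h) - F x) / of_real h" for x
  have \<phi>hH: "cmod (\<phi>h x - \<phi>h y) \<le> N * \<bar>x - y\<bar> powr \<eta>" if xy: "x \<in> {0..1}" "y \<in> {0..1}" for x y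
  proof -
    have "cmod ((F (x + h) - F (y + h)) - (F (x + 0) - F (y + 0))) \<le> N * \<bar>x - y\<bar> powr \<eta> * \<bar>h - 0\<bar>"
    proof (rule vector_mvt_bound[where S = "{0..h}" and f = "\<lambda>u. F (x + u) - F (y + u)"])
      show "((\<lambda>u. F (x + u) - F (y + u)) has_vector_derivative \<phi> (x + u) - \<phi> (y + u)) (at u within {0..h})" if "u \<in> {0..h}" for u
        using xy h that by (intro has_vector_derivative_diff Ft) auto
      show "cmod (\<phi> (x + u) - \<phi> (y + u)) \<le> N * \<bar>x - y\<bar> powr \<eta>" for u using \<phi>H[of "x + u" "y + u"] by simp
    qed (use h in auto)
    moreover have "\<phi>h x - \<phi>h y = ((F (x + h) - F (y + h)) - (F (x + 0) - F (y + 0))) / of_real h"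
      unfolding \<phi>h_def by (simp add: diff_divide_distrib)
    ultimately show ?thesis using h by (simp add: norm_divide divide_le_eq)
  qed
  have \<phi>hc: "cmod (\<phi>h x - D k f x) \<le> e / 2" if x: "x \<in> {0..1}" for x
  proof -
    have "cmod ((F (x + h) - of_real h * \<phi> x) - (F (x + 0) - of_real 0 * \<phi> x)) \<le> e / 2 * \<bar>h - 0\<bar>"
    proof (rule vector_mvt_bound[where S = "{0..h}" and f = "\<lambda>u. F (x + u) - of_real u * \<phi> x"])
      fix u assume u: "u \<in> {0..h}"
      have "((\<lambda>u. complex_of_real u * \<phi> x) has_vector_derivative 1 * \<phi> x) (at u within {0..h})"
        by (intro has_vector_derivative_mult_left has_vector_derivative_of_real) (auto intro!: derivative_eq_intros)
      thus "((\<lambda>u. F (x + u) - of_real u * \<phi> x) has_vector_derivative \<phi> (x + u) - \<phi> x) (at u within {0..h})"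
        using x h u by (intro has_vector_derivative_diff Ft) auto
      show "cmod (\<phi> (x + u) - \<phi> x) \<le> e / 2" using \<phi>u[of "x + u" x] u by simp
    qed (use h in auto)
    moreover have "\<phi>h x - D k f x = ((F (x + h) - of_real h * \<phi> x) - (F (x + 0) - of_real 0 * \<phi> x)) / of_real h"
      unfolding \<phi>h_def \<phi>_def cl_id[OF x] using h by (simp add: field_simps)
    ultimately show ?thesis using h by (simp add: norm_divide divide_le_eq)
  qed
  define \<psi> where "\<psi> x = (\<phi> (x + h) - \<phi> x) / of_real h" for x
  have \<phi>hd: "(\<phi>h has_vector_derivative \<psi> x) (at x within {0..1})" if x: "x \<in> {0..1}" for x
  proof -
    have "((\<lambda>u. F (h + u)) has_vector_derivative \<phi> (h + x)) (at x within {0..1})" using x h by (intro Ft) auto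
    moreover have "((\<lambda>u. F (0 + u)) has_vector_derivative \<phi> (0 + x)) (at x within {0..1})" using x by (intro Ft) auto
    ultimately have "((\<lambda>u. F (h + u) - F (0 + u)) has_vector_derivative \<phi> (h + x) - \<phi> (0 + x)) (at x within {0..1})"
      by (rule has_vector_derivative_diff)
    hence "((\<lambda>u. (F (h + u) - F (0 + u)) / of_real h) has_vector_derivative (\<phi> (h + x) - \<phi> (0 + x)) / of_real h) (at x within {0..1})"
      by (rule has_vector_derivative_divide)
    thus ?thesis unfolding \<phi>h_def[abs_def] \<psi>_def by (simp add: add.commute)
  qed
  have "continuous_on {0..1} \<psi>"
    unfolding \<psi>_def using h by (intro continuous_intros \<phi>c continuous_on_compose2[OF \<phi>c[of UNIV]]) auto
  then obtain p where p: "\<And>x. x \<in> {0..1} \<Longrightarrow> cmod (\<psi> x - poly p (of_real x)) \<le> e / 2"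
    using complex_poly_approx[OF _ half_gt_zero[OF e]] by blast
  obtain P where P: "pderiv P = p" "poly P 0 = \<phi>h 0" using poly_antideriv by blast
  \<comment> \<open>One Lipschitz estimate with two uses: it adds at most \<open>e\<close> to the
    Hoelder constant, and with \<open>P\<close> and \<open>\<phi>h\<close> equal at 0 it gives
    uniform closeness.\<close>
  have E: "cmod ((\<phi>h x - poly P (of_real x)) - (\<phi>h y - poly P (of_real y))) \<le> e / 2 * \<bar>x - y\<bar>" if "x \<in> {0..1}" "y \<in> {0..1}" for x y
  proof (rule vector_mvt_bound[where S = "{0..1}" and f = "\<lambda>x. \<phi>h x - poly P (of_real x)"])
    show "((\<lambda>x. \<phi>h x - poly P (of_real x)) has_vector_derivative \<psi> u - poly p (of_real u)) (at u within {0..1})" if "u \<in> {0..1}" for u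
      using poly_has_vector_derivative[of P u] unfolding P(1) by (intro has_vector_derivative_diff \<phi>hd that)
  qed (use p that in auto)
  \<comment> \<open>The integration constants are the derivatives of \<open>f\<close> at 0, so the
    errors of order below \<open>k\<close> vanish there and the bound \<open>e\<close> passes from
    order \<open>k\<close> down to order 0.\<close>
  obtain Q where Q: "(pderiv ^^ k) Q = P" "\<And>j. j < k \<Longrightarrow> poly ((pderiv ^^ j) Q) 0 = D j f 0"
    using poly_iterated_antideriv[of k P "\<lambda>j. D j f 0"] by blast
  have close: "cmod (D j f x - poly ((pderiv ^^ j) Q) (of_real x)) \<le> e" if "j \<le> k" "x \<in> {0..1}" for j x
    using that
  proof (induction j arbitrary: x rule: inc_induct)
    case base
    have "cmod (\<phi>h x - poly P (of_real x)) \<le> e / 2"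
    proof -
      have "e / 2 * \<bar>x - 0\<bar> \<le> e / 2 * 1" using base e by (intro mult_left_mono) auto
      thus ?thesis using E[OF base, of 0] P(2) by simp
    qed
    moreover have "cmod (D k f x - \<phi>h x) \<le> e / 2" using \<phi>hc[OF base] by (simp add: norm_minus_commute)
    ultimately show ?case unfolding Q(1)
      using norm_triangle_ineq[of "D k f x - \<phi>h x" "\<phi>h x - poly P (of_real x)"] by simp
  next
    case (step j)
    have "cmod ((D j f x - poly ((pderiv ^^ j) Q) (of_real x)) - (D j f 0 - poly ((pderiv ^^ j) Q) (of_real 0))) \<le> e * \<bar>x - 0\<bar>"
    proof (rule vector_mvt_bound[where S = "{0..1}" and f = "\<lambda>x. D j f x - poly ((pderiv ^^ j) Q) (of_real x)"])
      show "((\<lambda>x. D j f x - poly ((pderiv ^^ j) Q) (of_real x)) has_vector_derivative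
          D (Suc j) f u - poly ((pderiv ^^ Suc j) Q) (of_real u)) (at u within {0..1})" if "u \<in> {0..1}" for u
        using C_space_deriv[OF f _ that, of j] poly_has_vector_derivative[of "(pderiv ^^ j) Q" u] step.hyps
        by (intro has_vector_derivative_diff) auto
      show "cmod (D (Suc j) f u - poly ((pderiv ^^ Suc j) Q) (of_real u)) \<le> e" if "u \<in> {0..1}" for u
        by (rule step.IH[OF that])
    qed (use step.prems in auto)
    moreover have "e * \<bar>x - 0\<bar> \<le> e * 1" using step.prems e by (intro mult_left_mono) auto
    ultimately show ?case using Q(2)[of j] step.hyps by simp
  qed
  have "cmod (poly P (of_real x) - poly P (of_real y)) \<le> (N + e) * \<bar>x - y\<bar> powr \<eta>" if xy: "x \<in> {0..1}" "y \<in> {0..1}" for x y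
  proof -
    have "poly P (of_real x) - poly P (of_real y) = (\<phi>h x - \<phi>h y) - ((\<phi>h x - poly P (of_real x)) - (\<phi>h y - poly P (of_real y)))" by simp
    hence "cmod (poly P (of_real x) - poly P (of_real y)) \<le> N * \<bar>x - y\<bar> powr \<eta> + e / 2 * \<bar>x - y\<bar>"
      using norm_triangle_ineq4[of "\<phi>h x - \<phi>h y"] \<phi>hH[OF xy] E[OF xy] by (smt (verit))
    moreover have "e / 2 * \<bar>x - y\<bar> \<le> e * \<bar>x - y\<bar> powr \<eta>"
      using e xy \<eta>_less by (intro mult_mono abs_le_powr) auto
    ultimately show ?thesis by (simp add: distrib_right)
  qed
  with close Q(1) show ?thesis unfolding N_def by blast
qed

lemma restrict01_A_mem:
  assumes "g \<in> A_space"
  shows "restrict01 g \<in> C_space \<alpha>"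
    and "j \<le> k \<Longrightarrow> x \<in> {0..1} \<Longrightarrow> D j (restrict01 g) x = (deriv ^^ j) g (of_real x)"
  using restrict01_mem[OF A_space_holomorphic[OF assms] open_ball interval_in_disc]
    D_restrict01[OF A_space_holomorphic[OF assms] open_ball interval_in_disc] by auto

text \<open>For fractional \<open>\<alpha>\<close> polynomials are not dense in the norm, so the
  conclusion is uniform convergence of the derivatives together with a bound on the norms.\<close>

lemma approx_by_A:
  assumes f: "f \<in> C_space \<alpha>"
  obtains g B where "\<And>m. g m \<in> A_space" "\<And>m. C_norm \<alpha> (restrict01 (g m)) \<le> B"
    "\<And>j. j \<le> k \<Longrightarrow> uniform_limit {0..1} (\<lambda>m. D j (restrict01 (g m))) (D j f) sequentially"
proof -
  have "\<forall>m. \<exists>Q. (\<forall>j\<le>k. \<forall>x\<in>{0..1}. cmod (D j f x - poly ((pderiv ^^ j) Q) (of_real x)) \<le> 1 / real (Suc m)) \<and>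
    (\<forall>x\<in>{0..1}. \<forall>y\<in>{0..1}. cmod (poly ((pderiv ^^ k) Q) (of_real x) - poly ((pderiv ^^ k) Q) (of_real y))
       \<le> (2 * C_norm \<alpha> f + 1 / real (Suc m)) * \<bar>x - y\<bar> powr \<eta>)"
    by (intro allI poly_approx[OF f]) simp
  then obtain Q where Q1: "\<And>m j x. j \<le> k \<Longrightarrow> x \<in> {0..1} \<Longrightarrow> cmod (D j f x - poly ((pderiv ^^ j) (Q m)) (of_real x)) \<le> 1 / real (Suc m)"
    and Q2: "\<And>m x y. x \<in> {0..1} \<Longrightarrow> y \<in> {0..1} \<Longrightarrow> cmod (poly ((pderiv ^^ k) (Q m)) (of_real x) - poly ((pderiv ^^ k) (Q m)) (of_real y))
       \<le> (2 * C_norm \<alpha> f + 1 / real (Suc m)) * \<bar>x - y\<bar> powr \<eta>"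
    unfolding choice_iff by blast
  define g where "g m = (\<lambda>z. if z \<in> cball 1 (3/2) then poly (Q m) z else 0)" for m
  have gA: "g m \<in> A_space" for m
    unfolding g_def by (intro A_spaceI poly_holomorphic holomorphic_on_imp_continuous_on)
  have rg: "restrict01 (g m) = restrict01 (poly (Q m))" for m
    using interval_in_cdisc unfolding restrict01_def g_def by auto
  have Dg: "D j (restrict01 (g m)) x = poly ((pderiv ^^ j) (Q m)) (of_real x)" if "j \<le> k" "x \<in> {0..1}" for j x m
    unfolding rg higher_deriv_poly[symmetric]
    by (rule D_restrict01[of _ UNIV, OF _ _ _ that]) (auto intro: poly_holomorphic)
  define B where "B = 2 * C_norm \<alpha> f + 1"
  have le1: "1 / real (Suc m) \<le> 1" for m by simp
  have "C_norm \<alpha> (restrict01 (g m)) \<le> (real k + 2) * B" for m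
  proof (rule C_norm_le[of _ "\<lambda>j. D j (restrict01 (g m))"])
    show "(D j (restrict01 (g m)) has_vector_derivative D (Suc j) (restrict01 (g m)) x) (at x within {0..1})" if "j < k" "x \<in> {0..1}" for j x
      by (rule C_space_deriv[OF restrict01_A_mem(1)[OF gA] that])
    show "cmod (D j (restrict01 (g m)) x) \<le> B" if "j \<le> k" "x \<in> {0..1}" for j x
    proof -
      have "cmod (D j (restrict01 (g m)) x) \<le> cmod (D j f x) + cmod (D j f x - poly ((pderiv ^^ j) (Q m)) (of_real x))"
        unfolding Dg[OF that] using norm_triangle_ineq4[of "D j f x" "D j f x - poly ((pderiv ^^ j) (Q m)) (of_real x)"] by simp
      thus ?thesis using C_norm_upper[OF f that] Q1[OF that, of m] le1[of m] C_norm_nonneg[OF f] unfolding B_def by linarith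
    qed
    show "cmod (D k (restrict01 (g m)) x - D k (restrict01 (g m)) y) \<le> B * \<bar>x - y\<bar> powr \<eta>" if "x \<in> {0..1}" "y \<in> {0..1}" for x y
    proof -
      have "(2 * C_norm \<alpha> f + 1 / real (Suc m)) * \<bar>x - y\<bar> powr \<eta> \<le> B * \<bar>x - y\<bar> powr \<eta>"
        unfolding B_def using le1[of m] by (intro mult_right_mono add_left_mono) auto
      thus ?thesis using Q2[OF that, of m] Dg[of k] that by (simp del: of_nat_Suc)
    qed
  qed auto
  moreover have "uniform_limit {0..1} (\<lambda>m. D j (restrict01 (g m))) (D j f) sequentially" if j: "j \<le> k" for j
  proof (rule uniform_limitI)
    fix e :: real assume "e > 0"
    then obtain M where M: "1 / real (Suc M) < e" using nat_approx_posE by blast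
    have "dist (D j (restrict01 (g m)) x) (D j f x) < e" if "m \<ge> M" "x \<in> {0..1}" for m x
    proof -
      have "1 / real (Suc m) \<le> 1 / real (Suc M)" using that(1) by (intro divide_left_mono) auto
      thus ?thesis using Q1[OF j that(2), of m] M Dg[OF j that(2)] by (simp add: dist_norm norm_minus_commute del: of_nat_Suc)
    qed
    thus "\<forall>\<^sub>F m in sequentially. \<forall>x\<in>{0..1}. dist (D j (restrict01 (g m)) x) (D j f x) < e"
      unfolding eventually_sequentially by blast
  qed
  ultimately show ?thesis using that gA by blast
qed

lemma C_norm_tendsto_if_integer:
  assumes \<eta>: "\<eta> = 0" and s: "\<And>m. s m \<in> C_space \<alpha>" and f: "f \<in> C_space \<alpha>"
    and lim: "\<And>j. j \<le> k \<Longrightarrow> uniform_limit {0..1} (\<lambda>m. D j (s m)) (D j f) sequentially"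
  shows "(\<lambda>m. C_norm \<alpha> (\<lambda>x. s m x - f x)) \<longlonglongrightarrow> 0"
proof (rule LIMSEQ_I)
  fix e :: real assume e: "e > 0"
  define e' where "e' = e / (2 * (real k + 1))"
  have e': "e' > 0" using e unfolding e'_def by simp
  have "\<forall>\<^sub>F m in sequentially. \<forall>j\<in>{..k}. \<forall>x\<in>{0..1}. dist (D j (s m) x) (D j f x) < e'"
    using lim e' by (intro eventually_ball_finite) (auto dest: uniform_limitD)
  then obtain M where M: "\<And>m j x. m \<ge> M \<Longrightarrow> j \<le> k \<Longrightarrow> x \<in> {0..1} \<Longrightarrow> dist (D j (s m) x) (D j f x) < e'"
    unfolding eventually_sequentially by fastforce
  have "norm (C_norm \<alpha> (\<lambda>x. s m x - f x) - 0) < e" if "m \<ge> M" for m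
  proof -
    have "(\<Sum>j\<le>k. sup_norm j (\<lambda>x. s m x - f x)) \<le> (\<Sum>j\<le>k. e')"
    proof (intro sum_mono sup_norm_le)
      fix j x :: real and i assume "i \<in> {..k}" "x \<in> {0..1}"
      thus "cmod (D i (\<lambda>x. s m x - f x) x) \<le> e'"
        using D_diff[OF s f, of i x m] M[OF that, of i x] by (simp add: dist_norm less_imp_le)
    qed
    also have "\<dots> = e / 2" unfolding e'_def by (simp add: field_simps)
    finally have "C_norm \<alpha> (\<lambda>x. s m x - f x) \<le> e / 2" unfolding C_norm_eq holder_const_def using \<eta> by simp
    thus ?thesis using e C_norm_nonneg[OF C_space_diff[OF s f, of m]] by simp
  qed
  thus "\<exists>M. \<forall>m\<ge>M. norm (C_norm \<alpha> (\<lambda>x. s m x - f x) - 0) < e" by blast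
qed

lemma C_norm_modulus:
  assumes f: "f \<in> C_space \<alpha>" and j: "j \<le> k" and xy: "x \<in> {0..1}" "y \<in> {0..1}"
  shows "cmod (D j f x - D j f y) \<le> 2 * C_norm \<alpha> f * \<bar>x - y\<bar> powr \<eta>"
proof (cases "j = k")
  case True thus ?thesis using C_norm_holder[OF f xy] by simp
next
  case False
  hence jk: "j < k" using j by simp
  have "cmod (D j f x - D j f y) \<le> C_norm \<alpha> f * \<bar>x - y\<bar>"
    by (rule vector_mvt_bound[where S = "{0..1}", OF _ C_space_deriv[OF f jk]]) (use C_norm_upper[OF f, of "Suc j"] jk xy in auto)
  also have "\<dots> \<le> 2 * C_norm \<alpha> f * \<bar>x - y\<bar> powr \<eta>"
    using C_norm_nonneg[OF f] xy \<eta>_less by (intro mult_mono abs_le_powr) auto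
  finally show ?thesis .
qed

text \<open>For \<open>\<eta> > 0\<close> a norm bound makes all derivatives up to order
  \<open>k\<close> equicontinuous. Arzela-Ascoli is applied to one order after the other, refining
  the subsequence.\<close>

lemma C_compact:
  assumes \<eta>: "\<eta> \<noteq> 0" and s: "\<And>m. s m \<in> C_space \<alpha>" "\<And>m. C_norm \<alpha> (s m) \<le> B"
  obtains r G where "strict_mono (r :: nat \<Rightarrow> nat)"
    "\<And>j. j \<le> k \<Longrightarrow> uniform_limit {0..1} (\<lambda>m. D j (s (r m))) (G j) sequentially"
proof -
  have \<eta>pos: "\<eta> > 0" using \<eta> \<eta>_nonneg by simp
  have B0: "B \<ge> 0" using order_trans[OF C_norm_nonneg[OF s(1)] s(2)] .
  have mod: "cmod (D j (s m) x - D j (s m) y) \<le> 2 * B * \<bar>x - y\<bar> powr \<eta>" if "j \<le> k" "x \<in> {0..1}" "y \<in> {0..1}" for j m x y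
    by (rule order_trans[OF C_norm_modulus[OF s(1) that]]) (use s(2)[of m] in \<open>auto intro!: mult_right_mono\<close>)
  have "n \<le> Suc k \<Longrightarrow> \<exists>r. strict_mono (r :: nat \<Rightarrow> nat) \<and> (\<forall>j<n. \<exists>G. uniform_limit {0..1} (\<lambda>m. D j (s (r m))) G sequentially)" for n
  proof (induction n)
    case 0 show ?case by (intro exI[of _ id]) (auto simp: strict_mono_def)
  next
    case (Suc n)
    then obtain r where r: "strict_mono (r :: nat \<Rightarrow> nat)" "\<And>j. j < n \<Longrightarrow> \<exists>G. uniform_limit {0..1} (\<lambda>m. D j (s (r m))) G sequentially" by auto
    have nk: "n \<le> k" using Suc.prems by simp
    obtain g q where g: "strict_mono (q :: nat \<Rightarrow> nat)"
      "\<And>e. 0 < e \<Longrightarrow> \<exists>N. \<forall>m x. m \<ge> N \<and> x \<in> {0..1} \<longrightarrow> norm (D n (s (r (q m))) x - g x) < e"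
    proof (rule Arzela_Ascoli[of "{0..1::real}" "\<lambda>m. D n (s (r m))" B])
      show "norm (D n (s (r m)) x) \<le> B" if "x \<in> {0..1}" for m x
        using C_norm_upper[OF s(1) nk that] s(2) order_trans by blast
      fix x e :: real assume x: "x \<in> {0..1}" and e: "0 < e"
      \<comment> \<open>Solves \<open>(2 * B + 1) * d powr \<eta> = e\<close>; the added 1 avoids
        division by zero and makes the final inequality strict.\<close>
      define d where "d = (e / (2 * B + 1)) powr (1 / \<eta>)"
      have d: "d > 0" using e B0 unfolding d_def by simp
      have d\<eta>: "d powr \<eta> = e / (2 * B + 1)" unfolding d_def using \<eta>pos e B0 by (simp add: powr_powr)
      have "norm (D n (s (r m)) x - D n (s (r m)) y) < e" if y: "y \<in> {0..1}" "norm (x - y) < d" for m y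
      proof -
        have "norm (D n (s (r m)) x - D n (s (r m)) y) \<le> 2 * B * \<bar>x - y\<bar> powr \<eta>" by (rule mod[OF nk x y(1)])
        also have "\<dots> \<le> 2 * B * d powr \<eta>" using y(2) \<eta>pos B0 by (intro mult_left_mono powr_mono2) auto
        also have "\<dots> < e" unfolding d\<eta> using e B0 by (simp add: field_simps)
        finally show ?thesis .
      qed
      thus "\<exists>d>0. \<forall>m y. y \<in> {0..1} \<and> norm (x - y) < d \<longrightarrow> norm (D n (s (r m)) x - D n (s (r m)) y) < e"
        using d by blast
    qed auto
    have "uniform_limit {0..1} (\<lambda>m. D n (s (r (q m)))) g sequentially"
      unfolding uniform_limit_iff eventually_sequentially dist_norm using g(2) by blast
    moreover have "\<exists>G. uniform_limit {0..1} (\<lambda>m. D j (s (r (q m)))) G sequentially" if j: "j < n" for j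
    proof -
      obtain G where "uniform_limit {0..1} (\<lambda>m. D j (s (r m))) G sequentially" using r(2)[OF j] by blast
      from filterlim_compose[OF this filterlim_subseq[OF g(1)]] show ?thesis by blast
    qed
    ultimately have "\<forall>j<Suc n. \<exists>G. uniform_limit {0..1} (\<lambda>m. D j (s ((r \<circ> q) m))) G sequentially"
      by (auto simp: less_Suc_eq)
    thus ?case using strict_mono_o[OF r(1) g(1)] by blast
  qed
  from this[of "Suc k"] obtain r where r: "strict_mono (r :: nat \<Rightarrow> nat)"
    "\<And>j. j \<le> k \<Longrightarrow> \<exists>G. uniform_limit {0..1} (\<lambda>m. D j (s (r m))) G sequentially" by (auto simp: less_Suc_eq_le)
  then obtain G where "\<And>j. j \<le> k \<Longrightarrow> uniform_limit {0..1} (\<lambda>m. D j (s (r m))) (G j) sequentially" by metis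
  with r(1) show ?thesis using that by blast
qed

end

section \<open>The transfer operator against the Mayer operator\<close>

context holder_transfer
begin

text \<open>Both operators are the same formula with \<open>Suc k\<close> Taylor terms removed, and
  this number is admissible for the Mayer operator because \<open>\<alpha> < k + 1\<close>.\<close>

lemma L_restrict01:
  assumes g: "g \<in> A_space"
  shows "L_op \<alpha> \<beta> (restrict01 g) = restrict01 (mayer_op \<beta> g)"
proof
  fix x
  show "L_op \<alpha> \<beta> (restrict01 g) x = restrict01 (mayer_op \<beta> g) x"
  proof (cases "x \<in> {0..1}")
    case False
    thus ?thesis unfolding L_op_def restrict01_def Let_def by (simp only: if_False)
  next
    case True
    have Dg: "D n (restrict01 g) 0 = (deriv ^^ n) g 0" if "n \<le> k" for n
      using restrict01_A_mem(2)[OF g that, of 0] by simp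
    have K: "2 * Re \<beta> + real (Suc k) > 1" using \<beta> \<alpha>_eq \<eta>_less by simp
    have xm: "1 / (real (Suc m) + x) \<in> {0..1}" for m using inverse_Suc_mem[OF True, of m] by (simp add: add.commute)
    have "L_op \<alpha> \<beta> (restrict01 g) x = mayer_continued k \<beta> g (of_real x)"
    proof -
      have a: "(\<Sum>n\<le>k. D n (restrict01 g) 0 / fact n * hurwitz_zeta (of_nat n + 2 * \<beta>) (of_real x + 1))
         = (\<Sum>n\<le>k. (deriv ^^ n) g 0 / fact n * hurwitz_zeta (of_nat n + 2 * \<beta>) (of_real x + 1))"
        by (intro sum.cong refl) (simp add: Dg)
      have b: "of_real (real (Suc m) + x) powr (- (2 * \<beta>)) * (restrict01 g (1 / (real (Suc m) + x)) -
           (\<Sum>n\<le>k. D n (restrict01 g) 0 / fact n * of_real (1 / (real (Suc m) + x)) ^ n))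
         = (of_nat (Suc m) + of_real x) powr (- (2 * \<beta>)) * (g (1 / (of_nat (Suc m) + of_real x)) -
           (\<Sum>n\<le>k. (deriv ^^ n) g 0 / fact n * (1 / (of_nat (Suc m) + of_real x)) ^ n))" for m
      proof -
        have c: "complex_of_real (1 / (real (Suc m) + x)) = 1 / (of_nat (Suc m) + of_real x)" by simp
        have "restrict01 g (1 / (real (Suc m) + x)) = g (1 / (of_nat (Suc m) + of_real x))"
          unfolding restrict01_def c using xm[of m] by (simp only: if_True)
        moreover have "(\<Sum>n\<le>k. D n (restrict01 g) 0 / fact n * of_real (1 / (real (Suc m) + x)) ^ n)
          = (\<Sum>n\<le>k. (deriv ^^ n) g 0 / fact n * (1 / (of_nat (Suc m) + of_real x)) ^ n)"
          unfolding c by (intro sum.cong refl) (simp add: Dg)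
        moreover have "complex_of_real (real (Suc m) + x) = of_nat (Suc m) + of_real x" by simp
        ultimately show ?thesis by simp
      qed
      show ?thesis
        unfolding L_op_def mayer_continued_def mayer_series_def Let_def a b using True by (simp only: if_True)
    qed
    also have "\<dots> = mayer_op \<beta> g (of_real x)"
      unfolding mayer_continued_eq[OF interval_in_cdisc[OF True]] mayer_op_eq[OF g K] ..
    finally show ?thesis using True unfolding restrict01_def by (simp only: if_True)
  qed
qed

text \<open>Restriction intertwines the two operators, so the restricted Mayer resolvent solves the
  resolvent equation on the Hoelder space, where solutions are unique.\<close>

lemma resolvent_restrict01:
  assumes g: "g \<in> A_space" and z: "z \<notin> op_spectrum (C_space \<alpha>) (C_norm \<alpha>) (L_op \<alpha> \<beta>)"
    and z': "z \<notin> op_spectrum A_space A_norm (mayer_op \<beta>)"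
  shows "resolvent (L_op \<alpha> \<beta>) z (restrict01 g) = restrict01 (A.resolvent (mayer_op \<beta>) z g)"
proof -
  let ?u = "A.resolvent (mayer_op \<beta>) z g"
  have u: "?u \<in> A_space" by (rule A.op_mem[OF A.resolvent(1)[OF bounded_op_mayer z'] g])
  have "restrict01 ?u = resolvent (L_op \<alpha> \<beta>) z (restrict01 g)"
  proof (rule resolvent_unique[OF bounded_op_L z restrict01_A_mem(1)[OF g] restrict01_A_mem(1)[OF u]])
    fix x show "z * restrict01 ?u x - L_op \<alpha> \<beta> (restrict01 ?u) x = restrict01 g x"
      unfolding L_restrict01[OF u] restrict01_def using A.resolvent(2)[OF bounded_op_mayer z' g] by simp
  qed
  thus ?thesis by simp
qed

text \<open>Each branch depends on finitely many values and derivatives, so it converges; the bound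
  \<open>decay i * B\<close> dominates the series and Tannery's theorem exchanges limit and
  sum.\<close>

lemma L_pointwise_continuous:
  assumes s: "\<And>m. s m \<in> C_space \<alpha>" "\<And>m. C_norm \<alpha> (s m) \<le> B" and g: "g \<in> C_space \<alpha>"
    and lim: "\<And>j x. j \<le> k \<Longrightarrow> x \<in> {0..1} \<Longrightarrow> (\<lambda>m. D j (s m) x) \<longlonglongrightarrow> D j g x"
  shows "(\<lambda>m. L_op \<alpha> \<beta> (s m) x) \<longlonglongrightarrow> L_op \<alpha> \<beta> g x"
proof (cases "x \<in> {0..1}")
  case False
  thus ?thesis unfolding L_op_def Let_def by (simp only: if_False) simp
next
  case True
  have t: "(\<lambda>m. branch i (s m) x) \<longlonglongrightarrow> branch i g x" for i
  proof -
    have h: "moebius_map 0 1 1 (real (Suc i)) x \<in> {0..1}" using branch_good True unfolding good_moebius_def by blast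
    have "(\<lambda>m. s m y) \<longlonglongrightarrow> g y" if "y \<in> {0..1}" for y using lim[OF _ that, of 0] by simp
    thus ?thesis unfolding branch_def W_def U_def taylor_rem_0
      using True h by (simp only: if_True) (intro tendsto_intros lim; simp)
  qed
  have "(\<lambda>m. \<Sum>i. branch i (s m) x) \<longlonglongrightarrow> (\<Sum>i. branch i g x)"
  proof -
    have "norm (branch i (s m) x) \<le> decay i * B" for i m
    proof -
      have "norm (branch i (s m) x) \<le> C_norm \<alpha> (branch i (s m))" by (rule eval_le[OF op_mem[OF bounded_op_branch s(1)]])
      also have "\<dots> \<le> decay i * C_norm \<alpha> (s m)" by (rule branch_bound[OF s(1)])
      also have "\<dots> \<le> decay i * B" by (intro mult_left_mono s(2) decay_nonneg)
      finally show ?thesis .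
    qed
    hence "\<forall>\<^sub>F (i, m) in at_top \<times>\<^sub>F sequentially. norm (branch i (s m) x) \<le> decay i * B"
      by (intro always_eventually) auto
    from tannerys_theorem[of "\<lambda>i m. branch i (s m) x", OF t this summable_mult2[OF summable_decay]]
    show ?thesis by simp
  qed
  moreover have "(\<lambda>m. \<Sum>n\<le>k. (1 / fact n * D n (s m) 0) * zeta_vec n x) \<longlonglongrightarrow> (\<Sum>n\<le>k. (1 / fact n * D n g 0) * zeta_vec n x)"
    by (intro tendsto_intros lim) auto
  ultimately show ?thesis unfolding L_op_eq branch_tail_def by (intro tendsto_add) simp_all
qed

text \<open>For integer \<open>\<alpha>\<close> the sequence converges in norm. Otherwise, if
  convergence failed, a subsequence of the resolvents would stay away from the expected value; being
  bounded, it has a further subsequence with a limit \<open>g\<close> in the space. By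
  \<open>L_pointwise_continuous\<close> this \<open>g\<close> solves the resolvent equation for
  \<open>f\<close>, a contradiction by uniqueness.\<close>

lemma resolvent_pointwise:
  assumes z: "z \<notin> op_spectrum (C_space \<alpha>) (C_norm \<alpha>) (L_op \<alpha> \<beta>)"
    and s: "\<And>m. s m \<in> C_space \<alpha>" "\<And>m. C_norm \<alpha> (s m) \<le> B" and f: "f \<in> C_space \<alpha>"
    and lim: "\<And>j. j \<le> k \<Longrightarrow> uniform_limit {0..1} (\<lambda>m. D j (s m)) (D j f) sequentially"
  shows "(\<lambda>m. resolvent (L_op \<alpha> \<beta>) z (s m) x) \<longlonglongrightarrow> resolvent (L_op \<alpha> \<beta>) z f x"
proof -
  let ?R = "resolvent (L_op \<alpha> \<beta>) z"
  note R = resolvent[OF bounded_op_L z]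
  obtain C where C: "C \<ge> 0" "\<And>f. f \<in> C_space \<alpha> \<Longrightarrow> C_norm \<alpha> (?R f) \<le> C * C_norm \<alpha> f" using op_bound[OF R(1)] by metis
  have Rs: "?R (s m) \<in> C_space \<alpha>" for m by (rule op_mem[OF R(1) s(1)])
  have Rf: "?R f \<in> C_space \<alpha>" by (rule op_mem[OF R(1) f])
  show ?thesis
  proof (cases "\<eta> = 0")
    case True
    have lim0: "(\<lambda>m. C * C_norm \<alpha> (\<lambda>x. s m x - f x)) \<longlonglongrightarrow> 0"
      using tendsto_mult_left[OF C_norm_tendsto_if_integer[OF True s(1) f lim], of C] by simp
    have "(\<lambda>m. C_norm \<alpha> (\<lambda>x. ?R (s m) x - ?R f x)) \<longlonglongrightarrow> 0"
    proof (rule Lim_null_comparison[OF always_eventually lim0], rule allI)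
      fix m
      have "C_norm \<alpha> (\<lambda>x. ?R (s m) x - ?R f x) \<le> C * C_norm \<alpha> (\<lambda>x. s m x - f x)"
        using C(2)[OF C_space_diff[OF s(1) f], of m] op_diff[OF R(1) s(1) f, of m] by simp
      thus "norm (C_norm \<alpha> (\<lambda>x. ?R (s m) x - ?R f x)) \<le> C * C_norm \<alpha> (\<lambda>x. s m x - f x)"
        using C_norm_nonneg[OF C_space_diff[OF Rs Rf], of m] by simp
    qed
    thus ?thesis by (rule tendsto_eval[OF Rs Rf])
  next
    case False
    show ?thesis
    proof (rule ccontr)
      assume "\<not> ?thesis"
      then obtain e r where e: "e > 0" "strict_mono (r :: nat \<Rightarrow> nat)" "\<And>n. dist (?R (s (r n)) x) (?R f x) \<ge> e"
        using not_tendsto_subseq[of "\<lambda>m. ?R (s m) x"] by metis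
      have bd: "C_norm \<alpha> (?R (s (r n))) \<le> C * B" for n
        by (rule order_trans[OF C(2)[OF s(1)] mult_left_mono[OF s(2) C(1)]])
      obtain q G where q: "strict_mono (q :: nat \<Rightarrow> nat)"
        "\<And>j. j \<le> k \<Longrightarrow> uniform_limit {0..1} (\<lambda>m. D j (?R (s (r (q m))))) (G j) sequentially"
      proof (rule C_compact[of "\<lambda>m. ?R (s (r m))", OF False Rs bd])
        fix q G assume "strict_mono (q :: nat \<Rightarrow> nat)"
          "\<And>j. j \<le> k \<Longrightarrow> uniform_limit {0..1} (\<lambda>m. D j (?R (s (r (q m))))) (G j) sequentially"
        thus thesis by (rule that)
      qed
      define g where "g x = (if x \<in> {0..1} then G 0 x else 0)" for x
      note CL = C_limit[of "\<lambda>m. ?R (s (r (q m)))" "C * B" G g, OF Rs bd q(2)]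
      have gV: "g \<in> C_space \<alpha>" by (rule CL(1)) (auto simp: g_def)
      have Dg: "D j g y = G j y" if "j \<le> k" "y \<in> {0..1}" for j y
        by (rule CL(3)) (use that in \<open>auto simp: g_def\<close>)
      have lj: "(\<lambda>m. D j (?R (s (r (q m)))) y) \<longlonglongrightarrow> D j g y" if "j \<le> k" "y \<in> {0..1}" for j y
        unfolding Dg[OF that] by (rule tendsto_uniform_limitI[OF q(2)[OF that(1)] that(2)])
      have l0: "(\<lambda>m. ?R (s (r (q m))) y) \<longlonglongrightarrow> g y" for y
      proof (cases "y \<in> {0..1}")
        case True thus ?thesis using lj[of 0 y] by simp
      next
        case False thus ?thesis using C_space_outside[OF Rs] C_space_outside[OF gV] by simp
      qed
      have lL: "(\<lambda>m. L_op \<alpha> \<beta> (?R (s (r (q m)))) y) \<longlonglongrightarrow> L_op \<alpha> \<beta> g y" for y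
        by (rule L_pointwise_continuous[OF Rs bd gV lj])
      have sub: "strict_mono (r \<circ> q)" by (rule strict_mono_o[OF e(2) q(1)])
      have "z * g y - L_op \<alpha> \<beta> g y = f y" for y
      proof -
        have "(\<lambda>m. z * ?R (s (r (q m))) y - L_op \<alpha> \<beta> (?R (s (r (q m)))) y) \<longlonglongrightarrow> z * g y - L_op \<alpha> \<beta> g y"
          by (intro tendsto_intros l0 lL)
        hence 1: "(\<lambda>m. s (r (q m)) y) \<longlonglongrightarrow> z * g y - L_op \<alpha> \<beta> g y" unfolding R(2)[OF s(1)] .
        have "(\<lambda>m. s m y) \<longlonglongrightarrow> f y"
        proof (cases "y \<in> {0..1}")
          case True thus ?thesis using tendsto_uniform_limitI[OF lim[of 0] True] by simp
        next
          case False thus ?thesis using C_space_outside[OF s(1)] C_space_outside[OF f] by simp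
        qed
        from LIMSEQ_subseq_LIMSEQ[OF this sub] have "(\<lambda>m. s (r (q m)) y) \<longlonglongrightarrow> f y" by (simp add: o_def)
        with 1 show ?thesis using LIMSEQ_unique by blast
      qed
      hence "g = ?R f" by (rule resolvent_unique[OF bounded_op_L z f gV])
      hence "(\<lambda>m. ?R (s (r (q m))) x) \<longlonglongrightarrow> ?R f x" using l0[of x] by simp
      hence "\<forall>\<^sub>F m in sequentially. dist (?R (s (r (q m))) x) (?R f x) < e" using e(1) by (rule tendstoD)
      then obtain m where "dist (?R (s (r (q m))) x) (?R f x) < e" by (auto simp: eventually_sequentially)
      thus False using e(3)[of "q m"] by simp
    qed
  qed
qed

end

section \<open>Contour integrals of the resolvent\<close>

context complex_function_space
begin

lemma resolvent_compact_bound: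
  assumes T: "bounded_op V N T" and K: "compact K" "K \<inter> op_spectrum V N T = {}"
  obtains C where "C \<ge> 0" "\<And>z f. z \<in> K \<Longrightarrow> f \<in> V \<Longrightarrow> N (resolvent T z f) \<le> C * N f"
proof -
  have "\<forall>l\<in>K. \<exists>C d. C \<ge> 0 \<and> d > 0 \<and> (\<forall>m f. cmod (m - l) < d \<longrightarrow> m \<notin> op_spectrum V N T \<longrightarrow> f \<in> V \<longrightarrow> N (resolvent T m f) \<le> C * N f)"
  proof
    fix l assume "l \<in> K"
    hence "l \<notin> op_spectrum V N T" using K(2) by blast
    from resolvent_local_bound[OF T this]
    show "\<exists>C d. C \<ge> 0 \<and> d > 0 \<and> (\<forall>m f. cmod (m - l) < d \<longrightarrow> m \<notin> op_spectrum V N T \<longrightarrow> f \<in> V \<longrightarrow> N (resolvent T m f) \<le> C * N f)" by metis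
  qed
  then obtain C d where Cd: "\<And>l. l \<in> K \<Longrightarrow> C l \<ge> 0" "\<And>l. l \<in> K \<Longrightarrow> d l > 0"
    "\<And>l m f. l \<in> K \<Longrightarrow> cmod (m - l) < d l \<Longrightarrow> m \<notin> op_spectrum V N T \<Longrightarrow> f \<in> V \<Longrightarrow> N (resolvent T m f) \<le> C l * N f"
    unfolding bchoice_iff by blast
  have "K \<subseteq> (\<Union>l\<in>K. ball l (d l))" using Cd(2) by force
  then obtain F where F: "F \<subseteq> K" "finite F" "K \<subseteq> (\<Union>l\<in>F. ball l (d l))"
    using compactE_image[OF K(1), of K "\<lambda>l. ball l (d l)"] by (metis open_ball)
  have "N (resolvent T z f) \<le> (\<Sum>l\<in>F. C l) * N f" if z: "z \<in> K" and f: "f \<in> V" for z f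
  proof -
    obtain l where l: "l \<in> F" "z \<in> ball l (d l)" using F(3) z by blast
    have "N (resolvent T z f) \<le> C l * N f"
      using l F(1) z K(2) by (intro Cd(3) f) (auto simp: dist_norm norm_minus_commute)
    also have "\<dots> \<le> (\<Sum>l\<in>F. C l) * N f"
      using l F Cd(1) by (intro mult_right_mono member_le_sum norm_nonneg f) auto
    finally show ?thesis .
  qed
  moreover have "(\<Sum>l\<in>F. C l) \<ge> 0" using F(1) Cd(1) by (intro sum_nonneg) auto
  ultimately show ?thesis using that by blast
qed

text \<open>On a vector with \<open>A^n f = 0\<close>, where \<open>A = T - l\<close>, the resolvent
  is explicitly \<open>geo_op A (z - l) n f / (z - l)^n\<close>, a Laurent polynomial whose residue
  at \<open>l\<close> is \<open>f\<close>. So only the circle itself has to avoid the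
  spectrum.\<close>

lemma resolvent_contour_integral:
  assumes T: "bounded_op V N T" and f: "f \<in> gen_eigenspace V T l" and r: "r > 0"
    and sp: "\<And>z. z \<in> sphere l r \<Longrightarrow> z \<notin> op_spectrum V N T"
  shows "((\<lambda>z. resolvent T z f x) has_contour_integral (2 * of_real pi * \<i> * f x)) (circlepath l r)"
proof -
  obtain n where n: "n \<ge> 1" "f \<in> V" "(shift_op T l ^^ n) f = (\<lambda>x. 0)"
    using f unfolding gen_eigenspace_def by blast
  obtain p where p: "n = Suc p" using n(1) by (cases n) auto
  let ?A = "shift_op T l"
  have A: "bounded_op V N ?A" by (rule bounded_op_shift[OF T])
  define h where "h z = geo_op ?A (z - l) n f x" for z
  have hexp: "h z = (\<Sum>i<n. (z - l) ^ i * (?A ^^ (n - 1 - i)) f x)" for z unfolding h_def geo_op_def ..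
  have hol: "h holomorphic_on S" for S unfolding hexp[abs_def] by (intro holomorphic_intros)
  have "\<forall>\<^sub>F z in nhds l. h z = (\<Sum>i<n. (z - l) ^ i * (?A ^^ (n - 1 - i)) f x) + (z - l) ^ n * 0 \<and> cmod 0 \<le> 0"
    unfolding hexp by simp
  from higher_deriv_from_expansion[OF hol[of "ball l 1"] _ this, of p]
  have hd: "(deriv ^^ p) h l = fact p * f x" unfolding p by simp
  have "((\<lambda>u. h u / (u - l) ^ Suc p) has_contour_integral (2 * of_real pi * \<i>) / fact p * (deriv ^^ p) h l) (circlepath l r)"
    using Cauchy_has_contour_integral_higher_derivative_circlepath[of l r h l p] r hol
    by (simp add: holomorphic_on_imp_continuous_on)
  hence 1: "((\<lambda>u. h u / (u - l) ^ Suc p) has_contour_integral 2 * of_real pi * \<i> * f x) (circlepath l r)"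
    unfolding hd by (simp add: mult.assoc)
  show ?thesis
  proof (rule has_contour_integral_eq[OF 1])
    fix z assume "z \<in> path_image (circlepath l r)"
    hence z: "z \<in> sphere l r" using r by simp
    hence zl: "z - l \<noteq> 0" using r by auto
    let ?g = "geo_op ?A (z - l) n f"
    have g: "?g \<in> V" by (rule op_mem[OF bounded_op_geo[OF A] n(2)])
    have eq: "z * ?g y - T ?g y = (z - l) ^ n * f y" for y
      using geo_op_left[OF A n(2), of "z - l" n y] n(3) by (simp add: shift_op_def algebra_simps)
    have "(\<lambda>y. inverse ((z - l) ^ n) * ?g y) = resolvent T z f"
    proof (rule resolvent_unique[OF T sp[OF z] n(2) scale_mem[OF g]])
      fix y
      have "z * (inverse ((z - l) ^ n) * ?g y) - T (\<lambda>y. inverse ((z - l) ^ n) * ?g y) y = inverse ((z - l) ^ n) * (z * ?g y - T ?g y)"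
        unfolding op_scale[OF T g] by (simp add: algebra_simps)
      thus "z * (inverse ((z - l) ^ n) * ?g y) - T (\<lambda>y. inverse ((z - l) ^ n) * ?g y) y = f y"
        unfolding eq using zl by simp
    qed
    hence "resolvent T z f x = inverse ((z - l) ^ n) * ?g x" by (simp add: fun_eq_iff)
    thus "h z / (z - l) ^ Suc p = resolvent T z f x"
      unfolding h_def p[symmetric] by (simp add: divide_inverse mult.commute)
  qed
qed

end

section \<open>Extension of generalised eigenfunctions\<close>

context holder_transfer
begin

theorem gen_eigenfunction_extends:
  assumes l0: "l \<noteq> 0" and iso: "\<not> l islimpt op_spectrum (C_space \<alpha>) (C_norm \<alpha>) (L_op \<alpha> \<beta>)"
    and f: "f \<in> gen_eigenspace (C_space \<alpha>) (L_op \<alpha> \<beta>) l"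
  shows "\<exists>g\<in>gen_eigenspace A_space (mayer_op \<beta>) l. \<forall>x\<in>{0..1}. g (of_real x) = f x"
proof -
  let ?L = "L_op \<alpha> \<beta>" and ?M = "mayer_op \<beta>"
  let ?E = "gen_eigenspace A_space ?M l"
  \<comment> \<open>A positive radius below \<open>cmod l\<close>, so that the Fredholm determinant
    of the compact Mayer operator is available around \<open>l\<close>.\<close>
  define q where "q = cmod l / 2"
  have q: "q > 0" "cmod l > q" using l0 unfolding q_def by auto
  obtain d G where fam: "A.fredholm_family {\<mu>. cmod \<mu> > q} ?M d G" using mayer_fredholm[OF q(1)] by blast
  obtain \<delta>1 where \<delta>1: "\<delta>1 > 0" "\<And>z. z \<in> ball l \<delta>1 - {l} \<Longrightarrow> z \<notin> op_spectrum A_space A_norm ?M"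
    "\<And>g r. g \<in> A_space \<Longrightarrow> 0 < r \<Longrightarrow> r < \<delta>1 \<Longrightarrow> \<exists>e\<in>?E.
       \<forall>x. ((\<lambda>z. A.resolvent ?M z g x) has_contour_integral (2 * of_real pi * \<i> * e x)) (circlepath l r)"
    using A.fredholm_residue[OF bounded_op_mayer fam less_imp_le[OF q(1)] q(2)] by metis
  obtain \<delta>2 where \<delta>2: "\<delta>2 > 0" "\<And>z. z \<in> ball l \<delta>2 - {l} \<Longrightarrow> z \<notin> op_spectrum (C_space \<alpha>) (C_norm \<alpha>) ?L"
  proof -
    have "\<forall>\<^sub>F z in at l. z \<notin> op_spectrum (C_space \<alpha>) (C_norm \<alpha>) ?L" using iso by (simp add: islimpt_iff_eventually)
    then obtain \<delta> where "\<delta> > 0" "\<And>z. z \<noteq> l \<Longrightarrow> dist z l < \<delta> \<Longrightarrow> z \<notin> op_spectrum (C_space \<alpha>) (C_norm \<alpha>) ?L"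
      unfolding eventually_at by blast
    thus ?thesis using that[of \<delta>] by (auto simp: dist_commute)
  qed
  \<comment> \<open>Small enough that the circle lies in both punctured discs, where the spectra of
    both operators are absent.\<close>
  define r where "r = min \<delta>1 \<delta>2 / 2"
  have r: "r > 0" "r < \<delta>1" "r < \<delta>2" using \<delta>1(1) \<delta>2(1) unfolding r_def by auto
  have spL: "z \<notin> op_spectrum (C_space \<alpha>) (C_norm \<alpha>) ?L" and spM: "z \<notin> op_spectrum A_space A_norm ?M"
    if "z \<in> sphere l r" for z
    using \<delta>1(2)[of z] \<delta>2(2)[of z] that r by auto
  have fV: "f \<in> C_space \<alpha>" using f unfolding gen_eigenspace_def by blast
  obtain g B where g: "\<And>m. g m \<in> A_space" and gB: "\<And>m. C_norm \<alpha> (restrict01 (g m)) \<le> B"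
    and gl: "\<And>j. j \<le> k \<Longrightarrow> uniform_limit {0..1} (\<lambda>m. D j (restrict01 (g m))) (D j f) sequentially"
    using approx_by_A[OF fV] by metis
  have gV: "restrict01 (g m) \<in> C_space \<alpha>" for m by (rule restrict01_A_mem(1)[OF g])
  have "\<forall>m. \<exists>e\<in>?E. \<forall>x. ((\<lambda>z. A.resolvent ?M z (g m) x) has_contour_integral (2 * of_real pi * \<i> * e x)) (circlepath l r)"
    using \<delta>1(3)[OF g r(1,2)] by blast
  then obtain e where e: "\<And>m. e m \<in> ?E"
    "\<And>m x. ((\<lambda>z. A.resolvent ?M z (g m) x) has_contour_integral (2 * of_real pi * \<i> * e m x)) (circlepath l r)"
    by metis
  obtain C where C: "C \<ge> 0" "\<And>z f. z \<in> sphere l r \<Longrightarrow> f \<in> C_space \<alpha> \<Longrightarrow> C_norm \<alpha> (resolvent ?L z f) \<le> C * C_norm \<alpha> f"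
    using resolvent_compact_bound[OF bounded_op_L, of "sphere l r"] spL by (metis compact_sphere disjoint_iff)
  \<comment> \<open>The resolvents agree on restrictions, so \<open>e m\<close> on [0,1] is a
    contour integral of the Hoelder resolvent. It passes to the limit by dominated convergence, with
    the bound \<open>C\<close> on the circle, the norm bound \<open>B\<close> and the speed
    \<open>2 * pi * r\<close>.\<close>
  have lim: "(\<lambda>m. e m (of_real x)) \<longlonglongrightarrow> f x" if x: "x \<in> {0..1}" for x
  proof -
    let ?v = "\<lambda>t. vector_derivative (circlepath l r) (at t within {0..1})"
    define F where "F m t = resolvent ?L (circlepath l r t) (restrict01 (g m)) x * ?v t" for m t
    define F0 where "F0 t = resolvent ?L (circlepath l r t) f x * ?v t" for t
    have onc: "circlepath l r t \<in> sphere l r" if "t \<in> {0..1}" for t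
    proof -
      have "circlepath l r t \<in> path_image (circlepath l r)" unfolding path_image_def using that by blast
      thus ?thesis using r(1) by simp
    qed
    have Fi: "(F m has_integral (2 * of_real pi * \<i> * e m (of_real x))) {0..1}" for m
    proof -
      have "((\<lambda>z. resolvent ?L z (restrict01 (g m)) x) has_contour_integral (2 * of_real pi * \<i> * e m (of_real x))) (circlepath l r)"
      proof (rule has_contour_integral_eq[OF e(2)])
        fix z assume "z \<in> path_image (circlepath l r)"
        hence z: "z \<in> sphere l r" using r(1) by simp
        show "A.resolvent ?M z (g m) (of_real x) = resolvent ?L z (restrict01 (g m)) x"
          unfolding resolvent_restrict01[OF g spL[OF z] spM[OF z]] using x by (simp add: restrict01_def)
      qed
      thus ?thesis unfolding has_contour_integral_def F_def .
    qed
    have F0i: "(F0 has_integral (2 * of_real pi * \<i> * f x)) {0..1}"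
      using resolvent_contour_integral[OF bounded_op_L f r(1) spL] unfolding has_contour_integral_def F0_def .
    have "(\<lambda>m. integral {0..1} (F m)) \<longlonglongrightarrow> integral {0..1} F0"
    proof (rule dominated_convergence(2)[where h = "\<lambda>t. C * B * (2 * pi * r)"])
      show "F m integrable_on {0..1}" for m using Fi by (rule has_integral_integrable)
      show "(\<lambda>t. C * B * (2 * pi * r)) integrable_on {0..1::real}" by (rule integrable_const_ivl)
      fix t :: real assume t: "t \<in> {0..1}"
      show "norm (F m t) \<le> C * B * (2 * pi * r)" for m
      proof -
        let ?u = "resolvent ?L (circlepath l r t) (restrict01 (g m))"
        have "?u \<in> C_space \<alpha>" by (rule op_mem[OF resolvent(1)[OF bounded_op_L spL[OF onc[OF t]]] gV])
        hence "norm (?u x) \<le> C_norm \<alpha> ?u" by (rule eval_le)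
        also have "\<dots> \<le> C * C_norm \<alpha> (restrict01 (g m))" by (rule C(2)[OF onc[OF t] gV])
        also have "\<dots> \<le> C * B" by (rule mult_left_mono[OF gB C(1)])
        finally have "norm (?u x) \<le> C * B" .
        moreover have "norm (?v t) = 2 * pi * r"
          using t r(1) by (simp add: vector_derivative_circlepath01 norm_mult)
        ultimately show ?thesis unfolding F_def norm_mult using r(1) by (intro mult_mono) (auto intro: order_trans[OF norm_ge_zero])
      qed
      show "(\<lambda>m. F m t) \<longlonglongrightarrow> F0 t"
        unfolding F_def F0_def
        by (intro tendsto_mult tendsto_const resolvent_pointwise[OF spL[OF onc[OF t]] gV gB fV gl])
    qed
    hence "(\<lambda>m. 2 * of_real pi * \<i> * e m (of_real x)) \<longlonglongrightarrow> 2 * of_real pi * \<i> * f x"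
      unfolding integral_unique[OF Fi] integral_unique[OF F0i] .
    from tendsto_divide[OF this tendsto_const[of "2 * of_real pi * \<i>"]] show ?thesis by simp
  qed
  \<comment> \<open>The perturbation theorem with first power: by compactness the Mayer operator is
    within \<open>q < cmod l\<close> of finite rank, so \<open>l\<close> is outside its essential
    spectrum.\<close>
  have "finite_dim ?E"
  proof -
    obtain K where K: "2 * Re \<beta> + real K > 1" using exists_admissible by blast
    obtain Fr where Fr: "A.finite_rank Fr" "\<And>f. f \<in> A_space \<Longrightarrow> A_norm (\<lambda>z. mayer_reg \<beta> K f z - Fr f z) \<le> q * A_norm f"
      using mayer_reg_approx[OF K q(1)] by blast
    have "l \<notin> ess_spectrum A_space A_norm ?M"
      by (rule A.not_ess_spectrum_if_finite_rank_perturbation[OF bounded_op_mayer, where n = 1 and K = Fr and q = q])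
         (use Fr mayer_op_eq[OF _ K] q in auto)
    thus ?thesis unfolding ess_spectrum_def by blast
  qed
  then obtain Bs where Bs: "finite Bs" "\<And>w. w \<in> ?E \<Longrightarrow> \<exists>c. w = (\<lambda>x. \<Sum>b\<in>Bs. c b * b x)" unfolding finite_dim_def by blast
  \<comment> \<open>Convergence is known only on the real interval, so the lemma is applied with the
    embedded [0,1] as point set; \<open>Re\<close> undoes the embedding.\<close>
  have "\<exists>w\<in>?E. \<forall>z\<in>of_real ` {0..1}. w z = f (Re z)"
  proof (rule pointwise_limit_in_span[OF Bs(1) A.gen_eigenspace_subspace[OF bounded_op_mayer], where s = e and b = "\<lambda>b. b"])
    show "\<exists>c. w = (\<lambda>x. \<Sum>i\<in>Bs. c i * i x)" if "w \<in> ?E" for w by (rule Bs(2)[OF that])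
    show "(\<lambda>m. e m z) \<longlonglongrightarrow> f (Re z)" if "z \<in> of_real ` {0..1}" for z using that lim by auto
  qed (use e(1) in auto)
  thus ?thesis by auto
qed

end

theorem theorem1p1:
  fixes \<alpha> :: real and \<beta> :: complex
  assumes "\<alpha> > 0"
    and "Re \<beta> > (1 - \<alpha>) / 2"
    and "\<beta> \<notin> range (\<lambda>m::nat. (1 - of_nat m) / 2)"
  shows "ess_spectral_radius (C_space \<alpha>) (C_norm \<alpha>) (L_op \<alpha> \<beta>)
           \<le> spectral_radius A_space A_norm (mayer_op (of_real (Re \<beta> + \<alpha>)))
       \<and> (\<forall>l \<in> op_spectrum (C_space \<alpha>) (C_norm \<alpha>) (L_op \<alpha> \<beta>).
            ennreal (cmod l) > ess_spectral_radius (C_space \<alpha>) (C_norm \<alpha>) (L_op \<alpha> \<beta>) \<longrightarrow>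
            (\<forall>f \<in> gen_eigenspace (C_space \<alpha>) (L_op \<alpha> \<beta>) l.
               \<exists>g \<in> gen_eigenspace A_space (mayer_op \<beta>) l.
                 \<forall>x\<in>{0..1}. g (of_real x) = f x))"
proof -
  interpret holder_transfer \<alpha> \<beta> by unfold_locales (use assms in auto)
  let ?\<rho> = "spectral_radius A_space A_norm (mayer_op (of_real (Re \<beta> + \<alpha>)))"
  let ?\<rho>e = "ess_spectral_radius (C_space \<alpha>) (C_norm \<alpha>) (L_op \<alpha> \<beta>)"
  have "ennreal (cmod l) \<le> ?\<rho>" if l: "l \<in> ess_spectrum (C_space \<alpha>) (C_norm \<alpha>) (L_op \<alpha> \<beta>)" for l
  proof (rule ccontr)
    assume "\<not> ennreal (cmod l) \<le> ?\<rho>"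
    hence lt: "?\<rho> < ennreal (cmod l)" by simp
    \<comment> \<open>The extended radius lies strictly below a finite number, so it can be replaced
      by a real.\<close>
    define \<rho> where "\<rho> = enn2real ?\<rho>"
    have \<rho>: "ennreal \<rho> = ?\<rho>" unfolding \<rho>_def by (rule ennreal_enn2real[OF order.strict_trans2[OF lt top_greatest]])
    have \<rho>0: "\<rho> \<ge> 0" unfolding \<rho>_def by simp
    have "m \<notin> op_spectrum A_space A_norm (mayer_op (of_real (Re \<beta> + \<alpha>)))" if "cmod m > \<rho>" for m
    proof
      assume "m \<in> op_spectrum A_space A_norm (mayer_op (of_real (Re \<beta> + \<alpha>)))"
      hence "ennreal (cmod m) \<le> ?\<rho>" unfolding spectral_radius_def by (rule SUP_upper)
      thus False using that \<rho>0 unfolding \<rho>[symmetric] by (simp add: ennreal_le_iff)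
    qed
    moreover have "cmod l > \<rho>" using lt \<rho>0 unfolding \<rho>[symmetric] by (simp add: ennreal_less_iff)
    ultimately show False using L_not_ess_spectrum[OF _ \<rho>0] l by blast
  qed
  hence "?\<rho>e \<le> ?\<rho>" unfolding ess_spectral_radius_def by (rule SUP_least)
  moreover have "\<exists>g\<in>gen_eigenspace A_space (mayer_op \<beta>) l. \<forall>x\<in>{0..1}. g (of_real x) = f x"
    if l: "ennreal (cmod l) > ?\<rho>e" and f: "f \<in> gen_eigenspace (C_space \<alpha>) (L_op \<alpha> \<beta>) l" for l f
  proof (rule gen_eigenfunction_extends[OF _ _ f])
    \<comment> \<open>The extended number \<open>?\<rho>e\<close> is nonnegative and strictly below
      \<open>cmod l\<close>.\<close>
    show "l \<noteq> 0" using l by auto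
    have "l \<notin> ess_spectrum (C_space \<alpha>) (C_norm \<alpha>) (L_op \<alpha> \<beta>)"
    proof
      assume "l \<in> ess_spectrum (C_space \<alpha>) (C_norm \<alpha>) (L_op \<alpha> \<beta>)"
      hence "ennreal (cmod l) \<le> ?\<rho>e" unfolding ess_spectral_radius_def by (rule SUP_upper)
      thus False using l by simp
    qed
    thus "\<not> l islimpt op_spectrum (C_space \<alpha>) (C_norm \<alpha>) (L_op \<alpha> \<beta>)" unfolding ess_spectrum_def by blast
  qed
  ultimately show ?thesis by blast
qed

end
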